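(* Let $\mathcal{T}>0$ and let $(\widehat{F},\widehat{v})$ be a solution, belonging to $C^1([0,\mathcal{T}];H^j(\mathbb{R}^3))$ for some $j>\frac32+2$, of the system $$\partial_t\widehat{F}_{i\alpha}-\partial_\alpha\widehat{v}_i=0,\qquad \partial_t\widehat{v}_i-\partial_\alpha T_{i\alpha}(\widehat{F})=\mu\,\partial_\alpha\partial_\alpha\widehat{v}_i .$$ For $\epsilon>0$ let $(\bar F,\bar v)=(\bar F^\epsilon,\bar v^\epsilon)$ be smooth solutions on $\mathbb{R}^3\times[0,\mathcal{T}]$, bounded uniformly (also in $\epsilon$), of $$\partial_t\bar F_{i\alpha}-\partial_\alpha\bar v_i=0,\qquad \partial_t\bar v_i-\partial_\alpha T_{i\alpha}(\bar F)=\mu\,\partial_\alpha\partial_\alpha\bar v_i-\epsilon\,\partial_t^2\bar v_i ,$$ with $\bar F-\widehat F\in C^1([0,\mathcal T];L^2(\mathbb R^3))\cap C([0,\mathcal T];H^1(\mathbb R^3))$ and $\bar v-\widehat v\in C([0,\mathcal T];H^2(\mathbb R^3))\cap C^1([0,\mathcal T];H^1(\mathbb R^3))\cap C^2([0,\mathcal T];L^2(\mathbb R^3))$, and let $\Gamma>0$ (independent of $\epsilon$) be such that $\nabla_F T(F)\le\Gamma I$ for all $F$ under consideration. Set $$\varphi^{\epsilon}(t)=\int_{\mathbb{R}^3}\Big(|\bar v-\widehat v|^2+|\bar F-\widehat F|^2+\epsilon^2|\partial_t(\bar v-\widehat v)|^2+\epsilon|\nabla(\bar v-\widehat v)|^2\Big)dx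 .$$ Then there exist $\epsilon_0>0$ and a constant $C_{\mathcal{T}}>0$, both independent of $\epsilon$, such that for all $0<\epsilon\le\epsilon_0$ and all $t\in[0,\mathcal{T}]$, $$\varphi^{\epsilon}(t)\le C_{\mathcal{T}}\left(\epsilon^2+\varphi^{\epsilon}(0)\right).$$
   Context: Space is $\mathbb{R}^3$, indices $i,\alpha$ range over $\{1,2,3\}$, and repeated indices are summed. $\mu>0$ is a fixed constant, $\epsilon>0$ is the relaxation parameter. The stress $T=(T_{i\alpha}):\mathrm{Mat}_{3\times3}(\mathbb{R})\simeq\mathbb{R}^9\to\mathrm{Mat}_{3\times3}(\mathbb{R})$ is a given smooth function, and $\nabla_F T(F)$ is its Jacobian, a $9\times 9$ matrix; the inequality $\nabla_FT\le\Gamma I$ is a bound on the size of this matrix by $\Gamma$ (a bound on the characteristic speeds). The functions $\bar F,\widehat F$ take values in $\mathrm{Mat}_{3\times3}(\mathbb{R})$ and $\bar v,\widehat v$ in $\mathbb{R}^3$. $|\nabla(\bar v-\widehat v)|^2=\sum_{i,\alpha}|\partial_\alpha(\bar v_i-\widehat v_i)|^2$. *)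

theory Defs
  imports "HOL-Analysis.Analysis"
begin

text \<open>
  \<^term>\<open>Ck_on k S f\<close>: \<open>f\<close> is \<open>k\<close> times continuously differentiable on \<open>S\<close>, derivatives being taken
  relative to \<open>S\<close>.  It is used for \<open>S = UNIV\<close> and for slabs \<open>[0,\<T>] \<times> \<real>\<^sup>3\<close>; both are convex with
  nonempty interior, so that derivatives within \<open>S\<close> are unique (and one-sided in time at the ends
  of the slab).
\<close>

primrec Ck_on ::
  "nat \<Rightarrow> 'a::real_normed_vector set \<Rightarrow> ('a \<Rightarrow> 'b::real_normed_vector) \<Rightarrow> bool" where
  "Ck_on 0 S f \<longleftrightarrow> continuous_on S f"
| "Ck_on (Suc k) S f \<longleftrightarrow>
     (\<exists>f'. (\<forall>x\<in>S. (f has_derivative f' x) (at x within S)) \<and> (\<forall>h. Ck_on k S (\<lambda>x. f' x h)))"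

definition smooth_on :: "'a::real_normed_vector set \<Rightarrow> ('a \<Rightarrow> 'b::real_normed_vector) \<Rightarrow> bool" where
  "smooth_on S f \<longleftrightarrow> (\<forall>k. Ck_on k S f)"

definition test_function :: "(real^3 \<Rightarrow> real) \<Rightarrow> bool" where
  "test_function \<psi> \<longleftrightarrow> smooth_on UNIV \<psi> \<and> compact (closure {x. \<psi> x \<noteq> 0})"

text \<open>
  Sobolev spaces \<open>H\<^sup>s(\<real>\<^sup>3)\<close> for real \<open>s \<ge> 0\<close>, by means of the Fourier transform with the convention
  \<open>\<F> u(\<xi>) = \<integral> e\<^bsup>-i x\<cdot>\<xi>\<^esup> u(x) dx\<close>.  For \<open>u \<in> L\<^sup>2\<close>, the function \<open>g = \<F> u \<in> L\<^sup>2\<close> is characterised,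
  uniquely up to null sets, by \<open>u = \<F>\<^sup>-\<^sup>1 g\<close> in the sense of distributions, that is, by
  \<open>\<langle>u, \<psi>\<rangle> = \<langle>g, \<F>\<^sup>-\<^sup>1 \<psi>\<rangle>\<close> for all test functions \<open>\<psi>\<close>.  Real-valued \<open>\<psi>\<close> suffice by linearity.
\<close>

definition inv_fourier :: "(real^3 \<Rightarrow> real) \<Rightarrow> real^3 \<Rightarrow> complex" where
  "inv_fourier \<psi> \<xi> = (LINT x|lborel. cis (x \<bullet> \<xi>) * complex_of_real (\<psi> x)) / (2 * pi) ^ 3"

definition square_integrable :: "(real^3 \<Rightarrow> 'b::euclidean_space) \<Rightarrow> bool" where
  "square_integrable u \<longleftrightarrow> u \<in> borel_measurable lborel \<and> integrable lborel (\<lambda>x. (norm (u x))\<^sup>2)"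

definition is_fourier :: "(real^3 \<Rightarrow> real) \<Rightarrow> (real^3 \<Rightarrow> complex) \<Rightarrow> bool" where
  "is_fourier u g \<longleftrightarrow> square_integrable u \<and> square_integrable g \<and>
     (\<forall>\<psi>. test_function \<psi> \<longrightarrow>
        complex_of_real (LINT x|lborel. u x * \<psi> x) = (LINT \<xi>|lborel. g \<xi> * inv_fourier \<psi> \<xi>))"

definition fourier :: "(real^3 \<Rightarrow> real) \<Rightarrow> real^3 \<Rightarrow> complex" where
  "fourier u = (SOME g. is_fourier u g)"

definition in_H :: "real \<Rightarrow> (real^3 \<Rightarrow> real) \<Rightarrow> bool" where
  "in_H s u \<longleftrightarrow> square_integrable u \<and>
     integrable lborel (\<lambda>\<xi>. (1 + (norm \<xi>)\<^sup>2) powr s * (norm (fourier u \<xi>))\<^sup>2)"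

text \<open>The factor \<open>(2\<pi>)\<^sup>-\<^sup>3\<close> makes the norm of \<open>H\<^sup>0\<close> the norm of \<open>L\<^sup>2\<close>.\<close>

definition H_norm :: "real \<Rightarrow> (real^3 \<Rightarrow> real) \<Rightarrow> real" where
  "H_norm s u =
     sqrt ((LINT \<xi>|lborel. (1 + (norm \<xi>)\<^sup>2) powr s * (norm (fourier u \<xi>))\<^sup>2) / (2 * pi) ^ 3)"

text \<open>
  \<^term>\<open>Ck_H k s \<T> u\<close>: \<open>u \<in> C\<^sup>k([0,\<T>]; H\<^sup>s(\<real>\<^sup>3))\<close>.  The time derivative is the limit of difference
  quotients in the norm of \<open>H\<^sup>s\<close>.
\<close>

definition C0_H :: "real \<Rightarrow> real \<Rightarrow> (real \<Rightarrow> real^3 \<Rightarrow> real) \<Rightarrow> bool" where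
  "C0_H s \<T> u \<longleftrightarrow> (\<forall>t\<in>{0..\<T>}. in_H s (u t) \<and>
     ((\<lambda>\<tau>. H_norm s (\<lambda>x. u \<tau> x - u t x)) \<longlongrightarrow> 0) (at t within {0..\<T>}))"

primrec Ck_H :: "nat \<Rightarrow> real \<Rightarrow> real \<Rightarrow> (real \<Rightarrow> real^3 \<Rightarrow> real) \<Rightarrow> bool" where
  "Ck_H 0 s \<T> u \<longleftrightarrow> C0_H s \<T> u"
| "Ck_H (Suc k) s \<T> u \<longleftrightarrow> C0_H s \<T> u \<and>
     (\<exists>u'. Ck_H k s \<T> u' \<and>
       (\<forall>t\<in>{0..\<T>}. ((\<lambda>\<tau>. H_norm s (\<lambda>x. (u \<tau> x - u t x) / (\<tau> - t) - u' t x)) \<longlongrightarrow> 0)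
                      (at t within {0..\<T>})))"

definition Ck_H_vec :: "nat \<Rightarrow> real \<Rightarrow> real \<Rightarrow> (real \<Rightarrow> real^3 \<Rightarrow> real^3) \<Rightarrow> bool" where
  "Ck_H_vec k s \<T> v \<longleftrightarrow> (\<forall>i. Ck_H k s \<T> (\<lambda>t x. v t x $ i))"

definition Ck_H_mat :: "nat \<Rightarrow> real \<Rightarrow> real \<Rightarrow> (real \<Rightarrow> real^3 \<Rightarrow> real^3^3) \<Rightarrow> bool" where
  "Ck_H_mat k s \<T> F \<longleftrightarrow> (\<forall>i \<alpha>. Ck_H k s \<T> (\<lambda>t x. F t x $ i $ \<alpha>))"

text \<open>Classical partial derivatives; the time derivative is one-sided at \<open>0\<close> and \<open>\<T>\<close>.\<close>

definition pdx :: "3 \<Rightarrow> (real^3 \<Rightarrow> real) \<Rightarrow> real^3 \<Rightarrow> real" where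
  "pdx \<alpha> f x = frechet_derivative f (at x) (axis \<alpha> 1)"

definition pdt ::
  "real \<Rightarrow> (real \<Rightarrow> real^3 \<Rightarrow> 'b::real_normed_vector) \<Rightarrow> real \<Rightarrow> real^3 \<Rightarrow> 'b" where
  "pdt \<T> u t x = vector_derivative (\<lambda>s. u s x) (at t within {0..\<T>})"

text \<open>
  The systems are required pointwise on \<open>[0,\<T>] \<times> \<real>\<^sup>3\<close>.  The stress is called \<open>S\<close>, and \<open>F $ i $ \<alpha>\<close>
  is \<open>F\<^sub>i\<^sub>\<alpha>\<close>.
\<close>

definition viscoelastic_solution ::
  "real \<Rightarrow> (real^3^3 \<Rightarrow> real^3^3) \<Rightarrow> real \<Rightarrow>
   (real \<Rightarrow> real^3 \<Rightarrow> real^3^3) \<Rightarrow> (real \<Rightarrow> real^3 \<Rightarrow> real^3) \<Rightarrow> bool" where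
  "viscoelastic_solution \<mu> S \<T> F v \<longleftrightarrow>
     (\<forall>t\<in>{0..\<T>}. \<forall>x.
        (\<forall>i \<alpha>. pdt \<T> (\<lambda>t x. F t x $ i $ \<alpha>) t x - pdx \<alpha> (\<lambda>y. v t y $ i) x = 0) \<and>
        (\<forall>i. pdt \<T> (\<lambda>t x. v t x $ i) t x - (\<Sum>\<alpha>\<in>UNIV. pdx \<alpha> (\<lambda>y. S (F t y) $ i $ \<alpha>) x)
             = \<mu> * (\<Sum>\<alpha>\<in>UNIV. pdx \<alpha> (pdx \<alpha> (\<lambda>y. v t y $ i)) x)))"

definition relaxation_solution ::
  "real \<Rightarrow> real \<Rightarrow> (real^3^3 \<Rightarrow> real^3^3) \<Rightarrow> real \<Rightarrow>
   (real \<Rightarrow> real^3 \<Rightarrow> real^3^3) \<Rightarrow> (real \<Rightarrow> real^3 \<Rightarrow> real^3) \<Rightarrow> bool" where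
  "relaxation_solution \<epsilon> \<mu> S \<T> F v \<longleftrightarrow>
     (\<forall>t\<in>{0..\<T>}. \<forall>x.
        (\<forall>i \<alpha>. pdt \<T> (\<lambda>t x. F t x $ i $ \<alpha>) t x - pdx \<alpha> (\<lambda>y. v t y $ i) x = 0) \<and>
        (\<forall>i. pdt \<T> (\<lambda>t x. v t x $ i) t x - (\<Sum>\<alpha>\<in>UNIV. pdx \<alpha> (\<lambda>y. S (F t y) $ i $ \<alpha>) x)
             = \<mu> * (\<Sum>\<alpha>\<in>UNIV. pdx \<alpha> (pdx \<alpha> (\<lambda>y. v t y $ i)) x)
               - \<epsilon> * pdt \<T> (pdt \<T> (\<lambda>t x. v t x $ i)) t x))"

text \<open>The functional \<open>\<phi>\<^sup>\<epsilon>\<close> for the differences \<open>w\<close> of the velocities and \<open>G\<close> of the deformation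
  gradients.  The norm of \<^typ>\<open>real^3^3\<close> is the Euclidean norm of the nine entries.\<close>

definition phi ::
  "real \<Rightarrow> real \<Rightarrow> (real \<Rightarrow> real^3 \<Rightarrow> real^3^3) \<Rightarrow> (real \<Rightarrow> real^3 \<Rightarrow> real^3) \<Rightarrow> real \<Rightarrow> real" where
  "phi \<epsilon> \<T> G w t =
     (LINT x|lborel. (norm (w t x))\<^sup>2 + (norm (G t x))\<^sup>2 + \<epsilon>\<^sup>2 * (norm (pdt \<T> w t x))\<^sup>2
        + \<epsilon> * (\<Sum>i\<in>UNIV. \<Sum>\<alpha>\<in>UNIV. \<bar>pdx \<alpha> (\<lambda>y. w t y $ i) x\<bar>\<^sup>2))"

end

theory Submission
  imports Defs "HOL-Probability.Probability"
begin

text \<open>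
  The differences \<open>w\<close> of the velocities and \<open>G\<close> of the deformation gradients satisfy
  \<open>\<epsilon> w\<^sub>t\<^sub>t = - w\<^sub>t + div \<Sigma> + \<mu> \<Delta> w - \<epsilon> h\<close> and \<open>G\<^sub>t = \<nabla> w\<close>, where \<open>\<Sigma>\<close> is the difference of the stresses and \<open>h\<close> the
  acceleration of the limit velocity.  The energy
  \<open>\<integral> \<bar>w\<bar>\<^sup>2 / 2 + \<epsilon> w \<bullet> w\<^sub>t + \<epsilon>\<^sup>2 \<bar>w\<^sub>t\<bar>\<^sup>2 + \<epsilon> \<mu> \<bar>\<nabla> w\<bar>\<^sup>2 + 2 \<epsilon> \<Sigma> \<bullet> \<nabla> w + K \<bar>G\<bar>\<^sup>2 / 2\<close> is comparable to \<open>\<phi>\<close> up to a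
  multiple of \<open>\<integral> \<bar>G\<bar>\<^sup>2\<close> absorbed by \<open>K\<close>; it is obtained by testing the equation with \<open>w\<close> and with \<open>2 \<epsilon> w\<^sub>t\<close>, and the
  dissipation \<open>\<epsilon> \<bar>w\<^sub>t\<bar>\<^sup>2 + \<mu> \<bar>\<nabla> w\<bar>\<^sup>2\<close> absorbs the stress terms once \<open>\<epsilon>\<close> is small.  Gronwall's inequality concludes.

  No second time derivative of the limit velocity is assumed.  The assumptions on the differences provide it as
  \<open>h = v\<^sub>t\<^sub>t - w\<^sub>t\<^sub>t\<close> in \<open>L\<^sup>2\<close>; this does not depend on \<open>\<epsilon>\<close>, and the equation for \<open>\<epsilon> = 1\<close> bounds it uniformly in time.
  Pointwise derivatives and their \<open>L\<^sup>2\<close> counterparts are identified by Plancherel's theorem and Sobolev's embedding.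
\<close>

section \<open>Continuously differentiable functions and test functions\<close>

text \<open>Testing with \<open>w\<close> leaves \<open>\<epsilon> |wt|^2\<close> with the wrong
  sign; testing with \<open>2 \<epsilon> wt\<close> supplies twice that quantity with the right one,
  whence the factor 2. The price is \<open>2 \<epsilon> \<Sigma> \<bullet> \<nabla> wt\<close>, and
  no dissipation controls \<open>\<nabla> wt\<close>. It is therefore absorbed into a time
  derivative: \<open>2 \<epsilon> \<Sigma> \<bullet> \<nabla> w\<close> joins the energy, and the
  time derivative of \<open>\<Sigma>\<close>, paired with \<open>2 \<epsilon> \<nabla> w\<close>,
  remains. That derivative is at most \<open>L |\<nabla> w| + N |G|\<close>, where \<open>L\<close>
  bounds the derivative of the stress on a ball containing all states; the dissipation absorbs it
  once \<open>8 L \<epsilon> \<le> \<mu>\<close>. The other obstacle is the function spaces. The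
  Sobolev norm is an integral of a Fourier transform that \<open>SOME\<close> selects and that is
  known only through pairings with test functions. Existence, uniqueness up to null sets, inversion
  and an L^2 inequality are first obtained for absolutely convergent integrals by Gaussian damping,
  then carried to L^2 by truncation to balls.\<close>

lemma Ck_on_cong:
  assumes "Ck_on k S f" "\<And>x. x \<in> S \<Longrightarrow> f x = g x"
  shows "Ck_on k S g"
proof (cases k)
  case 0
  then show ?thesis using assms continuous_on_cong[of S S f g] by auto
next
  case (Suc m)
  then obtain f' where f': "\<forall>x\<in>S. (f has_derivative f' x) (at x within S)" "\<forall>h. Ck_on m S (\<lambda>x. f' x h)"
    using assms by auto
  have "\<forall>x\<in>S. (g has_derivative f' x) (at x within S)"
  proof
    fix x assume x: "x \<in> S"
    show "(g has_derivative f' x) (at x within S)"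
      by (rule has_derivative_transform[OF x _ f'(1)[rule_format, OF x]]) (simp add: assms(2))
  qed
  then show ?thesis using Suc f' by auto
qed

lemma Ck_on_Suc_imp: "Ck_on (Suc k) S f \<Longrightarrow> Ck_on k S f"
proof (induction k arbitrary: f)
  case 0
  then show ?case
    by (auto simp: continuous_on_eq_continuous_within intro: has_derivative_continuous)
next
  case (Suc k)
  from Suc.prems obtain f' where "\<forall>x\<in>S. (f has_derivative f' x) (at x within S)"
      "\<forall>h. Ck_on (Suc k) S (\<lambda>x. f' x h)" 
    by (subst (asm) Ck_on.simps(2)) blast
  then show ?case using Suc.IH by (subst Ck_on.simps(2)) blast
qed

lemma Ck_on_le: "Ck_on k S f \<Longrightarrow> m \<le> k \<Longrightarrow> Ck_on m S f"
proof (induction k arbitrary: m)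
  case (Suc k)
  then show ?case using Ck_on_Suc_imp le_Suc_eq by blast
qed simp

lemma Ck_on_continuous: "Ck_on k S f \<Longrightarrow> continuous_on S f"
  using Ck_on_le[of k S f 0] by simp

lemma Ck_on_const: "Ck_on k S (\<lambda>x. c)"
proof (induction k arbitrary: c)
  case (Suc k)
  show ?case by (auto intro!: exI[of _ "\<lambda>x h. 0"] Suc derivative_intros)
qed auto

lemma Ck_on_bounded_linear: "bounded_linear L \<Longrightarrow> Ck_on k S f \<Longrightarrow> Ck_on k S (\<lambda>x. L (f x))"
proof (induction k arbitrary: f)
  case 0
  then show ?case by (auto intro: bounded_linear.continuous_on)
next
  case (Suc k)
  then obtain f' where f': "\<forall>x\<in>S. (f has_derivative f' x) (at x within S)" "\<forall>h. Ck_on k S (\<lambda>x. f' x h)"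
    by auto
  show ?case
    using f' Suc
    by (auto intro!: exI[of _ "\<lambda>x h. L (f' x h)"] bounded_linear.has_derivative[OF Suc.prems(1)])
qed

lemma Ck_on_add: "Ck_on k S f \<Longrightarrow> Ck_on k S g \<Longrightarrow> Ck_on k S (\<lambda>x. f x + g x)"
proof (induction k arbitrary: f g)
  case 0
  then show ?case by (auto intro: continuous_intros)
next
  case (Suc k)
  then obtain f' g' where
      "\<forall>x\<in>S. (f has_derivative f' x) (at x within S)" "\<forall>h. Ck_on k S (\<lambda>x. f' x h)"
      "\<forall>x\<in>S. (g has_derivative g' x) (at x within S)" "\<forall>h. Ck_on k S (\<lambda>x. g' x h)"
    by auto
  then show ?case
    using Suc.IH by (auto intro!: exI[of _ "\<lambda>x h. f' x h + g' x h"] derivative_intros)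
qed

lemma Ck_on_uminus: "Ck_on k S f \<Longrightarrow> Ck_on k S (\<lambda>x. - f x)"
  by (rule Ck_on_bounded_linear[OF bounded_linear_minus[OF bounded_linear_ident]])

lemma Ck_on_diff: "Ck_on k S f \<Longrightarrow> Ck_on k S g \<Longrightarrow> Ck_on k S (\<lambda>x. f x - g x)"
  using Ck_on_add[OF _ Ck_on_uminus, of k S f g] by simp

lemma Ck_on_mult:
  fixes f g :: "'a::real_normed_vector \<Rightarrow> 'b::real_normed_algebra"
  shows "Ck_on k S f \<Longrightarrow> Ck_on k S g \<Longrightarrow> Ck_on k S (\<lambda>x. f x * g x)"
proof (induction k arbitrary: f g)
  case 0
  then show ?case by (auto intro: continuous_intros)
next
  case (Suc k)
  then obtain f' g' where *:
      "\<forall>x\<in>S. (f has_derivative f' x) (at x within S)" "\<forall>h. Ck_on k S (\<lambda>x. f' x h)"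
      "\<forall>x\<in>S. (g has_derivative g' x) (at x within S)" "\<forall>h. Ck_on k S (\<lambda>x. g' x h)"
    by auto
  have **: "Ck_on k S f" "Ck_on k S g" using Suc.prems by (auto simp del: Ck_on.simps intro: Ck_on_Suc_imp)
  show ?case
    using * ** Suc.IH
    by (auto intro!: exI[of _ "\<lambda>x h. f x * g' x h + f' x h * g x"] derivative_intros Ck_on_add)
qed

lemma smooth_on_prod:
  fixes f :: "'i \<Rightarrow> 'a::real_normed_vector \<Rightarrow> 'b::{real_normed_algebra,comm_ring_1}"
  assumes "\<And>i. i \<in> I \<Longrightarrow> smooth_on S (f i)"
  shows "smooth_on S (\<lambda>x. \<Prod>i\<in>I. f i x)"
  using assms
proof (induction I rule: infinite_finite_induct)
  case (insert i I)
  then show ?case by (auto simp: smooth_on_def intro!: Ck_on_mult)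
qed (auto simp: smooth_on_def intro: Ck_on_const)

section \<open>Test functions built from functions that are flat at the origin\<close>

text \<open>For \<open>p = 1\<close> this is the classical smooth function that vanishes on the
  negative half-line. The polynomial in \<open>1 / t\<close> makes the family closed under
  differentiation, so that smoothness becomes one induction.\<close>

definition flat :: "real poly \<Rightarrow> real \<Rightarrow> real" where
  "flat p t = (if t > 0 then poly p (1 / t) * exp (- 1 / t) else 0)"

text \<open>With \<open>s = 1 / t\<close>, both the exponential and the polynomial contribute a
  factor \<open>s^2\<close> from the chain rule, the polynomial with a minus sign.\<close>

definition dflat :: "real poly \<Rightarrow> real poly" where
  "dflat p = [:0, 0, 1:] * (p - pderiv p)"

lemma poly_exp_neg_tendsto_0: "((\<lambda>s. poly p s * exp (- s)) \<longlongrightarrow> (0::real)) at_top"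
proof -
  have "((\<lambda>s. \<Sum>i\<le>degree p. coeff p i * (s ^ i / exp s)) \<longlongrightarrow> (\<Sum>i\<le>degree p. coeff p i * 0)) at_top"
    by (intro tendsto_intros tendsto_power_div_exp_0)
  then show ?thesis
    by (simp add: poly_altdef sum_distrib_right exp_minus divide_inverse mult.assoc)
qed

lemma flat_tendsto_0: "(flat p \<longlongrightarrow> 0) (at_right 0)"
proof -
  have "((\<lambda>t. poly p (1/t) * exp (- (1 / t))) \<longlongrightarrow> 0) (at_right 0)"
    using filterlim_compose[OF poly_exp_neg_tendsto_0 filterlim_inverse_at_top_right, of p]
    by (simp add: divide_inverse)
  then show ?thesis
    by (rule Lim_transform_eventually) (auto simp: eventually_at_right_field flat_def intro!: exI[of _ 1])
qed

lemma flat_has_derivative: "(flat p has_real_derivative flat (dflat p) t) (at t)"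
proof -
  consider "t < 0" | "t = 0" | "t > 0" by linarith
  then show ?thesis
  proof cases
    case 1
    have "((\<lambda>t. 0) has_real_derivative 0) (at t)" by simp
    moreover have "eventually (\<lambda>s. s < 0) (nhds t)" using 1 by (auto intro: eventually_nhds_in_open[of "{..<0}", simplified])
    then have "eventually (\<lambda>s. flat p s = 0) (nhds t)" by eventually_elim (auto simp: flat_def)
    ultimately show ?thesis using 1 DERIV_cong_ev[of t t "flat p" "\<lambda>_. 0" 0 0] by (simp add: flat_def)
  next
    case 2
    \<comment> \<open>Division by \<open>h\<close> multiplies the polynomial by its variable
      \<open>1 / h\<close>, so the difference quotient at 0 is again a member of the family and
      tends to 0.\<close>
    have "((\<lambda>h. flat p h / h) \<longlongrightarrow> 0) (at_right 0)"
      by (rule Lim_transform_eventually[OF flat_tendsto_0[of "[:0,1:]*p"]])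
        (auto simp: eventually_at_right_field flat_def divide_simps intro!: exI[of _ 1])
    moreover have "((\<lambda>h. flat p h / h) \<longlongrightarrow> 0) (at_left 0)"
      by (rule Lim_transform_eventually[OF tendsto_const])
        (auto simp: eventually_at_left_field flat_def intro!: exI[of _ "-1"])
    ultimately have "((\<lambda>h. flat p h / h) \<longlongrightarrow> 0) (at 0)" by (simp add: filterlim_split_at_real)
    then show ?thesis using 2 by (simp add: DERIV_def flat_def)
  next
    case 3
    have "((\<lambda>t. poly p (1/t) * exp (- 1 / t)) has_real_derivative
       poly p (1/t) * (exp (- 1 / t) * (1/t^2)) + (poly (pderiv p) (1/t) * (-1/t^2)) * exp (-1/t)) (at t)"
      using 3 by (auto intro!: derivative_eq_intros DERIV_chain2[OF poly_DERIV] simp: power2_eq_square)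
    moreover have "eventually (\<lambda>s. s > 0) (nhds t)" using 3 by (auto intro: eventually_nhds_in_open[of "{0<..}", simplified])
    then have "eventually (\<lambda>s. flat p s = poly p (1/s) * exp (- 1 / s)) (nhds t)" by eventually_elim (auto simp: flat_def)
    moreover have "flat (dflat p) t = poly p (1/t) * (exp (- 1 / t) * (1/t^2)) + (poly (pderiv p) (1/t) * (-1/t^2)) * exp (-1/t)"
      using 3 by (simp add: flat_def dflat_def power2_eq_square field_simps)
    ultimately show ?thesis using DERIV_cong_ev[of t t "flat p" "\<lambda>t. poly p (1/t) * exp (- 1 / t)" ] by simp
  qed
qed

text \<open>Each directional derivative is a constant times the function of the same form for
  \<open>dflat p\<close>; hence the induction over \<open>k\<close> runs for all \<open>p\<close> at
  once.\<close>

lemma smooth_on_flat_affine: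
  fixes a :: "'a::real_inner"
  shows "smooth_on UNIV (\<lambda>x. flat p (x \<bullet> a + b))"
  unfolding smooth_on_def
proof
  fix k
  show "Ck_on k UNIV (\<lambda>x. flat p (x \<bullet> a + b))"
  proof (induction k arbitrary: p)
    case 0
    have "isCont (flat p) t" for t by (rule DERIV_isCont[OF flat_has_derivative])
    then have "continuous_on UNIV (flat p)" by (simp add: continuous_on_eq_continuous_at)
    moreover have "continuous_on UNIV (\<lambda>x. x \<bullet> a + b)" by (intro continuous_intros)
    ultimately have "continuous_on UNIV (\<lambda>x. flat p (x \<bullet> a + b))"
      by (rule continuous_on_compose2) auto
    then show ?case by simp
  next
    case (Suc k)
    have D: "((\<lambda>x. flat p (x \<bullet> a + b)) has_derivative (\<lambda>h. flat (dflat p) (x \<bullet> a + b) * (h \<bullet> a))) (at x)" for x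
      by (rule DERIV_compose_FDERIV[OF flat_has_derivative, THEN has_derivative_eq_rhs])
        (auto intro!: derivative_eq_intros)
    show ?case
      by (auto intro!: exI[of _ "\<lambda>x h. flat (dflat p) (x \<bullet> a + b) * (h \<bullet> a)"] D Ck_on_mult Suc Ck_on_const)
  qed
qed

lemma flat_1: "flat 1 t = (if t > 0 then exp (- 1 / t) else 0)"
  by (simp add: flat_def)

text \<open>As \<open>n\<close> tends to infinity these test functions tend to the indicator function of the box.\<close>

definition box_bump :: "nat \<Rightarrow> real^3 \<Rightarrow> real^3 \<Rightarrow> real^3 \<Rightarrow> real" where
  "box_bump n a b x = (\<Prod>e\<in>Basis. flat 1 (real n * (x \<bullet> e - a \<bullet> e)) * flat 1 (real n * (b \<bullet> e - x \<bullet> e)))"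

lemma box_bump_outside: "x \<notin> box a b \<Longrightarrow> box_bump n a b x = 0"
  unfolding box_bump_def by (rule prod_zero) (auto simp: mem_box flat_1 zero_less_mult_iff)

lemma box_bump_bounds: "0 \<le> box_bump n a b x" "box_bump n a b x \<le> 1"
  unfolding box_bump_def by (auto intro!: prod_nonneg prod_le_1 mult_le_one simp: flat_1)

lemma box_bump_tendsto: "(\<lambda>n. box_bump n a b x) \<longlonglongrightarrow> indicator (box a b) x"
proof (cases "x \<in> box a b")
  case True
  have *: "(\<lambda>n. flat 1 (real n * c)) \<longlonglongrightarrow> 1" if "c > 0" for c
  proof -
    have "(\<lambda>n. exp (- 1 / (real n * c))) \<longlonglongrightarrow> exp (- 0)"
    proof (intro tendsto_intros)
      have "(\<lambda>n. - (1 / c) * (1 / real n)) \<longlonglongrightarrow> - (1 / c) * 0" by (intro tendsto_intros lim_1_over_n)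
      then show "(\<lambda>n. - 1 / (real n * c)) \<longlonglongrightarrow> - 0" by (simp add: field_simps)
    qed
    then have "(\<lambda>n. exp (- 1 / (real n * c))) \<longlonglongrightarrow> 1" by simp
    then show ?thesis
      by (rule Lim_transform_eventually)
         (use that in \<open>auto intro!: eventually_sequentiallyI[of 1] simp: flat_1\<close>)
  qed
  have "(\<lambda>n. box_bump n a b x) \<longlonglongrightarrow> (\<Prod>e\<in>(Basis::(real^3) set). 1 * 1)"
    unfolding box_bump_def using True by (intro tendsto_intros *) (auto simp: mem_box)
  then show ?thesis using True by simp
qed (simp add: box_bump_outside)

lemma test_function_box_bump: "test_function (box_bump n a b)"
proof -
  have "smooth_on UNIV (box_bump n a b)"
  proof -
    have "smooth_on UNIV (\<lambda>x. flat 1 (real n * (x \<bullet> e - a \<bullet> e)) * flat 1 (real n * (b \<bullet> e - x \<bullet> e)))" for e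
      using smooth_on_flat_affine[of 1 "real n *\<^sub>R e" "- real n * (a \<bullet> e)"] smooth_on_flat_affine[of 1 "(-real n) *\<^sub>R e" "real n * (b \<bullet> e)"]
      by (auto simp: smooth_on_def algebra_simps intro!: Ck_on_mult)
    then show ?thesis unfolding box_bump_def by (intro smooth_on_prod)
  qed
  moreover have "{x. box_bump n a b x \<noteq> 0} \<subseteq> cbox a b" using box_bump_outside box_subset_cbox by blast
  then have "bounded {x. box_bump n a b x \<noteq> 0}" using bounded_cbox bounded_subset by blast
  ultimately show ?thesis by (simp add: test_function_def)
qed

lemma test_function_continuous: "test_function \<psi> \<Longrightarrow> continuous_on UNIV \<psi>"
  unfolding test_function_def smooth_on_def by (auto intro: Ck_on_continuous)

lemma test_function_support:
  assumes "test_function \<psi>" obtains a b where "\<And>x. x \<notin> box a b \<Longrightarrow> \<psi> x = 0"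
proof -
  have "bounded {x. \<psi> x \<noteq> 0}"
    using assms unfolding test_function_def by (meson bounded_closure bounded_subset closure_subset compact_imp_bounded)
  then obtain a where "{x. \<psi> x \<noteq> 0} \<subseteq> box (-a) a" using bounded_subset_box_symmetric by blast
  then show ?thesis using that[of "-a" a] by blast
qed

lemma test_function_bounded:
  assumes "test_function \<psi>" obtains B where "\<And>x. \<bar>\<psi> x\<bar> \<le> B" "B > 0"
proof -
  obtain a b where ab: "\<And>x. x \<notin> box a b \<Longrightarrow> \<psi> x = 0" using test_function_support[OF assms] by blast
  have "compact (\<psi> ` cbox a b)"
    by (intro compact_continuous_image continuous_on_subset[OF test_function_continuous[OF assms]]) auto
  then obtain B where "B > 0" "\<And>x. x \<in> cbox a b \<Longrightarrow> \<bar>\<psi> x\<bar> \<le> B" 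
    by (auto dest!: compact_imp_bounded simp: bounded_pos)
  then show ?thesis using that[of B] ab box_subset_cbox
    by (metis abs_zero less_eq_real_def subsetD)
qed

lemma test_function_measurable: "test_function \<psi> \<Longrightarrow> \<psi> \<in> borel_measurable borel"
  by (intro borel_measurable_continuous_onI test_function_continuous)

lemma Ck_on_Suc_UNIV_frechet:
  assumes "Ck_on (Suc k) UNIV f"
  shows "(f has_derivative frechet_derivative f (at x)) (at x)" "Ck_on k UNIV (\<lambda>x. frechet_derivative f (at x) h)"
proof -
  obtain f' where f': "\<forall>x. (f has_derivative f' x) (at x)" "\<forall>h. Ck_on k UNIV (\<lambda>x. f' x h)"
    using assms by auto
  have "f' = (\<lambda>x. frechet_derivative f (at x))" using f'(1) frechet_derivative_at by blast
  then show "(f has_derivative frechet_derivative f (at x)) (at x)" "Ck_on k UNIV (\<lambda>x. frechet_derivative f (at x) h)"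
    using f' by auto
qed

lemma Ck_on_pdx: "Ck_on (Suc k) UNIV f \<Longrightarrow> Ck_on k UNIV (pdx \<alpha> f)"
  using Ck_on_Suc_UNIV_frechet(2) unfolding pdx_def .

text \<open>Outside the closed support the function vanishes in a neighbourhood, hence so does its
  derivative; the support can only shrink.\<close>

lemma test_function_pdx:
  assumes "test_function \<psi>" shows "test_function (pdx \<alpha> \<psi>)"
proof -
  have "smooth_on UNIV (pdx \<alpha> \<psi>)"
    using assms Ck_on_pdx by (auto simp: test_function_def smooth_on_def simp del: Ck_on.simps)
  moreover have sub: "closure {x. pdx \<alpha> \<psi> x \<noteq> 0} \<subseteq> closure {x. \<psi> x \<noteq> 0}"
  proof (rule closure_minimal)
    show "{x. pdx \<alpha> \<psi> x \<noteq> 0} \<subseteq> closure {x. \<psi> x \<noteq> 0}"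
    proof (rule ccontr)
      assume "\<not> ?thesis"
      then obtain x where x: "pdx \<alpha> \<psi> x \<noteq> 0" "x \<in> - closure {x. \<psi> x \<noteq> 0}" by auto
      define U where "U = - closure {x. \<psi> x \<noteq> 0}"
      have U: "open U" "x \<in> U" using x(2) by (auto simp: U_def)
      have U0: "0 = \<psi> y" if "y \<in> U" for y
      proof (rule ccontr)
        assume "0 \<noteq> \<psi> y"
        then have "y \<in> closure {x. \<psi> x \<noteq> 0}" using subsetD[OF closure_subset, of y "{x. \<psi> x \<noteq> 0}"] by simp
        then show False using that by (simp add: U_def)
      qed
      have "(\<psi> has_derivative (\<lambda>h. 0)) (at x)"
        by (rule has_derivative_transform_within_open[OF has_derivative_const U]) (rule U0)
      then have "frechet_derivative \<psi> (at x) = (\<lambda>h. 0)" by (metis frechet_derivative_at)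
      then show False using x(1) by (simp add: pdx_def)
    qed
  qed simp
  moreover have "compact (closure {x. \<psi> x \<noteq> 0})" using assms by (simp add: test_function_def)
  then have "compact (closure {x. \<psi> x \<noteq> 0} \<inter> closure {x. pdx \<alpha> \<psi> x \<noteq> 0})"
    by (rule compact_Int_closed) (rule closed_closure)
  then have "compact (closure {x. pdx \<alpha> \<psi> x \<noteq> 0})" using sub by (simp add: Int_absorb1)
  ultimately show ?thesis unfolding test_function_def by blast
qed

section \<open>The fundamental lemma of the calculus of variations\<close>

text \<open>Since \<open>ennreal\<close> cuts off at 0, \<open>p\<close> and \<open>q\<close> are
  the positive and the negative part. The measures with these densities agree on boxes, which are
  stable under intersection, generate the Borel sets and exhaust the space; so the densities agree
  almost everywhere, and equal parts must both vanish.\<close>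

lemma AE_eq_0_if_box_integrals_real:
  fixes f :: "real^3 \<Rightarrow> real"
  assumes [measurable]: "f \<in> borel_measurable borel"
    and int: "\<And>a b. set_integrable lborel (box a b) f"
    and zero: "\<And>a b. (LINT x:box a b|lborel. f x) = 0"
  shows "AE x in lborel. f x = 0"
proof -
  define p where "p x = ennreal (f x)" for x
  define q where "q x = ennreal (- f x)" for x
  have [measurable]: "p \<in> borel_measurable borel" "q \<in> borel_measurable borel" unfolding p_def q_def by auto
  have fin: "(\<integral>\<^sup>+x\<in>box a b. p x \<partial>lborel) < \<infinity>" "(\<integral>\<^sup>+x\<in>box a b. q x \<partial>lborel) < \<infinity>" 
    and eq: "(\<integral>\<^sup>+x\<in>box a b. p x \<partial>lborel) = (\<integral>\<^sup>+x\<in>box a b. q x \<partial>lborel)" for a b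
  proof -
    let ?g = "\<lambda>x. indicator (box a b) x * f x"
    have i: "integrable lborel ?g" using int[of a b] by (simp add: set_integrable_def)
    have P: "(\<integral>\<^sup>+x\<in>box a b. p x \<partial>lborel) = (\<integral>\<^sup>+x. ennreal (?g x) \<partial>lborel)"
      by (intro nn_integral_cong) (auto simp: p_def indicator_def)
    have Q: "(\<integral>\<^sup>+x\<in>box a b. q x \<partial>lborel) = (\<integral>\<^sup>+x. ennreal (- ?g x) \<partial>lborel)"
      by (intro nn_integral_cong) (auto simp: q_def indicator_def)
    show f1: "(\<integral>\<^sup>+x\<in>box a b. p x \<partial>lborel) < \<infinity>" and f2: "(\<integral>\<^sup>+x\<in>box a b. q x \<partial>lborel) < \<infinity>"
      using i unfolding P Q by (auto simp: real_integrable_def top.not_eq_extremum)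
    have "0 = enn2real (\<integral>\<^sup>+x. ennreal (?g x) \<partial>lborel) - enn2real (\<integral>\<^sup>+x. ennreal (- ?g x) \<partial>lborel)"
      using zero[of a b] real_lebesgue_integral_def[OF i] by (simp add: set_lebesgue_integral_def)
    then have "ennreal (enn2real (\<integral>\<^sup>+x. ennreal (?g x) \<partial>lborel)) = ennreal (enn2real (\<integral>\<^sup>+x. ennreal (- ?g x) \<partial>lborel))"
      by simp
    moreover have "ennreal (enn2real (\<integral>\<^sup>+x. ennreal (?g x) \<partial>lborel)) = (\<integral>\<^sup>+x. ennreal (?g x) \<partial>lborel)"
      using f1 unfolding P by (intro ennreal_enn2real) (simp add: infinity_ennreal_def)
    moreover have "ennreal (enn2real (\<integral>\<^sup>+x. ennreal (- ?g x) \<partial>lborel)) = (\<integral>\<^sup>+x. ennreal (- ?g x) \<partial>lborel)"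
      using f2 unfolding Q by (intro ennreal_enn2real) (simp add: infinity_ennreal_def)
    ultimately show "(\<integral>\<^sup>+x\<in>box a b. p x \<partial>lborel) = (\<integral>\<^sup>+x\<in>box a b. q x \<partial>lborel)"
      unfolding P Q by (simp only:)
  qed
  have "density lborel p = density lborel q"
  proof (rule measure_eqI_generator_eq[where \<Omega>=UNIV and E="range (\<lambda>(a, b). box a b)" and A="\<lambda>n. box (- (real n *\<^sub>R One)) (real n *\<^sub>R One)"])
    show "Int_stable (range (\<lambda>(a::real^3, b). box a b))"
      by (auto simp: Int_stable_def box_Int_box)
    show "sets (density lborel p) = sigma_sets UNIV (range (\<lambda>(a, b). box a b))"
      "sets (density lborel q) = sigma_sets UNIV (range (\<lambda>(a, b). box a b))"
      by (simp_all add: borel_eq_box)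
    show "(\<Union>n. box (- (real n *\<^sub>R One)) (real n *\<^sub>R One)) = (UNIV :: (real^3) set)"
      by (rule UN_box_eq_UNIV)
  qed (use fin eq in \<open>auto simp: emeasure_density less_top\<close>)
  then have "AE x in lborel. p x = q x"
    by (intro sigma_finite_measure.density_unique[OF sigma_finite_lborel]) auto
  then show ?thesis
  proof eventually_elim
    case (elim x)
    then show "f x = 0" unfolding p_def q_def
      by (metis ennreal_eq_0_iff ennreal_neg linorder_le_cases neg_le_0_iff_le order_antisym)
  qed
qed

text \<open>The bumps of a box lie between 0 and 1, vanish outside it and converge to its indicator,
  so dominated convergence turns vanishing test integrals into vanishing box integrals.\<close>

lemma AE_eq_0_if_test_integrals_real:
  fixes f :: "real^3 \<Rightarrow> real"
  assumes [measurable]: "f \<in> borel_measurable borel"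
    and int: "\<And>a b. set_integrable lborel (box a b) f"
    and zero: "\<And>\<psi>. test_function \<psi> \<Longrightarrow> (LINT x|lborel. f x * \<psi> x) = 0"
  shows "AE x in lborel. f x = 0"
proof (rule AE_eq_0_if_box_integrals_real)
  fix a b :: "real^3"
  have [measurable]: "box_bump n a b \<in> borel_measurable borel" for n
    using test_function_box_bump by (rule test_function_measurable)
  have "(\<lambda>n. LINT x|lborel. f x * box_bump n a b x) \<longlonglongrightarrow> (LINT x|lborel. f x * indicator (box a b) x)"
  proof (rule integral_dominated_convergence)
    show "integrable lborel (\<lambda>x. indicator (box a b) x *\<^sub>R \<bar>f x\<bar>)"
      using set_integrable_abs[OF int[of a b]] by (simp add: set_integrable_def)
    show "AE x in lborel. (\<lambda>n. f x * box_bump n a b x) \<longlonglongrightarrow> f x * indicator (box a b) x"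
      by (intro AE_I2 tendsto_intros box_bump_tendsto)
    show "AE x in lborel. norm (f x * box_bump n a b x) \<le> indicator (box a b) x *\<^sub>R \<bar>f x\<bar>" for n
    proof (rule AE_I2)
      fix x show "norm (f x * box_bump n a b x) \<le> indicator (box a b) x *\<^sub>R \<bar>f x\<bar>"
        using box_bump_bounds[of n a b x] box_bump_outside[of x a b n]
        by (cases "x \<in> box a b") (auto simp: abs_mult mult_left_le)
    qed
  qed auto
  then have "(LINT x|lborel. f x * indicator (box a b) x) = 0"
    using zero[OF test_function_box_bump] by (simp add: LIMSEQ_const_iff)
  then show "(LINT x:box a b|lborel. f x) = 0" by (simp add: set_lebesgue_integral_def mult.commute)
qed (use assms in auto)

lemma AE_eq_0_if_test_integrals:
  fixes f :: "real^3 \<Rightarrow> complex"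
  assumes [measurable]: "f \<in> borel_measurable borel"
    and int: "\<And>a b. set_integrable lborel (box a b) f"
    and zero: "\<And>\<psi>. test_function \<psi> \<Longrightarrow> (LINT x|lborel. f x * complex_of_real (\<psi> x)) = 0"
  shows "AE x in lborel. f x = 0"
proof -
  have i: "integrable lborel (\<lambda>x. f x * complex_of_real (\<psi> x))" if tf: "test_function \<psi>" for \<psi>
  proof -
    obtain a b where ab: "\<And>x. x \<notin> box a b \<Longrightarrow> \<psi> x = 0" using test_function_support[OF tf] by blast
    obtain B where B: "\<And>x. \<bar>\<psi> x\<bar> \<le> B" "B > 0" using test_function_bounded[OF tf] by blast
    have [measurable]: "\<psi> \<in> borel_measurable borel" using tf by (rule test_function_measurable)
    show ?thesis
    proof (rule Bochner_Integration.integrable_bound)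
      show "integrable lborel (\<lambda>x. B *\<^sub>R (indicator (box a b) x *\<^sub>R f x))"
        using int[of a b] unfolding set_integrable_def by (intro integrable_scaleR_right)
      show "AE x in lborel. norm (f x * complex_of_real (\<psi> x)) \<le> norm (B *\<^sub>R (indicator (box a b) x *\<^sub>R f x))"
      proof (rule AE_I2)
        fix x show "norm (f x * complex_of_real (\<psi> x)) \<le> norm (B *\<^sub>R (indicator (box a b) x *\<^sub>R f x))"
          using ab[of x] B(1)[of x] B(2) by (cases "x \<in> box a b") (auto simp: norm_mult mult.commute mult_right_mono)
      qed
    qed measurable
  qed
  have "AE x in lborel. Re (f x) = 0"
  proof (rule AE_eq_0_if_test_integrals_real)
    show "set_integrable lborel (box a b) (\<lambda>x. Re (f x))" for a b
      using integrable_Re[OF int[of a b, unfolded set_integrable_def]] by (simp add: set_integrable_def)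
    fix \<psi> assume p: "test_function \<psi>"
    show "(LINT x|lborel. Re (f x) * \<psi> x) = 0"
      using integral_Re[OF i[OF p]] zero[OF p] by simp
  qed measurable
  moreover have "AE x in lborel. Im (f x) = 0"
  proof (rule AE_eq_0_if_test_integrals_real)
    show "set_integrable lborel (box a b) (\<lambda>x. Im (f x))" for a b
      using integrable_Im[OF int[of a b, unfolded set_integrable_def]] by (simp add: set_integrable_def)
    fix \<psi> assume p: "test_function \<psi>"
    show "(LINT x|lborel. Im (f x) * \<psi> x) = 0"
      using integral_Im[OF i[OF p]] zero[OF p] by simp
  qed measurable
  ultimately show ?thesis by eventually_elim (simp add: complex_eq_iff)
qed

section \<open>Fourier integrals\<close>

lemma dominated_convergence_at:
  fixes f :: "'a \<Rightarrow> 'b::{banach, second_countable_topology}" and s :: "'c::metric_space \<Rightarrow> 'a \<Rightarrow> 'b"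
  assumes f: "f \<in> borel_measurable M" and s: "\<And>y. y \<in> S - {t} \<Longrightarrow> s y \<in> borel_measurable M"
    and w: "integrable M w"
    and lim: "AE x in M. ((\<lambda>y. s y x) \<longlongrightarrow> f x) (at t within S)"
    and bound: "\<And>y. y \<in> S - {t} \<Longrightarrow> AE x in M. norm (s y x) \<le> w x"
  shows "((\<lambda>y. LINT x|M. s y x) \<longlongrightarrow> (LINT x|M. f x)) (at t within S)"
  unfolding tendsto_at_iff_sequentially comp_def
proof (intro allI impI)
  fix X assume X: "\<forall>i. X i \<in> S - {t}" "X \<longlonglongrightarrow> t"
  show "(\<lambda>i. LINT x|M. s (X i) x) \<longlonglongrightarrow> (LINT x|M. f x)"
  proof (rule integral_dominated_convergence[where w=w])
    show "AE x in M. (\<lambda>i. s (X i) x) \<longlonglongrightarrow> f x"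
      using lim by eventually_elim (use X in \<open>auto simp: tendsto_at_iff_sequentially comp_def\<close>)
  qed (use X f s w bound in auto)
qed

text \<open>In terms of \<open>FI\<close>, the Fourier transform of \<open>u\<close> is \<open>\<xi> \<mapsto> FI u (- \<xi>)\<close>, and its inverse is \<open>FI / (2 * pi) ^ 3\<close>.\<close>

definition FI :: "(real^3 \<Rightarrow> complex) \<Rightarrow> real^3 \<Rightarrow> complex" where
  "FI g x = (LINT \<xi>|lborel. cis (x \<bullet> \<xi>) * g \<xi>)"

lemma cis_measurable [measurable]: "cis \<in> borel_measurable borel"
  by (intro borel_measurable_continuous_onI) (auto intro!: continuous_intros)

lemma integrable_cis_mult:
  assumes "integrable lborel g"
  shows "integrable lborel (\<lambda>\<xi>. cis (x \<bullet> \<xi>) * (g (\<xi>::real^3) :: complex))"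
proof -
  have [measurable]: "g \<in> borel_measurable borel" using borel_measurable_integrable[OF assms] by simp
  show ?thesis by (rule Bochner_Integration.integrable_bound[OF assms]) (auto simp: norm_mult)
qed

lemma norm_FI_le: "norm (FI g x) \<le> (LINT \<xi>|lborel. norm (g \<xi>))"
  unfolding FI_def using integral_norm_bound[of lborel "\<lambda>\<xi>. cis (x \<bullet> \<xi>) * g \<xi>"] by (simp add: norm_mult)

text \<open>The quadratic bound gives the pointwise limit in \<open>FI_has_derivative\<close>; the
  linear one gives a majorant that costs only the first moment of the integrand.\<close>

lemma norm_cis_approx: "norm (cis \<theta> - 1 - \<i> * of_real \<theta>) \<le> \<theta>\<^sup>2 / 2" "norm (cis \<theta> - 1 - \<i> * of_real \<theta>) \<le> 2 * \<bar>\<theta>\<bar>"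
  using iexp_approx1[of \<theta> 1] iexp_approx2[of \<theta> 1] by (simp_all add: cis_conv_exp algebra_simps power2_eq_square)

lemma FI_continuous:
  assumes "integrable lborel g"
  shows "continuous_on UNIV (FI g)"
proof -
  have [measurable]: "g \<in> borel_measurable borel" using borel_measurable_integrable[OF assms] by simp
  have "((\<lambda>y. FI g y) \<longlongrightarrow> FI g x) (at x)" for x
    unfolding FI_def
  proof (rule dominated_convergence_at[where w="\<lambda>\<xi>. norm (g \<xi>)"])
    show "AE \<xi> in lborel. ((\<lambda>y. cis (y \<bullet> \<xi>) * g \<xi>) \<longlongrightarrow> cis (x \<bullet> \<xi>) * g \<xi>) (at x)"
      by (intro AE_I2 tendsto_intros tendsto_cis)
  qed (use assms in \<open>auto simp: norm_mult\<close>)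
  then show ?thesis by (simp add: continuous_on_def)
qed

lemma FI_has_derivative:
  assumes g: "integrable lborel g" and xg: "integrable lborel (\<lambda>\<xi>. norm \<xi> * norm (g \<xi>))"
  shows "(FI g has_derivative (\<lambda>h. FI (\<lambda>\<xi>. \<i> * of_real (h \<bullet> \<xi>) * g \<xi>) x)) (at x)"
proof -
  have [measurable]: "g \<in> borel_measurable borel" using borel_measurable_integrable[OF g] by simp
  have ih: "integrable lborel (\<lambda>\<xi>. \<i> * of_real (h \<bullet> \<xi>) * g \<xi>)" for h
    by (rule Bochner_Integration.integrable_bound[OF integrable_mult_right[OF xg, of "norm h"]])
      (auto simp: norm_mult mult.assoc[symmetric] intro!: mult_right_mono Cauchy_Schwarz_ineq2)
  let ?L = "\<lambda>h. FI (\<lambda>\<xi>. \<i> * of_real (h \<bullet> \<xi>) * g \<xi>) x"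
  have ch: "integrable lborel (\<lambda>\<xi>. cis (x \<bullet> \<xi>) * (\<i> * of_real (h \<bullet> \<xi>) * g \<xi>))" for h
    by (rule integrable_cis_mult[OF ih])
  have "bounded_linear ?L"
  proof (rule bounded_linear_intro[where K="LINT \<xi>|lborel. norm \<xi> * norm (g \<xi>)"])
    show "?L (h + k) = ?L h + ?L k" for h k
      unfolding FI_def using Bochner_Integration.integral_add[OF ch ch, of h k] by (simp add: algebra_simps inner_add_left)
    show "?L (c *\<^sub>R h) = c *\<^sub>R ?L h" for c h
    proof -
      have "?L (c *\<^sub>R h) = (LINT \<xi>|lborel. of_real c * (cis (x \<bullet> \<xi>) * (\<i> * of_real (h \<bullet> \<xi>) * g \<xi>)))"
        unfolding FI_def by (intro Bochner_Integration.integral_cong refl) (simp add: mult_ac)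
      then show ?thesis by (simp add: FI_def scaleR_conv_of_real)
    qed
    show "norm (?L h) \<le> norm h * (LINT \<xi>|lborel. norm \<xi> * norm (g \<xi>))" for h
    proof -
      have "norm (?L h) \<le> (LINT \<xi>|lborel. norm (\<i> * of_real (h \<bullet> \<xi>) * g \<xi>))" by (rule norm_FI_le)
      also have "\<dots> \<le> (LINT \<xi>|lborel. norm h * (norm \<xi> * norm (g \<xi>)))"
        by (intro integral_mono integrable_norm ih integrable_mult_right xg)
          (auto simp: norm_mult mult.assoc[symmetric] intro!: mult_right_mono Cauchy_Schwarz_ineq2)
      finally show ?thesis by simp
    qed
  qed
  moreover have "((\<lambda>y. norm (FI g y - FI g x - ?L (y - x)) / norm (y - x)) \<longlongrightarrow> 0) (at x)"
  proof (rule tendsto_sandwich[where f="\<lambda>_. 0"])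
    \<comment> \<open>Absolute value of the integrand in the first-order error divided by the
      distance, after the unimodular factor \<open>cis (x \<bullet> \<xi>)\<close> has been pulled
      out.\<close>
    define R where "R y \<xi> = norm (cis ((y - x) \<bullet> \<xi>) - 1 - \<i> * of_real ((y - x) \<bullet> \<xi>)) / norm (y - x) * norm (g \<xi>)" for y \<xi>
    have R_le: "R y \<xi> \<le> 2 * (norm \<xi> * norm (g \<xi>))" if "y \<noteq> x" for y \<xi>
    proof -
      have "norm (cis ((y - x) \<bullet> \<xi>) - 1 - \<i> * of_real ((y - x) \<bullet> \<xi>)) \<le> 2 * (norm (y - x) * norm \<xi>)"
        using norm_cis_approx(2)[of "(y - x) \<bullet> \<xi>"] Cauchy_Schwarz_ineq2[of "y - x" \<xi>] by linarith
      then have "norm (cis ((y - x) \<bullet> \<xi>) - 1 - \<i> * of_real ((y - x) \<bullet> \<xi>)) / norm (y - x) \<le> 2 * norm \<xi>"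
        using that by (simp add: divide_simps mult_ac)
      then show ?thesis unfolding R_def by (metis mult.assoc mult_right_mono norm_ge_zero)
    qed
    have R_le2: "R y \<xi> \<le> norm (y - x) * ((norm \<xi>)\<^sup>2 / 2 * norm (g \<xi>))" for y \<xi>
    proof -
      have "norm (cis ((y - x) \<bullet> \<xi>) - 1 - \<i> * of_real ((y - x) \<bullet> \<xi>)) \<le> (norm (y - x) * norm \<xi>)\<^sup>2 / 2"
        using norm_cis_approx(1)[of "(y - x) \<bullet> \<xi>"] power_mono[OF Cauchy_Schwarz_ineq2[of "y - x" \<xi>], of 2] by simp
      then have "norm (cis ((y - x) \<bullet> \<xi>) - 1 - \<i> * of_real ((y - x) \<bullet> \<xi>)) / norm (y - x) \<le> norm (y - x) * ((norm \<xi>)\<^sup>2 / 2)"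
        by (cases "y = x") (simp_all add: divide_simps power2_eq_square mult_ac)
      from mult_right_mono[OF this norm_ge_zero[of "g \<xi>"]] show ?thesis unfolding R_def by (simp add: mult.assoc)
    qed
    have R0: "0 \<le> R y \<xi>" for y \<xi> unfolding R_def by simp
    have [measurable]: "R y \<in> borel_measurable borel" for y unfolding R_def by measurable
    have "((\<lambda>y. LINT \<xi>|lborel. R y \<xi>) \<longlongrightarrow> (LINT \<xi>::real^3|lborel. 0)) (at x)"
    proof (rule dominated_convergence_at[where s=R and f="\<lambda>_. 0" and w="\<lambda>\<xi>. 2 * (norm \<xi> * norm (g \<xi>))"])
      show "AE \<xi> in lborel. ((\<lambda>y. R y \<xi>) \<longlongrightarrow> 0) (at x)"
      proof (rule AE_I2)
        fix \<xi>
        have "((\<lambda>y. norm (y - x) * ((norm \<xi>)\<^sup>2 / 2 * norm (g \<xi>))) \<longlongrightarrow> norm (x - x) * ((norm \<xi>)\<^sup>2 / 2 * norm (g \<xi>))) (at x)"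
          by (intro tendsto_intros)
        then have lim: "((\<lambda>y. norm (y - x) * ((norm \<xi>)\<^sup>2 / 2 * norm (g \<xi>))) \<longlongrightarrow> 0) (at x)" by simp
        show "((\<lambda>y. R y \<xi>) \<longlongrightarrow> 0) (at x)"
          by (rule tendsto_sandwich[OF _ _ tendsto_const lim]) (intro always_eventually allI R0 R_le2)+
      qed
    qed (use xg R_le R0 in auto)
    then show "((\<lambda>y. LINT \<xi>|lborel. R y \<xi>) \<longlongrightarrow> 0) (at x)" by simp
    have "norm (FI g y - FI g x - ?L (y - x)) / norm (y - x) \<le> (LINT \<xi>|lborel. R y \<xi>)" for y
    proof -
      have "FI g y - FI g x - ?L (y - x) = (LINT \<xi>|lborel. cis (y \<bullet> \<xi>) * g \<xi> - cis (x \<bullet> \<xi>) * g \<xi> - cis (x \<bullet> \<xi>) * (\<i> * of_real ((y - x) \<bullet> \<xi>) * g \<xi>))"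
        unfolding FI_def using integrable_cis_mult[OF g] ch by (simp add: Bochner_Integration.integral_diff)
      also have "\<dots> = (LINT \<xi>|lborel. cis (x \<bullet> \<xi>) * ((cis ((y - x) \<bullet> \<xi>) - 1 - \<i> * of_real ((y - x) \<bullet> \<xi>)) * g \<xi>))"
        by (intro Bochner_Integration.integral_cong refl) (simp add: algebra_simps cis_mult[symmetric] inner_diff_left cis_divide[symmetric])
      finally have "norm (FI g y - FI g x - ?L (y - x)) \<le> (LINT \<xi>|lborel. norm (cis (x \<bullet> \<xi>) * ((cis ((y - x) \<bullet> \<xi>) - 1 - \<i> * of_real ((y - x) \<bullet> \<xi>)) * g \<xi>)))"
        by (simp add: integral_norm_bound)
      also have "\<dots> = (LINT \<xi>|lborel. norm (cis ((y - x) \<bullet> \<xi>) - 1 - \<i> * of_real ((y - x) \<bullet> \<xi>)) * norm (g \<xi>))"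
        by (simp add: norm_mult)
      finally show ?thesis unfolding R_def times_divide_eq_left integral_divide_zero by (rule divide_right_mono) simp
    qed
    then show "\<forall>\<^sub>F y in at x. norm (FI g y - FI g x - ?L (y - x)) / norm (y - x) \<le> (LINT \<xi>|lborel. R y \<xi>)"
      by (rule always_eventually[OF allI])
  qed (auto intro: always_eventually)
  ultimately show ?thesis by (simp add: has_derivative_iff_norm)
qed

text \<open>A derivative multiplies the integrand by a linear function of \<open>\<xi>\<close> and
  thus uses up one moment.\<close>

lemma FI_Ck_on:
  assumes "g \<in> borel_measurable borel" "\<And>m. m \<le> k \<Longrightarrow> integrable lborel (\<lambda>\<xi>. norm \<xi> ^ m * norm (g \<xi>))"
  shows "Ck_on k UNIV (FI g)"
  using assms
proof (induction k arbitrary: g)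
  case 0
  have "integrable lborel g" using 0(2)[of 0] 0(1) by (simp add: integrable_norm_iff)
  then show ?case by (simp add: FI_continuous)
next
  case (Suc k)
  note [measurable] = Suc(2)
  have g: "integrable lborel g" using Suc(3)[of 0] by (simp add: integrable_norm_iff)
  have D: "(FI g has_derivative (\<lambda>h. FI (\<lambda>\<xi>. \<i> * of_real (h \<bullet> \<xi>) * g \<xi>) x)) (at x)" for x
    using FI_has_derivative[OF g] Suc(3)[of 1] by simp
  have "Ck_on k UNIV (FI (\<lambda>\<xi>. \<i> * of_real (h \<bullet> \<xi>) * g \<xi>))" for h
  proof (rule Suc.IH)
    fix m assume "m \<le> k"
    then have "integrable lborel (\<lambda>\<xi>. norm h * (norm \<xi> ^ Suc m * norm (g \<xi>)))"
      using Suc(3)[of "Suc m"] by (intro integrable_mult_right) simp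
    then show "integrable lborel (\<lambda>\<xi>. norm \<xi> ^ m * norm (\<i> * of_real (h \<bullet> \<xi>) * g \<xi>))"
    proof (rule Bochner_Integration.integrable_bound)
      show "AE \<xi> in lborel. norm (norm \<xi> ^ m * norm (\<i> * of_real (h \<bullet> \<xi>) * g \<xi>)) \<le> norm (norm h * (norm \<xi> ^ Suc m * norm (g \<xi>)))"
      proof (rule AE_I2)
        fix \<xi>
        have "(norm \<xi> ^ m * norm (g \<xi>)) * \<bar>h \<bullet> \<xi>\<bar> \<le> (norm \<xi> ^ m * norm (g \<xi>)) * (norm h * norm \<xi>)"
          by (intro mult_left_mono Cauchy_Schwarz_ineq2) auto
        then show "norm (norm \<xi> ^ m * norm (\<i> * of_real (h \<bullet> \<xi>) * g \<xi>)) \<le> norm (norm h * (norm \<xi> ^ Suc m * norm (g \<xi>)))"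
          by (simp add: norm_mult abs_mult mult_ac)
      qed
    qed measurable
  qed measurable
  then show ?case using D by (auto intro!: exI[of _ "\<lambda>x h. FI (\<lambda>\<xi>. \<i> * of_real (h \<bullet> \<xi>) * g \<xi>) x"])
qed

section \<open>Translation invariance and integrals of derivatives\<close>

lemma
  fixes f :: "'a::euclidean_space \<Rightarrow> 'b::{banach, second_countable_topology}"
  assumes "f \<in> borel_measurable borel"
  shows lborel_integral_translate: "(LINT x|lborel. f (x + c)) = (LINT x|lborel. f x)"
    and lborel_integrable_translate: "integrable lborel (\<lambda>x. f (x + c)) \<longleftrightarrow> integrable lborel f"
proof -
  note [measurable] = assms
  have "(LINT x|lborel. f x) = (LINT x|distr lborel borel ((+) c). f x)" by (simp add: lborel_distr_plus)
  also have "\<dots> = (LINT x|lborel. f (x + c))" by (subst integral_distr) (auto simp: add.commute)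
  finally show "(LINT x|lborel. f (x + c)) = (LINT x|lborel. f x)" by simp
  have "integrable lborel f \<longleftrightarrow> integrable (distr lborel borel ((+) c)) f" by (simp add: lborel_distr_plus)
  also have "\<dots> \<longleftrightarrow> integrable lborel (\<lambda>x. f (x + c))" by (subst integrable_distr_eq) (auto simp: add.commute)
  finally show "integrable lborel (\<lambda>x. f (x + c)) \<longleftrightarrow> integrable lborel f" by simp
qed

text \<open>No boundary terms at infinity are examined. The integral of
  \<open>pdx \<alpha> f\<close> over unit segments in direction \<open>\<alpha>\<close> is
  \<open>f (x + e) - f x\<close>, whose integral over \<open>x\<close> vanishes by translation
  invariance; by Fubini and the same invariance this is also the integral of
  \<open>pdx \<alpha> f\<close>.\<close>

lemma integral_pdx_eq_0:
  fixes f :: "real^3 \<Rightarrow> real"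
  assumes C1: "Ck_on (Suc 0) UNIV f" and f: "integrable lborel f" and p: "integrable lborel (pdx \<alpha> f)"
  shows "(LINT x|lborel. pdx \<alpha> f x) = 0"
proof -
  let ?p = "pdx \<alpha> f" and ?e = "axis \<alpha> 1 :: real^3"
  have cp: "continuous_on UNIV ?p" using Ck_on_pdx[OF C1, of \<alpha>] by simp
  have [measurable]: "?p \<in> borel_measurable borel" by (intro borel_measurable_continuous_onI cp)
  have [measurable]: "f \<in> borel_measurable borel" using borel_measurable_integrable[OF f] by simp
  have FTC: "(LINT s|lborel. ?p (x + s *\<^sub>R ?e) * indicator {0..1} s) = f (x + ?e) - f x" for x
  proof -
    have D: "DERIV (\<lambda>s. f (x + s *\<^sub>R ?e)) s :> ?p (x + s *\<^sub>R ?e)" for s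
    proof -
      have "((\<lambda>s. f (x + s *\<^sub>R ?e)) has_derivative (\<lambda>h. frechet_derivative f (at (x + s *\<^sub>R ?e)) (h *\<^sub>R ?e))) (at s)"
        by (rule has_derivative_compose[OF _ Ck_on_Suc_UNIV_frechet(1)[OF C1]]) (auto intro!: derivative_eq_intros)
      moreover have "linear (frechet_derivative f (at (x + s *\<^sub>R ?e)))"
        using Ck_on_Suc_UNIV_frechet(1)[OF C1] has_derivative_linear by blast
      ultimately show ?thesis
        by (simp add: has_field_derivative_def pdx_def linear_scale mult_commute_abs)
    qed
    have "continuous_on UNIV (\<lambda>s. x + s *\<^sub>R ?e)" by (intro continuous_intros)
    with cp have "continuous_on UNIV (\<lambda>s. ?p (x + s *\<^sub>R ?e))" by (rule continuous_on_compose2) simp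
    then have "isCont (\<lambda>s. ?p (x + s *\<^sub>R ?e)) s" for s by (simp add: continuous_on_eq_continuous_at)
    with D show ?thesis
      using integral_FTC_Icc_real[of 0 1 "\<lambda>s. f (x + s *\<^sub>R ?e)" "\<lambda>s. ?p (x + s *\<^sub>R ?e)"] by simp
  qed
  let ?k = "\<lambda>(s, x). ?p (x + s *\<^sub>R ?e) * indicator {0..1} (s::real)"
  have i: "integrable (lborel \<Otimes>\<^sub>M lborel) ?k"
  proof (rule lborel_pair.Fubini_integrable)
    have "(LINT x|lborel. norm (?k (s, x))) = indicator {0..1} s * (LINT x|lborel. \<bar>?p x\<bar>)" for s
    proof -
      have "(LINT x|lborel. norm (?k (s, x))) = (LINT x|lborel. indicator {0..1} s * \<bar>?p (x + s *\<^sub>R ?e)\<bar>)"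
        by (simp add: abs_mult mult.commute)
      also have "\<dots> = indicator {0..1} s * (LINT x|lborel. \<bar>?p (x + s *\<^sub>R ?e)\<bar>)" by simp
      also have "(LINT x|lborel. \<bar>?p (x + s *\<^sub>R ?e)\<bar>) = (LINT x|lborel. \<bar>?p x\<bar>)"
        by (rule lborel_integral_translate[where f="\<lambda>x. \<bar>?p x\<bar>"]) measurable
      finally show ?thesis .
    qed
    then show "integrable lborel (\<lambda>s. LINT x|lborel. norm (?k (s, x)))" by simp
    show "AE s in lborel. integrable lborel (\<lambda>x. ?k (s, x))"
      using p by (intro AE_I2) (auto intro!: integrable_mult_left simp: lborel_integrable_translate)
  qed measurable
  have "(LINT x|lborel. (LINT s|lborel. ?k (s, x))) = (LINT s|lborel. (LINT x|lborel. ?k (s, x)))"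
    using lborel_pair.Fubini_integral[of "\<lambda>s x. ?k (s, x)"] i by simp
  also have "(LINT x|lborel. (LINT s|lborel. ?k (s, x))) = (LINT x|lborel. f (x + ?e) - f x)"
    using FTC by simp
  also have "\<dots> = 0"
    using f by (subst Bochner_Integration.integral_diff) (auto simp: lborel_integrable_translate lborel_integral_translate)
  also have "(LINT s|lborel. (LINT x|lborel. ?k (s, x))) = (LINT s::real|lborel. indicator {0..1} s * (LINT x|lborel. ?p x))"
    by (simp add: lborel_integral_translate mult.commute)
  also have "\<dots> = (LINT x|lborel. ?p x)" by (simp add: content_real)
  finally show ?thesis by simp
qed

section \<open>Gaussian kernels\<close>

text \<open>Lebesgue measure is the image of the product of its one-dimensional copies under
  reassembly from coordinates, so products of functions of one coordinate reduce to the product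
  measure.\<close>

lemma
  fixes f :: "'a::euclidean_space \<Rightarrow> real \<Rightarrow> 'b::{real_normed_field, banach, second_countable_topology}"
  assumes i: "\<And>b. b \<in> Basis \<Longrightarrow> integrable lborel (f b)"
  shows lborel_integrable_prod_Basis: "integrable lborel (\<lambda>x. \<Prod>b\<in>Basis. f b (x \<bullet> b))"
    and lborel_integral_prod_Basis: "(LINT x|lborel. (\<Prod>b\<in>Basis. f b (x \<bullet> b))) = (\<Prod>b\<in>Basis. (LINT x|lborel. f b x))"
proof -
  interpret product_sigma_finite "\<lambda>_::'a. lborel :: real measure"
    by standard (rule sigma_finite_measure.sigma_finite_countable[OF sigma_finite_lborel])
  have [measurable]: "b \<in> Basis \<Longrightarrow> f b \<in> borel_measurable borel" for b
    using borel_measurable_integrable[OF i] by simp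
  have m: "(\<lambda>g. \<Sum>b\<in>Basis. g b *\<^sub>R b) \<in> (\<Pi>\<^sub>M b\<in>(Basis::'a set). lborel) \<rightarrow>\<^sub>M borel"
    by measurable
  have m2: "(\<lambda>x. \<Prod>b\<in>Basis. f b (x \<bullet> b)) \<in> borel_measurable borel" by measurable
  have eq: "(\<Prod>b\<in>Basis. f b ((\<Sum>c\<in>Basis. g c *\<^sub>R c) \<bullet> b)) = (\<Prod>b\<in>Basis. f b (g b))" for g :: "'a \<Rightarrow> real"
    by (intro prod.cong refl) simp
  have "integrable (\<Pi>\<^sub>M b\<in>(Basis::'a set). lborel) (\<lambda>g. \<Prod>b\<in>Basis. f b (g b))"
    by (rule product_integrable_prod) (auto simp: i)
  then show "integrable lborel (\<lambda>x. \<Prod>b\<in>Basis. f b (x \<bullet> b))"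
    by (subst lborel_eq) (simp add: integrable_distr_eq[OF m m2] eq)
  have "(LINT x|lborel. (\<Prod>b\<in>Basis. f b (x \<bullet> b))) = (LINT g|(\<Pi>\<^sub>M b\<in>(Basis::'a set). lborel). (\<Prod>b\<in>Basis. f b (g b)))"
    by (subst lborel_eq) (simp add: integral_distr[OF m m2] eq)
  also have "\<dots> = (\<Prod>b\<in>Basis. (LINT x|lborel. f b x))"
    by (rule product_integral_prod) (auto simp: i)
  finally show "(LINT x|lborel. (\<Prod>b\<in>Basis. f b (x \<bullet> b))) = (\<Prod>b\<in>Basis. (LINT x|lborel. f b x))" .
qed

lemma
  fixes f :: "'a::euclidean_space \<Rightarrow> 'b::{banach, second_countable_topology}"
  assumes [measurable]: "f \<in> borel_measurable borel" and c: "c \<noteq> 0"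
  shows lborel_integral_scale: "(LINT x|lborel. f (c *\<^sub>R x)) = (LINT x|lborel. f x) /\<^sub>R \<bar>c\<bar> ^ DIM('a)"
    and lborel_integrable_scale: "integrable lborel (\<lambda>x. f (c *\<^sub>R x)) \<longleftrightarrow> integrable lborel f"
proof -
  have eq: "(lborel :: 'a measure) = density (distr lborel borel (\<lambda>x. c *\<^sub>R x)) (\<lambda>_. ennreal (\<bar>c\<bar> ^ DIM('a)))"
    using lborel_affine[OF c, of 0] by (simp add: ennreal_power)
  have "(LINT x|lborel. f x) = \<bar>c\<bar> ^ DIM('a) *\<^sub>R (LINT x|lborel. f (c *\<^sub>R x))"
    by (subst eq) (simp add: integral_density integral_distr)
  then show "(LINT x|lborel. f (c *\<^sub>R x)) = (LINT x|lborel. f x) /\<^sub>R \<bar>c\<bar> ^ DIM('a)"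
    using c by simp
  show "integrable lborel (\<lambda>x. f (c *\<^sub>R x)) \<longleftrightarrow> integrable lborel f"
  proof -
    let ?k = "\<bar>c\<bar> ^ DIM('a)" and ?g = "\<lambda>x. f (c *\<^sub>R x)"
    have "integrable lborel f \<longleftrightarrow> integrable lborel (\<lambda>x. ?k *\<^sub>R ?g x)"
      by (subst eq) (simp add: integrable_density integrable_distr_eq)
    moreover have "integrable lborel (\<lambda>x. ?k *\<^sub>R ?g x) \<Longrightarrow> integrable lborel (\<lambda>x. inverse ?k *\<^sub>R (?k *\<^sub>R ?g x))"
      by (rule integrable_scaleR_right)
    moreover have "integrable lborel ?g \<Longrightarrow> integrable lborel (\<lambda>x. ?k *\<^sub>R ?g x)"
      by (rule integrable_scaleR_right)
    ultimately show ?thesis using c by auto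
  qed
qed

lemma
  fixes f :: "'a::euclidean_space \<Rightarrow> 'b::{banach, second_countable_topology}"
  assumes "f \<in> borel_measurable borel"
  shows lborel_integral_reflect: "(LINT x|lborel. f (- x)) = (LINT x|lborel. f x)"
    and lborel_integrable_reflect: "integrable lborel (\<lambda>x. f (- x)) \<longleftrightarrow> integrable lborel f"
  using lborel_integral_scale[OF assms, of "-1"] lborel_integrable_scale[OF assms, of "-1"] by auto

definition gauss :: "real^3 \<Rightarrow> real" where
  "gauss z = (\<Prod>b\<in>Basis. std_normal_density (z \<bullet> b))"

lemma gauss_measurable [measurable]: "gauss \<in> borel_measurable borel"
  unfolding gauss_def by measurable

lemma gauss_pos: "0 < gauss z"
  unfolding gauss_def by (intro prod_pos) (simp add: normal_density_pos)

lemma integrable_std_normal: "integrable lborel std_normal_density"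
  using integrable_normal_moment[of 1 0 0] by simp

lemma integrable_gauss: "integrable lborel gauss"
  unfolding gauss_def by (rule lborel_integrable_prod_Basis) (rule integrable_std_normal)

lemma integral_gauss: "(LINT z|lborel. gauss z) = 1"
  unfolding gauss_def by (subst lborel_integral_prod_Basis) (auto simp: integrable_std_normal)

lemma gauss_eq: "gauss z = exp (- (norm z)\<^sup>2 / 2) / sqrt (2 * pi) ^ 3"
proof -
  have "gauss z = (\<Prod>b\<in>Basis. exp (- (z \<bullet> b)\<^sup>2 / 2)) / sqrt (2 * pi) ^ 3"
    unfolding gauss_def std_normal_density_def by (simp add: prod_dividef)
  also have "(\<Prod>b\<in>Basis. exp (- (z \<bullet> b)\<^sup>2 / 2)) = exp (\<Sum>b\<in>Basis. - (z \<bullet> b)\<^sup>2 / 2)"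
    by (simp add: exp_sum)
  also have "(\<Sum>b\<in>Basis. - (z \<bullet> b)\<^sup>2 / 2) = - (norm z)\<^sup>2 / 2"
    by (simp add: norm_eq_sqrt_inner euclidean_inner[of z z] power2_eq_square sum_negf sum_divide_distrib real_sqrt_mult_self sum_nonneg)
  finally show ?thesis .
qed

text \<open>Character and Gaussian both factorise over the coordinates, and each factor is the
  characteristic function of the standard normal distribution.\<close>

lemma FI_gauss: "FI (\<lambda>z. complex_of_real (gauss z)) x = complex_of_real (exp (- (norm x)\<^sup>2 / 2))"
proof -
  have 1: "(LINT z|lborel. cis (t * z) * complex_of_real (std_normal_density z)) = complex_of_real (exp (- t\<^sup>2 / 2))" for t
  proof -
    have "complex_of_real (exp (- t\<^sup>2 / 2)) = (LINT z|std_normal_distribution. iexp (t * z))"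
      using char_std_normal_distribution by (simp add: char_def fun_eq_iff)
    also have "\<dots> = (LINT z|lborel. std_normal_density z *\<^sub>R iexp (t * z))"
      by (subst integral_density) (auto simp: normal_density_nonneg)
    finally show ?thesis by (simp add: cis_conv_exp scaleR_conv_of_real mult.commute)
  qed
  have int1: "integrable lborel (\<lambda>z. cis (t * z) * complex_of_real (std_normal_density z))" for t
    by (rule Bochner_Integration.integrable_bound[OF integrable_std_normal]) (auto simp: norm_mult)
  have "cis (x \<bullet> z) * complex_of_real (gauss z) = (\<Prod>b\<in>Basis. cis ((x \<bullet> b) * (z \<bullet> b)) * complex_of_real (std_normal_density (z \<bullet> b)))" for z
  proof -
    have "cis (x \<bullet> z) = (\<Prod>b\<in>Basis. cis ((x \<bullet> b) * (z \<bullet> b)))"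
      by (subst euclidean_inner) (simp add: cis_conv_exp exp_sum sum_distrib_left)
    then show ?thesis by (simp add: gauss_def prod.distrib)
  qed
  then have "FI (\<lambda>z. complex_of_real (gauss z)) x = (\<Prod>b\<in>Basis. (LINT z|lborel. cis ((x \<bullet> b) * z) * complex_of_real (std_normal_density z)))"
    unfolding FI_def by (simp add: lborel_integral_prod_Basis[OF int1])
  also have "\<dots> = (\<Prod>b\<in>Basis. complex_of_real (exp (- (x \<bullet> b)\<^sup>2 / 2)))" by (simp only: 1)
  also have "\<dots> = complex_of_real (gauss x * sqrt (2 * pi) ^ 3)"
    unfolding gauss_def std_normal_density_def by (simp add: prod_dividef)
  finally show ?thesis by (simp add: gauss_eq)
qed

section \<open>Gaussian regularisation of the Fourier integral\<close>

definition damp :: "real \<Rightarrow> real^3 \<Rightarrow> real" where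
  "damp s x = exp (- (norm (s *\<^sub>R x))\<^sup>2 / 2)"

text \<open>\<open>heat s\<close> is the Fourier transform of \<open>damp s\<close>; as \<open>s\<close> tends to \<open>0\<close> it approximates \<open>(2 * pi) ^ 3\<close>
  times the Dirac measure.\<close>

definition heat :: "real \<Rightarrow> real^3 \<Rightarrow> real" where
  "heat s z = (2 * pi) ^ 3 / s ^ 3 * gauss (z /\<^sub>R s)"

lemma damp_measurable [measurable]: "damp s \<in> borel_measurable borel"
  unfolding damp_def by measurable

lemma heat_measurable [measurable]: "heat s \<in> borel_measurable borel"
  unfolding heat_def by measurable

lemma damp_bounds: "0 < damp s x" "damp s x \<le> 1" and damp_minus: "damp s (- x) = damp s x"
  by (auto simp: damp_def)

lemma damp_tendsto: "(s \<longlongrightarrow> 0) F \<Longrightarrow> ((\<lambda>n. damp (s n) x) \<longlongrightarrow> 1) F"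
  unfolding damp_def by (auto intro!: tendsto_eq_intros)

lemma damp_eq: "damp s x = sqrt (2 * pi) ^ 3 * gauss (s *\<^sub>R x)"
  by (simp add: damp_def gauss_eq)

lemma integrable_damp: "s > 0 \<Longrightarrow> integrable lborel (damp s)"
  unfolding damp_eq[abs_def] using lborel_integrable_scale[OF gauss_measurable, of s] integrable_gauss
  by (intro integrable_mult_right) simp

lemma heat_nonneg: "s > 0 \<Longrightarrow> 0 \<le> heat s z" and heat_minus: "heat s (- z) = heat s z"
  unfolding heat_def using gauss_pos[of "z /\<^sub>R s"] by (auto simp: gauss_eq intro!: mult_nonneg_nonneg)

lemma FI_damp:
  assumes "s > 0" shows "FI (\<lambda>x. complex_of_real (damp s x)) z = complex_of_real (heat s z)"
proof -
  let ?f = "\<lambda>y. cis ((z /\<^sub>R s) \<bullet> y) * complex_of_real (gauss y)"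
  have "FI (\<lambda>x. complex_of_real (damp s x)) z = (LINT x|lborel. complex_of_real (sqrt (2 * pi) ^ 3) * ?f (s *\<^sub>R x))"
  proof -
    have "(z /\<^sub>R s) \<bullet> (s *\<^sub>R x) = z \<bullet> x" for x using assms by simp
    then show ?thesis
      unfolding FI_def by (intro Bochner_Integration.integral_cong refl) (simp only: damp_eq of_real_mult mult_ac)
  qed
  also have "\<dots> = complex_of_real (sqrt (2 * pi) ^ 3) * (LINT x|lborel. ?f (s *\<^sub>R x))"
    by (rule integral_mult_right_zero)
  also have "(LINT x|lborel. ?f (s *\<^sub>R x)) = (LINT y|lborel. ?f y) /\<^sub>R s ^ 3"
    using assms by (subst lborel_integral_scale) auto
  also have "(LINT y|lborel. ?f y) = complex_of_real (sqrt (2 * pi) ^ 3 * gauss (z /\<^sub>R s))"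
    using FI_gauss[of "z /\<^sub>R s"] by (simp add: FI_def gauss_eq)
  also have "complex_of_real (sqrt (2 * pi) ^ 3) * (complex_of_real (sqrt (2 * pi) ^ 3 * gauss (z /\<^sub>R s)) /\<^sub>R s ^ 3)
      = complex_of_real ((sqrt (2 * pi) ^ 3 * sqrt (2 * pi) ^ 3) / s ^ 3 * gauss (z /\<^sub>R s))"
    by (simp add: scaleR_conv_of_real field_simps)
  also have "sqrt (2 * pi) ^ 3 * sqrt (2 * pi) ^ 3 = (2 * pi) ^ 3"
    by (simp add: power_mult_distrib[symmetric])
  finally show ?thesis by (simp add: heat_def)
qed

lemma integrable_heat: "s > 0 \<Longrightarrow> integrable lborel (heat s)"
  unfolding heat_def using lborel_integrable_scale[OF gauss_measurable, of "inverse s"] integrable_gauss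
  by (intro integrable_mult_right) simp

text \<open>The substitution \<open>y = x + s z\<close> makes the kernel independent of
  \<open>s\<close>, so that the limit for \<open>s\<close> to 0 concerns \<open>f\<close>
  alone.\<close>

lemma integral_heat_mult:
  fixes f :: "real^3 \<Rightarrow> complex"
  assumes [measurable]: "f \<in> borel_measurable borel" and s: "s > 0"
  shows "(LINT y|lborel. f y * complex_of_real (heat s (y - x))) = (2 * pi) ^ 3 * (LINT z|lborel. f (x + s *\<^sub>R z) * complex_of_real (gauss z))"
proof -
  have "(LINT y|lborel. f y * complex_of_real (heat s (y - x))) = (LINT y|lborel. f (y + x) * complex_of_real (heat s (y + x - x)))"
    by (subst lborel_integral_translate) auto
  also have "\<dots> = (LINT y|lborel. f (x + y) * complex_of_real (heat s y))" by (simp add: add.commute)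
  also have "\<dots> = s ^ 3 *\<^sub>R (LINT y|lborel. f (x + s *\<^sub>R y) * complex_of_real (heat s (s *\<^sub>R y)))"
    using s by (subst lborel_integral_scale[where f="\<lambda>y. f (x + y) * complex_of_real (heat s y)"]) auto
  also have "\<dots> = s ^ 3 *\<^sub>R (LINT y|lborel. complex_of_real ((2 * pi) ^ 3 / s ^ 3) * (f (x + s *\<^sub>R y) * complex_of_real (gauss y)))"
    using s by (intro arg_cong[where f="\<lambda>x. s ^ 3 *\<^sub>R x"] Bochner_Integration.integral_cong refl) (simp add: heat_def mult_ac)
  also have "\<dots> = (2 * pi) ^ 3 * (LINT z|lborel. f (x + s *\<^sub>R z) * complex_of_real (gauss z))"
    using s by (subst integral_mult_right_zero) (simp add: scaleR_conv_of_real)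
  finally show ?thesis .
qed

lemma integral_heat: "s > 0 \<Longrightarrow> (LINT z|lborel. heat s z) = (2 * pi) ^ 3"
  using integral_heat_mult[of "\<lambda>_. 1" s 0] integral_gauss
  by (simp flip: of_real_mult of_real_power add: complex_of_real_def[symmetric] integral_complex_of_real del: of_real_mult of_real_power)

lemma nn_integral_heat:
  assumes "s > 0" shows "(\<integral>\<^sup>+y. ennreal (heat s (y - x)) \<partial>lborel) = ennreal ((2 * pi) ^ 3)"
    and "(\<integral>\<^sup>+y. ennreal (heat s (x - y)) \<partial>lborel) = ennreal ((2 * pi) ^ 3)"
proof -
  have *: "integrable lborel (\<lambda>y. heat s (y + (- x)))"
    using integrable_heat[OF assms] by (subst lborel_integrable_translate) auto
  then have "(\<integral>\<^sup>+y. ennreal (heat s (y - x)) \<partial>lborel) = ennreal (LINT y|lborel. heat s (y + (- x)))"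
    by (subst nn_integral_eq_integral[symmetric]) (auto simp: heat_nonneg assms)
  also have "(LINT y|lborel. heat s (y + (- x))) = (2 * pi) ^ 3"
    by (subst lborel_integral_translate) (auto simp: integral_heat assms)
  finally show "(\<integral>\<^sup>+y. ennreal (heat s (y - x)) \<partial>lborel) = ennreal ((2 * pi) ^ 3)" .
  then show "(\<integral>\<^sup>+y. ennreal (heat s (x - y)) \<partial>lborel) = ennreal ((2 * pi) ^ 3)"
    using heat_minus[of s "x - _"] by (simp add: minus_diff_eq)
qed

lemma FI_measurable [measurable (raw)]:
  assumes "integrable lborel u" shows "FI u \<in> borel_measurable borel"
  by (intro borel_measurable_continuous_onI FI_continuous assms)

text \<open>Fubini's theorem, as two integrable factors make the double integral absolutely
  convergent. This symmetric form of duality is what later extends to L^2.\<close>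

lemma FI_multiplication_formula:
  assumes u: "integrable lborel u" and k: "integrable lborel k"
  shows "(LINT \<xi>|lborel. FI u \<xi> * k \<xi>) = (LINT x|lborel. u x * FI k x)"
proof -
  have [measurable]: "u \<in> borel_measurable borel" "k \<in> borel_measurable borel"
    using borel_measurable_integrable[OF u] borel_measurable_integrable[OF k] by auto
  let ?H = "\<lambda>(\<xi>, x). cis (\<xi> \<bullet> x) * u x * k \<xi>"
  have "integrable (lborel \<Otimes>\<^sub>M lborel) ?H"
  proof (rule lborel_pair.Fubini_integrable)
    have "(LINT x|lborel. norm (?H (\<xi>, x))) = (LINT x|lborel. norm (u x)) * norm (k \<xi>)" for \<xi>
      by (simp add: norm_mult)
    then show "integrable lborel (\<lambda>\<xi>. LINT x|lborel. norm (?H (\<xi>, x)))" using k by simp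
    show "AE \<xi> in lborel. integrable lborel (\<lambda>x. ?H (\<xi>, x))"
      using integrable_cis_mult[OF u] by (intro AE_I2) auto
  qed measurable
  from lborel_pair.Fubini_integral[of "\<lambda>\<xi> x. ?H (\<xi>, x)"] this
  have "(LINT x|lborel. (LINT \<xi>|lborel. cis (\<xi> \<bullet> x) * u x * k \<xi>)) = (LINT \<xi>|lborel. (LINT x|lborel. cis (\<xi> \<bullet> x) * u x * k \<xi>))"
    by simp
  moreover have "(LINT x|lborel. cis (\<xi> \<bullet> x) * u x * k \<xi>) = FI u \<xi> * k \<xi>" for \<xi>
    unfolding FI_def by simp
  moreover have "(LINT \<xi>|lborel. cis (\<xi> \<bullet> x) * u x * k \<xi>) = u x * FI k x" for x
  proof -
    have "(LINT \<xi>|lborel. cis (\<xi> \<bullet> x) * u x * k \<xi>) = (LINT \<xi>|lborel. u x * (cis (x \<bullet> \<xi>) * k \<xi>))"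
      by (intro Bochner_Integration.integral_cong refl) (simp add: inner_commute mult_ac)
    then show ?thesis by (simp add: FI_def)
  qed
  ultimately show ?thesis by (simp only:)
qed

lemma FI_shift: "FI (\<lambda>\<xi>. cis (- (x \<bullet> \<xi>)) * k \<xi>) y = FI k (y - x)"
  unfolding FI_def
  by (intro Bochner_Integration.integral_cong refl) (simp add: cis_mult inner_diff_left flip: mult.assoc)

lemma FI_cnj: "FI (\<lambda>x. cnj (u x)) \<xi> = cnj (FI u (- \<xi>))"
proof -
  have "cnj (FI u (- \<xi>)) = (LINT x|lborel. cnj (cis ((- \<xi>) \<bullet> x) * u x))"
    unfolding FI_def by (rule Bochner_Integration.integral_cnj[symmetric])
  then show ?thesis by (simp add: FI_def cis_cnj)
qed

lemma integrable_FI_damp: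
  assumes "integrable lborel v" "s > 0" shows "integrable lborel (\<lambda>\<xi>. FI v \<xi> * complex_of_real (damp s \<xi>))"
proof (rule Bochner_Integration.integrable_bound[OF integrable_mult_right[OF integrable_damp[OF assms(2)], of "LINT \<xi>|lborel. norm (v \<xi>)"]])
  show "(\<lambda>\<xi>. FI v \<xi> * complex_of_real (damp s \<xi>)) \<in> borel_measurable lborel"
    using FI_measurable[OF assms(1)] by simp
  show "AE \<xi> in lborel. norm (FI v \<xi> * complex_of_real (damp s \<xi>)) \<le> norm ((LINT \<xi>|lborel. norm (v \<xi>)) * damp s \<xi>)"
  proof (rule AE_I2)
    fix \<xi>
    have "norm (FI v \<xi>) * damp s \<xi> \<le> (LINT \<xi>|lborel. norm (v \<xi>)) * damp s \<xi>"
      using damp_bounds[of s \<xi>] by (intro mult_right_mono norm_FI_le) auto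
    then show "norm (FI v \<xi> * complex_of_real (damp s \<xi>)) \<le> norm ((LINT \<xi>|lborel. norm (v \<xi>)) * damp s \<xi>)"
      using damp_bounds[of s \<xi>] by (simp add: norm_mult)
  qed
qed

text \<open>Inversion before the limit: the multiplication formula applied to a damped character,
  whose transform is a translate of the heat kernel.\<close>

lemma FI_FI_damp:
  assumes v: "integrable lborel v" and s: "s > 0"
  shows "FI (\<lambda>\<xi>. FI v (- \<xi>) * complex_of_real (damp s \<xi>)) x = (LINT y|lborel. v y * complex_of_real (heat s (y - x)))"
proof -
  note [measurable] = FI_measurable[OF v]
  let ?k = "\<lambda>\<xi>. FI v (- \<xi>) * complex_of_real (damp s \<xi>)"
  have d: "integrable lborel (\<lambda>\<xi>. cis (- (x \<bullet> \<xi>)) * complex_of_real (damp s \<xi>))"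
    using integrable_cis_mult[of "\<lambda>\<xi>. complex_of_real (damp s \<xi>)" "- x"] integrable_damp[OF s] by simp
  have "FI ?k x = (LINT \<xi>|lborel. FI v \<xi> * (cis (- (x \<bullet> \<xi>)) * complex_of_real (damp s \<xi>)))"
    unfolding FI_def[of ?k]
    using lborel_integral_reflect[of "\<lambda>\<xi>. cis (x \<bullet> \<xi>) * ?k \<xi>"] by (simp add: damp_minus mult_ac)
  also have "\<dots> = (LINT y|lborel. v y * FI (\<lambda>\<xi>. cis (- (x \<bullet> \<xi>)) * complex_of_real (damp s \<xi>)) y)"
    by (rule FI_multiplication_formula[OF v d])
  finally show ?thesis by (simp add: FI_shift FI_damp[OF s])
qed

lemma FI_damped_Parseval:
  assumes u: "integrable lborel u" and v: "integrable lborel v" and s: "s > 0"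
  shows "(LINT \<xi>|lborel. FI u (- \<xi>) * (FI v \<xi> * complex_of_real (damp s \<xi>)))
       = (LINT x|lborel. u x * (LINT y|lborel. v y * complex_of_real (heat s (y - x))))"
proof -
  note [measurable] = FI_measurable[OF u] FI_measurable[OF v]
  let ?k = "\<lambda>\<xi>. FI v (- \<xi>) * complex_of_real (damp s \<xi>)"
  have k: "integrable lborel ?k"
    using integrable_FI_damp[OF v s] lborel_integrable_reflect[of "\<lambda>\<xi>. FI v \<xi> * complex_of_real (damp s \<xi>)"]
    by (simp add: damp_minus)
  have "(LINT \<xi>|lborel. FI u (- \<xi>) * (FI v \<xi> * complex_of_real (damp s \<xi>))) = (LINT \<xi>|lborel. FI u \<xi> * ?k \<xi>)"
    using lborel_integral_reflect[of "\<lambda>\<xi>. FI u \<xi> * ?k \<xi>"] by (simp add: damp_minus)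
  also have "\<dots> = (LINT x|lborel. u x * FI ?k x)" by (rule FI_multiplication_formula[OF u k])
  finally show ?thesis by (simp only: FI_FI_damp[OF v s])
qed

section \<open>The L^2 bound for the Fourier integral\<close>

text \<open>The squared L^2 norm as an extended number: suprema, Fatou's lemma and Tonelli's theorem
  then apply before square integrability is known.\<close>

definition nrm2 :: "(real^3 \<Rightarrow> 'b::euclidean_space) \<Rightarrow> ennreal" where
  "nrm2 u = (\<integral>\<^sup>+x. ennreal ((norm (u x))\<^sup>2) \<partial>lborel)"

lemma norm_integral_le_nn:
  fixes f :: "'a \<Rightarrow> 'b::{banach, second_countable_topology}"
  shows "ennreal (norm (LINT x|M. f x)) \<le> (\<integral>\<^sup>+x. ennreal (norm (f x)) \<partial>M)"
  by (cases "integrable M f") (auto simp: integral_norm_bound_ennreal not_integrable_integral_eq)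

text \<open>By Gaussian damping, the integral of \<open>\<bar>FI u\<bar>\<^sup>2\<close> is the limit of \<open>\<langle>heat s * u, u\<rangle>\<close>, which Schur's test bounds.\<close>

lemma nrm2_FI_le:
  assumes u: "integrable lborel u"
  shows "nrm2 (FI u) \<le> ennreal ((2 * pi) ^ 3) * nrm2 u"
proof -
  have [measurable]: "u \<in> borel_measurable borel" using borel_measurable_integrable[OF u] by simp
  note [measurable] = FI_measurable[OF u]
  have uc: "integrable lborel (\<lambda>x. cnj (u x))" using u by simp
  define C where "C = ennreal ((2 * pi) ^ 3)"
  have hC: "(\<integral>\<^sup>+y. ennreal (heat s (y - x)) \<partial>lborel) = C" "(\<integral>\<^sup>+y. ennreal (heat s (x - y)) \<partial>lborel) = C" if "s > 0" for s x
    unfolding C_def by (rule nn_integral_heat[OF that])+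
  have damped: "(\<integral>\<^sup>+\<xi>. ennreal ((norm (FI u \<xi>))\<^sup>2 * damp s \<xi>) \<partial>lborel) \<le> C * nrm2 u" if s: "s > 0" for s
  proof -
    have "complex_of_real ((norm (FI u \<xi>))\<^sup>2 * damp s \<xi>) = FI (\<lambda>x. cnj (u x)) (- \<xi>) * (FI u \<xi> * complex_of_real (damp s \<xi>))" for \<xi>
      by (simp add: FI_cnj complex_norm_square[symmetric] mult_ac)
    note eq = this
    have bd: "integrable lborel (\<lambda>\<xi>. (norm (FI u \<xi>))\<^sup>2 * damp s \<xi>)"
    proof (rule Bochner_Integration.integrable_bound[OF integrable_mult_right[OF integrable_damp[OF s], of "(LINT \<xi>|lborel. norm (u \<xi>))\<^sup>2"]])
      show "AE \<xi> in lborel. norm ((norm (FI u \<xi>))\<^sup>2 * damp s \<xi>) \<le> norm ((LINT \<xi>|lborel. norm (u \<xi>))\<^sup>2 * damp s \<xi>)"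
        using damp_bounds[of s] by (intro AE_I2) (auto simp: abs_mult intro!: mult_right_mono power_mono norm_FI_le)
    qed measurable
    have "(\<integral>\<^sup>+\<xi>. ennreal ((norm (FI u \<xi>))\<^sup>2 * damp s \<xi>) \<partial>lborel) = ennreal (LINT \<xi>|lborel. (norm (FI u \<xi>))\<^sup>2 * damp s \<xi>)"
      using bd damp_bounds[of s] by (intro nn_integral_eq_integral) (auto intro!: AE_I2 mult_nonneg_nonneg intro: less_imp_le)
    also have "(LINT \<xi>|lborel. (norm (FI u \<xi>))\<^sup>2 * damp s \<xi>) \<le> norm (LINT \<xi>|lborel. complex_of_real ((norm (FI u \<xi>))\<^sup>2 * damp s \<xi>))"
      by (simp only: integral_complex_of_real norm_of_real abs_ge_self)
    also have "\<dots> = norm (LINT x|lborel. cnj (u x) * (LINT y|lborel. u y * complex_of_real (heat s (y - x))))"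
      unfolding eq using FI_damped_Parseval[OF uc u s] by simp
    also have "ennreal \<dots> \<le> (\<integral>\<^sup>+x. ennreal (norm (cnj (u x) * (LINT y|lborel. u y * complex_of_real (heat s (y - x))))) \<partial>lborel)"
      by (rule norm_integral_le_nn)
    \<comment> \<open>Schur's test: the product \<open>|u x| |u y|\<close> is split into half the
      sum of the squares. As the kernel has integral \<open>C\<close> in either variable, each half
      contributes \<open>C * nrm2 u / 2\<close>.\<close>
    also have "\<dots> \<le> (\<integral>\<^sup>+x. (\<integral>\<^sup>+y. ennreal ((norm (u x))\<^sup>2 / 2 * heat s (y - x)) + ennreal ((norm (u y))\<^sup>2 / 2 * heat s (y - x)) \<partial>lborel) \<partial>lborel)"
    proof (rule nn_integral_mono)
      fix x
      have "ennreal (norm (cnj (u x) * (LINT y|lborel. u y * complex_of_real (heat s (y - x)))))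
        = ennreal (norm (u x)) * ennreal (norm (LINT y|lborel. u y * complex_of_real (heat s (y - x))))"
        by (simp add: norm_mult ennreal_mult)
      also have "\<dots> \<le> ennreal (norm (u x)) * (\<integral>\<^sup>+y. ennreal (norm (u y * complex_of_real (heat s (y - x)))) \<partial>lborel)"
        by (intro mult_left_mono norm_integral_le_nn) auto
      also have "\<dots> = (\<integral>\<^sup>+y. ennreal (norm (u x)) * ennreal (norm (u y * complex_of_real (heat s (y - x)))) \<partial>lborel)"
        by (rule nn_integral_cmult[symmetric]) measurable
      also have "\<dots> \<le> (\<integral>\<^sup>+y. ennreal ((norm (u x))\<^sup>2 / 2 * heat s (y - x)) + ennreal ((norm (u y))\<^sup>2 / 2 * heat s (y - x)) \<partial>lborel)"
      proof (rule nn_integral_mono)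
        fix y
        have "norm (u x) * norm (u y) \<le> (norm (u x))\<^sup>2 / 2 + (norm (u y))\<^sup>2 / 2"
          using sum_squares_bound[of "norm (u x)" "norm (u y)"] by simp
        from mult_right_mono[OF this heat_nonneg[OF s, of "y - x"]]
        show "ennreal (norm (u x)) * ennreal (norm (u y * complex_of_real (heat s (y - x)))) \<le> ennreal ((norm (u x))\<^sup>2 / 2 * heat s (y - x)) + ennreal ((norm (u y))\<^sup>2 / 2 * heat s (y - x))"
          using heat_nonneg[OF s, of "y - x"]
          by (simp add: ennreal_mult[symmetric] ennreal_plus[symmetric] norm_mult distrib_right mult.assoc del: ennreal_plus)
      qed
      finally show "ennreal (norm (cnj (u x) * (LINT y|lborel. u y * complex_of_real (heat s (y - x)))))
        \<le> (\<integral>\<^sup>+y. ennreal ((norm (u x))\<^sup>2 / 2 * heat s (y - x)) + ennreal ((norm (u y))\<^sup>2 / 2 * heat s (y - x)) \<partial>lborel)" .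
    qed
    also have "\<dots> = (\<integral>\<^sup>+x. (\<integral>\<^sup>+y. ennreal ((norm (u x))\<^sup>2 / 2 * heat s (y - x)) \<partial>lborel) \<partial>lborel) + (\<integral>\<^sup>+x. (\<integral>\<^sup>+y. ennreal ((norm (u y))\<^sup>2 / 2 * heat s (y - x)) \<partial>lborel) \<partial>lborel)"
      by (simp add: nn_integral_add)
    also have "(\<integral>\<^sup>+x. (\<integral>\<^sup>+y. ennreal ((norm (u y))\<^sup>2 / 2 * heat s (y - x)) \<partial>lborel) \<partial>lborel) = (\<integral>\<^sup>+y. (\<integral>\<^sup>+x. ennreal ((norm (u y))\<^sup>2 / 2 * heat s (y - x)) \<partial>lborel) \<partial>lborel)"
      by (rule lborel_pair.Fubini') measurable
    also have "(\<integral>\<^sup>+y. (\<integral>\<^sup>+x. ennreal ((norm (u y))\<^sup>2 / 2 * heat s (y - x)) \<partial>lborel) \<partial>lborel) = C * nrm2 u / 2"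
      by (simp add: ennreal_mult'' heat_nonneg[OF s] nn_integral_cmult hC[OF s] nrm2_def divide_ennreal[symmetric] nn_integral_multc nn_integral_divide mult.commute flip: ennreal_times_divide)
    also have "(\<integral>\<^sup>+x. (\<integral>\<^sup>+y. ennreal ((norm (u x))\<^sup>2 / 2 * heat s (y - x)) \<partial>lborel) \<partial>lborel) = C * nrm2 u / 2"
      by (simp add: ennreal_mult'' heat_nonneg[OF s] nn_integral_cmult hC[OF s] nrm2_def divide_ennreal[symmetric] nn_integral_multc nn_integral_divide mult.commute flip: ennreal_times_divide)
    also have "C * nrm2 u / 2 + C * nrm2 u / 2 = C * nrm2 u"
    proof -
      have "C * nrm2 u / 2 + C * nrm2 u / 2 = (C * nrm2 u + C * nrm2 u) / 2" by (rule add_divide_distrib_ennreal[symmetric])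
      also have "C * nrm2 u + C * nrm2 u = C * nrm2 u * 2" by (simp add: mult_2_right)
      also have "C * nrm2 u * 2 / 2 = C * nrm2 u" by (rule mult_divide_eq_ennreal) auto
      finally show ?thesis .
    qed
    finally show ?thesis using ennreal_leI order_trans by blast
  qed
  \<comment> \<open>The damping is removed along \<open>s = 1 / (n + 1)\<close> by Fatou's lemma,
    because the damped bound is uniform in \<open>s\<close>.\<close>
  have lim: "(\<lambda>n. (norm (FI u \<xi>))\<^sup>2 * damp (1 / real (Suc n)) \<xi>) \<longlonglongrightarrow> (norm (FI u \<xi>))\<^sup>2 * 1" for \<xi>
    by (intro tendsto_intros damp_tendsto LIMSEQ_Suc[OF lim_1_over_n])
  have "nrm2 (FI u) = (\<integral>\<^sup>+\<xi>. liminf (\<lambda>n. ennreal ((norm (FI u \<xi>))\<^sup>2 * damp (1 / real (Suc n)) \<xi>)) \<partial>lborel)"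
    unfolding nrm2_def
  proof (intro nn_integral_cong)
    fix \<xi> show "ennreal ((norm (FI u \<xi>))\<^sup>2) = liminf (\<lambda>n. ennreal ((norm (FI u \<xi>))\<^sup>2 * damp (1 / real (Suc n)) \<xi>))"
      using lim_imp_Liminf[OF _ tendsto_ennrealI[OF lim[of \<xi>]]] by simp
  qed
  also have "\<dots> \<le> liminf (\<lambda>n. \<integral>\<^sup>+\<xi>. ennreal ((norm (FI u \<xi>))\<^sup>2 * damp (1 / real (Suc n)) \<xi>) \<partial>lborel)"
    by (rule nn_integral_liminf) measurable
  also have "\<dots> \<le> liminf (\<lambda>n. C * nrm2 u)"
    by (intro Liminf_mono always_eventually allI damped) simp
  also have "\<dots> = C * nrm2 u" by (simp add: Liminf_const)
  finally show ?thesis unfolding C_def .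
qed

section \<open>Square integrable functions\<close>

lemma square_integrable_measurable: "square_integrable u \<Longrightarrow> u \<in> borel_measurable borel"
  by (simp add: square_integrable_def)

lemma nrm2_eq_integral: "square_integrable u \<Longrightarrow> nrm2 u = ennreal (LINT x|lborel. (norm (u x))\<^sup>2)"
  unfolding nrm2_def square_integrable_def by (intro nn_integral_eq_integral) auto

lemma square_integrable_iff_nrm2: "u \<in> borel_measurable borel \<Longrightarrow> square_integrable u \<longleftrightarrow> nrm2 u < \<infinity>"
  unfolding nrm2_def square_integrable_def by (auto simp: integrable_iff_bounded)

lemma square_integrable_cong_AE:
  assumes "square_integrable u" "v \<in> borel_measurable borel" "AE x in lborel. u x = v x"
  shows "square_integrable v"
proof -
  have "nrm2 u = nrm2 v" unfolding nrm2_def by (rule nn_integral_cong_AE) (use assms(3) in auto)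
  then show ?thesis using assms square_integrable_iff_nrm2 square_integrable_measurable by metis
qed

lemma nrm2_mono: "(\<And>x. norm (u x) \<le> norm (v x)) \<Longrightarrow> nrm2 u \<le> nrm2 v"
  unfolding nrm2_def by (intro nn_integral_mono ennreal_leI power_mono) auto

lemma square_integrable_bound:
  assumes "square_integrable v" "u \<in> borel_measurable borel" "\<And>x. norm (u x) \<le> norm (v x)"
  shows "square_integrable u"
proof -
  have "nrm2 u \<le> nrm2 v" by (rule nrm2_mono) (rule assms(3))
  also have "\<dots> < \<infinity>" using assms(1) square_integrable_iff_nrm2[OF square_integrable_measurable[OF assms(1)]] by simp
  finally show ?thesis using square_integrable_iff_nrm2[OF assms(2)] by simp
qed

lemma norm_add_power2_le: "(norm (a + b))\<^sup>2 \<le> 2 * (norm a)\<^sup>2 + 2 * (norm (b::'a::real_normed_vector))\<^sup>2"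
proof -
  have "(norm (a + b))\<^sup>2 \<le> (norm a + norm b)\<^sup>2" by (intro power_mono norm_triangle_ineq) auto
  also have "\<dots> \<le> 2 * (norm a)\<^sup>2 + 2 * (norm b)\<^sup>2" using sum_squares_bound[of "norm a" "norm b"] by (simp add: power2_sum)
  finally show ?thesis .
qed

lemma square_integrable_add:
  assumes "square_integrable u" "square_integrable v" shows "square_integrable (\<lambda>x. u x + v x)"
proof -
  note [measurable] = assms[THEN square_integrable_measurable]
  have "integrable lborel (\<lambda>x. 2 * (norm (u x))\<^sup>2 + 2 * (norm (v x))\<^sup>2)"
    using assms by (auto simp: square_integrable_def)
  then have "integrable lborel (\<lambda>x. (norm (u x + v x))\<^sup>2)"
    by (rule Bochner_Integration.integrable_bound) (auto intro: order_trans[OF norm_add_power2_le])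
  then show ?thesis by (simp add: square_integrable_def)
qed

lemma square_integrable_bounded_linear:
  assumes u: "square_integrable u" and L: "bounded_linear L" shows "square_integrable (\<lambda>x. L (u x))"
proof -
  note [measurable] = u[THEN square_integrable_measurable]
  obtain K where K: "\<And>x. norm (L x) \<le> norm x * K" using bounded_linear.bounded[OF L] by blast
  have m: "(\<lambda>x. L (u x)) \<in> borel_measurable borel"
    by (rule measurable_compose[OF _ borel_measurable_continuous_onI[OF linear_continuous_on[OF L]]]) measurable
  have "integrable lborel (\<lambda>x. K\<^sup>2 * (norm (u x))\<^sup>2)" using u by (simp add: square_integrable_def)
  then have "integrable lborel (\<lambda>x. (norm (L (u x)))\<^sup>2)"
  proof (rule Bochner_Integration.integrable_bound)
    show "(\<lambda>x. (norm (L (u x)))\<^sup>2) \<in> borel_measurable lborel" using m by measurable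
    show "AE x in lborel. norm ((norm (L (u x)))\<^sup>2) \<le> norm (K\<^sup>2 * (norm (u x))\<^sup>2)"
      using power_mono[OF K norm_ge_zero, of _ 2] by (intro AE_I2) (simp add: power_mult_distrib mult.commute)
  qed
  then show ?thesis using m by (simp add: square_integrable_def)
qed

lemma square_integrable_cmult: "square_integrable u \<Longrightarrow> square_integrable (\<lambda>x. c * u x)"
  for u :: "real^3 \<Rightarrow> 'b::{euclidean_space, real_normed_algebra}"
  by (rule square_integrable_bounded_linear[where L="(*) c"]) (simp_all add: bounded_linear_mult_right)

lemma square_integrable_diff: "square_integrable u \<Longrightarrow> square_integrable v \<Longrightarrow> square_integrable (\<lambda>x. u x - v x)"
  using square_integrable_add[of u "\<lambda>x. - v x"] square_integrable_bounded_linear[of v uminus]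
  by (simp add: bounded_linear_minus bounded_linear_ident)

lemma square_integrable_reflect: "square_integrable u \<Longrightarrow> square_integrable (\<lambda>x. u (- x))"
  using lborel_integrable_reflect[of "\<lambda>x. (norm (u x))\<^sup>2"] by (auto simp: square_integrable_def)

lemma nrm2_add_le:
  assumes [measurable]: "u \<in> borel_measurable borel" "v \<in> borel_measurable borel"
  shows "nrm2 (\<lambda>x. u x + v x) \<le> 2 * nrm2 u + 2 * nrm2 v"
proof -
  have "nrm2 (\<lambda>x. u x + v x) \<le> (\<integral>\<^sup>+x. 2 * ennreal ((norm (u x))\<^sup>2) + 2 * ennreal ((norm (v x))\<^sup>2) \<partial>lborel)"
    unfolding nrm2_def
  proof (rule nn_integral_mono)
    fix x show "ennreal ((norm (u x + v x))\<^sup>2) \<le> 2 * ennreal ((norm (u x))\<^sup>2) + 2 * ennreal ((norm (v x))\<^sup>2)"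
      using ennreal_leI[OF norm_add_power2_le[of "u x" "v x"]] by (simp add: ennreal_mult)
  qed
  also have "\<dots> = 2 * nrm2 u + 2 * nrm2 v" unfolding nrm2_def by (simp add: nn_integral_add nn_integral_cmult)
  finally show ?thesis .
qed

lemma
  fixes f g :: "'a \<Rightarrow> real"
  assumes [measurable]: "f \<in> borel_measurable M" "g \<in> borel_measurable M"
    and f: "integrable M (\<lambda>x. (f x)\<^sup>2)" and g: "integrable M (\<lambda>x. (g x)\<^sup>2)"
  shows integrable_mult_L2: "integrable M (\<lambda>x. f x * g x)"
    and Cauchy_Schwarz_integral_abs: "(LINT x|M. \<bar>f x * g x\<bar>) \<le> sqrt (LINT x|M. (f x)\<^sup>2) * sqrt (LINT x|M. (g x)\<^sup>2)"
proof -
  have "integrable M (\<lambda>x. ((f x)\<^sup>2 + (g x)\<^sup>2) / 2)" using f g by auto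
  then show i: "integrable M (\<lambda>x. f x * g x)"
  proof (rule Bochner_Integration.integrable_bound)
    show "AE x in M. norm (f x * g x) \<le> norm (((f x)\<^sup>2 + (g x)\<^sup>2) / 2)"
    proof (rule AE_I2)
      fix x show "norm (f x * g x) \<le> norm (((f x)\<^sup>2 + (g x)\<^sup>2) / 2)"
        using sum_squares_bound[of "\<bar>f x\<bar>" "\<bar>g x\<bar>"] by (simp add: abs_mult)
    qed
  qed measurable
  have "(\<integral>\<^sup>+x. ennreal \<bar>f x\<bar> * ennreal \<bar>g x\<bar> \<partial>M)\<^sup>2 \<le> (\<integral>\<^sup>+x. ennreal \<bar>f x\<bar> ^ 2 \<partial>M) * (\<integral>\<^sup>+x. ennreal \<bar>g x\<bar> ^ 2 \<partial>M)"
    by (rule Cauchy_Schwarz_nn_integral) measurable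
  also have "(\<integral>\<^sup>+x. ennreal \<bar>f x\<bar> ^ 2 \<partial>M) = ennreal (LINT x|M. (f x)\<^sup>2)"
    using f by (simp add: ennreal_power nn_integral_eq_integral)
  also have "(\<integral>\<^sup>+x. ennreal \<bar>g x\<bar> ^ 2 \<partial>M) = ennreal (LINT x|M. (g x)\<^sup>2)"
    using g by (simp add: ennreal_power nn_integral_eq_integral)
  also have "(\<integral>\<^sup>+x. ennreal \<bar>f x\<bar> * ennreal \<bar>g x\<bar> \<partial>M) = ennreal (LINT x|M. \<bar>f x * g x\<bar>)"
    using i by (simp add: ennreal_mult[symmetric] abs_mult[symmetric] nn_integral_eq_integral)
  finally have "ennreal ((LINT x|M. \<bar>f x * g x\<bar>)\<^sup>2) \<le> ennreal ((LINT x|M. (f x)\<^sup>2) * (LINT x|M. (g x)\<^sup>2))"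
    by (simp add: ennreal_power ennreal_mult)
  then have "(LINT x|M. \<bar>f x * g x\<bar>)\<^sup>2 \<le> (LINT x|M. (f x)\<^sup>2) * (LINT x|M. (g x)\<^sup>2)"
    by (subst (asm) ennreal_le_iff) auto
  then show "(LINT x|M. \<bar>f x * g x\<bar>) \<le> sqrt (LINT x|M. (f x)\<^sup>2) * sqrt (LINT x|M. (g x)\<^sup>2)"
    by (simp add: real_le_rsqrt flip: real_sqrt_mult)
qed

lemma
  fixes u v :: "real^3 \<Rightarrow> complex"
  assumes u: "square_integrable u" and v: "square_integrable v"
  shows integrable_mult_square_integrable: "integrable lborel (\<lambda>x. u x * v x)"
    and norm_integral_mult_le: "norm (LINT x|lborel. u x * v x) \<le> sqrt (LINT x|lborel. (norm (u x))\<^sup>2) * sqrt (LINT x|lborel. (norm (v x))\<^sup>2)"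
proof -
  note [measurable] = assms[THEN square_integrable_measurable]
  have i: "integrable lborel (\<lambda>x. norm (u x) * norm (v x))"
    using u v by (intro integrable_mult_L2) (auto simp: square_integrable_def)
  then show "integrable lborel (\<lambda>x. u x * v x)"
    by (rule Bochner_Integration.integrable_bound) (auto simp: norm_mult)
  have "norm (LINT x|lborel. u x * v x) \<le> (LINT x|lborel. \<bar>norm (u x) * norm (v x)\<bar>)"
    using integral_norm_bound[of lborel "\<lambda>x. u x * v x"] by (simp add: norm_mult)
  also have "\<dots> \<le> sqrt (LINT x|lborel. (norm (u x))\<^sup>2) * sqrt (LINT x|lborel. (norm (v x))\<^sup>2)"
    using u v by (intro Cauchy_Schwarz_integral_abs) (auto simp: square_integrable_def)
  finally show "norm (LINT x|lborel. u x * v x) \<le> sqrt (LINT x|lborel. (norm (u x))\<^sup>2) * sqrt (LINT x|lborel. (norm (v x))\<^sup>2)" .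
qed

lemma tendsto_integral_mult_L2:
  fixes h :: "real^3 \<Rightarrow> complex"
  assumes g: "\<And>n::nat. square_integrable (g n)" and h: "square_integrable h" and k: "square_integrable k"
    and lim: "(\<lambda>n. nrm2 (\<lambda>x. h x - g n x)) \<longlonglongrightarrow> 0"
  shows "(\<lambda>n. LINT x|lborel. g n x * k x) \<longlonglongrightarrow> (LINT x|lborel. h x * k x)"
proof -
  have d: "square_integrable (\<lambda>x. h x - g n x)" for n by (intro square_integrable_diff h g)
  have "(\<lambda>n. ennreal (LINT x|lborel. (norm (h x - g n x))\<^sup>2)) \<longlonglongrightarrow> ennreal 0"
    using lim nrm2_eq_integral[OF d] by simp
  then have l: "(\<lambda>n. LINT x|lborel. (norm (h x - g n x))\<^sup>2) \<longlonglongrightarrow> 0"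
    by (subst (asm) tendsto_ennreal_iff) auto
  have "(\<lambda>n. sqrt (LINT x|lborel. (norm (h x - g n x))\<^sup>2) * sqrt (LINT x|lborel. (norm (k x))\<^sup>2)) \<longlonglongrightarrow> sqrt 0 * sqrt (LINT x|lborel. (norm (k x))\<^sup>2)"
    by (intro tendsto_intros l)
  then have z: "(\<lambda>n. sqrt (LINT x|lborel. (norm (h x - g n x))\<^sup>2) * sqrt (LINT x|lborel. (norm (k x))\<^sup>2)) \<longlonglongrightarrow> 0" by simp
  have "norm ((LINT x|lborel. h x * k x) - (LINT x|lborel. g n x * k x)) \<le> sqrt (LINT x|lborel. (norm (h x - g n x))\<^sup>2) * sqrt (LINT x|lborel. (norm (k x))\<^sup>2)" for n
  proof -
    have "(LINT x|lborel. h x * k x) - (LINT x|lborel. g n x * k x) = (LINT x|lborel. (h x - g n x) * k x)"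
      using integrable_mult_square_integrable[OF h k] integrable_mult_square_integrable[OF g k]
      by (simp add: left_diff_distrib)
    then show ?thesis using norm_integral_mult_le[OF d k] by simp
  qed
  then have "(\<lambda>n. (LINT x|lborel. h x * k x) - (LINT x|lborel. g n x * k x)) \<longlonglongrightarrow> 0"
    by (intro Lim_null_comparison[OF _ z]) (auto intro: always_eventually)
  from tendsto_diff[OF tendsto_const[of "LINT x|lborel. h x * k x"] this] show ?thesis by simp
qed

section \<open>Completeness of L^2 and extension of the Fourier integral\<close>

text \<open>Fatou's lemma. It transfers Cauchy estimates to almost everywhere limits, here and
  wherever an L^2 limit has to be identified.\<close>

lemma nrm2_le_of_tendsto:
  assumes [measurable]: "\<And>n::nat. g n \<in> borel_measurable borel" "f \<in> borel_measurable borel"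
    and lim: "AE x in lborel. (\<lambda>n. g n x) \<longlonglongrightarrow> h x"
    and bd: "eventually (\<lambda>n. nrm2 (\<lambda>x. g n x - f x) \<le> B) sequentially"
  shows "nrm2 (\<lambda>x. h x - f x) \<le> B"
proof -
  have "nrm2 (\<lambda>x. h x - f x) = (\<integral>\<^sup>+x. liminf (\<lambda>n. ennreal ((norm (g n x - f x))\<^sup>2)) \<partial>lborel)"
    unfolding nrm2_def
  proof (rule nn_integral_cong_AE, use lim in eventually_elim)
    case (elim x)
    then have "(\<lambda>n. ennreal ((norm (g n x - f x))\<^sup>2)) \<longlonglongrightarrow> ennreal ((norm (h x - f x))\<^sup>2)"
      by (intro tendsto_ennrealI tendsto_intros)
    from lim_imp_Liminf[OF trivial_limit_sequentially this]
    show "ennreal ((norm (h x - f x))\<^sup>2) = liminf (\<lambda>n. ennreal ((norm (g n x - f x))\<^sup>2))" by (rule sym)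
  qed
  also have "\<dots> \<le> liminf (\<lambda>n. nrm2 (\<lambda>x. g n x - f x))"
    unfolding nrm2_def by (rule nn_integral_liminf) measurable
  also have "\<dots> \<le> liminf (\<lambda>n::nat. B)" by (rule Liminf_mono[OF bd])
  finally show ?thesis by (simp add: Liminf_const)
qed

text \<open>The Riesz-Fischer theorem. A rapidly converging subsequence converges almost everywhere,
  and the preceding lemma carries the Cauchy bound of the whole sequence over to that limit, with
  the same rate \<open>e\<close>.\<close>

lemma nrm2_complete:
  fixes g :: "nat \<Rightarrow> real^3 \<Rightarrow> complex"
  assumes [measurable]: "\<And>n. g n \<in> borel_measurable borel"
    and bd: "\<And>m n. n \<le> m \<Longrightarrow> nrm2 (\<lambda>x. g m x - g n x) \<le> e n" and e: "e \<longlonglongrightarrow> 0"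
  obtains h where "h \<in> borel_measurable borel" "\<And>n. nrm2 (\<lambda>x. h x - g n x) \<le> e n"
proof -
  \<comment> \<open>Squared distances below \<open>(1/4) ^ k\<close> stay summable after
    multiplication by \<open>2 ^ k\<close>; this weight later recovers summability of the distances
    themselves from that of their squares.\<close>
  have "\<exists>N. \<forall>m\<ge>N. e m \<le> ennreal ((1/4) ^ k)" for k
  proof -
    have "eventually (\<lambda>m. e m < ennreal ((1/4) ^ k)) sequentially"
      by (rule order_tendstoD(2)[OF e]) simp
    then show ?thesis by (auto simp: eventually_sequentially intro: less_imp_le)
  qed
  then obtain N where N: "\<And>k m. m \<ge> N k \<Longrightarrow> e m \<le> ennreal ((1/4) ^ k)" by metis
  \<comment> \<open>Summation makes the indices increase and stay above both \<open>N k\<close> and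
    \<open>k\<close>.\<close>
  define r where "r k = (\<Sum>i\<le>k. N i + 1)" for k
  have r_mono: "r k \<le> r (Suc k)" for k unfolding r_def by simp
  have r_N: "N k \<le> r k" for k unfolding r_def by (cases k) auto
  have r_ge: "k \<le> r k" for k unfolding r_def by (induction k) auto
  define d where "d k x = norm (g (r (Suc k)) x - g (r k) x)" for k x
  have [measurable]: "d k \<in> borel_measurable borel" for k unfolding d_def by measurable
  have half: "2 ^ k * (1/4) ^ k = (1/2 :: real) ^ k" for k by (simp flip: power_mult_distrib)
  have "(\<integral>\<^sup>+x. (\<Sum>k. ennreal (2 ^ k * (d k x)\<^sup>2)) \<partial>lborel) = (\<Sum>k. \<integral>\<^sup>+x. ennreal (2 ^ k * (d k x)\<^sup>2) \<partial>lborel)"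
    by (rule nn_integral_suminf) measurable
  also have "\<dots> \<le> (\<Sum>k. ennreal ((1/2) ^ k))"
  proof (rule suminf_le)
    fix k
    have "(\<integral>\<^sup>+x. ennreal (2 ^ k * (d k x)\<^sup>2) \<partial>lborel) = ennreal (2 ^ k) * nrm2 (\<lambda>x. g (r (Suc k)) x - g (r k) x)"
      unfolding nrm2_def d_def by (subst nn_integral_cmult[symmetric]) (auto simp: ennreal_mult)
    also have "\<dots> \<le> ennreal (2 ^ k) * ennreal ((1/4) ^ k)"
      by (intro mult_left_mono order_trans[OF bd[OF r_mono] N[OF r_N]]) auto
    also have "\<dots> = ennreal ((1/2) ^ k)" unfolding half[symmetric] by (rule ennreal_mult[symmetric]) auto
    finally show "(\<integral>\<^sup>+x. ennreal (2 ^ k * (d k x)\<^sup>2) \<partial>lborel) \<le> ennreal ((1/2) ^ k)" .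
  qed (rule summableI)+
  also have "\<dots> = ennreal (\<Sum>k. (1/2) ^ k)"
    by (rule suminf_ennreal2) (auto intro: summable_geometric)
  also have "\<dots> < \<infinity>" by (rule ennreal_less_top[folded infinity_ennreal_def])
  finally have fin: "(\<integral>\<^sup>+x. (\<Sum>k. ennreal (2 ^ k * (d k x)\<^sup>2)) \<partial>lborel) < \<infinity>" .
  have "AE x in lborel. (\<Sum>k. ennreal (2 ^ k * (d k x)\<^sup>2)) \<noteq> \<infinity>"
    by (rule nn_integral_PInf_AE[OF _ less_imp_neq[OF fin]]) measurable
  then have conv: "AE x in lborel. (\<lambda>k. g (r k) x) \<longlonglongrightarrow> lim (\<lambda>k. g (r k) x)"
  proof eventually_elim
    case (elim x)
    then have "summable (\<lambda>k. 2 ^ k * (d k x)\<^sup>2)" by (intro summable_suminf_not_top) auto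
    then have "summable (\<lambda>k. (1/2) ^ k + 2 ^ k * (d k x)\<^sup>2)" by (intro summable_add summable_geometric) auto
    then have "summable (\<lambda>k. d k x)"
    proof (rule summable_comparison_test')
      fix k :: nat
      \<comment> \<open>The weighted inequality \<open>2 d \<le> 1 / q + q d^2\<close> passes from
        weighted squares to first powers.\<close>
      define q where "q = (2::real) ^ k"
      have "1 / q + q * (d k x)\<^sup>2 - 2 * d k x = (q * d k x - 1)\<^sup>2 / q"
        by (simp add: q_def field_simps power2_eq_square)
      also have "\<dots> \<ge> 0" by (simp add: q_def)
      finally have "2 * d k x \<le> (1/2) ^ k + 2 ^ k * (d k x)\<^sup>2"
        by (simp add: q_def power_one_over)
      moreover have "0 \<le> d k x" by (simp add: d_def)
      ultimately show "norm (d k x) \<le> (1/2) ^ k + 2 ^ k * (d k x)\<^sup>2" by simp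
    qed
    then have "summable (\<lambda>k. g (r (Suc k)) x - g (r k) x)" unfolding d_def by (rule summable_norm_cancel)
    then have "convergent (\<lambda>n. \<Sum>k<n. g (r (Suc k)) x - g (r k) x)" by (simp add: summable_iff_convergent)
    then have "convergent (\<lambda>n. g (r n) x - g (r 0) x)" by (simp add: sum_lessThan_telescope[of "\<lambda>k. g (r k) x"])
    then have "convergent (\<lambda>n. (g (r n) x - g (r 0) x) + g (r 0) x)" by (intro convergent_add convergent_const)
    then show ?case by (simp add: convergent_LIMSEQ_iff)
  qed
  show thesis
  proof (rule that)
    show "(\<lambda>x. lim (\<lambda>k. g (r k) x)) \<in> borel_measurable borel" by measurable
    fix n
    show "nrm2 (\<lambda>x. lim (\<lambda>k. g (r k) x) - g n x) \<le> e n"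
    proof (rule nrm2_le_of_tendsto[OF _ _ conv])
      show "eventually (\<lambda>k. nrm2 (\<lambda>x. g (r k) x - g n x) \<le> e n) sequentially"
        by (rule eventually_sequentiallyI[of n]) (rule bd[OF order_trans[OF _ r_ge]])
    qed measurable
  qed
qed

text \<open>Restriction to a ball makes a square integrable function integrable, so that
  \<open>FI\<close> of it is a genuine integral.\<close>

definition trunc :: "nat \<Rightarrow> (real^3 \<Rightarrow> complex) \<Rightarrow> real^3 \<Rightarrow> complex" where
  "trunc n u x = indicator (ball 0 (real n)) x *\<^sub>R u x"

lemma integrable_indicator_square_integrable:
  fixes u :: "real^3 \<Rightarrow> 'b::euclidean_space"
  assumes u: "square_integrable u" and A: "A \<in> sets borel" "bounded A"
  shows "integrable lborel (\<lambda>x. indicator A x *\<^sub>R u x)"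
proof -
  note [measurable] = u[THEN square_integrable_measurable] A(1)
  have "integrable lborel (indicator A :: real^3 \<Rightarrow> real)"
    using emeasure_bounded_finite[OF A(2)] by (intro integrable_real_indicator) auto
  then have "integrable lborel (\<lambda>x. indicator A x + (norm (u x))\<^sup>2)"
    using u by (auto simp: square_integrable_def)
  then show ?thesis
  proof (rule Bochner_Integration.integrable_bound)
    show "AE x in lborel. norm (indicator A x *\<^sub>R u x) \<le> norm (indicator A x + (norm (u x))\<^sup>2)"
    proof (rule AE_I2)
      fix x
      have "norm (u x) \<le> 1 + (norm (u x))\<^sup>2"
        using sum_squares_bound[of 1 "norm (u x)"] norm_ge_zero[of "u x"] by (simp only: mult_1_right one_power2)
      then show "norm (indicator A x *\<^sub>R u x) \<le> norm (indicator A x + (norm (u x))\<^sup>2)"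
        by (cases "x \<in> A") auto
    qed
  qed measurable
qed

lemma trunc_integrable: "square_integrable u \<Longrightarrow> integrable lborel (trunc n u)"
  unfolding trunc_def by (rule integrable_indicator_square_integrable) auto

lemma trunc_square_integrable: "square_integrable u \<Longrightarrow> square_integrable (trunc n u)"
  by (rule square_integrable_bound[of u]) (auto simp: trunc_def[abs_def] indicator_def dest: square_integrable_measurable)

lemma FI_diff: "integrable lborel u \<Longrightarrow> integrable lborel v \<Longrightarrow> FI (\<lambda>x. u x - v x) \<xi> = FI u \<xi> - FI v \<xi>"
  unfolding FI_def using integrable_cis_mult[of u \<xi>] integrable_cis_mult[of v \<xi>] by (simp add: right_diff_distrib)

lemma square_integrable_FI:
  assumes "integrable lborel u" "square_integrable u" shows "square_integrable (FI u)"
proof -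
  have "nrm2 (FI u) < \<infinity>"
  proof (rule le_less_trans[OF nrm2_FI_le[OF assms(1)]])
    show "ennreal ((2 * pi) ^ 3) * nrm2 u < \<infinity>"
      using assms(2) square_integrable_iff_nrm2[OF square_integrable_measurable[OF assms(2)]]
      by (simp add: ennreal_mult_less_top)
  qed
  then show ?thesis using FI_measurable[OF assms(1)] by (simp add: square_integrable_iff_nrm2)
qed

text \<open>By \<open>nrm2_FI_le\<close> the transforms of the truncations form a Cauchy sequence
  with rate given by the tails \<open>t n\<close>; completeness supplies the limit.\<close>

lemma FI_extend_L2:
  assumes u: "square_integrable u"
  obtains g where "square_integrable g" "nrm2 g \<le> ennreal ((2 * pi) ^ 3) * nrm2 u"
    "(\<lambda>n. nrm2 (\<lambda>x. g x - FI (trunc n u) x)) \<longlonglongrightarrow> 0"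
proof -
  note [measurable] = u[THEN square_integrable_measurable]
  define C where "C = ennreal ((2 * pi) ^ 3)"
  define t where "t n = nrm2 (\<lambda>x. indicator (- ball 0 (real n)) x *\<^sub>R u x)" for n :: nat
  have ti: "square_integrable (\<lambda>x. indicator (- ball 0 (real n)) x *\<^sub>R u x)" for n :: nat
    by (rule square_integrable_bound[OF u]) (auto simp: indicator_def)
  have "(\<lambda>n. LINT x|lborel. (norm (indicator (- ball 0 (real n)) x *\<^sub>R u x))\<^sup>2) \<longlonglongrightarrow> (LINT x::real^3|lborel. 0)"
  proof (rule integral_dominated_convergence)
    show "integrable lborel (\<lambda>x. (norm (u x))\<^sup>2)" using u by (simp add: square_integrable_def)
    show "AE x in lborel. (\<lambda>n. (norm (indicator (- ball 0 (real n)) x *\<^sub>R u x))\<^sup>2) \<longlonglongrightarrow> 0"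
    proof (rule AE_I2)
      fix x :: "real^3"
      obtain N :: nat where N: "norm x < real N" using reals_Archimedean2 by blast
      show "(\<lambda>n. (norm (indicator (- ball 0 (real n)) x *\<^sub>R u x))\<^sup>2) \<longlonglongrightarrow> 0"
        by (rule tendsto_eventually) (use N in \<open>auto intro!: eventually_sequentiallyI[of N]\<close>)
    qed
  qed (auto simp: indicator_def)
  then have "(\<lambda>n. ennreal (LINT x|lborel. (norm (indicator (- ball 0 (real n)) x *\<^sub>R u x))\<^sup>2)) \<longlonglongrightarrow> ennreal 0"
    by (intro tendsto_ennrealI) simp
  then have "t \<longlonglongrightarrow> 0" unfolding t_def[abs_def] nrm2_eq_integral[OF ti] by simp
  then have e: "(\<lambda>n. C * t n) \<longlonglongrightarrow> 0"
    using ennreal_tendsto_cmult[of C t 0 sequentially] by (simp add: C_def)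
  have bd: "nrm2 (\<lambda>x. FI (trunc m u) x - FI (trunc n u) x) \<le> C * t n" if "n \<le> m" for m n
  proof -
    have "nrm2 (\<lambda>x. FI (trunc m u) x - FI (trunc n u) x) = nrm2 (FI (\<lambda>x. trunc m u x - trunc n u x))"
      by (simp add: FI_diff trunc_integrable[OF u] nrm2_def)
    also have "\<dots> \<le> C * nrm2 (\<lambda>x. trunc m u x - trunc n u x)"
      unfolding C_def by (intro nrm2_FI_le Bochner_Integration.integrable_diff trunc_integrable u)
    also have "\<dots> \<le> C * t n" unfolding t_def
      by (intro mult_left_mono nrm2_mono) (use that in \<open>auto simp: trunc_def indicator_def\<close>)
    finally show ?thesis .
  qed
  have [measurable]: "FI (trunc n u) \<in> borel_measurable borel" for n by (rule FI_measurable[OF trunc_integrable[OF u]])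
  obtain g where g: "g \<in> borel_measurable borel" "\<And>n. nrm2 (\<lambda>x. g x - FI (trunc n u) x) \<le> C * t n"
    by (rule nrm2_complete[of "\<lambda>n. FI (trunc n u)" "\<lambda>n. C * t n"]) (use bd e in auto)
  \<comment> \<open>The ball of radius 0 is empty, so the error bound at index 0 is the norm bound
    for \<open>g\<close> itself.\<close>
  have "trunc 0 u = (\<lambda>x. 0)" by (auto simp: trunc_def)
  then have "FI (trunc 0 u) = (\<lambda>x. 0)" by (auto simp: FI_def)
  then have gb: "nrm2 g \<le> C * nrm2 u" using g(2)[of 0] by (simp add: t_def)
  show thesis
  proof (rule that)
    show "nrm2 g \<le> ennreal ((2 * pi) ^ 3) * nrm2 u" using gb by (simp add: C_def)
    have "C * nrm2 u < \<infinity>" using u square_integrable_iff_nrm2[of u] by (auto simp: C_def ennreal_mult_less_top)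
    then show "square_integrable g" using gb g(1) by (simp add: square_integrable_iff_nrm2 le_less_trans)
    show "(\<lambda>n. nrm2 (\<lambda>x. g x - FI (trunc n u) x)) \<longlonglongrightarrow> 0"
      by (rule tendsto_sandwich[OF _ _ tendsto_const e]) (use g(2) in auto)
  qed
qed

lemma trunc_mult_tendsto:
  assumes i: "integrable lborel (\<lambda>x. u x * v x)" and [measurable]: "u \<in> borel_measurable borel" "v \<in> borel_measurable borel"
  shows "(\<lambda>n. LINT x|lborel. trunc n u x * v x) \<longlonglongrightarrow> (LINT x|lborel. u x * v x)"
proof (rule integral_dominated_convergence)
  show "integrable lborel (\<lambda>x. norm (u x * v x))" using i by simp
  show "AE x in lborel. (\<lambda>n. trunc n u x * v x) \<longlonglongrightarrow> u x * v x"
  proof (rule AE_I2)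
    fix x :: "real^3"
    obtain N :: nat where N: "norm x < real N" using reals_Archimedean2 by blast
    show "(\<lambda>n. trunc n u x * v x) \<longlonglongrightarrow> u x * v x"
      by (rule tendsto_eventually) (use N in \<open>auto intro!: eventually_sequentiallyI[of N] simp: trunc_def\<close>)
  qed
qed (auto simp: trunc_def[abs_def] indicator_def)

text \<open>Here \<open>z\<close> serves as the transform of \<open>h\<close>. All later uses go
  through its pairing and its norm bound, both inherited from the truncations in the limit.\<close>

lemma FI_multiplication_L2:
  assumes h: "square_integrable h"
  obtains z where "square_integrable z" "nrm2 z \<le> ennreal ((2 * pi) ^ 3) * nrm2 h"
    "\<And>\<phi>. integrable lborel \<phi> \<Longrightarrow> square_integrable \<phi> \<Longrightarrow> (LINT x|lborel. z x * \<phi> x) = (LINT x|lborel. h x * FI \<phi> x)"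
proof -
  obtain z where z: "square_integrable z" "nrm2 z \<le> ennreal ((2 * pi) ^ 3) * nrm2 h"
    "(\<lambda>n. nrm2 (\<lambda>x. z x - FI (trunc n h) x)) \<longlonglongrightarrow> 0" using FI_extend_L2[OF h] by blast
  have "(LINT x|lborel. z x * \<phi> x) = (LINT x|lborel. h x * FI \<phi> x)" if p: "integrable lborel \<phi>" "square_integrable \<phi>" for \<phi>
  proof (rule LIMSEQ_unique)
    show "(\<lambda>n. LINT x|lborel. FI (trunc n h) x * \<phi> x) \<longlonglongrightarrow> (LINT x|lborel. z x * \<phi> x)"
      by (rule tendsto_integral_mult_L2[OF square_integrable_FI z(1) p(2) z(3)])
        (auto intro: trunc_integrable trunc_square_integrable h)
    have "(\<lambda>n. LINT x|lborel. trunc n h x * FI \<phi> x) \<longlonglongrightarrow> (LINT x|lborel. h x * FI \<phi> x)"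
      by (intro trunc_mult_tendsto integrable_mult_square_integrable h square_integrable_FI p square_integrable_measurable)
    then show "(\<lambda>n. LINT x|lborel. FI (trunc n h) x * \<phi> x) \<longlonglongrightarrow> (LINT x|lborel. h x * FI \<phi> x)"
      by (simp add: FI_multiplication_formula[OF trunc_integrable[OF h] p(1)])
  qed
  then show thesis using that z by blast
qed

lemma test_function_integrable:
  assumes "test_function \<psi>" shows "integrable lborel \<psi>" "square_integrable \<psi>"
proof -
  note [measurable] = test_function_measurable[OF assms]
  obtain a b where ab: "\<And>x. x \<notin> box a b \<Longrightarrow> \<psi> x = 0" using test_function_support[OF assms] by blast
  obtain B where B: "\<And>x. \<bar>\<psi> x\<bar> \<le> B" "B > 0" using test_function_bounded[OF assms] by blast
  have i: "integrable lborel (\<lambda>x. c * indicator (box a b) x)" for c :: real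
    using emeasure_bounded_finite[OF bounded_box, of a b] by (intro integrable_mult_right integrable_real_indicator) auto
  show "integrable lborel \<psi>"
    by (rule Bochner_Integration.integrable_bound[OF i[of B]]) (use ab B in \<open>auto simp: indicator_def intro: order_trans[OF B(1) abs_ge_self]\<close>)
  have "integrable lborel (\<lambda>x. (norm (\<psi> x))\<^sup>2)"
    by (rule Bochner_Integration.integrable_bound[OF i[of "B\<^sup>2"]])
      (use ab B in \<open>auto simp: indicator_def abs_le_square_iff[symmetric]\<close>)
  then show "square_integrable \<psi>" by (simp add: square_integrable_def)
qed

lemma square_integrable_of_real: "square_integrable u \<Longrightarrow> square_integrable (\<lambda>x. complex_of_real (u x))"
  by (rule square_integrable_bounded_linear[OF _ bounded_linear_of_real])

lemma test_function_integrable_complex: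
  assumes "test_function \<psi>" shows "integrable lborel (\<lambda>x. complex_of_real (\<psi> x))" "square_integrable (\<lambda>x. complex_of_real (\<psi> x))"
  using test_function_integrable[OF assms] by (auto intro: square_integrable_of_real)

text \<open>The heat kernel is an approximate identity up to the factor \<open>(2 * pi) ^ 3\<close>:
  after rescaling, \<open>B * gauss\<close> is a majorant, and continuity of \<open>v\<close> gives
  the pointwise limit.\<close>

lemma integral_heat_tendsto:
  fixes v :: "real^3 \<Rightarrow> complex"
  assumes v: "continuous_on UNIV v" and B: "\<And>x. norm (v x) \<le> B" and s: "\<And>n. s n > 0" "s \<longlonglongrightarrow> 0"
  shows "(\<lambda>n. LINT y|lborel. v y * complex_of_real (heat (s n) (y - x))) \<longlonglongrightarrow> (2 * pi) ^ 3 * v x"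
    "norm (LINT y|lborel. v y * complex_of_real (heat (s n) (y - x))) \<le> (2 * pi) ^ 3 * B"
proof -
  have [measurable]: "v \<in> borel_measurable borel" by (rule borel_measurable_continuous_onI[OF v])
  have eq: "(LINT y|lborel. v y * complex_of_real (heat (s n) (y - x))) = (2 * pi) ^ 3 * (LINT z|lborel. v (x + s n *\<^sub>R z) * complex_of_real (gauss z))" for n
    by (rule integral_heat_mult) (auto simp: s)
  have i: "integrable lborel (\<lambda>z. B * gauss z)" using integrable_gauss by simp
  have bd: "norm (v (x + c *\<^sub>R z) * complex_of_real (gauss z)) \<le> B * gauss z" for c z
    using B[of "x + c *\<^sub>R z"] gauss_pos[of z] by (simp add: norm_mult mult_right_mono)
  have "(\<lambda>n. LINT z|lborel. v (x + s n *\<^sub>R z) * complex_of_real (gauss z)) \<longlonglongrightarrow> (LINT z|lborel. v x * complex_of_real (gauss z))"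
  proof (rule integral_dominated_convergence[OF _ _ i])
    show "AE z in lborel. (\<lambda>n. v (x + s n *\<^sub>R z) * complex_of_real (gauss z)) \<longlonglongrightarrow> v x * complex_of_real (gauss z)"
    proof (intro AE_I2 tendsto_mult tendsto_const)
      fix z
      have "(\<lambda>n. x + s n *\<^sub>R z) \<longlonglongrightarrow> x + 0 *\<^sub>R z" by (intro tendsto_intros s)
      then show "(\<lambda>n. v (x + s n *\<^sub>R z)) \<longlonglongrightarrow> v x"
        using v by (intro continuous_on_tendsto_compose[of UNIV v]) auto
    qed
  qed (use bd in auto)
  also have "(LINT z|lborel. v x * complex_of_real (gauss z)) = v x" using integral_gauss by simp
  finally show "(\<lambda>n. LINT y|lborel. v y * complex_of_real (heat (s n) (y - x))) \<longlonglongrightarrow> (2 * pi) ^ 3 * v x"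
    unfolding eq by (intro tendsto_intros)
  have "norm (LINT z|lborel. v (x + s n *\<^sub>R z) * complex_of_real (gauss z)) \<le> (LINT z|lborel. norm (v (x + s n *\<^sub>R z) * complex_of_real (gauss z)))"
    by (rule integral_norm_bound)
  also have "\<dots> \<le> (LINT z|lborel. B * gauss z)"
    using bd by (intro integral_mono i integrable_norm Bochner_Integration.integrable_bound[OF i]) (auto intro!: AE_I2 order_trans[OF bd abs_ge_self])
  also have "\<dots> = B" using integral_gauss by simp
  finally show "norm (LINT y|lborel. v y * complex_of_real (heat (s n) (y - x))) \<le> (2 * pi) ^ 3 * B"
    unfolding eq by (simp add: norm_mult norm_power)
qed

section \<open>The Fourier transform on square integrable functions\<close>

lemma inverse_Suc_seq: "\<And>n. 1 / real (Suc n) > 0" "(\<lambda>n. 1 / real (Suc n)) \<longlonglongrightarrow> 0"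
  by (simp, rule LIMSEQ_Suc[OF lim_1_over_n])

text \<open>Limit of the damped identity. On the left \<open>damp\<close> is at most 1 and tends to
  1; on the right the inner integral tends to \<open>(2 * pi) ^ 3 * v x\<close> and stays bounded.
  The reflection in one factor replaces a complex conjugation, since the pairing is
  bilinear.\<close>

lemma FI_Parseval:
  fixes u v :: "real^3 \<Rightarrow> complex"
  assumes u: "integrable lborel u" "square_integrable u" and v: "integrable lborel v" "square_integrable v"
    and cv: "continuous_on UNIV v" and B: "\<And>x. norm (v x) \<le> B"
  shows "(LINT \<xi>|lborel. FI u (- \<xi>) * FI v \<xi>) = (2 * pi) ^ 3 * (LINT x|lborel. u x * v x)"
proof (rule LIMSEQ_unique)
  note [measurable] = u(2)[THEN square_integrable_measurable] v(2)[THEN square_integrable_measurable] FI_measurable[OF u(1)] FI_measurable[OF v(1)]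
  define s where "s n = 1 / real (Suc n)" for n
  have s: "\<And>n. s n > 0" "s \<longlonglongrightarrow> 0" unfolding s_def[abs_def] by (fact inverse_Suc_seq)+
  have i: "integrable lborel (\<lambda>\<xi>. FI u (- \<xi>) * FI v \<xi>)"
    by (intro integrable_mult_square_integrable square_integrable_reflect square_integrable_FI u v)
  show "(\<lambda>n. LINT \<xi>|lborel. FI u (- \<xi>) * (FI v \<xi> * complex_of_real (damp (s n) \<xi>))) \<longlonglongrightarrow> (LINT \<xi>|lborel. FI u (- \<xi>) * FI v \<xi>)"
  proof (rule integral_dominated_convergence)
    show "integrable lborel (\<lambda>\<xi>. norm (FI u (- \<xi>) * FI v \<xi>))" using i by simp
    show "AE \<xi> in lborel. (\<lambda>n. FI u (- \<xi>) * (FI v \<xi> * complex_of_real (damp (s n) \<xi>))) \<longlonglongrightarrow> FI u (- \<xi>) * FI v \<xi>"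
    proof (rule AE_I2)
      fix \<xi>
      have "(\<lambda>n. FI u (- \<xi>) * (FI v \<xi> * complex_of_real (damp (s n) \<xi>))) \<longlonglongrightarrow> FI u (- \<xi>) * (FI v \<xi> * complex_of_real 1)"
        by (intro tendsto_intros damp_tendsto s)
      then show "(\<lambda>n. FI u (- \<xi>) * (FI v \<xi> * complex_of_real (damp (s n) \<xi>))) \<longlonglongrightarrow> FI u (- \<xi>) * FI v \<xi>" by simp
    qed
    show "AE \<xi> in lborel. norm (FI u (- \<xi>) * (FI v \<xi> * complex_of_real (damp (s n) \<xi>))) \<le> norm (FI u (- \<xi>) * FI v \<xi>)" for n
    proof (rule AE_I2)
      fix \<xi>
      have "norm (FI u (- \<xi>)) * norm (FI v \<xi>) * \<bar>damp (s n) \<xi>\<bar> \<le> norm (FI u (- \<xi>)) * norm (FI v \<xi>)"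
        using damp_bounds[of "s n" \<xi>] by (intro mult_right_le_one_le) auto
      then show "norm (FI u (- \<xi>) * (FI v \<xi> * complex_of_real (damp (s n) \<xi>))) \<le> norm (FI u (- \<xi>) * FI v \<xi>)"
        by (simp add: norm_mult mult.assoc)
    qed
  qed measurable
  have "(\<lambda>n. LINT x|lborel. u x * (LINT y|lborel. v y * complex_of_real (heat (s n) (y - x)))) \<longlonglongrightarrow> (LINT x|lborel. u x * ((2 * pi) ^ 3 * v x))"
  proof (rule integral_dominated_convergence)
    show "integrable lborel (\<lambda>x. norm (u x) * ((2 * pi) ^ 3 * B))" using u by simp
    show "AE x in lborel. (\<lambda>n. u x * (LINT y|lborel. v y * complex_of_real (heat (s n) (y - x)))) \<longlonglongrightarrow> u x * ((2 * pi) ^ 3 * v x)"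
      by (intro AE_I2 tendsto_mult tendsto_const integral_heat_tendsto[OF cv B s])
    show "AE x in lborel. norm (u x * (LINT y|lborel. v y * complex_of_real (heat (s n) (y - x)))) \<le> norm (u x) * ((2 * pi) ^ 3 * B)" for n
      using integral_heat_tendsto(2)[OF cv B s] by (intro AE_I2) (simp add: norm_mult mult_left_mono)
  qed measurable
  also have "(LINT x|lborel. u x * ((2 * pi) ^ 3 * v x)) = (LINT x|lborel. (2 * pi) ^ 3 * (u x * v x))"
    by (simp add: mult_ac)
  finally show "(\<lambda>n. LINT \<xi>|lborel. FI u (- \<xi>) * (FI v \<xi> * complex_of_real (damp (s n) \<xi>))) \<longlonglongrightarrow> (2 * pi) ^ 3 * (LINT x|lborel. u x * v x)"
    unfolding FI_damped_Parseval[OF u(1) v(1) s(1)] by (simp only: integral_mult_right_zero)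
qed

lemma inv_fourier_eq: "inv_fourier \<psi> \<xi> = FI (\<lambda>x. complex_of_real (\<psi> x)) \<xi> / (2 * pi) ^ 3"
  unfolding inv_fourier_def FI_def by (simp add: inner_commute)

abbreviation (input) cplx :: "('a \<Rightarrow> real) \<Rightarrow> 'a \<Rightarrow> complex" where
  "cplx f \<equiv> (\<lambda>x. complex_of_real (f x))"

lemma is_fourier_iff:
  "is_fourier u g \<longleftrightarrow> square_integrable u \<and> square_integrable g \<and>
     (\<forall>\<psi>. test_function \<psi> \<longrightarrow> (LINT \<xi>|lborel. g \<xi> * FI (cplx \<psi>) \<xi>) = (2 * pi) ^ 3 * complex_of_real (LINT x|lborel. u x * \<psi> x))"
proof -
  have eq: "(LINT \<xi>|lborel. g \<xi> * FI (cplx \<psi>) \<xi>) = (2 * pi) ^ 3 * (LINT \<xi>|lborel. g \<xi> * inv_fourier \<psi> \<xi>)" for \<psi>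
    unfolding inv_fourier_eq times_divide_eq_right integral_divide_zero by simp
  have "complex_of_real (LINT x|lborel. u x * \<psi> x) = (LINT \<xi>|lborel. g \<xi> * inv_fourier \<psi> \<xi>) \<longleftrightarrow>
     (LINT \<xi>|lborel. g \<xi> * FI (cplx \<psi>) \<xi>) = (2 * pi) ^ 3 * complex_of_real (LINT x|lborel. u x * \<psi> x)" for \<psi>
    unfolding eq by auto
  then show ?thesis unfolding is_fourier_def by (simp only:)
qed

text \<open>The witness is the L^2 extension of \<open>FI\<close>, reflected because of the sign
  convention. Parseval's identity holds for each truncation and survives the L^2 limit.\<close>

lemma is_fourier_exists:
  assumes u: "square_integrable u" shows "\<exists>g. is_fourier u g"
proof -
  have cu: "square_integrable (cplx u)" by (rule square_integrable_of_real[OF u])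
  obtain G where G: "square_integrable G" "(\<lambda>n. nrm2 (\<lambda>x. G x - FI (trunc n (cplx u)) x)) \<longlonglongrightarrow> 0"
    using FI_extend_L2[OF cu] by blast
  note [measurable] = square_integrable_measurable[OF G(1)]
  let ?g = "\<lambda>\<xi>. G (- \<xi>)" and ?h = "\<lambda>n \<xi>. FI (trunc n (cplx u)) (- \<xi>)"
  have g: "square_integrable ?g" by (rule square_integrable_reflect[OF G(1)])
  have h: "square_integrable (?h n)" for n
    by (intro square_integrable_reflect square_integrable_FI trunc_integrable trunc_square_integrable cu)
  have "nrm2 (\<lambda>x. G (- x) - FI (trunc n (cplx u)) (- x)) = nrm2 (\<lambda>x. G x - FI (trunc n (cplx u)) x)" for n
  proof -
    have d: "square_integrable (\<lambda>x. G x - FI (trunc n (cplx u)) x)"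
      by (intro square_integrable_diff G square_integrable_FI trunc_integrable trunc_square_integrable cu)
    show ?thesis
      using lborel_integral_reflect[of "\<lambda>x. (norm (G x - FI (trunc n (cplx u)) x))\<^sup>2"] square_integrable_measurable[OF d]
      by (simp add: nrm2_eq_integral[OF d] nrm2_eq_integral[OF square_integrable_reflect[OF d]])
  qed
  with G(2) have lim: "(\<lambda>n. nrm2 (\<lambda>x. ?g x - ?h n x)) \<longlonglongrightarrow> 0" by simp
  have "(LINT \<xi>|lborel. ?g \<xi> * FI (cplx \<psi>) \<xi>) = (2 * pi) ^ 3 * complex_of_real (LINT x|lborel. u x * \<psi> x)" if psi: "test_function \<psi>" for \<psi>
  proof (rule LIMSEQ_unique)
    note p = test_function_integrable_complex[OF psi]
    show "(\<lambda>n. LINT \<xi>|lborel. ?h n \<xi> * FI (cplx \<psi>) \<xi>) \<longlonglongrightarrow> (LINT \<xi>|lborel. ?g \<xi> * FI (cplx \<psi>) \<xi>)"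
      by (rule tendsto_integral_mult_L2[OF h g square_integrable_FI[OF p] lim])
    obtain B where B: "\<And>x. \<bar>\<psi> x\<bar> \<le> B" using test_function_bounded[OF psi] by blast
    have "(LINT \<xi>|lborel. ?h n \<xi> * FI (cplx \<psi>) \<xi>) = (2 * pi) ^ 3 * (LINT x|lborel. trunc n (cplx u) x * cplx \<psi> x)" for n
      by (rule FI_Parseval[OF trunc_integrable[OF cu] trunc_square_integrable[OF cu] p _, of B])
        (auto simp: B intro!: continuous_intros test_function_continuous[OF psi])
    moreover have "(\<lambda>n. LINT x|lborel. trunc n (cplx u) x * cplx \<psi> x) \<longlonglongrightarrow> (LINT x|lborel. cplx u x * cplx \<psi> x)"
      by (intro trunc_mult_tendsto integrable_mult_square_integrable cu p square_integrable_measurable)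
    moreover have "(LINT x|lborel. cplx u x * cplx \<psi> x) = complex_of_real (LINT x|lborel. u x * \<psi> x)"
      by (simp flip: integral_complex_of_real)
    ultimately show "(\<lambda>n. LINT \<xi>|lborel. ?h n \<xi> * FI (cplx \<psi>) \<xi>) \<longlonglongrightarrow> (2 * pi) ^ 3 * complex_of_real (LINT x|lborel. u x * \<psi> x)"
      by (simp add: tendsto_mult_left)
  qed
  then show ?thesis using u g by (auto simp: is_fourier_iff)
qed

lemma is_fourier_fourier: "square_integrable u \<Longrightarrow> is_fourier u (fourier u)"
  unfolding fourier_def by (rule someI_ex[OF is_fourier_exists])

section \<open>Uniqueness of the transform and the inequality of Plancherel\<close>

lemma AE_eq_0_if_test_integrals_L2:
  fixes z :: "real^3 \<Rightarrow> complex"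
  assumes z: "square_integrable z" and "\<And>\<psi>. test_function \<psi> \<Longrightarrow> (LINT x|lborel. z x * complex_of_real (\<psi> x)) = 0"
  shows "AE x in lborel. z x = 0"
  by (rule AE_eq_0_if_test_integrals)
    (use assms integrable_indicator_square_integrable[OF z] square_integrable_measurable[OF z] in
      \<open>auto simp: set_integrable_def bounded_box\<close>)

text \<open>Transforms of test functions are in general not test functions, so the hypothesis does
  not give \<open>h = 0\<close> directly. It says that the transform \<open>z\<close> of
  \<open>h\<close> annihilates test functions; hence \<open>z = 0\<close>, and then \<open>h\<close>
  annihilates \<open>FI \<phi>\<close> for every \<open>\<phi>\<close> both integrable and square
  integrable. Such \<open>FI \<phi>\<close> approximate any test function \<open>\<eta>\<close> in
  L^2.\<close>

lemma fourier_injective: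
  assumes h: "square_integrable h" and zero: "\<And>\<psi>. test_function \<psi> \<Longrightarrow> (LINT \<xi>|lborel. h \<xi> * FI (cplx \<psi>) \<xi>) = 0"
  shows "AE \<xi> in lborel. h \<xi> = 0"
proof -
  obtain z where z: "square_integrable z"
    and zm: "\<And>\<phi>. integrable lborel \<phi> \<Longrightarrow> square_integrable \<phi> \<Longrightarrow> (LINT x|lborel. z x * \<phi> x) = (LINT x|lborel. h x * FI \<phi> x)"
    using FI_multiplication_L2[OF h] by blast
  have "AE x in lborel. z x = 0"
    by (rule AE_eq_0_if_test_integrals_L2[OF z]) (simp add: zm test_function_integrable_complex zero)
  then have h0: "(LINT x|lborel. h x * FI \<phi> x) = 0" if "integrable lborel \<phi>" "square_integrable \<phi>" for \<phi>
    by (subst zm[OF that, symmetric]) (rule integral_eq_zero_AE, auto)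
  show ?thesis
  proof (rule AE_eq_0_if_test_integrals_L2[OF h])
    fix \<eta> assume e: "test_function \<eta>"
    note eta = test_function_integrable_complex[OF e]
    obtain B where B: "\<And>x. \<bar>\<eta> x\<bar> \<le> B" using test_function_bounded[OF e] by blast
    define s where "s n = 1 / real (Suc n)" for n
    have s: "\<And>n. s n > 0" "s \<longlonglongrightarrow> 0" unfolding s_def[abs_def] by (fact inverse_Suc_seq)+
    \<comment> \<open>Damping makes the transform of \<open>\<eta>\<close> integrable, and
      transforming once more yields \<open>\<eta>\<close> smoothed by the heat kernel.\<close>
    define \<phi> where "\<phi> n \<xi> = FI (cplx \<eta>) (- \<xi>) * complex_of_real (damp (s n) \<xi>)" for n \<xi>
    note [measurable] = FI_measurable[OF eta(1)]
    have F: "square_integrable (\<lambda>\<xi>. FI (cplx \<eta>) (- \<xi>))" by (intro square_integrable_reflect square_integrable_FI eta)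
    have phi_i: "integrable lborel (\<phi> n)" for n
      using integrable_FI_damp[OF eta(1) s(1)] lborel_integrable_reflect[of "\<lambda>\<xi>. FI (cplx \<eta>) \<xi> * complex_of_real (damp (s n) \<xi>)"]
      by (simp add: damp_minus \<phi>_def[abs_def])
    have phi_s: "square_integrable (\<phi> n)" for n
    proof (rule square_integrable_bound[OF F])
      fix \<xi> show "norm (\<phi> n \<xi>) \<le> norm (FI (cplx \<eta>) (- \<xi>))"
        using damp_bounds[of "s n" \<xi>] unfolding \<phi>_def norm_mult norm_of_real by (intro mult_right_le_one_le) auto
    qed (unfold \<phi>_def[abs_def], measurable)
    have FIphi: "FI (\<phi> n) x = (LINT y|lborel. cplx \<eta> y * complex_of_real (heat (s n) (y - x)))" for n x
      unfolding \<phi>_def[abs_def] by (rule FI_FI_damp[OF eta(1) s(1)])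
    have lim: "(\<lambda>n. FI (\<phi> n) x) \<longlonglongrightarrow> (2 * pi) ^ 3 * cplx \<eta> x" for x
      unfolding FIphi by (rule integral_heat_tendsto[where B=B, OF _ _ s])
        (auto simp: B intro!: continuous_intros test_function_continuous[OF e])
    define t where "t n = nrm2 (\<lambda>\<xi>. FI (cplx \<eta>) (- \<xi>) * complex_of_real (1 - damp (s n) \<xi>))" for n
    have ts: "square_integrable (\<lambda>\<xi>. FI (cplx \<eta>) (- \<xi>) * complex_of_real (1 - damp (s n) \<xi>))" for n
    proof (rule square_integrable_bound[OF F])
      fix \<xi> show "norm (FI (cplx \<eta>) (- \<xi>) * complex_of_real (1 - damp (s n) \<xi>)) \<le> norm (FI (cplx \<eta>) (- \<xi>))"
        using damp_bounds[of "s n" \<xi>] unfolding norm_mult norm_of_real by (intro mult_right_le_one_le) auto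
    qed measurable
    have "(\<lambda>n. LINT \<xi>|lborel. (norm (FI (cplx \<eta>) (- \<xi>) * complex_of_real (1 - damp (s n) \<xi>)))\<^sup>2) \<longlonglongrightarrow> (LINT \<xi>::real^3|lborel. 0)"
    proof (rule integral_dominated_convergence)
      show "integrable lborel (\<lambda>\<xi>. (norm (FI (cplx \<eta>) (- \<xi>)))\<^sup>2)" using F by (simp add: square_integrable_def)
      show "AE \<xi> in lborel. (\<lambda>n. (norm (FI (cplx \<eta>) (- \<xi>) * complex_of_real (1 - damp (s n) \<xi>)))\<^sup>2) \<longlonglongrightarrow> 0"
      proof (rule AE_I2)
        fix \<xi>
        have "(\<lambda>n. (norm (FI (cplx \<eta>) (- \<xi>) * complex_of_real (1 - damp (s n) \<xi>)))\<^sup>2) \<longlonglongrightarrow> (norm (FI (cplx \<eta>) (- \<xi>) * complex_of_real (1 - 1)))\<^sup>2"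
          by (intro tendsto_intros damp_tendsto s)
        then show "(\<lambda>n. (norm (FI (cplx \<eta>) (- \<xi>) * complex_of_real (1 - damp (s n) \<xi>)))\<^sup>2) \<longlonglongrightarrow> 0" by simp
      qed
      show "AE \<xi> in lborel. norm ((norm (FI (cplx \<eta>) (- \<xi>) * complex_of_real (1 - damp (s n) \<xi>)))\<^sup>2) \<le> (norm (FI (cplx \<eta>) (- \<xi>)))\<^sup>2" for n
      proof (rule AE_I2)
        fix \<xi>
        have "norm (FI (cplx \<eta>) (- \<xi>) * complex_of_real (1 - damp (s n) \<xi>)) \<le> norm (FI (cplx \<eta>) (- \<xi>))"
          using damp_bounds[of "s n" \<xi>] unfolding norm_mult norm_of_real by (intro mult_right_le_one_le) auto
        then show "norm ((norm (FI (cplx \<eta>) (- \<xi>) * complex_of_real (1 - damp (s n) \<xi>)))\<^sup>2) \<le> (norm (FI (cplx \<eta>) (- \<xi>)))\<^sup>2"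
          by (simp add: power_mono del: norm_mult)
      qed
    qed measurable
    then have "(\<lambda>n. ennreal (LINT \<xi>|lborel. (norm (FI (cplx \<eta>) (- \<xi>) * complex_of_real (1 - damp (s n) \<xi>)))\<^sup>2)) \<longlonglongrightarrow> ennreal 0"
      by (intro tendsto_ennrealI) simp
    then have t0: "t \<longlonglongrightarrow> 0" unfolding t_def[abs_def] nrm2_eq_integral[OF ts] by simp
    have e0: "(\<lambda>n. ennreal ((2 * pi) ^ 3) * t n) \<longlonglongrightarrow> 0"
      using ennreal_tendsto_cmult[of "ennreal ((2 * pi) ^ 3)" t 0 sequentially] t0 by simp
    \<comment> \<open>The limit of \<open>FI (\<phi> m)\<close> is known pointwise only. The L^2
      rate comes from Fatou's lemma and the bound for \<open>FI (\<phi> m - \<phi> n)\<close>, since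
      the damping factors increase to 1 with the index.\<close>
    have near: "nrm2 (\<lambda>x. (2 * pi) ^ 3 * cplx \<eta> x - FI (\<phi> n) x) \<le> ennreal ((2 * pi) ^ 3) * t n" for n
    proof (rule nrm2_le_of_tendsto[where g="\<lambda>m. FI (\<phi> m)"])
      show "AE x in lborel. (\<lambda>m. FI (\<phi> m) x) \<longlonglongrightarrow> (2 * pi) ^ 3 * cplx \<eta> x" by (intro AE_I2 lim)
      show "\<forall>\<^sub>F m in sequentially. nrm2 (\<lambda>x. FI (\<phi> m) x - FI (\<phi> n) x) \<le> ennreal ((2 * pi) ^ 3) * t n"
      proof (rule eventually_sequentiallyI[of n])
        fix m assume "n \<le> m"
        have "nrm2 (\<lambda>x. FI (\<phi> m) x - FI (\<phi> n) x) = nrm2 (FI (\<lambda>x. \<phi> m x - \<phi> n x))"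
          by (simp add: FI_diff phi_i nrm2_def)
        also have "\<dots> \<le> ennreal ((2 * pi) ^ 3) * nrm2 (\<lambda>x. \<phi> m x - \<phi> n x)"
          by (intro nrm2_FI_le Bochner_Integration.integrable_diff phi_i)
        also have "\<dots> \<le> ennreal ((2 * pi) ^ 3) * t n" unfolding t_def
        proof (intro mult_left_mono nrm2_mono)
          fix \<xi> :: "real^3"
          have "s m \<le> s n" unfolding s_def using \<open>n \<le> m\<close> by (simp add: frac_le)
          then have "(norm (s m *\<^sub>R \<xi>))\<^sup>2 \<le> (norm (s n *\<^sub>R \<xi>))\<^sup>2"
            using s(1)[of m] s(1)[of n] by (intro power_mono) (auto intro!: mult_right_mono)
          then have "damp (s n) \<xi> \<le> damp (s m) \<xi>" by (simp add: damp_def)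
          then have "\<bar>damp (s m) \<xi> - damp (s n) \<xi>\<bar> \<le> \<bar>1 - damp (s n) \<xi>\<bar>"
            using damp_bounds(2)[of "s m" \<xi>] by simp
          moreover have "\<phi> m \<xi> - \<phi> n \<xi> = FI (cplx \<eta>) (- \<xi>) * complex_of_real (damp (s m) \<xi> - damp (s n) \<xi>)"
            by (simp add: \<phi>_def right_diff_distrib)
          ultimately show "norm (\<phi> m \<xi> - \<phi> n \<xi>) \<le> norm (FI (cplx \<eta>) (- \<xi>) * complex_of_real (1 - damp (s n) \<xi>))"
            unfolding norm_mult norm_of_real by (simp only: mult_left_mono norm_mult norm_of_real norm_ge_zero)
        qed auto
        finally show "nrm2 (\<lambda>x. FI (\<phi> m) x - FI (\<phi> n) x) \<le> ennreal ((2 * pi) ^ 3) * t n" .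
      qed
    qed (rule FI_measurable[OF phi_i])+
    have "(\<lambda>n. LINT x|lborel. FI (\<phi> n) x * h x) \<longlonglongrightarrow> (LINT x|lborel. ((2 * pi) ^ 3 * cplx \<eta> x) * h x)"
    proof (rule tendsto_integral_mult_L2)
      show "(\<lambda>n. nrm2 (\<lambda>x. (2 * pi) ^ 3 * cplx \<eta> x - FI (\<phi> n) x)) \<longlonglongrightarrow> 0"
        by (rule tendsto_sandwich[OF _ _ tendsto_const e0]) (use near in auto)
    qed (intro square_integrable_FI phi_i phi_s h square_integrable_cmult eta)+
    then have "(LINT x|lborel. ((2 * pi) ^ 3 * cplx \<eta> x) * h x) = 0"
      using h0[OF phi_i phi_s] by (simp add: mult.commute LIMSEQ_const_iff)
    moreover have "(LINT x|lborel. ((2 * pi) ^ 3 * cplx \<eta> x) * h x) = (LINT x|lborel. (2 * pi) ^ 3 * (h x * cplx \<eta> x))"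
      by (intro Bochner_Integration.integral_cong refl) (simp only: mult_ac)
    ultimately show "(LINT x|lborel. h x * cplx \<eta> x) = 0" by (simp only: integral_mult_right_zero) simp
  qed
qed

lemma is_fourier_lincomb:
  assumes u: "is_fourier u g" and v: "is_fourier v k"
  shows "is_fourier (\<lambda>x. a * u x + b * v x) (\<lambda>\<xi>. complex_of_real a * g \<xi> + complex_of_real b * k \<xi>)"
  unfolding is_fourier_iff
proof (intro conjI allI impI)
  show "square_integrable (\<lambda>x. a * u x + b * v x)" "square_integrable (\<lambda>\<xi>. complex_of_real a * g \<xi> + complex_of_real b * k \<xi>)"
    using u v unfolding is_fourier_iff by (auto intro!: square_integrable_add square_integrable_cmult)
  fix \<psi> assume p: "test_function \<psi>"
  note psi = test_function_integrable_complex[OF p]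
  have s: "square_integrable u" "square_integrable v" "square_integrable g" "square_integrable k" using u v unfolding is_fourier_iff by auto
  have "integrable lborel (\<lambda>x. Re (cplx w x * cplx \<psi> x))" if "square_integrable w" for w
    by (intro integrable_Re integrable_mult_square_integrable psi square_integrable_of_real that)
  then have i: "integrable lborel (\<lambda>x. w x * \<psi> x)" if "square_integrable w" for w using that by simp
  have j: "integrable lborel (\<lambda>x. w x * FI (cplx \<psi>) x)" if "square_integrable w" for w
    by (intro integrable_mult_square_integrable that square_integrable_FI psi)
  have "(LINT x|lborel. (a * u x + b * v x) * \<psi> x) = a * (LINT x|lborel. u x * \<psi> x) + b * (LINT x|lborel. v x * \<psi> x)"
    using i[OF s(1)] i[OF s(2)] by (simp add: distrib_right mult.assoc)
  moreover have "(LINT \<xi>|lborel. (complex_of_real a * g \<xi> + complex_of_real b * k \<xi>) * FI (cplx \<psi>) \<xi>)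
      = complex_of_real a * (LINT \<xi>|lborel. g \<xi> * FI (cplx \<psi>) \<xi>) + complex_of_real b * (LINT \<xi>|lborel. k \<xi> * FI (cplx \<psi>) \<xi>)"
    using j[OF s(3)] j[OF s(4)] by (simp add: distrib_right mult.assoc)
  ultimately show "(LINT \<xi>|lborel. (complex_of_real a * g \<xi> + complex_of_real b * k \<xi>) * FI (cplx \<psi>) \<xi>)
      = (2 * pi) ^ 3 * complex_of_real (LINT x|lborel. (a * u x + b * v x) * \<psi> x)"
    using u v p unfolding is_fourier_iff by (simp add: algebra_simps)
qed

text \<open>This makes the choice in \<open>fourier\<close> harmless: weighted integrals of its
  modulus do not depend on the function selected.\<close>

lemma is_fourier_unique:
  assumes "is_fourier u g" "is_fourier u k" shows "AE \<xi> in lborel. g \<xi> = k \<xi>"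
proof -
  have s: "square_integrable g" "square_integrable k" using assms unfolding is_fourier_iff by auto
  have "AE \<xi> in lborel. g \<xi> - k \<xi> = 0"
  proof (rule fourier_injective)
    fix \<psi> assume p: "test_function \<psi>"
    have j: "integrable lborel (\<lambda>x. w x * FI (cplx \<psi>) x)" if "square_integrable w" for w
      by (intro integrable_mult_square_integrable that square_integrable_FI test_function_integrable_complex p)
    show "(LINT \<xi>|lborel. (g \<xi> - k \<xi>) * FI (cplx \<psi>) \<xi>) = 0"
      using assms p j[OF s(1)] j[OF s(2)] unfolding is_fourier_iff by (simp add: left_diff_distrib)
  qed (intro square_integrable_diff s)
  then show ?thesis by simp
qed

lemma is_fourier_cong_AE:
  assumes "square_integrable u" "v \<in> borel_measurable borel" "AE x in lborel. u x = v x"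
  shows "is_fourier u = is_fourier v"
proof -
  have "square_integrable v" by (rule square_integrable_cong_AE[OF assms])
  moreover have "(LINT x|lborel. u x * \<psi> x) = (LINT x|lborel. v x * \<psi> x)" if "test_function \<psi>" for \<psi>
    using test_function_measurable[OF that] square_integrable_measurable[OF assms(1)] assms(2,3)
    by (intro integral_cong_AE) auto
  ultimately show ?thesis using assms(1) by (auto simp: is_fourier_iff fun_eq_iff)
qed

lemma fourier_cong_AE:
  "square_integrable u \<Longrightarrow> v \<in> borel_measurable borel \<Longrightarrow> AE x in lborel. u x = v x \<Longrightarrow> fourier u = fourier v"
  using is_fourier_cong_AE[of u v] by (simp add: fourier_def)

text \<open>One half of Plancherel's theorem, the one that bounds L^2 by Sobolev norms. The L^2
  bound is applied to \<open>g\<close> rather than to \<open>u\<close>: the transform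
  \<open>z\<close> of \<open>g\<close> equals \<open>(2 * pi) ^ 3\<close> times \<open>u\<close>, by
  testing.\<close>

lemma is_fourier_norm_le:
  assumes "is_fourier u g"
  shows "(LINT x|lborel. (u x)\<^sup>2) \<le> (LINT \<xi>|lborel. (norm (g \<xi>))\<^sup>2) / (2 * pi) ^ 3"
proof -
  have u: "square_integrable u" and g: "square_integrable g"
    and ug: "\<And>\<psi>. test_function \<psi> \<Longrightarrow> (LINT \<xi>|lborel. g \<xi> * FI (cplx \<psi>) \<xi>) = (2 * pi) ^ 3 * complex_of_real (LINT x|lborel. u x * \<psi> x)"
    using assms unfolding is_fourier_iff by auto
  define c :: real where "c = (2 * pi) ^ 3"
  have c: "c > 0" unfolding c_def by simp
  obtain z where z: "square_integrable z" "nrm2 z \<le> ennreal c * nrm2 g"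
    and zm: "\<And>\<phi>. integrable lborel \<phi> \<Longrightarrow> square_integrable \<phi> \<Longrightarrow> (LINT x|lborel. z x * \<phi> x) = (LINT x|lborel. g x * FI \<phi> x)"
    unfolding c_def using FI_multiplication_L2[OF g] by blast
  have cu: "square_integrable (\<lambda>x. complex_of_real c * cplx u x)" by (intro square_integrable_cmult square_integrable_of_real u)
  have "AE x in lborel. z x - complex_of_real c * cplx u x = 0"
  proof (rule AE_eq_0_if_test_integrals_L2)
    fix \<psi> assume p: "test_function \<psi>"
    note psi = test_function_integrable_complex[OF p]
    have "(LINT x|lborel. (z x - complex_of_real c * cplx u x) * cplx \<psi> x) = (LINT x|lborel. z x * cplx \<psi> x) - (LINT x|lborel. (complex_of_real c * cplx u x) * cplx \<psi> x)"
      using integrable_mult_square_integrable[OF z(1) psi(2)] integrable_mult_square_integrable[OF cu psi(2)]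
      by (simp add: left_diff_distrib)
    also have "(LINT x|lborel. (complex_of_real c * cplx u x) * cplx \<psi> x) = complex_of_real c * complex_of_real (LINT x|lborel. u x * \<psi> x)"
      by (simp flip: integral_complex_of_real add: mult.assoc)
    also have "(LINT x|lborel. z x * cplx \<psi> x) = (2 * pi) ^ 3 * complex_of_real (LINT x|lborel. u x * \<psi> x)"
      using zm[OF psi] ug[OF p] by simp
    finally show "(LINT x|lborel. (z x - complex_of_real c * cplx u x) * cplx \<psi> x) = 0" by (simp add: c_def)
  qed (intro square_integrable_diff z cu)
  then have "nrm2 z = nrm2 (\<lambda>x. complex_of_real c * cplx u x)"
    unfolding nrm2_def by (intro nn_integral_cong_AE) (auto elim: eventually_mono)
  then have "ennreal (LINT x|lborel. (norm (complex_of_real c * cplx u x))\<^sup>2) \<le> ennreal c * ennreal (LINT \<xi>|lborel. (norm (g \<xi>))\<^sup>2)"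
    using z(2) by (simp only: nrm2_eq_integral[OF cu] nrm2_eq_integral[OF g])
  then have "(LINT x|lborel. (norm (complex_of_real c * cplx u x))\<^sup>2) \<le> c * (LINT \<xi>|lborel. (norm (g \<xi>))\<^sup>2)"
    using c by (subst (asm) ennreal_mult[symmetric]) (auto simp: ennreal_le_iff)
  then have "c\<^sup>2 * (LINT x|lborel. (u x)\<^sup>2) \<le> c * (LINT \<xi>|lborel. (norm (g \<xi>))\<^sup>2)"
    by (simp add: norm_mult power_mult_distrib)
  then show ?thesis using c unfolding c_def[symmetric] by (simp add: power2_eq_square field_simps)
qed

section \<open>Fourier transforms of derivatives and the inversion formula\<close>

lemma pdx_mult:
  assumes "Ck_on (Suc 0) UNIV a" "Ck_on (Suc 0) UNIV b"
  shows "pdx \<alpha> (\<lambda>x. a x * b x) x = a x * pdx \<alpha> b x + pdx \<alpha> a x * b x"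
proof -
  have "((\<lambda>x. a x * b x) has_derivative (\<lambda>h. a x * frechet_derivative b (at x) h + frechet_derivative a (at x) h * b x)) (at x)"
    by (intro has_derivative_mult Ck_on_Suc_UNIV_frechet(1)[OF assms(1)] Ck_on_Suc_UNIV_frechet(1)[OF assms(2)])
  from frechet_derivative_at[OF this, symmetric] show ?thesis by (simp add: pdx_def)
qed

lemma integral_by_parts_pdx:
  assumes a: "Ck_on (Suc 0) UNIV a" and b: "Ck_on (Suc 0) UNIV b"
    and "integrable lborel (\<lambda>x. a x * b x)"
    and i1: "integrable lborel (\<lambda>x. a x * pdx \<alpha> b x)" and i2: "integrable lborel (\<lambda>x. pdx \<alpha> a x * b x)"
  shows "(LINT x|lborel. a x * pdx \<alpha> b x) = - (LINT x|lborel. pdx \<alpha> a x * b x)"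
proof -
  have "(LINT x|lborel. pdx \<alpha> (\<lambda>x. a x * b x) x) = 0"
  proof (rule integral_pdx_eq_0)
    show "integrable lborel (pdx \<alpha> (\<lambda>x. a x * b x))" using i1 i2 by (simp add: pdx_mult[OF a b, abs_def])
  qed (use assms Ck_on_mult in blast)+
  then show ?thesis using i1 i2 by (simp add: pdx_mult[OF a b])
qed

lemma integrable_continuous_test:
  fixes f :: "real^3 \<Rightarrow> real"
  assumes f: "continuous_on UNIV f" and p: "test_function \<psi>"
  shows "integrable lborel (\<lambda>x. f x * \<psi> x)"
proof -
  obtain a b where ab: "\<And>x. x \<notin> box a b \<Longrightarrow> \<psi> x = 0" using test_function_support[OF p] by blast
  have "integrable lborel (\<lambda>x. indicator (cbox a b) x *\<^sub>R (f x * \<psi> x))"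
    by (intro borel_integrable_compact continuous_intros continuous_on_subset[OF f] continuous_on_subset[OF test_function_continuous[OF p]]) auto
  also have "(\<lambda>x. indicator (cbox a b) x *\<^sub>R (f x * \<psi> x)) = (\<lambda>x. f x * \<psi> x)"
    using ab box_subset_cbox by (fastforce simp: indicator_def fun_eq_iff)
  finally show ?thesis .
qed

lemma Ck_on_trig: 
  shows "Ck_on (Suc 0) UNIV (\<lambda>x. cos (\<xi> \<bullet> x))" "Ck_on (Suc 0) UNIV (\<lambda>x. sin (\<xi> \<bullet> x))"
    "pdx \<alpha> (\<lambda>x. cos (\<xi> \<bullet> x)) x = - (\<xi> $ \<alpha>) * sin (\<xi> \<bullet> x)" "pdx \<alpha> (\<lambda>x. sin (\<xi> \<bullet> x)) x = \<xi> $ \<alpha> * cos (\<xi> \<bullet> x)"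
proof -
  have c: "((\<lambda>x. cos (\<xi> \<bullet> x)) has_derivative (\<lambda>h. - (\<xi> \<bullet> h) * sin (\<xi> \<bullet> x))) (at x)" for x :: "real^3"
    by (auto intro!: derivative_eq_intros)
  have s: "((\<lambda>x. sin (\<xi> \<bullet> x)) has_derivative (\<lambda>h. (\<xi> \<bullet> h) * cos (\<xi> \<bullet> x))) (at x)" for x :: "real^3"
    by (auto intro!: derivative_eq_intros)
  show "Ck_on (Suc 0) UNIV (\<lambda>x. cos (\<xi> \<bullet> x))" "Ck_on (Suc 0) UNIV (\<lambda>x. sin (\<xi> \<bullet> x))"
    unfolding Ck_on.simps
    by (rule exI[of _ "\<lambda>x h. - (\<xi> \<bullet> h) * sin (\<xi> \<bullet> x)"], use c in \<open>auto intro!: continuous_intros\<close>)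
      (rule exI[of _ "\<lambda>x h. (\<xi> \<bullet> h) * cos (\<xi> \<bullet> x)"], use s in \<open>auto intro!: continuous_intros\<close>)
  show "pdx \<alpha> (\<lambda>x. cos (\<xi> \<bullet> x)) x = - (\<xi> $ \<alpha>) * sin (\<xi> \<bullet> x)" "pdx \<alpha> (\<lambda>x. sin (\<xi> \<bullet> x)) x = \<xi> $ \<alpha> * cos (\<xi> \<bullet> x)"
    unfolding pdx_def frechet_derivative_at[OF c, symmetric] frechet_derivative_at[OF s, symmetric] by (simp_all add: inner_axis)
qed

lemma test_function_Ck: "test_function \<psi> \<Longrightarrow> Ck_on k UNIV \<psi>"
  by (simp add: test_function_def smooth_on_def)

text \<open>The character is split into cosine and sine because integration by parts is available
  for real functions; the two parts are exchanged by differentiation.\<close>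

lemma FI_pdx_test:
  assumes p: "test_function \<psi>"
  shows "FI (cplx (pdx \<alpha> \<psi>)) \<xi> = - \<i> * complex_of_real (\<xi> $ \<alpha>) * FI (cplx \<psi>) \<xi>"
proof -
  note q = test_function_pdx[OF p, of \<alpha>]
  note C = test_function_Ck[OF p, of "Suc 0"]
  have cc: "continuous_on UNIV (\<lambda>x. cos (\<xi> \<bullet> x))" "continuous_on UNIV (\<lambda>x. sin (\<xi> \<bullet> x))"
    by (intro continuous_intros)+
  have i: "integrable lborel (\<lambda>x. cos (\<xi> \<bullet> x) * f x)" "integrable lborel (\<lambda>x. sin (\<xi> \<bullet> x) * f x)" if "test_function f" for f
    by (intro integrable_continuous_test cc that)+
  have i': "integrable lborel (\<lambda>x. - (\<xi> $ \<alpha>) * sin (\<xi> \<bullet> x) * \<psi> x)" "integrable lborel (\<lambda>x. \<xi> $ \<alpha> * cos (\<xi> \<bullet> x) * \<psi> x)"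
    by (intro integrable_continuous_test p continuous_intros)+
  have cs: "(LINT x|lborel. cos (\<xi> \<bullet> x) * pdx \<alpha> \<psi> x) = \<xi> $ \<alpha> * (LINT x|lborel. sin (\<xi> \<bullet> x) * \<psi> x)"
    using integral_by_parts_pdx[OF Ck_on_trig(1) C i(1)[OF p] i(1)[OF q]] i'(1)
    by (simp add: Ck_on_trig mult.assoc)
  have sn: "(LINT x|lborel. sin (\<xi> \<bullet> x) * pdx \<alpha> \<psi> x) = - (\<xi> $ \<alpha>) * (LINT x|lborel. cos (\<xi> \<bullet> x) * \<psi> x)"
    using integral_by_parts_pdx[OF Ck_on_trig(2) C i(2)[OF p] i(2)[OF q]] i'(2)
    by (simp add: Ck_on_trig mult.assoc)
  have FIeq: "FI (cplx f) \<xi> = Complex (LINT x|lborel. cos (\<xi> \<bullet> x) * f x) (LINT x|lborel. sin (\<xi> \<bullet> x) * f x)" if f: "test_function f" for f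
  proof -
    note ii = integrable_cis_mult[OF test_function_integrable_complex(1)[OF f], of \<xi>]
    show ?thesis unfolding FI_def
      using integral_Re[OF ii] integral_Im[OF ii] by (simp add: complex_eq_iff)
  qed
  show ?thesis unfolding FIeq[OF p] FIeq[OF q] cs sn by (simp add: complex_eq_iff)
qed

lemma set_integrable_box_continuous:
  fixes f :: "real^3 \<Rightarrow> 'b::euclidean_space"
  assumes "continuous_on UNIV f" shows "set_integrable lborel (box a b) f"
proof -
  have "set_integrable lborel (cbox a b) f"
    unfolding set_integrable_def by (intro borel_integrable_compact continuous_on_subset[OF assms]) auto
  then show ?thesis by (rule set_integrable_subset) (auto simp: box_subset_cbox)
qed

lemma AE_eq_0_continuous:
  fixes f :: "real^3 \<Rightarrow> 'b::real_normed_vector"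
  assumes f: "continuous_on UNIV f" and ae: "AE x in lborel. f x = 0" shows "f x = 0"
proof (rule ccontr)
  assume "f x \<noteq> 0"
  have "open (f -` (- {0}))" by (rule open_vimage[OF _ f]) auto
  moreover have "f -` (- {0}) \<noteq> {}" using \<open>f x \<noteq> 0\<close> by auto
  moreover have "negligible (f -` (- {0}))"
  proof -
    have "f -` (- {0}) \<in> null_sets lborel"
      using ae \<open>open (f -` (- {0}))\<close> by (subst AE_iff_null_sets) auto
    then show ?thesis by (auto simp: negligible_iff_null_sets intro: null_sets_completionI)
  qed
  ultimately show False using open_not_negligible by blast
qed

text \<open>Square integrability of \<open>pdx \<alpha> u\<close> is part of the conclusion. The L^2
  function \<open>z\<close> with the expected transform exists by duality, and testing, with the
  derivative moved onto the test function, shows that it is \<open>(2 * pi) ^ 3\<close> times the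
  classical derivative.\<close>

lemma is_fourier_pdx:
  assumes ug: "is_fourier u g" and C1: "Ck_on (Suc 0) UNIV u"
    and xg: "square_integrable (\<lambda>\<xi>. complex_of_real (\<xi> $ \<alpha>) * g \<xi>)"
  shows "is_fourier (pdx \<alpha> u) (\<lambda>\<xi>. \<i> * (complex_of_real (\<xi> $ \<alpha>) * g \<xi>))"
proof -
  have u: "square_integrable u" and g: "square_integrable g" using ug unfolding is_fourier_iff by auto
  define c :: real where "c = (2 * pi) ^ 3"
  have c: "c > 0" unfolding c_def by simp
  let ?g = "\<lambda>\<xi>. \<i> * (complex_of_real (\<xi> $ \<alpha>) * g \<xi>)"
  have ig: "square_integrable ?g" by (rule square_integrable_cmult[OF xg])
  have cont: "continuous_on UNIV (pdx \<alpha> u)" "continuous_on UNIV u" using Ck_on_pdx[OF C1, of \<alpha>] Ck_on_continuous[OF C1] by auto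
  obtain z where z: "square_integrable z"
    and zm: "\<And>\<phi>. integrable lborel \<phi> \<Longrightarrow> square_integrable \<phi> \<Longrightarrow> (LINT x|lborel. z x * \<phi> x) = (LINT x|lborel. ?g x * FI \<phi> x)"
    using FI_multiplication_L2[OF ig] by blast
  have eq: "(LINT \<xi>|lborel. ?g \<xi> * FI (cplx \<psi>) \<xi>) = (2 * pi) ^ 3 * complex_of_real (LINT x|lborel. pdx \<alpha> u x * \<psi> x)" if p: "test_function \<psi>" for \<psi>
  proof -
    have "(LINT \<xi>|lborel. ?g \<xi> * FI (cplx \<psi>) \<xi>) = - (LINT \<xi>|lborel. g \<xi> * FI (cplx (pdx \<alpha> \<psi>)) \<xi>)"
      unfolding FI_pdx_test[OF p] by (simp flip: Bochner_Integration.integral_minus add: mult_ac)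
    also have "(LINT \<xi>|lborel. g \<xi> * FI (cplx (pdx \<alpha> \<psi>)) \<xi>) = (2 * pi) ^ 3 * complex_of_real (LINT x|lborel. u x * pdx \<alpha> \<psi> x)"
      using ug test_function_pdx[OF p, of \<alpha>] unfolding is_fourier_iff by blast
    also have "(LINT x|lborel. u x * pdx \<alpha> \<psi> x) = - (LINT x|lborel. pdx \<alpha> u x * \<psi> x)"
      by (intro integral_by_parts_pdx C1 test_function_Ck p integrable_continuous_test cont test_function_pdx)
    finally show ?thesis by simp
  qed
  have "AE x in lborel. z x - complex_of_real c * cplx (pdx \<alpha> u) x = 0"
  proof (rule AE_eq_0_if_test_integrals)
    note [measurable] = square_integrable_measurable[OF z] borel_measurable_continuous_onI[OF cont(1)]
    show "(\<lambda>x. z x - complex_of_real c * cplx (pdx \<alpha> u) x) \<in> borel_measurable borel" by measurable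
    show "set_integrable lborel (box a b) (\<lambda>x. z x - complex_of_real c * cplx (pdx \<alpha> u) x)" for a b
    proof (rule set_integral_diff)
      show "set_integrable lborel (box a b) z"
        unfolding set_integrable_def by (rule integrable_indicator_square_integrable[OF z]) (auto simp: bounded_box)
      show "set_integrable lborel (box a b) (\<lambda>x. complex_of_real c * cplx (pdx \<alpha> u) x)"
        by (rule set_integrable_box_continuous) (intro continuous_intros cont)
    qed
    fix \<psi> assume p: "test_function \<psi>"
    note psi = test_function_integrable_complex[OF p]
    have ip: "integrable lborel (\<lambda>x. complex_of_real (pdx \<alpha> u x * \<psi> x))"
      by (rule integrable_of_real[OF integrable_continuous_test[OF cont(1) p]])
    have "(LINT x|lborel. (z x - complex_of_real c * cplx (pdx \<alpha> u) x) * cplx \<psi> x) = (LINT x|lborel. z x * cplx \<psi> x - complex_of_real c * complex_of_real (pdx \<alpha> u x * \<psi> x))"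
      by (simp add: left_diff_distrib mult.assoc)
    also have "\<dots> = (LINT x|lborel. z x * cplx \<psi> x) - (LINT x|lborel. complex_of_real c * complex_of_real (pdx \<alpha> u x * \<psi> x))"
      using integrable_mult_square_integrable[OF z(1) psi(2)] ip by (intro Bochner_Integration.integral_diff) auto
    also have "(LINT x|lborel. complex_of_real c * complex_of_real (pdx \<alpha> u x * \<psi> x)) = complex_of_real c * complex_of_real (LINT x|lborel. pdx \<alpha> u x * \<psi> x)"
      by (simp only: integral_mult_right_zero integral_complex_of_real)
    also have "(LINT x|lborel. z x * cplx \<psi> x) = (2 * pi) ^ 3 * complex_of_real (LINT x|lborel. pdx \<alpha> u x * \<psi> x)"
      using zm[OF psi] eq[OF p] by simp
    finally show "(LINT x|lborel. (z x - complex_of_real c * cplx (pdx \<alpha> u) x) * cplx \<psi> x) = 0" by (simp add: c_def)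
  qed
  then have ae: "AE x in lborel. Re (z x) / c = pdx \<alpha> u x"
  proof eventually_elim
    case (elim x)
    then have "z x = complex_of_real (c * pdx \<alpha> u x)" by simp
    then show ?case using c by simp
  qed
  have zr: "square_integrable (\<lambda>x. Re (z x) / c)"
    using square_integrable_bounded_linear[OF z bounded_linear_Re] square_integrable_cmult[of "\<lambda>x. Re (z x)" "1 / c"] by simp
  have "square_integrable (pdx \<alpha> u)"
    by (rule square_integrable_cong_AE[OF zr borel_measurable_continuous_onI[OF cont(1)] ae])
  then show ?thesis using ig eq unfolding is_fourier_iff by blast
qed

text \<open>Both sides are tested; as \<open>g\<close> is integrable, the multiplication formula
  moves the transform onto the test function, where the definition of \<open>is_fourier\<close>
  applies.\<close>

lemma is_fourier_inversion_AE:
  assumes ug: "is_fourier u g" and g: "integrable lborel g"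
  shows "AE x in lborel. cplx u x = FI g x / (2 * pi) ^ 3"
proof -
  have u: "square_integrable u" using ug unfolding is_fourier_iff by auto
  define c :: real where "c = (2 * pi) ^ 3"
  have c: "c > 0" unfolding c_def by simp
  note [measurable] = square_integrable_measurable[OF u] FI_measurable[OF g]
  have cu: "square_integrable (\<lambda>x. complex_of_real c * cplx u x)" by (intro square_integrable_cmult square_integrable_of_real u)
  have "AE x in lborel. FI g x - complex_of_real c * cplx u x = 0"
  proof (rule AE_eq_0_if_test_integrals)
    show "(\<lambda>x. FI g x - complex_of_real c * cplx u x) \<in> borel_measurable borel" by measurable
    show "set_integrable lborel (box a b) (\<lambda>x. FI g x - complex_of_real c * cplx u x)" for a b
    proof (rule set_integral_diff)
      show "set_integrable lborel (box a b) (\<lambda>x. complex_of_real c * cplx u x)"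
        unfolding set_integrable_def by (rule integrable_indicator_square_integrable[OF cu]) (auto simp: bounded_box)
      show "set_integrable lborel (box a b) (FI g)"
        by (rule set_integrable_box_continuous[OF FI_continuous[OF g]])
    qed
    fix \<psi> assume p: "test_function \<psi>"
    note psi = test_function_integrable_complex[OF p]
    have i1: "integrable lborel (\<lambda>x. FI g x * cplx \<psi> x)"
    proof (rule Bochner_Integration.integrable_bound[OF integrable_mult_right[OF integrable_norm[OF psi(1)], of "LINT \<xi>|lborel. norm (g \<xi>)"]])
      show "AE x in lborel. norm (FI g x * cplx \<psi> x) \<le> norm ((LINT \<xi>|lborel. norm (g \<xi>)) * norm (cplx \<psi> x))"
        by (intro AE_I2) (auto simp: norm_mult abs_mult intro!: mult_right_mono norm_FI_le order_trans[OF norm_FI_le abs_ge_self])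
      show "(\<lambda>x. FI g x * cplx \<psi> x) \<in> borel_measurable lborel" using test_function_measurable[OF p] by simp
    qed
    have "(LINT x|lborel. (FI g x - complex_of_real c * cplx u x) * cplx \<psi> x) = (LINT x|lborel. FI g x * cplx \<psi> x) - (LINT x|lborel. (complex_of_real c * cplx u x) * cplx \<psi> x)"
      using i1 integrable_mult_square_integrable[OF cu psi(2)] by (simp add: left_diff_distrib)
    also have "(LINT x|lborel. (complex_of_real c * cplx u x) * cplx \<psi> x) = complex_of_real c * complex_of_real (LINT x|lborel. u x * \<psi> x)"
      by (simp flip: integral_complex_of_real add: mult.assoc)
    also have "(LINT x|lborel. FI g x * cplx \<psi> x) = (LINT x|lborel. g x * FI (cplx \<psi>) x)"
      by (rule FI_multiplication_formula[OF g psi(1)])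
    also have "\<dots> = (2 * pi) ^ 3 * complex_of_real (LINT x|lborel. u x * \<psi> x)"
      using ug p unfolding is_fourier_iff by blast
    finally show "(LINT x|lborel. (FI g x - complex_of_real c * cplx u x) * cplx \<psi> x) = 0" by (simp add: c_def)
  qed
  then show ?thesis
  proof eventually_elim
    case (elim x)
    then show ?case using c by (simp add: c_def)
  qed
qed

lemma is_fourier_inversion:
  assumes ug: "is_fourier u g" and g: "integrable lborel g" and u: "continuous_on UNIV u"
  shows "cplx u x = FI g x / (2 * pi) ^ 3"
proof -
  have "cplx u x - FI g x / (2 * pi) ^ 3 = 0"
  proof (rule AE_eq_0_continuous)
    show "continuous_on UNIV (\<lambda>x. cplx u x - FI g x / (2 * pi) ^ 3)"
      by (intro continuous_intros u FI_continuous[OF g]) simp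
    show "AE x in lborel. cplx u x - FI g x / (2 * pi) ^ 3 = 0"
      using is_fourier_inversion_AE[OF ug g] by simp
  qed
  then show ?thesis by simp
qed

section \<open>Sobolev spaces\<close>

text \<open>Comparison with \<open>(1 + |t|) powr (- 2 * q)\<close>, which has an explicit primitive
  on the half-line, by \<open>(1 + |t|)^2 \<le> 2 (1 + t^2)\<close>.\<close>

lemma integrable_inverse_square_powr:
  assumes q: "q > 1/2"
  shows "integrable lborel (\<lambda>t::real. (1 + t\<^sup>2) powr (- q))"
proof -
  define f where "f t = (1 + \<bar>t\<bar>) powr (- 2 * q)" for t :: real
  have [measurable]: "f \<in> borel_measurable borel" unfolding f_def by measurable
  define F where "F t = (1 + t) powr (1 - 2 * q) / (1 - 2 * q)" for t :: real
  have "(\<integral>\<^sup>+t. ennreal ((1 + t) powr (- 2 * q)) * indicator {0..} t \<partial>lborel) = 0 - F 0"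
  proof (rule nn_integral_FTC_atLeast)
    show "DERIV F t :> (1 + t) powr (- 2 * q)" if "0 \<le> t" for t
    proof -
      have "((\<lambda>t. 1 + t) has_real_derivative 1) (at t)" by (auto intro!: derivative_eq_intros)
      from DERIV_chain2[OF has_real_derivative_powr this, of "1 - 2 * q"] that
      have "((\<lambda>t. (1 + t) powr (1 - 2 * q)) has_real_derivative (1 - 2 * q) * (1 + t) powr (- 2 * q)) (at t)" by simp
      from DERIV_cdivide[OF this, of "1 - 2 * q"] show ?thesis unfolding F_def using q by simp
    qed
    have "((\<lambda>t. (1 + t) powr (1 - 2 * q)) \<longlongrightarrow> 0) at_top"
      using q by (intro tendsto_neg_powr filterlim_tendsto_add_at_top[OF tendsto_const] filterlim_ident) auto
    then have "((\<lambda>t. (1 + t) powr (1 - 2 * q) / (1 - 2 * q)) \<longlongrightarrow> 0 / (1 - 2 * q)) at_top"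
      using q by (intro tendsto_divide tendsto_const) auto
    then show "(F \<longlongrightarrow> 0) at_top" unfolding F_def by simp
  qed auto
  also have "(\<integral>\<^sup>+t. ennreal ((1 + t) powr (- 2 * q)) * indicator {0..} t \<partial>lborel) = (\<integral>\<^sup>+t. ennreal (norm (indicator {0..} t * f t)) \<partial>lborel)"
    by (intro nn_integral_cong) (auto simp: indicator_def f_def)
  finally have i1: "integrable lborel (\<lambda>t. indicator {0..} t * f t)"
    by (intro integrableI_bounded) auto
  have i2: "integrable lborel (\<lambda>t. indicator {0..} (- t) * f (- t))"
    using i1 lborel_integrable_reflect[of "\<lambda>t. indicator {0..} t * f t"] by simp
  have "integrable lborel (\<lambda>t. 2 powr q * (indicator {0..} t * f t + indicator {0..} (- t) * f (- t)))"
    by (intro integrable_mult_right Bochner_Integration.integrable_add i1 i2)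
  then show ?thesis
  proof (rule Bochner_Integration.integrable_bound)
    show "AE t in lborel. norm ((1 + t\<^sup>2) powr (- q)) \<le> norm (2 powr q * (indicator {0..} t * f t + indicator {0..} (- t) * f (- t)))"
    proof (rule AE_I2)
      fix t :: real
      have sq: "(1 + \<bar>t\<bar>)\<^sup>2 \<le> 2 * (1 + t\<^sup>2)" using sum_squares_bound[of 1 "\<bar>t\<bar>"] by (simp add: power2_sum)
      have pos: "0 < 1 + t\<^sup>2" by (simp add: add_pos_nonneg)
      have "(2 * (1 + t\<^sup>2)) powr (- q) \<le> ((1 + \<bar>t\<bar>)\<^sup>2) powr (- q)"
        using sq q by (intro powr_mono2') auto
      also have "((1 + \<bar>t\<bar>)\<^sup>2) powr (- q) = f t"
        unfolding f_def by (simp add: powr_powr flip: powr_numeral)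
      finally have "(2 * (1 + t\<^sup>2)) powr (- q) \<le> f t" .
      moreover have "(2 * (1 + t\<^sup>2)) powr (- q) = 2 powr (- q) * (1 + t\<^sup>2) powr (- q)" by (rule powr_mult)
      ultimately have "2 powr (- q) * (1 + t\<^sup>2) powr (- q) \<le> f t" by (simp only:)
      then have "2 powr q * (2 powr (- q) * (1 + t\<^sup>2) powr (- q)) \<le> 2 powr q * f t" by (rule mult_left_mono) simp
      moreover have "2 powr q * (2 powr (- q) * (1 + t\<^sup>2) powr (- q)) = (1 + t\<^sup>2) powr (- q)"
        by (simp add: powr_add[symmetric] flip: mult.assoc)
      ultimately have A: "(1 + t\<^sup>2) powr (- q) \<le> 2 powr q * f t" by (simp only:)
      have "f t \<le> indicator {0..} t * f t + indicator {0..} (- t) * f (- t)"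
        by (auto simp: f_def indicator_def)
      then have B: "2 powr q * f t \<le> 2 powr q * (indicator {0..} t * f t + indicator {0..} (- t) * f (- t))"
        by (intro mult_left_mono) auto
      show "norm ((1 + t\<^sup>2) powr (- q)) \<le> norm (2 powr q * (indicator {0..} t * f t + indicator {0..} (- t) * f (- t)))"
        using order_trans[OF order_trans[OF A B] abs_ge_self] by (simp only: real_norm_def abs_of_nonneg[OF powr_ge_zero])
    qed
  qed measurable
qed

text \<open>The exponent is shared equally among the three coordinates: the integrand is at most the
  product of one-dimensional ones with exponent \<open>r / 3\<close>, and \<open>r / 3 > 1/2\<close>
  is the condition for these.\<close>

lemma integrable_japanese_powr:
  assumes r: "r > 3/2"
  shows "integrable lborel (\<lambda>\<xi>::real^3. (1 + (norm \<xi>)\<^sup>2) powr (- r))"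
proof -
  have "integrable lborel (\<lambda>\<xi>::real^3. \<Prod>b\<in>Basis. (1 + (\<xi> \<bullet> b)\<^sup>2) powr (- (r / 3)))"
    by (rule lborel_integrable_prod_Basis) (rule integrable_inverse_square_powr, use r in simp)
  then show ?thesis
  proof (rule Bochner_Integration.integrable_bound)
    show "AE \<xi>::real^3 in lborel. norm ((1 + (norm \<xi>)\<^sup>2) powr (- r)) \<le> norm (\<Prod>b\<in>Basis. (1 + (\<xi> \<bullet> b)\<^sup>2) powr (- (r / 3)))"
    proof (rule AE_I2)
      fix \<xi> :: "real^3"
      have pos: "0 < 1 + (norm \<xi>)\<^sup>2" by (simp add: add_pos_nonneg)
      have "(1 + (norm \<xi>)\<^sup>2) powr (- r) = (\<Prod>b\<in>(Basis::(real^3) set). (1 + (norm \<xi>)\<^sup>2) powr (- (r / 3)))"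
        using pos by (simp add: powr_powr flip: powr_numeral)
      also have "\<dots> \<le> (\<Prod>b\<in>Basis. (1 + (\<xi> \<bullet> b)\<^sup>2) powr (- (r / 3)))"
      proof (rule prod_mono)
        fix b :: "real^3" assume b: "b \<in> Basis"
        have "\<bar>\<xi> \<bullet> b\<bar> \<le> norm \<xi>" by (rule Basis_le_norm[OF b])
        then have "(\<xi> \<bullet> b)\<^sup>2 \<le> (norm \<xi>)\<^sup>2" using abs_le_square_iff[of "\<xi> \<bullet> b" "norm \<xi>"] by simp
        then have "(1 + (norm \<xi>)\<^sup>2) powr (- (r / 3)) \<le> (1 + (\<xi> \<bullet> b)\<^sup>2) powr (- (r / 3))"
          using r by (intro powr_mono2') (auto simp: add_pos_nonneg)
        then show "0 \<le> (1 + (norm \<xi>)\<^sup>2) powr (- (r / 3)) \<and> (1 + (norm \<xi>)\<^sup>2) powr (- (r / 3)) \<le> (1 + (\<xi> \<bullet> b)\<^sup>2) powr (- (r / 3))" by simp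
      qed
      finally show "norm ((1 + (norm \<xi>)\<^sup>2) powr (- r)) \<le> norm (\<Prod>b\<in>Basis. (1 + (\<xi> \<bullet> b)\<^sup>2) powr (- (r / 3)))"
        by (simp add: prod_nonneg)
    qed
  qed measurable
qed

definition hw :: "real \<Rightarrow> real^3 \<Rightarrow> real" where "hw s \<xi> = (1 + (norm \<xi>)\<^sup>2) powr s"

lemma hw_measurable [measurable]: "hw s \<in> borel_measurable borel"
  unfolding hw_def by measurable

lemma hw_base: "0 < 1 + (norm (\<xi>::real^3))\<^sup>2" "1 \<le> 1 + (norm (\<xi>::real^3))\<^sup>2"
  by (simp_all add: add_pos_nonneg)

lemma hw_pos: "0 < hw s \<xi>"
  unfolding hw_def using hw_base(1)[of \<xi>] by simp

lemma hw_add: "hw (s + r) \<xi> = hw s \<xi> * hw r \<xi>"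
  unfolding hw_def by (rule powr_add)

lemma hw_ge_1: "0 \<le> s \<Longrightarrow> 1 \<le> hw s \<xi>"
  unfolding hw_def using hw_base(2)[of \<xi>] by (rule ge_one_powr_ge_zero)

lemma is_fourier_measurable: "is_fourier u g \<Longrightarrow> g \<in> borel_measurable borel" "is_fourier u g \<Longrightarrow> u \<in> borel_measurable borel"
  unfolding is_fourier_iff by (auto dest: square_integrable_measurable)

text \<open>Any function satisfying \<open>is_fourier\<close> may replace the selected one, so
  transforms of sums and derivatives can be written down explicitly.\<close>

lemma
  assumes ug: "is_fourier u g"
  shows in_H_iff: "in_H s u \<longleftrightarrow> integrable lborel (\<lambda>\<xi>. hw s \<xi> * (norm (g \<xi>))\<^sup>2)"
    and H_norm_power2: "(H_norm s u)\<^sup>2 = (LINT \<xi>|lborel. hw s \<xi> * (norm (g \<xi>))\<^sup>2) / (2 * pi) ^ 3"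
proof -
  have u: "square_integrable u" using ug unfolding is_fourier_iff by auto
  note f = is_fourier_fourier[OF u]
  note [measurable] = is_fourier_measurable[OF ug] is_fourier_measurable[OF f]
  have ae: "AE \<xi> in lborel. hw s \<xi> * (norm (fourier u \<xi>))\<^sup>2 = hw s \<xi> * (norm (g \<xi>))\<^sup>2"
    using is_fourier_unique[OF f ug] by eventually_elim simp
  have "integrable lborel (\<lambda>\<xi>. hw s \<xi> * (norm (fourier u \<xi>))\<^sup>2) \<longleftrightarrow> integrable lborel (\<lambda>\<xi>. hw s \<xi> * (norm (g \<xi>))\<^sup>2)"
    by (rule integrable_cong_AE[OF _ _ ae]) measurable
  then show "in_H s u \<longleftrightarrow> integrable lborel (\<lambda>\<xi>. hw s \<xi> * (norm (g \<xi>))\<^sup>2)"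
    unfolding in_H_def hw_def using u by simp
  have "(LINT \<xi>|lborel. hw s \<xi> * (norm (fourier u \<xi>))\<^sup>2) = (LINT \<xi>|lborel. hw s \<xi> * (norm (g \<xi>))\<^sup>2)"
    by (rule integral_cong_AE[OF _ _ ae]) measurable
  moreover have "0 \<le> (LINT \<xi>|lborel. hw s \<xi> * (norm (g \<xi>))\<^sup>2)"
    using hw_pos by (intro integral_nonneg_AE AE_I2) (simp add: less_imp_le)
  ultimately show "(H_norm s u)\<^sup>2 = (LINT \<xi>|lborel. hw s \<xi> * (norm (g \<xi>))\<^sup>2) / (2 * pi) ^ 3"
    unfolding H_norm_def hw_def by simp
qed

lemma in_H_fourier: "in_H s u \<Longrightarrow> is_fourier u (fourier u)"
  by (simp add: in_H_def is_fourier_fourier)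

lemma H_norm_nonneg: "0 \<le> H_norm s u"
proof -
  have "0 \<le> (LINT \<xi>|lborel. (1 + (norm \<xi>)\<^sup>2) powr s * (norm (fourier u \<xi>))\<^sup>2)" by (intro integral_nonneg_AE AE_I2) simp
  then show ?thesis unfolding H_norm_def by simp
qed

text \<open>The factor 2 stands in for the triangle inequality of the norm; it suffices for local
  bounds.\<close>

lemma
  assumes u: "in_H s u" and v: "in_H s v"
  shows in_H_lincomb: "in_H s (\<lambda>x. a * u x + b * v x)"
    and H_norm_lincomb_le: "(H_norm s (\<lambda>x. a * u x + b * v x))\<^sup>2 \<le> 2 * a\<^sup>2 * (H_norm s u)\<^sup>2 + 2 * b\<^sup>2 * (H_norm s v)\<^sup>2"
proof -
  note fu = in_H_fourier[OF u] and fv = in_H_fourier[OF v]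
  note [measurable] = is_fourier_measurable[OF fu] is_fourier_measurable[OF fv]
  note f = is_fourier_lincomb[OF fu fv, of a b]
  let ?g = "\<lambda>\<xi>. complex_of_real a * fourier u \<xi> + complex_of_real b * fourier v \<xi>"
  let ?b = "\<lambda>\<xi>. 2 * a\<^sup>2 * (hw s \<xi> * (norm (fourier u \<xi>))\<^sup>2) + 2 * b\<^sup>2 * (hw s \<xi> * (norm (fourier v \<xi>))\<^sup>2)"
  have iu: "integrable lborel (\<lambda>\<xi>. hw s \<xi> * (norm (fourier u \<xi>))\<^sup>2)" "integrable lborel (\<lambda>\<xi>. hw s \<xi> * (norm (fourier v \<xi>))\<^sup>2)"
    using u v in_H_iff[OF fu] in_H_iff[OF fv] by auto
  have i: "integrable lborel ?b" using iu by auto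
  have le: "hw s \<xi> * (norm (?g \<xi>))\<^sup>2 \<le> ?b \<xi>" for \<xi>
  proof -
    have "(norm (?g \<xi>))\<^sup>2 \<le> 2 * a\<^sup>2 * (norm (fourier u \<xi>))\<^sup>2 + 2 * b\<^sup>2 * (norm (fourier v \<xi>))\<^sup>2"
      using norm_add_power2_le[of "complex_of_real a * fourier u \<xi>" "complex_of_real b * fourier v \<xi>"]
      by (simp add: norm_mult power_mult_distrib mult.assoc)
    from mult_left_mono[OF this less_imp_le[OF hw_pos[of s \<xi>]]] show ?thesis by (simp add: algebra_simps)
  qed
  have ig: "integrable lborel (\<lambda>\<xi>. hw s \<xi> * (norm (?g \<xi>))\<^sup>2)"
  proof (rule Bochner_Integration.integrable_bound[OF i])
    show "AE \<xi> in lborel. norm (hw s \<xi> * (norm (?g \<xi>))\<^sup>2) \<le> norm (?b \<xi>)"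
    proof (rule AE_I2)
      fix \<xi>
      have "0 \<le> hw s \<xi> * (norm (?g \<xi>))\<^sup>2" using hw_pos[of s \<xi>] by simp
      then show "norm (hw s \<xi> * (norm (?g \<xi>))\<^sup>2) \<le> norm (?b \<xi>)" using le[of \<xi>] by simp
    qed
  qed measurable
  then show "in_H s (\<lambda>x. a * u x + b * v x)" by (simp add: in_H_iff[OF f])
  have "(LINT \<xi>|lborel. hw s \<xi> * (norm (?g \<xi>))\<^sup>2) \<le> (LINT \<xi>|lborel. ?b \<xi>)"
    by (rule integral_mono[OF ig i le])
  also have "\<dots> = 2 * a\<^sup>2 * (LINT \<xi>|lborel. hw s \<xi> * (norm (fourier u \<xi>))\<^sup>2) + 2 * b\<^sup>2 * (LINT \<xi>|lborel. hw s \<xi> * (norm (fourier v \<xi>))\<^sup>2)"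
    using iu by simp
  finally have "(LINT \<xi>|lborel. hw s \<xi> * (norm (?g \<xi>))\<^sup>2) / (2 * pi) ^ 3 \<le> (2 * a\<^sup>2 * (LINT \<xi>|lborel. hw s \<xi> * (norm (fourier u \<xi>))\<^sup>2) + 2 * b\<^sup>2 * (LINT \<xi>|lborel. hw s \<xi> * (norm (fourier v \<xi>))\<^sup>2)) / (2 * pi) ^ 3"
    by (rule divide_right_mono) simp
  then show "(H_norm s (\<lambda>x. a * u x + b * v x))\<^sup>2 \<le> 2 * a\<^sup>2 * (H_norm s u)\<^sup>2 + 2 * b\<^sup>2 * (H_norm s v)\<^sup>2"
    unfolding H_norm_power2[OF f] H_norm_power2[OF fu] H_norm_power2[OF fv] add_divide_distrib times_divide_eq_right .
qed

lemma in_H_diff: "in_H s u \<Longrightarrow> in_H s v \<Longrightarrow> in_H s (\<lambda>x. u x - v x)"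
  using in_H_lincomb[of s u v 1 "-1"] by simp

lemma in_H_quotient: "in_H s u \<Longrightarrow> in_H s v \<Longrightarrow> in_H s w \<Longrightarrow> in_H s (\<lambda>x. (u x - v x) / c - w x)"
  using in_H_lincomb[of s "\<lambda>x. u x - v x" w "1 / c" "-1"] in_H_diff[of s u v] by simp

lemma in_H_square_integrable: "in_H s u \<Longrightarrow> square_integrable u"
  by (simp add: in_H_def)

lemma L2_le_H_norm:
  assumes u: "in_H s u" and s: "0 \<le> s" shows "(LINT x|lborel. (u x)\<^sup>2) \<le> (H_norm s u)\<^sup>2"
proof -
  note fu = in_H_fourier[OF u]
  have "(LINT x|lborel. (u x)\<^sup>2) \<le> (LINT \<xi>|lborel. (norm (fourier u \<xi>))\<^sup>2) / (2 * pi) ^ 3"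
    by (rule is_fourier_norm_le[OF fu])
  also have "\<dots> \<le> (H_norm s u)\<^sup>2"
    unfolding H_norm_power2[OF fu]
  proof (intro divide_right_mono integral_mono)
    show "integrable lborel (\<lambda>\<xi>. (norm (fourier u \<xi>))\<^sup>2)"
      using fu by (auto simp: is_fourier_iff square_integrable_def)
    show "integrable lborel (\<lambda>\<xi>. hw s \<xi> * (norm (fourier u \<xi>))\<^sup>2)" using u in_H_iff[OF fu] by auto
    show "(norm (fourier u \<xi>))\<^sup>2 \<le> hw s \<xi> * (norm (fourier u \<xi>))\<^sup>2" for \<xi>
      using mult_right_mono[OF hw_ge_1[OF s], of "(norm (fourier u \<xi>))\<^sup>2" \<xi>] by simp
  qed auto
  finally show ?thesis .
qed

text \<open>The factor \<open>\<xi> $ \<alpha>\<close> is at most the square root of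
  \<open>hw 1 \<xi>\<close>, so a derivative costs one order of the weight; \<open>1 \<le> s\<close>
  keeps the new transform in L^2, as \<open>is_fourier_pdx\<close> demands.\<close>

lemma in_H_pdx:
  assumes u: "in_H s u" and s: "1 \<le> s" and C1: "Ck_on (Suc 0) UNIV u"
  shows "in_H (s - 1) (pdx \<alpha> u)" "H_norm (s - 1) (pdx \<alpha> u) \<le> H_norm s u"
proof -
  note fu = in_H_fourier[OF u]
  note [measurable] = is_fourier_measurable[OF fu]
  let ?k = "\<lambda>\<xi>. complex_of_real (\<xi> $ \<alpha>) * fourier u \<xi>"
  have i: "integrable lborel (\<lambda>\<xi>. hw s \<xi> * (norm (fourier u \<xi>))\<^sup>2)" using u in_H_iff[OF fu] by auto
  have nth: "(\<lambda>\<xi>::real^3. \<xi> $ \<alpha>) \<in> borel_measurable borel"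
    by (intro borel_measurable_continuous_onI continuous_intros)
  note [measurable] = nth
  have le: "hw (s - 1) \<xi> * (norm (?k \<xi>))\<^sup>2 \<le> hw s \<xi> * (norm (fourier u \<xi>))\<^sup>2" for \<xi>
  proof -
    have "(\<xi> $ \<alpha>)\<^sup>2 \<le> (norm \<xi>)\<^sup>2"
      using component_le_norm_cart[of \<xi> \<alpha>] abs_le_square_iff[of "\<xi> $ \<alpha>" "norm \<xi>"] by simp
    then have "(\<xi> $ \<alpha>)\<^sup>2 \<le> hw 1 \<xi>" unfolding hw_def by simp
    then have "hw (s - 1) \<xi> * (\<xi> $ \<alpha>)\<^sup>2 \<le> hw (s - 1) \<xi> * hw 1 \<xi>"
      using hw_pos[of "s - 1" \<xi>] by (intro mult_left_mono) auto
    also have "\<dots> = hw s \<xi>" using hw_add[of "s - 1" 1 \<xi>] by simp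
    finally have "hw (s - 1) \<xi> * (\<xi> $ \<alpha>)\<^sup>2 * (norm (fourier u \<xi>))\<^sup>2 \<le> hw s \<xi> * (norm (fourier u \<xi>))\<^sup>2"
      by (intro mult_right_mono) auto
    then show ?thesis by (simp add: norm_mult power_mult_distrib mult.assoc)
  qed
  have ik: "integrable lborel (\<lambda>\<xi>. hw (s - 1) \<xi> * (norm (?k \<xi>))\<^sup>2)"
  proof (rule Bochner_Integration.integrable_bound[OF i])
    show "AE \<xi> in lborel. norm (hw (s - 1) \<xi> * (norm (?k \<xi>))\<^sup>2) \<le> norm (hw s \<xi> * (norm (fourier u \<xi>))\<^sup>2)"
    proof (rule AE_I2)
      fix \<xi>
      have "0 \<le> hw (s - 1) \<xi> * (norm (?k \<xi>))\<^sup>2" using hw_pos[of "s - 1" \<xi>] by simp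
      then show "norm (hw (s - 1) \<xi> * (norm (?k \<xi>))\<^sup>2) \<le> norm (hw s \<xi> * (norm (fourier u \<xi>))\<^sup>2)" using le[of \<xi>] by simp
    qed
  qed measurable
  have "integrable lborel (\<lambda>\<xi>. (norm (?k \<xi>))\<^sup>2)"
  proof (rule Bochner_Integration.integrable_bound[OF ik])
    show "AE \<xi> in lborel. norm ((norm (?k \<xi>))\<^sup>2) \<le> norm (hw (s - 1) \<xi> * (norm (?k \<xi>))\<^sup>2)"
    proof (rule AE_I2)
      fix \<xi>
      have "1 * (norm (?k \<xi>))\<^sup>2 \<le> hw (s - 1) \<xi> * (norm (?k \<xi>))\<^sup>2"
        using s by (intro mult_right_mono hw_ge_1) auto
      then show "norm ((norm (?k \<xi>))\<^sup>2) \<le> norm (hw (s - 1) \<xi> * (norm (?k \<xi>))\<^sup>2)"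
        using hw_pos[of "s - 1" \<xi>] by (simp add: abs_mult del: norm_mult)
    qed
  qed measurable
  then have sk: "square_integrable ?k" by (simp add: square_integrable_def)
  note f = is_fourier_pdx[OF fu C1 sk]
  have "norm (\<i> * ?k \<xi>) = norm (?k \<xi>)" for \<xi> by (simp add: norm_mult)
  note nk = this
  show "in_H (s - 1) (pdx \<alpha> u)" unfolding in_H_iff[OF f] nk by (rule ik)
  have "(H_norm (s - 1) (pdx \<alpha> u))\<^sup>2 \<le> (H_norm s u)\<^sup>2"
    unfolding H_norm_power2[OF f] H_norm_power2[OF fu] nk by (intro divide_right_mono integral_mono ik i le) auto
  then show "H_norm (s - 1) (pdx \<alpha> u) \<le> H_norm s u" using H_norm_nonneg power2_le_imp_le by blast
qed

section \<open>Sobolev embedding and pointwise representatives\<close>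

text \<open>Cauchy-Schwarz for the product of \<open>norm \<xi> ^ p * hw (- s / 2) \<xi>\<close> and
  \<open>hw (s / 2) \<xi> * norm (g \<xi>)\<close>. The square of the first is at most
  \<open>hw (real p - s)\<close>, which is integrable exactly in the range assumed for
  \<open>s\<close>.\<close>

lemma
  assumes ug: "is_fourier u g" and u: "in_H s u" and s: "s > 3/2 + real p"
  shows in_H_fourier_moment: "integrable lborel (\<lambda>\<xi>. norm \<xi> ^ p * norm (g \<xi>))"
    and in_H_fourier_moment_le: "(LINT \<xi>|lborel. norm \<xi> ^ p * norm (g \<xi>)) \<le> sqrt (LINT \<xi>|lborel. hw (real p - s) \<xi>) * (sqrt ((2 * pi) ^ 3) * H_norm s u)"
proof -
  note [measurable] = is_fourier_measurable[OF ug]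
  let ?A = "\<lambda>\<xi>. norm \<xi> ^ p * hw (- s / 2) \<xi>" and ?B = "\<lambda>\<xi>. hw (s / 2) \<xi> * norm (g \<xi>)"
  have B2: "(?B \<xi>)\<^sup>2 = hw s \<xi> * (norm (g \<xi>))\<^sup>2" for \<xi>
    using hw_add[of "s / 2" "s / 2" \<xi>] by (simp add: power_mult_distrib power2_eq_square)
  have A2: "(?A \<xi>)\<^sup>2 \<le> hw (real p - s) \<xi>" for \<xi>
  proof -
    have "(norm \<xi> ^ p)\<^sup>2 = ((norm \<xi>)\<^sup>2) ^ p" by (simp add: power_mult[symmetric] mult.commute)
    also have "\<dots> \<le> (1 + (norm \<xi>)\<^sup>2) ^ p" by (intro power_mono) auto
    also have "\<dots> = hw (real p) \<xi>" unfolding hw_def using hw_base(1)[of \<xi>] by (simp add: powr_realpow)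
    finally have "(norm \<xi> ^ p)\<^sup>2 * hw (- s) \<xi> \<le> hw (real p) \<xi> * hw (- s) \<xi>"
      using hw_pos[of "- s" \<xi>] by (intro mult_right_mono) auto
    moreover have "(hw (- s / 2) \<xi>)\<^sup>2 = hw (- s) \<xi>"
      using hw_add[of "- s / 2" "- s / 2" \<xi>] by (simp add: power2_eq_square)
    ultimately show ?thesis using hw_add[of "real p" "- s" \<xi>] by (simp add: power_mult_distrib)
  qed
  have iw: "integrable lborel (hw (real p - s))"
    unfolding hw_def using integrable_japanese_powr[of "s - real p"] s by simp
  have iA: "integrable lborel (\<lambda>\<xi>. (?A \<xi>)\<^sup>2)"
    by (rule Bochner_Integration.integrable_bound[OF iw]) (use A2 hw_pos[of "real p - s"] in \<open>auto intro: order_trans[OF _ abs_ge_self]\<close>)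
  have iB: "integrable lborel (\<lambda>\<xi>. (?B \<xi>)\<^sup>2)" unfolding B2 using u in_H_iff[OF ug] by simp
  have AB: "?A \<xi> * ?B \<xi> = norm \<xi> ^ p * norm (g \<xi>)" for \<xi>
    using hw_add[of "- s / 2" "s / 2" \<xi>] hw_base(1)[of \<xi>] by (simp add: hw_def algebra_simps)
  have "integrable lborel (\<lambda>\<xi>. ?A \<xi> * ?B \<xi>)" by (rule integrable_mult_L2[OF _ _ iA iB]) measurable
  then show "integrable lborel (\<lambda>\<xi>. norm \<xi> ^ p * norm (g \<xi>))" by (simp only: AB)
  have "(LINT \<xi>|lborel. norm \<xi> ^ p * norm (g \<xi>)) = (LINT \<xi>|lborel. \<bar>?A \<xi> * ?B \<xi>\<bar>)"
    by (intro Bochner_Integration.integral_cong refl) (simp only: AB, simp)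
  also have "\<dots> \<le> sqrt (LINT \<xi>|lborel. (?A \<xi>)\<^sup>2) * sqrt (LINT \<xi>|lborel. (?B \<xi>)\<^sup>2)"
    by (rule Cauchy_Schwarz_integral_abs[OF _ _ iA iB]) measurable
  also have "sqrt (LINT \<xi>|lborel. (?B \<xi>)\<^sup>2) = sqrt ((2 * pi) ^ 3) * H_norm s u"
  proof -
    have "(LINT \<xi>|lborel. (?B \<xi>)\<^sup>2) = (2 * pi) ^ 3 * (H_norm s u)\<^sup>2" unfolding B2 H_norm_power2[OF ug] by simp
    then show ?thesis by (simp add: real_sqrt_mult H_norm_nonneg)
  qed
  also have "sqrt (LINT \<xi>|lborel. (?A \<xi>)\<^sup>2) * (sqrt ((2 * pi) ^ 3) * H_norm s u) \<le> sqrt (LINT \<xi>|lborel. hw (real p - s) \<xi>) * (sqrt ((2 * pi) ^ 3) * H_norm s u)"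
    by (intro mult_right_mono real_sqrt_le_mono integral_mono iA iw A2 mult_nonneg_nonneg H_norm_nonneg) auto
  finally show "(LINT \<xi>|lborel. norm \<xi> ^ p * norm (g \<xi>)) \<le> sqrt (LINT \<xi>|lborel. hw (real p - s) \<xi>) * (sqrt ((2 * pi) ^ 3) * H_norm s u)" .
qed

text \<open>The moments of the transform up to order \<open>k\<close> are integrable, so the
  inversion formula exhibits a representative of class C^k; a continuous \<open>u\<close> coincides
  with it everywhere.\<close>

lemma Sobolev_embedding:
  assumes u: "in_H s u" and s: "s > 3/2 + real k"
  shows "\<exists>v. Ck_on k UNIV v \<and> (AE x in lborel. u x = v x)"
    and "continuous_on UNIV u \<Longrightarrow> Ck_on k UNIV u"
proof -
  note fu = in_H_fourier[OF u]
  note [measurable] = is_fourier_measurable[OF fu]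
  have mom: "integrable lborel (\<lambda>\<xi>. norm \<xi> ^ m * norm (fourier u \<xi>))" if "m \<le> k" for m
    using s that by (intro in_H_fourier_moment[OF fu u]) auto
  have g: "integrable lborel (fourier u)" using mom[of 0] by (simp add: integrable_norm_iff)
  let ?v = "\<lambda>x. Re (FI (fourier u) x / (2 * pi) ^ 3)"
  have "bounded_linear (\<lambda>z::complex. Re (z / (2 * pi) ^ 3))"
    by (intro bounded_linear_compose[OF bounded_linear_Re] bounded_linear_divide)
  from Ck_on_bounded_linear[OF this FI_Ck_on[OF _ mom]] have C: "Ck_on k UNIV ?v" by simp
  moreover have "AE x in lborel. u x = ?v x"
    using is_fourier_inversion_AE[OF fu g] by eventually_elim (metis Re_complex_of_real)
  ultimately show "\<exists>v. Ck_on k UNIV v \<and> (AE x in lborel. u x = v x)" by blast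
  assume c: "continuous_on UNIV u"
  have uv: "u x = ?v x" for x using is_fourier_inversion[OF fu g c, of x] by (metis Re_complex_of_real)
  show "Ck_on k UNIV u" by (rule Ck_on_cong[OF C]) (simp only: uv)
qed

lemma Sobolev_sup_bound:
  assumes s: "s > 3/2"
  obtains C where "C \<ge> 0" "\<And>u x. in_H s u \<Longrightarrow> continuous_on UNIV u \<Longrightarrow> \<bar>u x\<bar> \<le> C * H_norm s u"
proof -
  define C where "C = sqrt (LINT \<xi>|lborel. hw (- s) \<xi>) * sqrt ((2 * pi) ^ 3) / (2 * pi) ^ 3"
  have "0 \<le> (LINT \<xi>|lborel. hw (- s) \<xi>)" using hw_pos by (intro integral_nonneg_AE AE_I2) (simp add: less_imp_le)
  then have "C \<ge> 0" unfolding C_def by simp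
  moreover have "\<bar>u x\<bar> \<le> C * H_norm s u" if u: "in_H s u" and c: "continuous_on UNIV u" for u x
  proof -
    note fu = in_H_fourier[OF u]
    note [measurable] = is_fourier_measurable[OF fu]
    have g: "integrable lborel (fourier u)"
      using in_H_fourier_moment[OF fu u, of 0] s by (simp add: integrable_norm_iff)
    have "\<bar>u x\<bar> = norm (complex_of_real (u x))" by simp
    also have "\<dots> = norm (FI (fourier u) x) / (2 * pi) ^ 3"
      unfolding is_fourier_inversion[OF fu g c] by (simp add: norm_divide norm_mult norm_power)
    also have "\<dots> \<le> (LINT \<xi>|lborel. norm (fourier u \<xi>)) / (2 * pi) ^ 3"
      by (intro divide_right_mono norm_FI_le) auto
    also have "\<dots> \<le> (sqrt (LINT \<xi>|lborel. hw (- s) \<xi>) * (sqrt ((2 * pi) ^ 3) * H_norm s u)) / (2 * pi) ^ 3"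
      using in_H_fourier_moment_le[OF fu u, of 0] s by (intro divide_right_mono) auto
    finally show ?thesis by (simp add: C_def mult_ac)
  qed
  ultimately show thesis using that by blast
qed

lemma in_H_cong_AE:
  assumes "in_H s u" "v \<in> borel_measurable borel" "AE x in lborel. u x = v x"
  shows "in_H s v" "H_norm s v = H_norm s u"
proof -
  have u: "square_integrable u" using assms by (simp add: in_H_def)
  have "fourier u = fourier v" by (rule fourier_cong_AE[OF u assms(2,3)])
  then show "in_H s v" "H_norm s v = H_norm s u"
    using square_integrable_cong_AE[OF u assms(2,3)] assms(1) by (simp_all add: in_H_def H_norm_def)
qed

lemma eventually_at_within_mem: "\<forall>\<^sub>F \<tau> in at t within A. \<tau> \<in> A"
  by (simp add: eventually_at_filter)

text \<open>The quadratic inequality with factor 2 gives bounds near each time rather than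
  continuity of the norm; bisection of the interval glues them together.\<close>

lemma C0_H_bounded:
  assumes C0: "C0_H s T u" and T: "T \<ge> 0"
  obtains K where "\<And>t. t \<in> {0..T} \<Longrightarrow> H_norm s (u t) \<le> K"
proof -
  define P where "P c d \<longleftrightarrow> (\<exists>K. \<forall>t\<in>{0..T}. c \<le> t \<and> t \<le> d \<longrightarrow> H_norm s (u t) \<le> K)" for c d
  have "P 0 T"
  proof (rule Bolzano[OF T])
    fix a b c assume "P a b" "P b c"
    then obtain K L where "\<forall>t\<in>{0..T}. a \<le> t \<and> t \<le> b \<longrightarrow> H_norm s (u t) \<le> K"
      "\<forall>t\<in>{0..T}. b \<le> t \<and> t \<le> c \<longrightarrow> H_norm s (u t) \<le> L" unfolding P_def by auto
    then have "\<forall>t\<in>{0..T}. a \<le> t \<and> t \<le> c \<longrightarrow> H_norm s (u t) \<le> max K L"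
      by (metis le_max_iff_disj linorder_le_cases)
    then show "P a c" unfolding P_def by blast
  next
    fix x assume "0 \<le> x" "x \<le> T"
    then have x: "x \<in> {0..T}" by simp
    have "((\<lambda>\<tau>. H_norm s (\<lambda>y. u \<tau> y - u x y)) \<longlongrightarrow> 0) (at x within {0..T})" and xH: "in_H s (u x)"
      using C0 x unfolding C0_H_def by auto
    then have "\<forall>\<^sub>F \<tau> in at x within {0..T}. H_norm s (\<lambda>y. u \<tau> y - u x y) < 1"
      by (intro order_tendstoD(2)) auto
    then obtain d where d: "d > 0" "\<And>\<tau>. \<tau> \<in> {0..T} \<Longrightarrow> \<tau> \<noteq> x \<Longrightarrow> dist \<tau> x < d \<Longrightarrow> H_norm s (\<lambda>y. u \<tau> y - u x y) < 1"
      unfolding eventually_at by auto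
    define K where "K = sqrt (2 + 2 * (H_norm s (u x))\<^sup>2)"
    have "H_norm s (u \<tau>) \<le> K" if t: "\<tau> \<in> {0..T}" "dist \<tau> x < d" for \<tau>
    proof -
      have "(H_norm s (u \<tau>))\<^sup>2 \<le> 2 + 2 * (H_norm s (u x))\<^sup>2"
      proof (cases "\<tau> = x")
        case False
        have tH: "in_H s (u \<tau>)" using C0 t unfolding C0_H_def by auto
        have "(H_norm s (\<lambda>y. u \<tau> y - u x y))\<^sup>2 \<le> 1\<^sup>2"
          using d(2)[OF t(1) False t(2)] by (intro power_mono H_norm_nonneg) auto
        moreover have "(H_norm s (\<lambda>y. 1 * (u \<tau> y - u x y) + 1 * u x y))\<^sup>2 \<le> 2 * 1\<^sup>2 * (H_norm s (\<lambda>y. u \<tau> y - u x y))\<^sup>2 + 2 * 1\<^sup>2 * (H_norm s (u x))\<^sup>2"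
          by (intro H_norm_lincomb_le in_H_diff tH xH)
        ultimately show ?thesis by simp
      qed simp
      then show ?thesis unfolding K_def by (intro real_le_rsqrt)
    qed
    then have "P a b" if "a \<le> x" "x \<le> b" "b - a < d" for a b
      unfolding P_def using that by (intro exI[of _ K]) (auto simp: dist_real_def)
    then show "\<exists>d>0. \<forall>a b. a \<le> x \<and> x \<le> b \<and> b - a < d \<longrightarrow> P a b" using d(1) by blast
  qed
  then obtain K where "\<forall>t\<in>{0..T}. 0 \<le> t \<and> t \<le> T \<longrightarrow> H_norm s (u t) \<le> K" unfolding P_def by blast
  then show thesis by (intro that[of K]) simp
qed

text \<open>The strong derivative is given only as an element of the Sobolev space. It is replaced
  by its representative of class C^1, and the sup bound then turns convergence of the quotients in
  norm into convergence at every point.\<close>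

lemma Ck_H_1_pointwise:
  assumes C1: "Ck_H 1 s T u" and s: "s > 3/2 + 1" and T: "T > 0"
    and c: "\<And>t. t \<in> {0..T} \<Longrightarrow> continuous_on UNIV (u t)"
  obtains u' where "\<And>t. t \<in> {0..T} \<Longrightarrow> in_H s (u' t)" "\<And>t. t \<in> {0..T} \<Longrightarrow> Ck_on (Suc 0) UNIV (u' t)"
    "\<And>t x. t \<in> {0..T} \<Longrightarrow> ((\<lambda>\<tau>. u \<tau> x) has_vector_derivative u' t x) (at t within {0..T})"
    "\<And>t. t \<in> {0..T} \<Longrightarrow> ((\<lambda>\<tau>. H_norm s (\<lambda>x. (u \<tau> x - u t x) / (\<tau> - t) - u' t x)) \<longlongrightarrow> 0) (at t within {0..T})"
proof -
  obtain v where v0: "Ck_H 0 s T v"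
    and lim': "\<forall>t\<in>{0..T}. ((\<lambda>\<tau>. H_norm s (\<lambda>x. (u \<tau> x - u t x) / (\<tau> - t) - v t x)) \<longlongrightarrow> 0) (at t within {0..T})"
    and u0: "C0_H s T u"
    using C1 unfolding One_nat_def Ck_H.simps(2) by blast
  note lim = bspec[OF lim']
  have u: "in_H s (u t)" if "t \<in> {0..T}" for t using u0 that unfolding C0_H_def by blast
  have v: "in_H s (v t)" if "t \<in> {0..T}" for t using v0 that unfolding Ck_H.simps(1) C0_H_def by blast
  have "\<forall>t. \<exists>w. t \<in> {0..T} \<longrightarrow> Ck_on (Suc 0) UNIV w \<and> (AE x in lborel. v t x = w x)"
    using Sobolev_embedding(1)[OF v, of _ "Suc 0"] s by (metis of_nat_1 One_nat_def)
  then obtain w where w: "\<And>t. t \<in> {0..T} \<Longrightarrow> Ck_on (Suc 0) UNIV (w t)" "\<And>t. t \<in> {0..T} \<Longrightarrow> AE x in lborel. v t x = w t x"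
    by metis
  have wc: "continuous_on UNIV (w t)" if "t \<in> {0..T}" for t by (rule Ck_on_continuous[OF w(1)[OF that]])
  have wH: "in_H s (w t)" if "t \<in> {0..T}" for t
    by (rule in_H_cong_AE(1)[OF v[OF that] borel_measurable_continuous_onI[OF wc[OF that]] w(2)[OF that]])
  have limw: "((\<lambda>\<tau>. H_norm s (\<lambda>x. (u \<tau> x - u t x) / (\<tau> - t) - w t x)) \<longlongrightarrow> 0) (at t within {0..T})" if t: "t \<in> {0..T}" for t
  proof (rule Lim_transform_eventually[OF lim[OF t]])
    show "\<forall>\<^sub>F \<tau> in at t within {0..T}. H_norm s (\<lambda>x. (u \<tau> x - u t x) / (\<tau> - t) - v t x) = H_norm s (\<lambda>x. (u \<tau> x - u t x) / (\<tau> - t) - w t x)"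
      using eventually_at_within_mem
    proof eventually_elim
      case (elim \<tau>)
      have i: "in_H s (\<lambda>x. (u \<tau> x - u t x) / (\<tau> - t) - v t x)" "in_H s (\<lambda>x. (u \<tau> x - u t x) / (\<tau> - t) - w t x)"
        by (intro in_H_quotient u v wH elim t)+
      have "AE x in lborel. (u \<tau> x - u t x) / (\<tau> - t) - v t x = (u \<tau> x - u t x) / (\<tau> - t) - w t x"
        using w(2)[OF t] by eventually_elim simp
      from in_H_cong_AE(2)[OF i(1) square_integrable_measurable[OF in_H_square_integrable[OF i(2)]] this] show ?case by simp
    qed
  qed
  obtain C where C: "C \<ge> 0" "\<And>u x. in_H s u \<Longrightarrow> continuous_on UNIV u \<Longrightarrow> \<bar>u x\<bar> \<le> C * H_norm s u"
    using Sobolev_sup_bound[of s] s by auto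
  have "((\<lambda>\<tau>. u \<tau> x) has_vector_derivative w t x) (at t within {0..T})" if t: "t \<in> {0..T}" for t x
    unfolding has_real_derivative_iff_has_vector_derivative[symmetric] has_field_derivative_iff
  proof (rule LIM_zero_cancel, rule Lim_null_comparison)
    show "((\<lambda>\<tau>. C * H_norm s (\<lambda>x. (u \<tau> x - u t x) / (\<tau> - t) - w t x)) \<longlongrightarrow> 0) (at t within {0..T})"
      using tendsto_mult_left[OF limw[OF t], of C] by simp
    show "\<forall>\<^sub>F \<tau> in at t within {0..T}. norm ((u \<tau> x - u t x) / (\<tau> - t) - w t x) \<le> C * H_norm s (\<lambda>x. (u \<tau> x - u t x) / (\<tau> - t) - w t x)"
      using eventually_at_within_mem
    proof eventually_elim
      case (elim \<tau>)
      have "continuous_on UNIV (\<lambda>x. (u \<tau> x - u t x) * inverse (\<tau> - t) - w t x)" by (intro continuous_intros c wc elim t)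
      then show ?case
        using C(2)[OF in_H_quotient[OF u[OF elim] u[OF t] wH[OF t]], of "\<tau> - t" x] by (simp add: divide_inverse)
    qed
  qed
  then show thesis using that wH w(1) limw by blast
qed

section \<open>Strong time derivatives\<close>

lemma approach_seq:
  fixes t T :: real
  assumes "T > 0" "t \<in> {0..T}"
  obtains X :: "nat \<Rightarrow> real" where "\<And>n. X n \<in> {0..T} - {t}" "X \<longlonglongrightarrow> t"
proof -
  \<comment> \<open>An endpoint different from \<open>t\<close>; convex combinations of
    \<open>t\<close> with it stay in the interval and avoid \<open>t\<close>.\<close>
  define e where "e = (if t = 0 then T else 0)"
  have e: "e \<in> {0..T}" "e \<noteq> t" using assms by (auto simp: e_def)
  define X where "X n = t + (1 / real (Suc n)) * (e - t)" for n
  have "X \<longlonglongrightarrow> t + 0 * (e - t)" unfolding X_def by (intro tendsto_intros LIMSEQ_Suc[OF lim_1_over_n])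
  then have lim: "X \<longlonglongrightarrow> t" by simp
  have "X n \<in> {0..T} - {t}" for n
  proof -
    define r where "r = 1 / real (Suc n)"
    have r: "0 < r" "r \<le> 1" unfolding r_def by auto
    have "X n = (1 - r) * t + r * e" unfolding X_def r_def[symmetric] by (simp add: algebra_simps)
    moreover have "0 \<le> (1 - r) * t + r * e" using r e assms by (intro add_nonneg_nonneg mult_nonneg_nonneg) auto
    moreover have "(1 - r) * t + r * e \<le> (1 - r) * T + r * T"
      using r e assms by (intro add_mono mult_left_mono) auto
    moreover have "X n \<noteq> t" unfolding X_def r_def[symmetric] using r e by simp
    ultimately show ?thesis by (auto simp: algebra_simps)
  qed
  then show thesis using lim by (rule that)
qed

lemma at_within_Icc_nontrivial: "T > 0 \<Longrightarrow> t \<in> {0..T} \<Longrightarrow> at t within {0..T::real} \<noteq> bot"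
  by (metis approach_seq islimpt_sequential trivial_limit_within)

text \<open>Fatou's lemma along a sequence of times. This is the bridge between strong and classical
  derivatives: differences of the two are limits in both senses.\<close>

lemma L2_limit_pointwise_AE:
  fixes f :: "real \<Rightarrow> real^3 \<Rightarrow> real"
  assumes T: "T > 0" "t \<in> {0..T}" and f: "\<And>\<tau>. \<tau> \<in> {0..T} \<Longrightarrow> square_integrable (f \<tau>)"
    and lim: "((\<lambda>\<tau>. LINT x|lborel. (f \<tau> x)\<^sup>2) \<longlongrightarrow> 0) (at t within {0..T})"
    and pw: "\<And>x. ((\<lambda>\<tau>. f \<tau> x) \<longlongrightarrow> h x) (at t within {0..T})"
  shows "AE x in lborel. h x = 0"
proof -
  obtain X where X: "\<And>n. X n \<in> {0..T} - {t}" "X \<longlonglongrightarrow> t" using approach_seq[OF T] by blast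
  have XF: "filterlim X (at t within {0..T}) sequentially"
    using X by (auto simp: filterlim_at intro: always_eventually)
  have sX: "square_integrable (f (X n))" for n using X f by auto
  note [measurable] = square_integrable_measurable[OF sX]
  have limX: "(\<lambda>n. f (X n) x) \<longlonglongrightarrow> h x" for x by (rule filterlim_compose[OF pw XF])
  have hm[measurable]: "h \<in> borel_measurable borel"
    by (rule borel_measurable_LIMSEQ_metric[of "\<lambda>n. f (X n)"]) (use limX in auto)
  have le: "nrm2 (\<lambda>x. h x - 0) \<le> ennreal B" if "B > 0" for B
  proof (rule nrm2_le_of_tendsto[where g="\<lambda>n. f (X n)"])
    have "(\<lambda>n. LINT x|lborel. (f (X n) x)\<^sup>2) \<longlonglongrightarrow> 0" by (rule filterlim_compose[OF lim XF])
    then have "eventually (\<lambda>n. (LINT x|lborel. (f (X n) x)\<^sup>2) < B) sequentially" using that by (rule order_tendstoD)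
    then show "\<forall>\<^sub>F n in sequentially. nrm2 (\<lambda>x. f (X n) x - 0) \<le> ennreal B"
      by eventually_elim (simp add: nrm2_eq_integral[OF sX] ennreal_leI)
  qed (use limX in auto)
  have "nrm2 h \<le> 0"
  proof (rule ennreal_le_epsilon)
    fix e :: real assume "0 < e"
    then show "nrm2 h \<le> 0 + ennreal e" using le[of e] by simp
  qed
  then have "nrm2 h = 0" by simp
  then have "AE x in lborel. ennreal ((norm (h x))\<^sup>2) = 0"
    unfolding nrm2_def by (rule nn_integral_0_iff_AE[THEN iffD1, rotated]) measurable
  then show ?thesis by eventually_elim simp
qed

lemma C0_H_cong:
  assumes u: "C0_H s T u" and ae: "\<And>t. t \<in> {0..T} \<Longrightarrow> AE x in lborel. u t x = v t x"
    and m: "\<And>t. t \<in> {0..T} \<Longrightarrow> v t \<in> borel_measurable borel"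
  shows "C0_H s T v"
  unfolding C0_H_def
proof (intro ballI conjI)
  fix t assume t: "t \<in> {0..T}"
  have uH: "in_H s (u t)" if "t \<in> {0..T}" for t using u that unfolding C0_H_def by blast
  have vH: "in_H s (v t)" if "t \<in> {0..T}" for t by (rule in_H_cong_AE(1)[OF uH m ae]) (use that in auto)
  show "in_H s (v t)" by (rule vH[OF t])
  have lim: "((\<lambda>\<tau>. H_norm s (\<lambda>x. u \<tau> x - u t x)) \<longlongrightarrow> 0) (at t within {0..T})" using u t unfolding C0_H_def by blast
  show "((\<lambda>\<tau>. H_norm s (\<lambda>x. v \<tau> x - v t x)) \<longlongrightarrow> 0) (at t within {0..T})"
  proof (rule Lim_transform_eventually[OF lim])
    show "\<forall>\<^sub>F \<tau> in at t within {0..T}. H_norm s (\<lambda>x. u \<tau> x - u t x) = H_norm s (\<lambda>x. v \<tau> x - v t x)"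
      using eventually_at_within_mem
    proof eventually_elim
      case (elim \<tau>)
      have "AE x in lborel. u \<tau> x - u t x = v \<tau> x - v t x" using ae[OF t] ae[OF elim] by eventually_elim simp
      from in_H_cong_AE(2)[OF in_H_diff[OF uH[OF elim] uH[OF t]] square_integrable_measurable[OF in_H_square_integrable[OF in_H_diff[OF vH[OF elim] vH[OF t]]]] this]
      show ?case by simp
    qed
  qed
qed

lemma H_quotient_lim_cong:
  assumes t: "t \<in> {0..T}"
    and lim: "((\<lambda>\<tau>. H_norm s (\<lambda>x. (u \<tau> x - u t x) / (\<tau> - t) - p x)) \<longlongrightarrow> 0) (at t within {0..T})"
    and uH: "\<And>t. t \<in> {0..T} \<Longrightarrow> in_H s (u t)" and pH: "in_H s p"
    and ae: "\<And>t. t \<in> {0..T} \<Longrightarrow> AE x in lborel. u t x = v t x" "AE x in lborel. p x = q x"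
    and m: "\<And>t. t \<in> {0..T} \<Longrightarrow> v t \<in> borel_measurable borel" "q \<in> borel_measurable borel"
  shows "((\<lambda>\<tau>. H_norm s (\<lambda>x. (v \<tau> x - v t x) / (\<tau> - t) - q x)) \<longlongrightarrow> 0) (at t within {0..T})"
proof (rule Lim_transform_eventually[OF lim])
  show "\<forall>\<^sub>F \<tau> in at t within {0..T}. H_norm s (\<lambda>x. (u \<tau> x - u t x) / (\<tau> - t) - p x) = H_norm s (\<lambda>x. (v \<tau> x - v t x) / (\<tau> - t) - q x)"
    using eventually_at_within_mem
  proof eventually_elim
    case (elim \<tau>)
    have "AE x in lborel. (u \<tau> x - u t x) / (\<tau> - t) - p x = (v \<tau> x - v t x) / (\<tau> - t) - q x"
      using ae(1)[OF t] ae(1)[OF elim] ae(2) by eventually_elim simp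
    moreover have "(\<lambda>x. (v \<tau> x - v t x) / (\<tau> - t) - q x) \<in> borel_measurable borel"
      using m(1)[OF t] m(1)[OF elim] m(2) by measurable
    ultimately show ?case using in_H_cong_AE(2)[OF in_H_quotient[OF uH[OF elim] uH[OF t] pH]] by simp
  qed
qed

lemma Ck_H_C0: "Ck_H k s T u \<Longrightarrow> C0_H s T u"
  by (cases k) auto

lemma Ck_H_in_H: "Ck_H k s T u \<Longrightarrow> t \<in> {0..T} \<Longrightarrow> in_H s (u t)"
  using Ck_H_C0 unfolding C0_H_def by blast

lemma Ck_H_SucE:
  assumes "Ck_H (Suc k) s T u"
  obtains u' where "Ck_H k s T u'"
    "\<And>t. t \<in> {0..T} \<Longrightarrow> ((\<lambda>\<tau>. H_norm s (\<lambda>x. (u \<tau> x - u t x) / (\<tau> - t) - u' t x)) \<longlongrightarrow> 0) (at t within {0..T})"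
proof -
  from assms[unfolded Ck_H.simps(2)] obtain u' where a: "Ck_H k s T u'"
    and b: "\<forall>t\<in>{0..T}. ((\<lambda>\<tau>. H_norm s (\<lambda>x. (u \<tau> x - u t x) / (\<tau> - t) - u' t x)) \<longlongrightarrow> 0) (at t within {0..T})"
    by (elim conjE exE)
  show thesis by (rule that[OF a]) (rule bspec[OF b])
qed

lemma Ck_H_cong:
  assumes u: "Ck_H k s T u" and ae: "\<And>t. t \<in> {0..T} \<Longrightarrow> AE x in lborel. u t x = v t x"
    and m: "\<And>t. t \<in> {0..T} \<Longrightarrow> v t \<in> borel_measurable borel"
  shows "Ck_H k s T v"
proof (cases k)
  case 0
  then show ?thesis using C0_H_cong[OF _ ae m] u by simp
next
  case (Suc m')
  then obtain u' where u': "Ck_H m' s T u'"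
    "\<And>t. t \<in> {0..T} \<Longrightarrow> ((\<lambda>\<tau>. H_norm s (\<lambda>x. (u \<tau> x - u t x) / (\<tau> - t) - u' t x)) \<longlongrightarrow> 0) (at t within {0..T})"
    using u Ck_H_SucE by blast
  have "((\<lambda>\<tau>. H_norm s (\<lambda>x. (v \<tau> x - v t x) / (\<tau> - t) - u' t x)) \<longlongrightarrow> 0) (at t within {0..T})" if t: "t \<in> {0..T}" for t
    by (rule H_quotient_lim_cong[OF t u'(2)[OF t] Ck_H_in_H[OF u] Ck_H_in_H[OF u'(1) t] ae _ m])
      (use square_integrable_measurable[OF in_H_square_integrable[OF Ck_H_in_H[OF u'(1) t]]] in auto)
  then show ?thesis using Suc u'(1) C0_H_cong[OF Ck_H_C0[OF u] ae m] by auto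
qed

lemma L2_lim_of_H_norm:
  assumes "((\<lambda>\<tau>. H_norm s (f \<tau>)) \<longlongrightarrow> 0) (at t within A)" "\<And>\<tau>. \<tau> \<in> A \<Longrightarrow> in_H s (f \<tau>)" "0 \<le> s"
  shows "((\<lambda>\<tau>. LINT x|lborel. (f \<tau> x)\<^sup>2) \<longlongrightarrow> 0) (at t within A)"
proof (rule Lim_null_comparison)
  show "((\<lambda>\<tau>. (H_norm s (f \<tau>))\<^sup>2) \<longlongrightarrow> 0) (at t within A)" using tendsto_power[OF assms(1), of 2] by simp
  show "\<forall>\<^sub>F \<tau> in at t within A. norm (LINT x|lborel. (f \<tau> x)\<^sup>2) \<le> (H_norm s (f \<tau>))\<^sup>2"
    using eventually_at_within_mem by eventually_elim (use L2_le_H_norm[OF assms(2) assms(3)] in simp)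
qed

text \<open>The derivative hidden in \<open>Ck_H\<close> is determined up to null sets and agrees
  with the pointwise derivative \<open>p\<close>, since the same quotients converge to both. From
  here on the explicit \<open>p\<close> replaces the anonymous witness.\<close>

lemma Ck_H_Suc_pointwise:
  assumes u: "Ck_H (Suc k) s T u" and s: "0 \<le> s" and T: "T > 0"
    and pw: "\<And>t x. t \<in> {0..T} \<Longrightarrow> ((\<lambda>\<tau>. u \<tau> x) has_vector_derivative p t x) (at t within {0..T})"
    and m: "\<And>t. t \<in> {0..T} \<Longrightarrow> p t \<in> borel_measurable borel"
  shows "Ck_H k s T p"
    and "\<And>t. t \<in> {0..T} \<Longrightarrow> ((\<lambda>\<tau>. H_norm s (\<lambda>x. (u \<tau> x - u t x) / (\<tau> - t) - p t x)) \<longlongrightarrow> 0) (at t within {0..T})"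
proof -
  obtain u' where u': "Ck_H k s T u'"
    and lim: "\<And>t. t \<in> {0..T} \<Longrightarrow> ((\<lambda>\<tau>. H_norm s (\<lambda>x. (u \<tau> x - u t x) / (\<tau> - t) - u' t x)) \<longlongrightarrow> 0) (at t within {0..T})"
    using Ck_H_SucE[OF u] by blast
  note uH = Ck_H_in_H[OF u] and u'H = Ck_H_in_H[OF u']
  have um: "u t \<in> borel_measurable borel" if "t \<in> {0..T}" for t
    using uH[OF that] in_H_square_integrable square_integrable_measurable by blast
  have ae: "AE x in lborel. u' t x = p t x" if t: "t \<in> {0..T}" for t
  proof -
    have "AE x in lborel. p t x - u' t x = 0"
    proof (rule L2_limit_pointwise_AE[OF T t])
      show "square_integrable (\<lambda>x. (u \<tau> x - u t x) / (\<tau> - t) - u' t x)" if "\<tau> \<in> {0..T}" for \<tau>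
        by (intro in_H_square_integrable[of s] in_H_quotient uH u'H that t)
      show "((\<lambda>\<tau>. LINT x|lborel. ((u \<tau> x - u t x) / (\<tau> - t) - u' t x)\<^sup>2) \<longlongrightarrow> 0) (at t within {0..T})"
        by (rule L2_lim_of_H_norm[OF lim[OF t] _ s]) (intro in_H_quotient uH u'H t)
      show "((\<lambda>\<tau>. (u \<tau> x - u t x) / (\<tau> - t) - u' t x) \<longlongrightarrow> p t x - u' t x) (at t within {0..T})" for x
        using pw[OF t, of x] unfolding has_real_derivative_iff_has_vector_derivative[symmetric] has_field_derivative_iff
        by (intro tendsto_intros)
    qed
    then show ?thesis by eventually_elim simp
  qed
  show "Ck_H k s T p" by (rule Ck_H_cong[OF u' ae m])
  show "((\<lambda>\<tau>. H_norm s (\<lambda>x. (u \<tau> x - u t x) / (\<tau> - t) - p t x)) \<longlongrightarrow> 0) (at t within {0..T})" if t: "t \<in> {0..T}" for t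
    by (rule H_quotient_lim_cong[OF t lim[OF t] uH u'H[OF t] _ ae[OF t] um m[OF t]]) auto
qed

section \<open>Derivatives of curves in the sense of L^2\<close>

text \<open>Only increments of the curve are asked to be square integrable. The values of the stress
  along a solution need not be, as the stress may be nonzero at the origin.\<close>

definition L2_deriv :: "real \<Rightarrow> (real \<Rightarrow> real^3 \<Rightarrow> 'b::euclidean_space) \<Rightarrow> (real^3 \<Rightarrow> 'b) \<Rightarrow> real \<Rightarrow> bool" where
  "L2_deriv T u u' t \<longleftrightarrow> square_integrable u' \<and> (\<forall>\<tau>\<in>{0..T}. square_integrable (\<lambda>x. u \<tau> x - u t x)) \<and>
     ((\<lambda>\<tau>. LINT x|lborel. (norm ((u \<tau> x - u t x) /\<^sub>R (\<tau> - t) - u' x))\<^sup>2) \<longlongrightarrow> 0) (at t within {0..T})"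

lemma L2_deriv_of_H:
  assumes t: "t \<in> {0..T}" and s: "0 \<le> s"
    and lim: "((\<lambda>\<tau>. H_norm s (\<lambda>x. (u \<tau> x - u t x) / (\<tau> - t) - p x)) \<longlongrightarrow> 0) (at t within {0..T})"
    and uH: "\<And>t. t \<in> {0..T} \<Longrightarrow> in_H s (u t)" and pH: "in_H s p"
  shows "L2_deriv T u p t"
  unfolding L2_deriv_def
proof (intro conjI ballI)
  show "square_integrable p" by (rule in_H_square_integrable[OF pH])
  show "square_integrable (\<lambda>x. u \<tau> x - u t x)" if "\<tau> \<in> {0..T}" for \<tau>
    by (intro in_H_square_integrable[of s] in_H_diff uH that t)
  have "((\<lambda>\<tau>. LINT x|lborel. ((u \<tau> x - u t x) / (\<tau> - t) - p x)\<^sup>2) \<longlongrightarrow> 0) (at t within {0..T})"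
    by (rule L2_lim_of_H_norm[OF lim _ s]) (intro in_H_quotient uH pH t)
  then show "((\<lambda>\<tau>. LINT x|lborel. (norm ((u \<tau> x - u t x) /\<^sub>R (\<tau> - t) - p x))\<^sup>2) \<longlongrightarrow> 0) (at t within {0..T})"
    by (simp add: divide_inverse mult.commute)
qed

lemma norm_vec_power2: "(norm (x :: ('b::real_normed_vector)^3))\<^sup>2 = (\<Sum>i\<in>UNIV. (norm (x $ i))\<^sup>2)"
  unfolding norm_vec_def L2_set_def by (simp add: sum_nonneg)

lemma square_integrable_vec:
  fixes u :: "real^3 \<Rightarrow> ('b::euclidean_space)^3"
  assumes "\<And>i. square_integrable (\<lambda>x. u x $ i)" shows "square_integrable u"
proof -
  have m: "(\<lambda>x. u x $ i) \<in> borel_measurable borel" for i using assms square_integrable_measurable by blast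
  have "(\<lambda>x. u x \<bullet> b) \<in> borel_measurable borel" if b: "b \<in> Basis" for b
  proof -
    obtain i e where be: "b = axis i e" using b by (auto simp: Basis_vec_def)
    show ?thesis unfolding be inner_axis using m[of i] by measurable
  qed
  then have "u \<in> borel_measurable borel" by (rule borel_measurable_euclidean_space[THEN iffD2, rule_format])
  then show ?thesis using assms by (auto simp: square_integrable_def norm_vec_power2)
qed

lemma L2_deriv_vec:
  fixes u :: "real \<Rightarrow> real^3 \<Rightarrow> ('b::euclidean_space)^3"
  assumes "\<And>i. L2_deriv T (\<lambda>t x. u t x $ i) (\<lambda>x. u' x $ i) t" and t: "t \<in> {0..T}"
  shows "L2_deriv T u u' t"
  unfolding L2_deriv_def
proof (intro conjI ballI)
  show u': "square_integrable u'" using assms by (intro square_integrable_vec) (auto simp: L2_deriv_def)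
  show "square_integrable (\<lambda>x. u \<tau> x - u t x)" if "\<tau> \<in> {0..T}" for \<tau>
    using assms that by (intro square_integrable_vec) (auto simp: L2_deriv_def)
  have "((\<lambda>\<tau>. \<Sum>i\<in>UNIV. LINT x|lborel. (norm ((u \<tau> x $ i - u t x $ i) /\<^sub>R (\<tau> - t) - u' x $ i))\<^sup>2) \<longlongrightarrow> (\<Sum>i\<in>(UNIV::3 set). 0)) (at t within {0..T})"
    using assms(1) by (intro tendsto_sum) (auto simp: L2_deriv_def)
  then have "((\<lambda>\<tau>. \<Sum>i\<in>UNIV. LINT x|lborel. (norm ((u \<tau> x $ i - u t x $ i) /\<^sub>R (\<tau> - t) - u' x $ i))\<^sup>2) \<longlongrightarrow> 0) (at t within {0..T})" by simp
  then show "((\<lambda>\<tau>. LINT x|lborel. (norm ((u \<tau> x - u t x) /\<^sub>R (\<tau> - t) - u' x))\<^sup>2) \<longlongrightarrow> 0) (at t within {0..T})"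
  proof (rule Lim_transform_eventually)
    show "\<forall>\<^sub>F \<tau> in at t within {0..T}. (\<Sum>i\<in>UNIV. LINT x|lborel. (norm ((u \<tau> x $ i - u t x $ i) /\<^sub>R (\<tau> - t) - u' x $ i))\<^sup>2) = (LINT x|lborel. (norm ((u \<tau> x - u t x) /\<^sub>R (\<tau> - t) - u' x))\<^sup>2)"
      using eventually_at_within_mem
    proof eventually_elim
      case (elim \<tau>)
      have "square_integrable (\<lambda>x. (u \<tau> x $ i - u t x $ i) /\<^sub>R (\<tau> - t) - u' x $ i)" for i
        using assms(1)[of i] elim
        by (intro square_integrable_diff[OF square_integrable_bounded_linear[OF _ bounded_linear_scaleR_right]]) (auto simp: L2_deriv_def)
      then have "integrable lborel (\<lambda>x. (norm ((u \<tau> x $ i - u t x $ i) /\<^sub>R (\<tau> - t) - u' x $ i))\<^sup>2)" for i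
        by (simp add: square_integrable_def)
      then show ?case by (simp add: norm_vec_power2 Bochner_Integration.integral_sum)
    qed
  qed
qed

lemma
  fixes u v :: "real^3 \<Rightarrow> 'b::euclidean_space"
  assumes u: "square_integrable u" and v: "square_integrable v"
  shows integrable_inner_L2: "integrable lborel (\<lambda>x. u x \<bullet> v x)"
    and integral_inner_le: "\<bar>LINT x|lborel. u x \<bullet> v x\<bar> \<le> sqrt (LINT x|lborel. (norm (u x))\<^sup>2) * sqrt (LINT x|lborel. (norm (v x))\<^sup>2)"
proof -
  note [measurable] = assms[THEN square_integrable_measurable]
  have i: "integrable lborel (\<lambda>x. norm (u x) * norm (v x))"
    using u v by (intro integrable_mult_L2) (auto simp: square_integrable_def)
  then show i': "integrable lborel (\<lambda>x. u x \<bullet> v x)"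
    by (rule Bochner_Integration.integrable_bound) (auto simp: Cauchy_Schwarz_ineq2)
  have "\<bar>LINT x|lborel. u x \<bullet> v x\<bar> \<le> (LINT x|lborel. \<bar>u x \<bullet> v x\<bar>)"
    using integral_norm_bound[of lborel "\<lambda>x. u x \<bullet> v x"] by simp
  also have "\<dots> \<le> (LINT x|lborel. \<bar>norm (u x) * norm (v x)\<bar>)"
    using i i' by (intro integral_mono) (auto simp: Cauchy_Schwarz_ineq2)
  also have "\<dots> \<le> sqrt (LINT x|lborel. (norm (u x))\<^sup>2) * sqrt (LINT x|lborel. (norm (v x))\<^sup>2)"
    using u v by (intro Cauchy_Schwarz_integral_abs) (auto simp: square_integrable_def)
  finally show "\<bar>LINT x|lborel. u x \<bullet> v x\<bar> \<le> sqrt (LINT x|lborel. (norm (u x))\<^sup>2) * sqrt (LINT x|lborel. (norm (v x))\<^sup>2)" .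
qed

lemma L2_deriv_quotient:
  assumes d: "L2_deriv T a a' t" and b: "square_integrable b"
  shows "((\<lambda>\<tau>. LINT x|lborel. ((a \<tau> x - a t x) /\<^sub>R (\<tau> - t)) \<bullet> b x) \<longlongrightarrow> (LINT x|lborel. a' x \<bullet> b x)) (at t within {0..T})"
proof (rule LIM_zero_cancel, rule Lim_null_comparison)
  let ?r = "\<lambda>\<tau> x. (a \<tau> x - a t x) /\<^sub>R (\<tau> - t) - a' x"
  have "((\<lambda>\<tau>. sqrt (LINT x|lborel. (norm (?r \<tau> x))\<^sup>2) * sqrt (LINT x|lborel. (norm (b x))\<^sup>2)) \<longlongrightarrow> sqrt 0 * sqrt (LINT x|lborel. (norm (b x))\<^sup>2)) (at t within {0..T})"
    using d unfolding L2_deriv_def by (intro tendsto_mult tendsto_real_sqrt tendsto_const) auto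
  then show "((\<lambda>\<tau>. sqrt (LINT x|lborel. (norm (?r \<tau> x))\<^sup>2) * sqrt (LINT x|lborel. (norm (b x))\<^sup>2)) \<longlongrightarrow> 0) (at t within {0..T})" by simp
  show "\<forall>\<^sub>F \<tau> in at t within {0..T}. norm ((LINT x|lborel. ((a \<tau> x - a t x) /\<^sub>R (\<tau> - t)) \<bullet> b x) - (LINT x|lborel. a' x \<bullet> b x)) \<le> sqrt (LINT x|lborel. (norm (?r \<tau> x))\<^sup>2) * sqrt (LINT x|lborel. (norm (b x))\<^sup>2)"
    using eventually_at_within_mem
  proof eventually_elim
    case (elim \<tau>)
    have s: "square_integrable (\<lambda>x. (a \<tau> x - a t x) /\<^sub>R (\<tau> - t))" "square_integrable a'"
      using d elim by (auto simp: L2_deriv_def intro: square_integrable_bounded_linear[OF _ bounded_linear_scaleR_right])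
    have "(LINT x|lborel. ((a \<tau> x - a t x) /\<^sub>R (\<tau> - t)) \<bullet> b x) - (LINT x|lborel. a' x \<bullet> b x) = (LINT x|lborel. ?r \<tau> x \<bullet> b x)"
      using integrable_inner_L2[OF s(1) b] integrable_inner_L2[OF s(2) b]
      by (simp add: inner_diff_left del: inner_scaleR_left)
    then show ?case using integral_inner_le[OF square_integrable_diff[OF s] b] by simp
  qed
qed

text \<open>The discrete product rule holds exactly, with the remainder \<open>\<tau> - t\<close>
  times the inner product of the two difference quotients; these stay bounded in L^2, so the
  remainder vanishes.\<close>

lemma L2_deriv_inner:
  assumes a: "\<And>t. t \<in> {0..T} \<Longrightarrow> square_integrable (a t)" and b: "\<And>t. t \<in> {0..T} \<Longrightarrow> square_integrable (b t)"
    and da: "L2_deriv T a a' t" and db: "L2_deriv T b b' t" and t: "t \<in> {0..T}"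
  shows "((\<lambda>t. LINT x|lborel. a t x \<bullet> b t x) has_real_derivative (LINT x|lborel. a' x \<bullet> b t x) + (LINT x|lborel. a t x \<bullet> b' x)) (at t within {0..T})"
  unfolding has_field_derivative_iff
proof -
  let ?F = "at t within {0..T}"
  let ?A = "\<lambda>\<tau> x. (a \<tau> x - a t x) /\<^sub>R (\<tau> - t)" and ?B = "\<lambda>\<tau> x. (b \<tau> x - b t x) /\<^sub>R (\<tau> - t)"
  have sA: "square_integrable (?A \<tau>)" "square_integrable (?B \<tau>)" if "\<tau> \<in> {0..T}" for \<tau>
    using da db that by (auto simp: L2_deriv_def intro: square_integrable_bounded_linear[OF _ bounded_linear_scaleR_right])
  have s': "square_integrable a'" "square_integrable b'" using da db by (auto simp: L2_deriv_def)
  have l1: "((\<lambda>\<tau>. LINT x|lborel. ?A \<tau> x \<bullet> b t x) \<longlongrightarrow> (LINT x|lborel. a' x \<bullet> b t x)) ?F"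
    by (rule L2_deriv_quotient[OF da b[OF t]])
  have l2: "((\<lambda>\<tau>. LINT x|lborel. a t x \<bullet> ?B \<tau> x) \<longlongrightarrow> (LINT x|lborel. a t x \<bullet> b' x)) ?F"
    using L2_deriv_quotient[OF db a[OF t]] by (simp add: inner_commute)
  define ra where "ra \<tau> = (LINT x|lborel. (norm (?A \<tau> x - a' x))\<^sup>2)" for \<tau>
  define rb where "rb \<tau> = (LINT x|lborel. (norm (?B \<tau> x - b' x))\<^sup>2)" for \<tau>
  have r: "(ra \<longlongrightarrow> 0) ?F" "(rb \<longlongrightarrow> 0) ?F" using da db unfolding ra_def rb_def L2_deriv_def by auto
  define Na where "Na = (LINT x|lborel. (norm (a' x))\<^sup>2)"
  define Nb where "Nb = (LINT x|lborel. (norm (b' x))\<^sup>2)"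
  have nb: "(LINT x|lborel. (norm (c x))\<^sup>2) \<le> 2 * (LINT x|lborel. (norm (c x - c' x))\<^sup>2) + 2 * (LINT x|lborel. (norm (c' x))\<^sup>2)"
    if "square_integrable c" "square_integrable c'" for c c' :: "real^3 \<Rightarrow> 'a"
  proof -
    have i: "integrable lborel (\<lambda>x. (norm (c x - c' x))\<^sup>2)" "integrable lborel (\<lambda>x. (norm (c' x))\<^sup>2)" "integrable lborel (\<lambda>x. (norm (c x))\<^sup>2)"
      using that square_integrable_diff[OF that] by (auto simp: square_integrable_def)
    have "(LINT x|lborel. (norm (c x))\<^sup>2) \<le> (LINT x|lborel. 2 * (norm (c x - c' x))\<^sup>2 + 2 * (norm (c' x))\<^sup>2)"
    proof (rule integral_mono)
      show "integrable lborel (\<lambda>x. 2 * (norm (c x - c' x))\<^sup>2 + 2 * (norm (c' x))\<^sup>2)" using i by auto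
      show "(norm (c x))\<^sup>2 \<le> 2 * (norm (c x - c' x))\<^sup>2 + 2 * (norm (c' x))\<^sup>2" for x
        using norm_add_power2_le[of "c x - c' x" "c' x"] by simp
    qed (rule i)
    then show ?thesis using i by simp
  qed
  have l3: "((\<lambda>\<tau>. (\<tau> - t) * (LINT x|lborel. ?A \<tau> x \<bullet> ?B \<tau> x)) \<longlongrightarrow> 0) ?F"
  proof (rule Lim_null_comparison)
    have "((\<lambda>\<tau>. \<bar>\<tau> - t\<bar> * (sqrt (2 * ra \<tau> + 2 * Na) * sqrt (2 * rb \<tau> + 2 * Nb))) \<longlongrightarrow> \<bar>t - t\<bar> * (sqrt (2 * 0 + 2 * Na) * sqrt (2 * 0 + 2 * Nb))) ?F"
      by (intro tendsto_intros r)
    then show "((\<lambda>\<tau>. \<bar>\<tau> - t\<bar> * (sqrt (2 * ra \<tau> + 2 * Na) * sqrt (2 * rb \<tau> + 2 * Nb))) \<longlongrightarrow> 0) ?F" by simp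
    show "\<forall>\<^sub>F \<tau> in ?F. norm ((\<tau> - t) * (LINT x|lborel. ?A \<tau> x \<bullet> ?B \<tau> x)) \<le> \<bar>\<tau> - t\<bar> * (sqrt (2 * ra \<tau> + 2 * Na) * sqrt (2 * rb \<tau> + 2 * Nb))"
      using eventually_at_within_mem
    proof eventually_elim
      case (elim \<tau>)
      have "\<bar>LINT x|lborel. ?A \<tau> x \<bullet> ?B \<tau> x\<bar> \<le> sqrt (LINT x|lborel. (norm (?A \<tau> x))\<^sup>2) * sqrt (LINT x|lborel. (norm (?B \<tau> x))\<^sup>2)"
        by (rule integral_inner_le[OF sA[OF elim]])
      also have "\<dots> \<le> sqrt (2 * ra \<tau> + 2 * Na) * sqrt (2 * rb \<tau> + 2 * Nb)"
        unfolding ra_def rb_def Na_def Nb_def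
        by (intro mult_mono real_sqrt_le_mono nb sA elim s' real_sqrt_ge_zero add_nonneg_nonneg mult_nonneg_nonneg integral_nonneg_AE AE_I2) auto
      finally show ?case unfolding real_norm_def abs_mult by (rule mult_left_mono) simp
    qed
  qed
  have "((\<lambda>\<tau>. (LINT x|lborel. ?A \<tau> x \<bullet> b t x) + (LINT x|lborel. a t x \<bullet> ?B \<tau> x) + (\<tau> - t) * (LINT x|lborel. ?A \<tau> x \<bullet> ?B \<tau> x)) \<longlongrightarrow> (LINT x|lborel. a' x \<bullet> b t x) + (LINT x|lborel. a t x \<bullet> b' x) + 0) ?F"
    by (intro tendsto_add l1 l2 l3)
  then have "((\<lambda>\<tau>. (LINT x|lborel. ?A \<tau> x \<bullet> b t x) + (LINT x|lborel. a t x \<bullet> ?B \<tau> x) + (\<tau> - t) * (LINT x|lborel. ?A \<tau> x \<bullet> ?B \<tau> x)) \<longlongrightarrow> (LINT x|lborel. a' x \<bullet> b t x) + (LINT x|lborel. a t x \<bullet> b' x)) ?F"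
    by simp
  then show "((\<lambda>\<tau>. ((LINT x|lborel. a \<tau> x \<bullet> b \<tau> x) - (LINT x|lborel. a t x \<bullet> b t x)) / (\<tau> - t)) \<longlongrightarrow> (LINT x|lborel. a' x \<bullet> b t x) + (LINT x|lborel. a t x \<bullet> b' x)) ?F"
  proof (rule Lim_transform_eventually)
    have "\<forall>\<^sub>F \<tau> in ?F. \<tau> \<in> {0..T} \<and> \<tau> \<noteq> t" by (simp add: eventually_at_filter)
    then show "\<forall>\<^sub>F \<tau> in ?F. (LINT x|lborel. ?A \<tau> x \<bullet> b t x) + (LINT x|lborel. a t x \<bullet> ?B \<tau> x) + (\<tau> - t) * (LINT x|lborel. ?A \<tau> x \<bullet> ?B \<tau> x) = ((LINT x|lborel. a \<tau> x \<bullet> b \<tau> x) - (LINT x|lborel. a t x \<bullet> b t x)) / (\<tau> - t)"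
    proof eventually_elim
      case (elim \<tau>)
      then have \<tau>: "\<tau> \<in> {0..T}" "\<tau> \<noteq> t" by auto
      note i = integrable_inner_L2
      have pw: "?A \<tau> x \<bullet> b t x + a t x \<bullet> ?B \<tau> x + (\<tau> - t) * (?A \<tau> x \<bullet> ?B \<tau> x) = (a \<tau> x \<bullet> b \<tau> x - a t x \<bullet> b t x) / (\<tau> - t)" for x
      proof -
        define c where "c = \<tau> - t"
        have c: "c \<noteq> 0" using \<tau> by (simp add: c_def)
        show ?thesis unfolding c_def[symmetric] using c
          by (simp add: inner_diff_left inner_diff_right field_simps)
      qed
      have "(LINT x|lborel. ?A \<tau> x \<bullet> b t x) + (LINT x|lborel. a t x \<bullet> ?B \<tau> x) + (\<tau> - t) * (LINT x|lborel. ?A \<tau> x \<bullet> ?B \<tau> x)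
         = (LINT x|lborel. ?A \<tau> x \<bullet> b t x + a t x \<bullet> ?B \<tau> x + (\<tau> - t) * (?A \<tau> x \<bullet> ?B \<tau> x))"
        using i[OF sA(1)[OF \<tau>(1)] b[OF t]] i[OF a[OF t] sA(2)[OF \<tau>(1)]] i[OF sA[OF \<tau>(1)]]
        by (simp del: inner_scaleR_left inner_scaleR_right)
      also have "\<dots> = (LINT x|lborel. (a \<tau> x \<bullet> b \<tau> x - a t x \<bullet> b t x) / (\<tau> - t))" by (simp only: pw)
      also have "\<dots> = ((LINT x|lborel. a \<tau> x \<bullet> b \<tau> x) - (LINT x|lborel. a t x \<bullet> b t x)) / (\<tau> - t)"
        using i[OF a[OF t] b[OF t]] i[OF a[OF \<tau>(1)] b[OF \<tau>(1)]] by simp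
      finally show ?case .
    qed
  qed
qed

lemma integral_by_parts_L2:
  assumes "Ck_on (Suc 0) UNIV a" "Ck_on (Suc 0) UNIV b"
    and s: "square_integrable a" "square_integrable b" "square_integrable (pdx \<alpha> a)" "square_integrable (pdx \<alpha> b)"
  shows "(LINT x|lborel. a x * pdx \<alpha> b x) = - (LINT x|lborel. pdx \<alpha> a x * b x)"
proof (rule integral_by_parts_pdx[OF assms(1,2)])
  show "integrable lborel (\<lambda>x. a x * b x)" using integrable_inner_L2[OF s(1,2)] by simp
  show "integrable lborel (\<lambda>x. a x * pdx \<alpha> b x)" using integrable_inner_L2[OF s(1,4)] by simp
  show "integrable lborel (\<lambda>x. pdx \<alpha> a x * b x)" using integrable_inner_L2[OF s(3,2)] by simp
qed

section \<open>Superposition operators and functions on slabs\<close>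

lemma linear_eq_sum_Basis:
  fixes D :: "'a::euclidean_space \<Rightarrow> 'b::real_vector"
  assumes "linear D" shows "D h = (\<Sum>b\<in>Basis. (h \<bullet> b) *\<^sub>R D b)"
proof -
  have "D h = D (\<Sum>b\<in>Basis. (h \<bullet> b) *\<^sub>R b)" by (simp add: euclidean_representation)
  also have "\<dots> = (\<Sum>b\<in>Basis. D ((h \<bullet> b) *\<^sub>R b))" by (rule linear_sum[OF assms])
  finally show ?thesis by (simp add: linear_scale[OF assms])
qed

lemma norm_linear_le_sum_Basis:
  fixes D :: "'a::euclidean_space \<Rightarrow> 'b::real_normed_vector"
  assumes "linear D" "\<And>b. b \<in> Basis \<Longrightarrow> norm (D b) \<le> B b"
  shows "norm (D h) \<le> (\<Sum>b\<in>Basis. B b) * norm h"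
proof -
  have "norm (D h) \<le> (\<Sum>b\<in>Basis. norm ((h \<bullet> b) *\<^sub>R D b))"
    by (subst linear_eq_sum_Basis[OF assms(1)]) (rule norm_sum)
  also have "\<dots> \<le> (\<Sum>b\<in>Basis. norm h * B b)"
    using assms(2) Basis_le_norm by (intro sum_mono) (auto intro!: mult_mono)
  finally show ?thesis by (simp add: sum_distrib_left mult.commute)
qed

lemma Ck_on_Suc_linear: "Ck_on (Suc k) UNIV f \<Longrightarrow> linear (frechet_derivative f (at p))"
  using Ck_on_Suc_UNIV_frechet(1) has_derivative_linear by blast

text \<open>\<open>Ck_on\<close> speaks of the derivative in each fixed direction only. Compactness
  is therefore used for the basis vectors one by one, and linearity assembles the bounds.\<close>

lemma C1_ball_bounds:
  fixes f :: "'a::euclidean_space \<Rightarrow> 'b::euclidean_space"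
  assumes C1: "Ck_on (Suc 0) UNIV f"
  obtains L where "L \<ge> 0" "\<And>p h. norm p \<le> M \<Longrightarrow> norm (frechet_derivative f (at p) h) \<le> L * norm h"
    "\<And>p q. norm p \<le> M \<Longrightarrow> norm q \<le> M \<Longrightarrow> norm (f p - f q) \<le> L * norm (p - q)"
proof -
  let ?D = "\<lambda>p. frechet_derivative f (at p)"
  have "\<forall>b. \<exists>B\<ge>0. \<forall>p. norm p \<le> M \<longrightarrow> norm (?D p b) \<le> B"
  proof
    fix b
    have "continuous_on UNIV (\<lambda>p. ?D p b)" using Ck_on_Suc_UNIV_frechet(2)[OF C1, of b] by simp
    then have "compact ((\<lambda>p. ?D p b) ` cball 0 M)"
      by (rule compact_continuous_image[OF continuous_on_subset[OF _ subset_UNIV] compact_cball])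
    then have "bounded ((\<lambda>p. ?D p b) ` cball 0 M)" by (rule compact_imp_bounded)
    then obtain B where B: "B > 0" "\<forall>y\<in>(\<lambda>p. ?D p b) ` cball 0 M. norm y \<le> B"
      unfolding bounded_pos by (elim exE conjE)
    have "norm (?D p b) \<le> B" if "norm p \<le> M" for p
      using bspec[OF B(2) imageI, of p] that by simp
    then show "\<exists>B\<ge>0. \<forall>p. norm p \<le> M \<longrightarrow> norm (?D p b) \<le> B" using B(1) less_imp_le by blast
  qed
  then obtain B where B: "\<And>b. B b \<ge> 0" "\<And>b p. norm p \<le> M \<Longrightarrow> norm (?D p b) \<le> B b" by metis
  define L where "L = (\<Sum>b\<in>Basis. B b)"
  have L0: "L \<ge> 0" unfolding L_def by (intro sum_nonneg B)
  have L1: "norm (?D p h) \<le> L * norm h" if "norm p \<le> M" for p h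
    unfolding L_def by (rule norm_linear_le_sum_Basis[OF Ck_on_Suc_linear[OF C1] B(2)[OF that]])
  have "norm (f p - f q) \<le> L * norm (p - q)" if "norm p \<le> M" "norm q \<le> M" for p q
  proof (rule differentiable_bound[where S="cball 0 M"])
    show "(f has_derivative ?D x) (at x within cball 0 M)" for x
      by (rule has_derivative_at_withinI[OF Ck_on_Suc_UNIV_frechet(1)[OF C1]])
    show "onorm (?D x) \<le> L" if "x \<in> cball 0 M" for x using L0 L1 that by (intro onorm_bound) auto
  qed (use that in auto)
  then show thesis using that L0 L1 by blast
qed

text \<open>The preceding lemma applied to the directional derivative along each basis
  vector.\<close>

lemma C2_ball_Lipschitz:
  fixes f :: "'a::euclidean_space \<Rightarrow> 'b::euclidean_space"
  assumes C2: "Ck_on (Suc (Suc 0)) UNIV f"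
  obtains L where "L \<ge> 0" "\<And>p q h. norm p \<le> M \<Longrightarrow> norm q \<le> M \<Longrightarrow>
    norm (frechet_derivative f (at p) h - frechet_derivative f (at q) h) \<le> L * norm (p - q) * norm h"
proof -
  let ?D = "\<lambda>p. frechet_derivative f (at p)"
  have "\<forall>b. \<exists>B\<ge>0. \<forall>p q. norm p \<le> M \<longrightarrow> norm q \<le> M \<longrightarrow> norm (?D p b - ?D q b) \<le> B * norm (p - q)"
    using C1_ball_bounds[OF Ck_on_Suc_UNIV_frechet(2)[OF C2], of M] by metis
  then obtain B where B: "\<And>b. B b \<ge> 0" "\<And>b p q. norm p \<le> M \<Longrightarrow> norm q \<le> M \<Longrightarrow> norm (?D p b - ?D q b) \<le> B b * norm (p - q)" by metis
  show thesis
  proof (rule that[of "\<Sum>b\<in>Basis. B b"])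
    show "0 \<le> (\<Sum>b\<in>Basis. B b)" by (intro sum_nonneg B)
    fix p q :: 'a and h assume pq: "norm p \<le> M" "norm q \<le> M"
    have "norm (?D p h - ?D q h) \<le> (\<Sum>b\<in>Basis. B b * norm (p - q)) * norm h"
      by (rule norm_linear_le_sum_Basis[where D="\<lambda>h. ?D p h - ?D q h"])
        (auto intro!: linear_compose_sub Ck_on_Suc_linear[OF C2] B pq simp del: Ck_on.simps)
    then show "norm (?D p h - ?D q h) \<le> (\<Sum>b\<in>Basis. B b) * norm (p - q) * norm h" by (simp add: sum_distrib_right)
  qed
qed

lemma Ck_on_vec:
  fixes u :: "'a::real_normed_vector \<Rightarrow> ('b::euclidean_space)^'n"
  assumes "\<And>i. Ck_on k S (\<lambda>x. u x $ i)" shows "Ck_on k S u"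
proof -
  have ax: "bounded_linear (axis i :: 'b \<Rightarrow> 'b^'n)" for i
    unfolding linear_conv_bounded_linear[symmetric]
    by (rule linearI) (auto simp: vec_eq_iff axis_def)
  have eq: "u x = (\<Sum>i\<in>UNIV. axis i (u x $ i))" for x
    by (simp add: vec_eq_iff axis_def sum.delta)
  have "Ck_on k S (\<lambda>x. \<Sum>i\<in>I. axis i (u x $ i))" for I :: "'n set"
    by (induction I rule: infinite_finite_induct) (auto intro: Ck_on_const Ck_on_add Ck_on_bounded_linear[OF ax assms])
  from this[of UNIV] show ?thesis by (rule Ck_on_cong) (rule eq[symmetric])
qed

lemma Ck_on_component: "Ck_on k S u \<Longrightarrow> Ck_on k S (\<lambda>x. u x $ i)"
  by (rule Ck_on_bounded_linear[OF bounded_linear_vec_nth])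

lemma frechet_derivative_bounded_linear:
  assumes C1: "Ck_on (Suc 0) UNIV f" and L: "bounded_linear L"
  shows "frechet_derivative (\<lambda>x. L (f x)) (at x) h = L (frechet_derivative f (at x) h)"
proof -
  have "frechet_derivative (\<lambda>x. L (f x)) (at x) = (\<lambda>h. L (frechet_derivative f (at x) h))"
    by (rule frechet_derivative_at[symmetric]) (rule bounded_linear.has_derivative[OF L Ck_on_Suc_UNIV_frechet(1)[OF C1]])
  then show ?thesis by (simp only:)
qed

lemma
  fixes g :: "'b::euclidean_space \<Rightarrow> 'c::real_normed_vector" and F :: "'a::real_normed_vector \<Rightarrow> 'b"
  assumes g: "Ck_on (Suc 0) UNIV g" and F: "Ck_on (Suc 0) UNIV F"
  shows Ck_on_compose_C1: "Ck_on (Suc 0) UNIV (\<lambda>x. g (F x))"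
    and frechet_derivative_compose_C1:
      "frechet_derivative (\<lambda>x. g (F x)) (at x) h = frechet_derivative g (at (F x)) (frechet_derivative F (at x) h)"
proof -
  let ?D = "\<lambda>x h. frechet_derivative g (at (F x)) (frechet_derivative F (at x) h)"
  have D: "((\<lambda>x. g (F x)) has_derivative ?D x) (at x)" for x
    by (rule has_derivative_compose[OF Ck_on_Suc_UNIV_frechet(1)[OF F] Ck_on_Suc_UNIV_frechet(1)[OF g]])
  have "continuous_on UNIV (\<lambda>x. ?D x h)" for h
  proof -
    have "continuous_on UNIV (\<lambda>p. frechet_derivative g (at p) b)" for b
      using Ck_on_Suc_UNIV_frechet(2)[OF g, of b] by simp
    then have "continuous_on UNIV (\<lambda>x. frechet_derivative g (at (F x)) b)" for b
      using continuous_on_compose2[OF _ Ck_on_continuous[OF F]] by blast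
    moreover have "continuous_on UNIV (\<lambda>x. frechet_derivative F (at x) h)"
      using Ck_on_Suc_UNIV_frechet(2)[OF F, of h] by simp
    \<comment> \<open>Expansion in the basis separates the moving direction from the moving base
      point, since continuity is known for fixed directions.\<close>
    ultimately show ?thesis
      by (subst linear_eq_sum_Basis[OF Ck_on_Suc_linear[OF g]]) (intro continuous_intros)
  qed
  then show "Ck_on (Suc 0) UNIV (\<lambda>x. g (F x))" using D by (auto intro!: exI[of _ ?D])
  show "frechet_derivative (\<lambda>x. g (F x)) (at x) h = ?D x h"
    using frechet_derivative_at[OF D, symmetric] by simp
qed

lemma frechet_derivative_measurable:
  fixes g :: "'b::euclidean_space \<Rightarrow> 'c::euclidean_space"
  assumes g: "Ck_on (Suc 0) UNIV g" and [measurable]: "u \<in> borel_measurable M" "v \<in> borel_measurable M"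
  shows "(\<lambda>x. frechet_derivative g (at (u x)) (v x)) \<in> borel_measurable M"
proof -
  have "(\<lambda>p. frechet_derivative g (at p) b) \<in> borel_measurable borel" for b
    using Ck_on_Suc_UNIV_frechet(2)[OF g, of b] by (intro borel_measurable_continuous_onI) simp
  then have [measurable]: "(\<lambda>x. frechet_derivative g (at (u x)) b) \<in> borel_measurable M" for b
    by (rule measurable_compose[rotated]) measurable
  show ?thesis by (subst linear_eq_sum_Basis[OF Ck_on_Suc_linear[OF g]]) measurable
qed

text \<open>Superposition operators are in general not Frechet differentiable on L^2, so the chain
  rule is proved along the curve. The relative linearisation error \<open>\<omega>\<close> is
  bounded by \<open>2 * L\<close> and tends to 0 pointwise; multiplied by the fixed function
  \<open>norm (U' x)\<close> it tends to 0 in L^2 by dominated convergence.\<close>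

lemma L2_deriv_compose:
  fixes g :: "'b::euclidean_space \<Rightarrow> 'c::euclidean_space"
  assumes g: "Ck_on (Suc 0) UNIV g" and d: "L2_deriv T U U' t" and t: "t \<in> {0..T}"
    and m: "\<And>\<tau>. \<tau> \<in> {0..T} \<Longrightarrow> U \<tau> \<in> borel_measurable borel"
    and M: "\<And>\<tau> x. \<tau> \<in> {0..T} \<Longrightarrow> norm (U \<tau> x) \<le> M"
    and cont: "\<And>x. ((\<lambda>\<tau>. U \<tau> x) \<longlongrightarrow> U t x) (at t within {0..T})"
  shows "L2_deriv T (\<lambda>\<tau> x. g (U \<tau> x)) (\<lambda>x. frechet_derivative g (at (U t x)) (U' x)) t"
proof -
  let ?D = "\<lambda>p. frechet_derivative g (at p)" and ?F = "at t within {0..T}"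
  obtain L where L: "L \<ge> 0" "\<And>p h. norm p \<le> M \<Longrightarrow> norm (?D p h) \<le> L * norm h"
    "\<And>p q. norm p \<le> M \<Longrightarrow> norm q \<le> M \<Longrightarrow> norm (g p - g q) \<le> L * norm (p - q)"
    using C1_ball_bounds[OF g, of M] by metis
  have [measurable]: "g \<in> borel_measurable borel" by (rule borel_measurable_continuous_onI[OF Ck_on_continuous[OF g]])
  have U': "square_integrable U'" and Ud: "\<And>\<tau>. \<tau> \<in> {0..T} \<Longrightarrow> square_integrable (\<lambda>x. U \<tau> x - U t x)"
    and lim: "((\<lambda>\<tau>. LINT x|lborel. (norm ((U \<tau> x - U t x) /\<^sub>R (\<tau> - t) - U' x))\<^sup>2) \<longlongrightarrow> 0) ?F"
    using d by (auto simp: L2_deriv_def)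
  note [measurable] = square_integrable_measurable[OF U'] m
  have sq: "square_integrable (\<lambda>x. L *\<^sub>R u x)" if "square_integrable u" for u :: "real^3 \<Rightarrow> 'b"
    by (rule square_integrable_bounded_linear[OF that bounded_linear_scaleR_right])
  have gm: "(\<lambda>x. ?D (U t x) (V x)) \<in> borel_measurable borel" if "V \<in> borel_measurable borel" for V
    by (rule frechet_derivative_measurable[OF g m[OF t] that])
  have sD: "square_integrable (\<lambda>x. ?D (U t x) (V x))" if "square_integrable V" for V
    by (rule square_integrable_bound[OF sq[OF that] gm[OF square_integrable_measurable[OF that]]])
      (use L M t in auto)
  have sg: "square_integrable (\<lambda>x. g (U \<tau> x) - g (U t x))" if "\<tau> \<in> {0..T}" for \<tau>
    by (rule square_integrable_bound[OF sq[OF Ud[OF that]]])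
      (use L M t that m[OF t] m[OF that] in auto)
  \<comment> \<open>The value 0 where the increment vanishes makes \<open>\<omega>\<close>
    continuous along the curve.\<close>
  define \<omega> where "\<omega> \<tau> x = (if U \<tau> x = U t x then 0 else norm (g (U \<tau> x) - g (U t x) - ?D (U t x) (U \<tau> x - U t x)) / norm (U \<tau> x - U t x))" for \<tau> x
  have om_m: "\<omega> \<tau> \<in> borel_measurable borel" if "\<tau> \<in> {0..T}" for \<tau>
  proof -
    note [measurable] = m[OF that] m[OF t]
    have "(\<lambda>x. ?D (U t x) (U \<tau> x - U t x)) \<in> borel_measurable borel" by (rule gm) measurable
    note [measurable] = this
    show ?thesis unfolding \<omega>_def by measurable
  qed
  have om_nn: "0 \<le> \<omega> \<tau> x" for \<tau> x by (simp add: \<omega>_def)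
  have om_le: "\<omega> \<tau> x \<le> 2 * L" if "\<tau> \<in> {0..T}" for \<tau> x
  proof (cases "U \<tau> x = U t x")
    case False
    have "norm (g (U \<tau> x) - g (U t x) - ?D (U t x) (U \<tau> x - U t x)) \<le> norm (g (U \<tau> x) - g (U t x)) + norm (?D (U t x) (U \<tau> x - U t x))"
      by (rule norm_triangle_ineq4)
    also have "\<dots> \<le> L * norm (U \<tau> x - U t x) + L * norm (U \<tau> x - U t x)"
      using L M t that by (intro add_mono) auto
    finally show ?thesis using False by (simp add: \<omega>_def divide_simps)
  qed (use L in \<open>simp add: \<omega>_def\<close>)
  have om_lim: "((\<lambda>\<tau>. \<omega> \<tau> x) \<longlongrightarrow> 0) ?F" for x
  proof -
    have "((\<lambda>y. norm (g y - g (U t x) - ?D (U t x) (y - U t x)) / norm (y - U t x)) \<longlongrightarrow> 0) (at (U t x))"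
      using Ck_on_Suc_UNIV_frechet(1)[OF g, of "U t x"] by (simp add: has_derivative_iff_norm)
    then have "isCont (\<lambda>y. if y = U t x then 0 else norm (g y - g (U t x) - ?D (U t x) (y - U t x)) / norm (y - U t x)) (U t x)"
      unfolding isCont_def by (simp cong: LIM_cong)
    then show ?thesis unfolding \<omega>_def using isCont_tendsto_compose[OF _ cont[of x]] by fastforce
  qed
  let ?r = "\<lambda>\<tau> x. (U \<tau> x - U t x) /\<^sub>R (\<tau> - t) - U' x"
  let ?R = "\<lambda>\<tau> x. (g (U \<tau> x) - g (U t x)) /\<^sub>R (\<tau> - t) - ?D (U t x) (U' x)"
  have sr: "square_integrable (?r \<tau>)" if "\<tau> \<in> {0..T}" for \<tau>
    by (intro square_integrable_diff[OF square_integrable_bounded_linear[OF _ bounded_linear_scaleR_right]] U' Ud that)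
  \<comment> \<open>The norm of \<open>?R\<close> is at most \<open>3 * L\<close> times that of
    \<open>?r\<close> plus \<open>\<omega>\<close> times that of \<open>U'\<close>, because
    \<open>\<omega> + L \<le> 3 * L\<close>; squaring a sum doubles the squares, and
    \<open>2 * 3^2 = 18\<close>.\<close>
  have pw: "(norm (?R \<tau> x))\<^sup>2 \<le> 18 * L\<^sup>2 * (norm (?r \<tau> x))\<^sup>2 + 2 * ((\<omega> \<tau> x)\<^sup>2 * (norm (U' x))\<^sup>2)" if "\<tau> \<in> {0..T}" for \<tau> x
  proof -
    define a where "a = g (U \<tau> x) - g (U t x) - ?D (U t x) (U \<tau> x - U t x)"
    have lin: "linear (?D (U t x))" by (rule Ck_on_Suc_linear[OF g])
    have "?R \<tau> x = a /\<^sub>R (\<tau> - t) + ?D (U t x) (?r \<tau> x)"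
      by (simp add: a_def linear_diff[OF lin] linear_scale[OF lin] scaleR_diff_right)
    then have "norm (?R \<tau> x) \<le> norm (a /\<^sub>R (\<tau> - t)) + norm (?D (U t x) (?r \<tau> x))"
      by (simp only: norm_triangle_ineq)
    also have "norm (?D (U t x) (?r \<tau> x)) \<le> L * norm (?r \<tau> x)" by (rule L(2)[OF M[OF t]])
    also have "norm (a /\<^sub>R (\<tau> - t)) = \<omega> \<tau> x * norm ((U \<tau> x - U t x) /\<^sub>R (\<tau> - t))"
      by (cases "U \<tau> x = U t x") (simp_all add: a_def \<omega>_def linear_0[OF lin])
    also have "norm ((U \<tau> x - U t x) /\<^sub>R (\<tau> - t)) \<le> norm (?r \<tau> x) + norm (U' x)"
      using norm_triangle_ineq[of "?r \<tau> x" "U' x"] by simp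
    finally have "norm (?R \<tau> x) \<le> \<omega> \<tau> x * (norm (?r \<tau> x) + norm (U' x)) + L * norm (?r \<tau> x)"
      using om_nn by (simp add: mult_left_mono)
    also have "\<dots> \<le> 3 * L * norm (?r \<tau> x) + \<omega> \<tau> x * norm (U' x)"
      using mult_right_mono[OF om_le[OF that, of x] norm_ge_zero[of "?r \<tau> x"]] by (simp add: algebra_simps)
    finally have "(norm (?R \<tau> x))\<^sup>2 \<le> (3 * L * norm (?r \<tau> x) + \<omega> \<tau> x * norm (U' x))\<^sup>2"
      by (intro power_mono) auto
    also have "\<dots> \<le> 2 * (3 * L * norm (?r \<tau> x))\<^sup>2 + 2 * (\<omega> \<tau> x * norm (U' x))\<^sup>2"
      using norm_add_power2_le[of "3 * L * norm (?r \<tau> x)" "\<omega> \<tau> x * norm (U' x)"] by simp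
    finally show ?thesis by (simp add: power_mult_distrib)
  qed
  have wi: "integrable lborel (\<lambda>x. 4 * L\<^sup>2 * (norm (U' x))\<^sup>2)" using U' by (simp add: square_integrable_def)
  have om2: "(\<omega> \<tau> x)\<^sup>2 * (norm (U' x))\<^sup>2 \<le> 4 * L\<^sup>2 * (norm (U' x))\<^sup>2" if "\<tau> \<in> {0..T}" for \<tau> x
    using power_mono[OF om_le[OF that, of x] om_nn, of 2] by (intro mult_right_mono) (auto simp: power_mult_distrib)
  have omi: "integrable lborel (\<lambda>x. (\<omega> \<tau> x)\<^sup>2 * (norm (U' x))\<^sup>2)" if "\<tau> \<in> {0..T}" for \<tau>
  proof (rule Bochner_Integration.integrable_bound[OF wi])
    show "(\<lambda>x. (\<omega> \<tau> x)\<^sup>2 * (norm (U' x))\<^sup>2) \<in> borel_measurable lborel" using om_m[OF that] by measurable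
    show "AE x in lborel. norm ((\<omega> \<tau> x)\<^sup>2 * (norm (U' x))\<^sup>2) \<le> norm (4 * L\<^sup>2 * (norm (U' x))\<^sup>2)"
      using om2[OF that] by (intro AE_I2) simp
  qed
  have lim2: "((\<lambda>\<tau>. LINT x|lborel. (\<omega> \<tau> x)\<^sup>2 * (norm (U' x))\<^sup>2) \<longlongrightarrow> (LINT x::real^3|lborel. 0)) ?F"
  proof (rule dominated_convergence_at[OF _ _ wi])
    show "AE x in lborel. ((\<lambda>\<tau>. (\<omega> \<tau> x)\<^sup>2 * (norm (U' x))\<^sup>2) \<longlongrightarrow> 0) ?F"
    proof (rule AE_I2)
      fix x
      have "((\<lambda>\<tau>. (\<omega> \<tau> x)\<^sup>2 * (norm (U' x))\<^sup>2) \<longlongrightarrow> 0\<^sup>2 * (norm (U' x))\<^sup>2) ?F" by (intro tendsto_intros om_lim)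
      then show "((\<lambda>\<tau>. (\<omega> \<tau> x)\<^sup>2 * (norm (U' x))\<^sup>2) \<longlongrightarrow> 0) ?F" by simp
    qed
    show "(\<lambda>x. (\<omega> \<tau> x)\<^sup>2 * (norm (U' x))\<^sup>2) \<in> borel_measurable lborel" if "\<tau> \<in> {0..T} - {t}" for \<tau>
    proof -
      have [measurable]: "\<omega> \<tau> \<in> borel_measurable borel" using om_m that by blast
      show ?thesis by measurable
    qed
    show "AE x in lborel. norm ((\<omega> \<tau> x)\<^sup>2 * (norm (U' x))\<^sup>2) \<le> 4 * L\<^sup>2 * (norm (U' x))\<^sup>2" if "\<tau> \<in> {0..T} - {t}" for \<tau>
      using om2 that by (intro AE_I2) simp
  qed simp
  show ?thesis unfolding L2_deriv_def
  proof (intro conjI ballI)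
    show "square_integrable (\<lambda>x. ?D (U t x) (U' x))" by (rule sD[OF U'])
    show "square_integrable (\<lambda>x. g (U \<tau> x) - g (U t x))" if "\<tau> \<in> {0..T}" for \<tau> by (rule sg[OF that])
    show "((\<lambda>\<tau>. LINT x|lborel. (norm (?R \<tau> x))\<^sup>2) \<longlongrightarrow> 0) ?F"
    proof (rule Lim_null_comparison)
      have "((\<lambda>\<tau>. 18 * L\<^sup>2 * (LINT x|lborel. (norm (?r \<tau> x))\<^sup>2) + 2 * (LINT x|lborel. (\<omega> \<tau> x)\<^sup>2 * (norm (U' x))\<^sup>2)) \<longlongrightarrow> 18 * L\<^sup>2 * 0 + 2 * 0) ?F"
        using lim2 by (intro tendsto_add tendsto_mult tendsto_const lim) simp
      then show "((\<lambda>\<tau>. 18 * L\<^sup>2 * (LINT x|lborel. (norm (?r \<tau> x))\<^sup>2) + 2 * (LINT x|lborel. (\<omega> \<tau> x)\<^sup>2 * (norm (U' x))\<^sup>2)) \<longlongrightarrow> 0) ?F" by simp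
      show "\<forall>\<^sub>F \<tau> in ?F. norm (LINT x|lborel. (norm (?R \<tau> x))\<^sup>2) \<le> 18 * L\<^sup>2 * (LINT x|lborel. (norm (?r \<tau> x))\<^sup>2) + 2 * (LINT x|lborel. (\<omega> \<tau> x)\<^sup>2 * (norm (U' x))\<^sup>2)"
        using eventually_at_within_mem
      proof eventually_elim
        case (elim \<tau>)
        have i1: "integrable lborel (\<lambda>x. (norm (?r \<tau> x))\<^sup>2)" using sr[OF elim] by (simp add: square_integrable_def)
        have "square_integrable (?R \<tau>)"
          by (intro square_integrable_diff[OF square_integrable_bounded_linear[OF _ bounded_linear_scaleR_right]] sD U' sg elim)
        then have i2: "integrable lborel (\<lambda>x. (norm (?R \<tau> x))\<^sup>2)" by (simp add: square_integrable_def)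
        have "(LINT x|lborel. (norm (?R \<tau> x))\<^sup>2) \<le> (LINT x|lborel. 18 * L\<^sup>2 * (norm (?r \<tau> x))\<^sup>2 + 2 * ((\<omega> \<tau> x)\<^sup>2 * (norm (U' x))\<^sup>2))"
          by (rule integral_mono[OF i2 _ pw[OF elim]]) (intro Bochner_Integration.integrable_add integrable_mult_right i1 omi elim)
        also have "\<dots> = 18 * L\<^sup>2 * (LINT x|lborel. (norm (?r \<tau> x))\<^sup>2) + 2 * (LINT x|lborel. (\<omega> \<tau> x)\<^sup>2 * (norm (U' x))\<^sup>2)"
          by (subst Bochner_Integration.integral_add) (auto intro!: integrable_mult_right i1 omi elim)
        finally show ?case by simp
      qed
    qed
  qed
qed

lemma L2_deriv_diff:
  assumes a: "L2_deriv T a a' t" and b: "L2_deriv T b b' t" and t: "t \<in> {0..T}"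
  shows "L2_deriv T (\<lambda>\<tau> x. a \<tau> x - b \<tau> x) (\<lambda>x. a' x - b' x) t"
  unfolding L2_deriv_def
proof (intro conjI ballI)
  have s: "square_integrable a'" "square_integrable b'"
    "\<And>\<tau>. \<tau> \<in> {0..T} \<Longrightarrow> square_integrable (\<lambda>x. a \<tau> x - a t x)" "\<And>\<tau>. \<tau> \<in> {0..T} \<Longrightarrow> square_integrable (\<lambda>x. b \<tau> x - b t x)"
    using a b by (auto simp: L2_deriv_def)
  show "square_integrable (\<lambda>x. a' x - b' x)" by (intro square_integrable_diff s)
  show "square_integrable (\<lambda>x. a \<tau> x - b \<tau> x - (a t x - b t x))" if "\<tau> \<in> {0..T}" for \<tau>
    using square_integrable_diff[OF s(3)[OF that] s(4)[OF that]] by (simp add: algebra_simps)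
  let ?ra = "\<lambda>\<tau> x. (a \<tau> x - a t x) /\<^sub>R (\<tau> - t) - a' x" and ?rb = "\<lambda>\<tau> x. (b \<tau> x - b t x) /\<^sub>R (\<tau> - t) - b' x"
  have sr: "square_integrable (?ra \<tau>)" "square_integrable (?rb \<tau>)" if "\<tau> \<in> {0..T}" for \<tau>
    by (intro square_integrable_diff[OF square_integrable_bounded_linear[OF _ bounded_linear_scaleR_right]] s that)+
  show "((\<lambda>\<tau>. LINT x|lborel. (norm ((a \<tau> x - b \<tau> x - (a t x - b t x)) /\<^sub>R (\<tau> - t) - (a' x - b' x)))\<^sup>2) \<longlongrightarrow> 0) (at t within {0..T})"
  proof (rule Lim_null_comparison)
    have "((\<lambda>\<tau>. 2 * (LINT x|lborel. (norm (?ra \<tau> x))\<^sup>2) + 2 * (LINT x|lborel. (norm (?rb \<tau> x))\<^sup>2)) \<longlongrightarrow> 2 * 0 + 2 * 0) (at t within {0..T})"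
      using a b by (intro tendsto_add tendsto_mult tendsto_const) (auto simp: L2_deriv_def)
    then show "((\<lambda>\<tau>. 2 * (LINT x|lborel. (norm (?ra \<tau> x))\<^sup>2) + 2 * (LINT x|lborel. (norm (?rb \<tau> x))\<^sup>2)) \<longlongrightarrow> 0) (at t within {0..T})" by simp
    show "\<forall>\<^sub>F \<tau> in at t within {0..T}. norm (LINT x|lborel. (norm ((a \<tau> x - b \<tau> x - (a t x - b t x)) /\<^sub>R (\<tau> - t) - (a' x - b' x)))\<^sup>2) \<le> 2 * (LINT x|lborel. (norm (?ra \<tau> x))\<^sup>2) + 2 * (LINT x|lborel. (norm (?rb \<tau> x))\<^sup>2)"
      using eventually_at_within_mem
    proof eventually_elim
      case (elim \<tau>)
      have eq: "(a \<tau> x - b \<tau> x - (a t x - b t x)) /\<^sub>R (\<tau> - t) - (a' x - b' x) = ?ra \<tau> x - ?rb \<tau> x" for x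
        by (simp add: scaleR_diff_right)
      have i: "integrable lborel (\<lambda>x. (norm (?ra \<tau> x))\<^sup>2)" "integrable lborel (\<lambda>x. (norm (?rb \<tau> x))\<^sup>2)"
        "integrable lborel (\<lambda>x. (norm (?ra \<tau> x - ?rb \<tau> x))\<^sup>2)"
        using sr[OF elim] square_integrable_diff[OF sr[OF elim]] by (auto simp: square_integrable_def)
      have "(LINT x|lborel. (norm (?ra \<tau> x - ?rb \<tau> x))\<^sup>2) \<le> (LINT x|lborel. 2 * (norm (?ra \<tau> x))\<^sup>2 + 2 * (norm (?rb \<tau> x))\<^sup>2)"
      proof (rule integral_mono[OF i(3)])
        show "(norm (?ra \<tau> x - ?rb \<tau> x))\<^sup>2 \<le> 2 * (norm (?ra \<tau> x))\<^sup>2 + 2 * (norm (?rb \<tau> x))\<^sup>2" for x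
          using norm_add_power2_le[of "?ra \<tau> x" "- ?rb \<tau> x"] by (simp only: norm_minus_cancel add_uminus_conv_diff)
      qed (intro Bochner_Integration.integrable_add integrable_mult_right i)
      also have "\<dots> = 2 * (LINT x|lborel. (norm (?ra \<tau> x))\<^sup>2) + 2 * (LINT x|lborel. (norm (?rb \<tau> x))\<^sup>2)"
        by (subst Bochner_Integration.integral_add) (auto intro!: integrable_mult_right i)
      finally show ?case unfolding eq by simp
    qed
  qed
qed

lemma Ck_on_slice:
  fixes f :: "real \<times> 'a::real_normed_vector \<Rightarrow> 'b::real_normed_vector"
  assumes "Ck_on k ({0..T} \<times> UNIV) f" "t \<in> {0..T}"
  shows "Ck_on k UNIV (\<lambda>x. f (t, x))"
  using assms
proof (induction k arbitrary: f)
  case 0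
  then show ?case by (auto intro!: continuous_on_compose2[of "{0..T} \<times> UNIV" f] continuous_intros)
next
  case (Suc k)
  from Suc.prems(1) obtain f' where f': "\<forall>z\<in>{0..T} \<times> UNIV. (f has_derivative f' z) (at z within {0..T} \<times> UNIV)"
    "\<forall>h. Ck_on k ({0..T} \<times> UNIV) (\<lambda>z. f' z h)" unfolding Ck_on.simps by blast
  have "((\<lambda>x. f (t, x)) has_derivative (\<lambda>h. f' (t, x) (0, h))) (at x)" for x
  proof (rule has_derivative_in_compose[where f="\<lambda>x. (t, x)" and g=f])
    show "((\<lambda>x. (t, x)) has_derivative (\<lambda>h. (0, h))) (at x)" by (auto intro!: derivative_eq_intros)
    show "(f has_derivative f' (t, x)) (at (t, x) within range (\<lambda>x. (t, x)))"
      by (rule has_derivative_subset[of _ _ _ "{0..T} \<times> UNIV"]) (use f' Suc.prems(2) in auto)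
  qed
  moreover have "Ck_on k UNIV (\<lambda>x. f' (t, x) (0, h))" for h
    using Suc.IH[OF f'(2)[rule_format] Suc.prems(2)] .
  ultimately show ?case unfolding Ck_on.simps by (auto intro!: exI[of _ "\<lambda>x h. f' (t, x) (0, h)"] simp del: Ck_on.simps)
qed

text \<open>The time derivative is the full derivative within the slab in direction
  \<open>(1, 0)\<close>. It inherits all but one order of regularity from \<open>Ck_on\<close>,
  which allows \<open>pdt\<close> to be iterated.\<close>

lemma
  fixes u :: "real \<Rightarrow> real^3 \<Rightarrow> 'b::real_normed_vector"
  assumes C: "Ck_on (Suc k) ({0..T} \<times> UNIV) (\<lambda>(t, x). u t x)" and T: "T > 0"
  shows slab_has_vector_derivative: "t \<in> {0..T} \<Longrightarrow> ((\<lambda>s. u s x) has_vector_derivative pdt T u t x) (at t within {0..T})"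
    and Ck_on_slab_pdt: "Ck_on k ({0..T} \<times> UNIV) (\<lambda>(t, x). pdt T u t x)"
proof -
  let ?f = "\<lambda>(t, x). u t x"
  from C obtain f' where f': "\<forall>z\<in>{0..T} \<times> UNIV. (?f has_derivative f' z) (at z within {0..T} \<times> UNIV)"
    "\<forall>h. Ck_on k ({0..T} \<times> UNIV) (\<lambda>z. f' z h)" unfolding Ck_on.simps by blast
  have D: "((\<lambda>s. u s x) has_vector_derivative f' (t, x) (1, 0)) (at t within {0..T})" if t: "t \<in> {0..T}" for t x
  proof -
    have d: "(?f has_derivative f' (t, x)) (at (t, x) within {0..T} \<times> UNIV)" using f' t by auto
    have "((\<lambda>s. ?f (s, x)) has_derivative (\<lambda>h. f' (t, x) (h, 0))) (at t within {0..T})"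
    proof (rule has_derivative_in_compose[where f="\<lambda>s. (s, x)" and g="?f"])
      show "((\<lambda>s. (s, x)) has_derivative (\<lambda>h. (h, 0))) (at t within {0..T})" by (auto intro!: derivative_eq_intros)
      show "(?f has_derivative f' (t, x)) (at (t, x) within (\<lambda>s. (s, x)) ` {0..T})"
        by (rule has_derivative_subset[OF d]) auto
    qed
    moreover have "(\<lambda>h. f' (t, x) (h, 0)) = (\<lambda>h. h *\<^sub>R f' (t, x) (1, 0))"
    proof
      fix h show "f' (t, x) (h, 0) = h *\<^sub>R f' (t, x) (1, 0)"
        using linear_scale[OF has_derivative_linear[OF d], of h "(1, 0)"]
        by (simp only: scaleR_Pair scaleR_zero_right real_scaleR_def mult_1_right)
    qed
    ultimately show ?thesis by (simp only: has_vector_derivative_def case_prod_conv)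
  qed
  have eq: "pdt T u t x = f' (t, x) (1, 0)" if "t \<in> {0..T}" for t x
    unfolding pdt_def by (rule vector_derivative_within[OF at_within_Icc_nontrivial[OF T that] D[OF that]])
  show "((\<lambda>s. u s x) has_vector_derivative pdt T u t x) (at t within {0..T})" if "t \<in> {0..T}"
    unfolding eq[OF that] by (rule D[OF that])
  show "Ck_on k ({0..T} \<times> UNIV) (\<lambda>(t, x). pdt T u t x)"
    by (rule Ck_on_cong[OF f'(2)[rule_format, of "(1, 0)"]]) (auto simp: eq)
qed

section \<open>The energy estimate\<close>

lemma Gronwall_Icc:
  fixes E :: "real \<Rightarrow> real"
  assumes D: "\<And>t. t \<in> {0..T} \<Longrightarrow> (E has_real_derivative E' t) (at t within {0..T})"
    and le: "\<And>t. t \<in> {0..T} \<Longrightarrow> E' t \<le> k * E t + b" and k: "k \<ge> 0" and b: "b \<ge> 0" and t: "t \<in> {0..T}"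
  shows "E t \<le> exp (k * T) * (\<bar>E 0\<bar> + b * T)"
proof -
  \<comment> \<open>The integrating factor removes the term \<open>k * E\<close>; subtracting
    \<open>b * s\<close> compensates the forcing, as the factor is at most 1. So \<open>f\<close>
    does not increase.\<close>
  define f where "f s = exp (- (k * s)) * E s - b * s" for s
  have Df: "(f has_real_derivative exp (- (k * s)) * (E' s - k * E s) - b) (at s within {0..T})" if "s \<in> {0..T}" for s
    unfolding f_def using D[OF that] by (auto intro!: derivative_eq_intros simp: algebra_simps)
  have "f t \<le> f 0"
  proof (rule DERIV_nonpos_imp_decreasing_open[where f=f and a=0 and b=t])
    show "0 \<le> t" using t by simp
    show "continuous_on {0..t} f"
    proof (rule continuous_on_subset)
      show "continuous_on {0..T} f" by (rule DERIV_continuous_on[OF Df])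
    qed (use t in auto)
    fix s assume s: "0 < s" "s < t"
    have sT: "s \<in> {0..T}" using s t by auto
    have "at s within {0..T} = at s" using s t by (intro at_within_Icc_at) auto
    then have "DERIV f s :> exp (- (k * s)) * (E' s - k * E s) - b" using Df[OF sT] by simp
    moreover have "exp (- (k * s)) * (E' s - k * E s) \<le> b"
    proof -
      have "exp (- (k * s)) * (E' s - k * E s) \<le> exp (- (k * s)) * b" using le[OF sT] by (intro mult_left_mono) auto
      also have "\<dots> \<le> 1 * b" using k b s by (intro mult_right_mono) auto
      finally show ?thesis by simp
    qed
    ultimately show "\<exists>y. DERIV f s :> y \<and> y \<le> 0" by (intro exI conjI) auto
  qed
  then have "exp (- (k * t)) * E t \<le> E 0 + b * t" by (simp add: f_def)
  also have "\<dots> \<le> \<bar>E 0\<bar> + b * T" using t b by (intro add_mono mult_left_mono) auto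
  finally have "exp (k * t) * (exp (- (k * t)) * E t) \<le> exp (k * t) * (\<bar>E 0\<bar> + b * T)" by (intro mult_left_mono) auto
  also have "\<dots> \<le> exp (k * T) * (\<bar>E 0\<bar> + b * T)"
    using t k b by (intro mult_right_mono add_nonneg_nonneg mult_nonneg_nonneg) (auto intro: mult_left_mono)
  also have "exp (k * t) * (exp (- (k * t)) * E t) = E t" by (simp add: exp_minus)
  finally show ?thesis .
qed

section \<open>Pointwise inequalities for the energy and its dissipation\<close>

lemma two_mult_le_weighted:
  fixes a b c :: real
  assumes "c > 0" shows "2 * a * b \<le> c * a\<^sup>2 + b\<^sup>2 / c"
proof -
  have "0 \<le> (c * a - b)\<^sup>2 / c" using assms by simp
  also have "\<dots> = c * a\<^sup>2 + b\<^sup>2 / c - 2 * a * b" using assms by (simp add: power2_eq_square field_simps)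
  finally show ?thesis by simp
qed

lemma inner_abs_le: "\<bar>a \<bullet> b\<bar> \<le> norm a * norm (b::'a::real_inner)"
  by (rule Cauchy_Schwarz_ineq2)

text \<open>The mixed term in \<open>w\<close> and \<open>wt\<close> is absorbed with
  \<open>1/8\<close> of the squares to spare. Half of the gradient term absorbs the stress term at
  the cost \<open>2 * L^2 / \<mu>\<close> times the square of \<open>norm g\<close>, which dictates
  the last coefficient of the energy.\<close>

lemma energy_density_lower:
  fixes w wt :: "'a::real_inner" and d g s :: "'b::real_inner" and \<epsilon> \<mu> L :: real
  assumes e: "0 < \<epsilon>" "\<epsilon> \<le> 1" and mu: "\<mu> > 0" and s: "norm s \<le> L * norm g"
  shows "min (1/8) (\<mu>/2) * ((norm w)\<^sup>2 + (norm g)\<^sup>2 + \<epsilon>\<^sup>2 * (norm wt)\<^sup>2 + \<epsilon> * (norm d)\<^sup>2)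
    \<le> (norm w)\<^sup>2 / 2 + \<epsilon> * (w \<bullet> wt) + \<epsilon>\<^sup>2 * (norm wt)\<^sup>2 + \<epsilon> * \<mu> * (norm d)\<^sup>2 + 2 * \<epsilon> * (s \<bullet> d) + (1 + 2 * L\<^sup>2 / \<mu>) * (norm g)\<^sup>2"
proof -
  define c where "c = min (1/8) (\<mu>/2)"
  define a b x y where "a = norm w" and "b = \<epsilon> * norm wt" and "x = norm d" and "y = norm g"
  have c: "c \<le> 1/8" "c \<le> \<mu>/2" "0 < c" using mu by (auto simp: c_def)
  have nn: "0 \<le> x" "0 \<le> y" by (simp_all add: x_def y_def)
  have 1: "\<epsilon> * (w \<bullet> wt) \<ge> - (a * b)"
  proof -
    have "\<epsilon> * (w \<bullet> wt) \<ge> \<epsilon> * (- (norm w * norm wt))"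
      using inner_abs_le[of w wt] e by (intro mult_left_mono) auto
    then show ?thesis by (simp add: a_def b_def mult_ac)
  qed
  have "\<bar>s \<bullet> d\<bar> \<le> L * y * x"
    using inner_abs_le[of s d] mult_right_mono[OF s, of "norm d"] by (simp add: x_def y_def)
  then have "2 * \<epsilon> * (s \<bullet> d) \<ge> 2 * \<epsilon> * (- (L * y * x))" using e by (intro mult_left_mono) auto
  moreover have "2 * x * (L * y) \<le> (\<mu>/2) * x\<^sup>2 + (L * y)\<^sup>2 / (\<mu>/2)" using mu by (intro two_mult_le_weighted) auto
  then have "\<epsilon> * (2 * x * (L * y)) \<le> \<epsilon> * ((\<mu>/2) * x\<^sup>2 + (L * y)\<^sup>2 / (\<mu>/2))" using e by (intro mult_left_mono) auto
  moreover have "\<epsilon> * ((L * y)\<^sup>2 / (\<mu>/2)) \<le> 1 * ((L * y)\<^sup>2 / (\<mu>/2))" using e mu by (intro mult_right_mono) auto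
  ultimately have 2: "2 * \<epsilon> * (s \<bullet> d) \<ge> - ((\<mu> * (\<epsilon> * x\<^sup>2)) / 2) - 2 * (L\<^sup>2 / \<mu> * y\<^sup>2)"
    using mu by (simp add: algebra_simps power_mult_distrib)
  \<comment> \<open>Completed square of the quadratic form in \<open>a\<close> and \<open>b\<close>
    that remains after \<open>1/8\<close> of both squares has been taken away.\<close>
  have "0 \<le> (3/8) * (a - (4/3) * b)\<^sup>2 + (5/24) * b\<^sup>2" by simp
  also have "\<dots> = a\<^sup>2 / 2 - a * b + b\<^sup>2 - (a\<^sup>2 + b\<^sup>2) / 8" by (simp add: power2_eq_square algebra_simps add_divide_distrib)
  finally have 3: "a\<^sup>2 / 8 + b\<^sup>2 / 8 \<le> a\<^sup>2 / 2 - a * b + b\<^sup>2" by (simp add: add_divide_distrib)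
  have "c * a\<^sup>2 \<le> (1/8) * a\<^sup>2" "c * b\<^sup>2 \<le> (1/8) * b\<^sup>2" using c by (intro mult_right_mono; simp)+
  then have 4: "c * a\<^sup>2 \<le> a\<^sup>2 / 8" "c * b\<^sup>2 \<le> b\<^sup>2 / 8" by simp_all
  have "c * (\<epsilon> * x\<^sup>2) \<le> \<mu>/2 * (\<epsilon> * x\<^sup>2)" using c e by (intro mult_right_mono) auto
  then have 5: "c * (\<epsilon> * x\<^sup>2) \<le> (\<mu> * (\<epsilon> * x\<^sup>2)) / 2" by simp
  have 6: "c * y\<^sup>2 \<le> 1 * y\<^sup>2" using c by (intro mult_right_mono) auto
  have "c * (a\<^sup>2 + y\<^sup>2 + b\<^sup>2 + \<epsilon> * x\<^sup>2) \<le> a\<^sup>2 / 2 + \<epsilon> * (w \<bullet> wt) + b\<^sup>2 + \<mu> * (\<epsilon> * x\<^sup>2) + 2 * \<epsilon> * (s \<bullet> d) + (1 + 2 * (L\<^sup>2 / \<mu>)) * y\<^sup>2"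
    using 1 2[unfolded mult.assoc] 3 4 5 6 unfolding distrib_right distrib_left mult.assoc mult_1_left by linarith
  then show ?thesis by (simp add: a_def b_def x_def y_def c_def power_mult_distrib mult_ac)
qed

text \<open>The gradient term is counted twice, once for itself and once for the stress term; of the
  three units of \<open>L^2 / \<mu>\<close>, two belong to the energy and one to the stress
  term.\<close>

lemma energy_density_upper:
  fixes w wt :: "'a::real_inner" and d g s :: "'b::real_inner" and \<epsilon> \<mu> L :: real
  assumes e: "0 < \<epsilon>" "\<epsilon> \<le> 1" and mu: "\<mu> > 0" and s: "norm s \<le> L * norm g"
  shows "(norm w)\<^sup>2 / 2 + \<epsilon> * (w \<bullet> wt) + \<epsilon>\<^sup>2 * (norm wt)\<^sup>2 + \<epsilon> * \<mu> * (norm d)\<^sup>2 + 2 * \<epsilon> * (s \<bullet> d) + (1 + 2 * L\<^sup>2 / \<mu>) * (norm g)\<^sup>2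
    \<le> (2 + 2 * \<mu> + 3 * L\<^sup>2 / \<mu>) * ((norm w)\<^sup>2 + (norm g)\<^sup>2 + \<epsilon>\<^sup>2 * (norm wt)\<^sup>2 + \<epsilon> * (norm d)\<^sup>2)"
proof -
  define a b x y where "a = norm w" and "b = \<epsilon> * norm wt" and "x = norm d" and "y = norm g"
  define r where "r = L\<^sup>2 / \<mu>"
  have r: "0 \<le> r" using mu by (simp add: r_def)
  have "\<epsilon> * (w \<bullet> wt) \<le> \<epsilon> * (norm w * norm wt)"
    using inner_abs_le[of w wt] e by (intro mult_left_mono) auto
  then have 1: "\<epsilon> * (w \<bullet> wt) \<le> a\<^sup>2 / 2 + b\<^sup>2 / 2"
    using sum_squares_bound[of a b] by (simp add: a_def b_def mult_ac)
  have "\<bar>s \<bullet> d\<bar> \<le> L * y * x"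
    using inner_abs_le[of s d] mult_right_mono[OF s, of "norm d"] by (simp add: x_def y_def)
  then have "2 * \<epsilon> * (s \<bullet> d) \<le> 2 * \<epsilon> * (L * y * x)" using e by (intro mult_left_mono) auto
  moreover have "2 * x * (L * y) \<le> \<mu> * x\<^sup>2 + (L * y)\<^sup>2 / \<mu>" using mu by (intro two_mult_le_weighted) auto
  then have "\<epsilon> * (2 * x * (L * y)) \<le> \<epsilon> * (\<mu> * x\<^sup>2 + (L * y)\<^sup>2 / \<mu>)" using e by (intro mult_left_mono) auto
  moreover have "\<epsilon> * ((L * y)\<^sup>2 / \<mu>) \<le> 1 * ((L * y)\<^sup>2 / \<mu>)" using e mu by (intro mult_right_mono) auto
  ultimately have 2: "2 * \<epsilon> * (s \<bullet> d) \<le> \<mu> * (\<epsilon> * x\<^sup>2) + r * y\<^sup>2"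
    using mu by (simp add: algebra_simps power_mult_distrib r_def)
  have nn: "0 \<le> \<epsilon> * x\<^sup>2" using e by simp
  have 3: "0 \<le> \<mu> * a\<^sup>2" "0 \<le> \<mu> * b\<^sup>2" "0 \<le> \<mu> * y\<^sup>2" "0 \<le> r * a\<^sup>2" "0 \<le> r * b\<^sup>2" "0 \<le> r * y\<^sup>2" "0 \<le> r * (\<epsilon> * x\<^sup>2)" "0 \<le> \<mu> * (\<epsilon> * x\<^sup>2)"
    using mu r nn by simp_all
  have "a\<^sup>2 / 2 + \<epsilon> * (w \<bullet> wt) + b\<^sup>2 + \<mu> * (\<epsilon> * x\<^sup>2) + 2 * \<epsilon> * (s \<bullet> d) + (1 + 2 * r) * y\<^sup>2 \<le> (2 + 2 * \<mu> + 3 * r) * (a\<^sup>2 + y\<^sup>2 + b\<^sup>2 + \<epsilon> * x\<^sup>2)"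
    using 1 2[unfolded mult.assoc] 3 nn zero_le_power2[of a] zero_le_power2[of b] zero_le_power2[of y]
    unfolding distrib_right distrib_left mult.assoc mult_1_left by linarith
  then show ?thesis by (simp add: a_def b_def x_def y_def r_def power_mult_distrib mult_ac)
qed

text \<open>Of \<open>\<mu>\<close> times the square of \<open>norm d\<close>, a quarter absorbs the
  part of \<open>st\<close> linear in \<open>d\<close>, by smallness of \<open>\<epsilon>\<close>,
  and a half absorbs all products of \<open>norm d\<close> and \<open>norm g\<close>, whose
  coefficients add up to \<open>L + 2 * N + k\<close>.\<close>

lemma dissipation_density:
  fixes w wt h :: "'a::real_inner" and d g s st :: "'b::real_inner" and \<epsilon> \<mu> L :: real
  assumes e: "0 < \<epsilon>" "\<epsilon> \<le> 1" and mu: "\<mu> > 0" and s: "norm s \<le> L * norm g" and L: "0 \<le> L" and N: "0 \<le> N" and k: "0 \<le> k"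
    and st: "norm st \<le> L * norm d + N * norm g" and small: "8 * L * \<epsilon> \<le> \<mu>"
  shows "- \<epsilon> * (norm wt)\<^sup>2 - d \<bullet> s - \<mu> * (norm d)\<^sup>2 - \<epsilon> * (w \<bullet> h) - 2 * \<epsilon>\<^sup>2 * (wt \<bullet> h) + 2 * \<epsilon> * (st \<bullet> d) + k * (d \<bullet> g)
    \<le> (1 + (L + 2 * N + k)\<^sup>2 / \<mu>) * ((norm w)\<^sup>2 + (norm g)\<^sup>2 + \<epsilon>\<^sup>2 * (norm wt)\<^sup>2 + \<epsilon> * (norm d)\<^sup>2) + 2 * \<epsilon>\<^sup>2 * (norm h)\<^sup>2"
proof -
  define a b x y z where "a = norm w" and "b = \<epsilon> * norm wt" and "x = norm d" and "y = norm g" and "z = \<epsilon> * norm h"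
  define c where "c = L + 2 * N + k"
  have nn: "0 \<le> x" "0 \<le> y" by (simp_all add: x_def y_def)
  have 1: "- (d \<bullet> s) \<le> L * (x * y)"
    using inner_abs_le[of d s] mult_left_mono[OF s, of "norm d"] by (simp add: x_def y_def mult_ac)
  have "\<epsilon> * (- (w \<bullet> h)) \<le> \<epsilon> * (norm w * norm h)" using inner_abs_le[of w h] e by (intro mult_left_mono) auto
  then have 2: "- (\<epsilon> * (w \<bullet> h)) \<le> a\<^sup>2 / 2 + z\<^sup>2 / 2" using sum_squares_bound[of a z] by (simp add: a_def z_def mult_ac)
  have "2 * \<epsilon>\<^sup>2 * (- (wt \<bullet> h)) \<le> 2 * \<epsilon>\<^sup>2 * (norm wt * norm h)" using inner_abs_le[of wt h] e by (intro mult_left_mono) auto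
  then have 3: "- (2 * \<epsilon>\<^sup>2 * (wt \<bullet> h)) \<le> b\<^sup>2 + z\<^sup>2"
    using sum_squares_bound[of b z] by (simp add: b_def z_def power2_eq_square mult_ac)
  have "\<bar>st \<bullet> d\<bar> \<le> (L * x + N * y) * x"
    using inner_abs_le[of st d] mult_right_mono[OF st, of "norm d"] by (simp add: x_def y_def)
  then have "2 * \<epsilon> * (st \<bullet> d) \<le> 2 * \<epsilon> * ((L * x + N * y) * x)" using e by (intro mult_left_mono) auto
  also have "\<dots> = (2 * L * \<epsilon>) * x\<^sup>2 + \<epsilon> * (2 * N * (x * y))" by (simp add: power2_eq_square algebra_simps)
  \<comment> \<open>The hypothesis \<open>small\<close> says
    \<open>2 * L * \<epsilon> \<le> \<mu> / 4\<close>, and \<open>\<epsilon> \<le> 1\<close> removes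
    the factor of the mixed term.\<close>
  also have "\<dots> \<le> (\<mu> / 4) * x\<^sup>2 + 1 * (2 * N * (x * y))"
    using small e N nn by (intro add_mono mult_right_mono) auto
  finally have 4: "2 * \<epsilon> * (st \<bullet> d) \<le> (\<mu> * x\<^sup>2) / 4 + 2 * N * (x * y)" by simp
  have 5: "k * (d \<bullet> g) \<le> k * (x * y)"
    using inner_abs_le[of d g] k by (intro mult_left_mono) (auto simp: x_def y_def)
  have "2 * x * (c * y) \<le> \<mu> * x\<^sup>2 + (c * y)\<^sup>2 / \<mu>" using mu by (rule two_mult_le_weighted)
  moreover have "2 * x * (c * y) = 2 * (c * (x * y))" by simp
  moreover have "(c * y)\<^sup>2 / \<mu> = (c\<^sup>2 / \<mu>) * y\<^sup>2" by (simp add: power_mult_distrib)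
  moreover have "0 \<le> (c\<^sup>2 / \<mu>) * y\<^sup>2" using mu by simp
  ultimately have six: "c * (x * y) \<le> (\<mu> * x\<^sup>2) / 2 + (c\<^sup>2 / \<mu>) * y\<^sup>2" by linarith
  define r where "r = c\<^sup>2 / \<mu>"
  note 6 = six[folded r_def]
  have r: "0 \<le> r" using mu by (simp add: r_def)
  have 7: "0 \<le> \<epsilon> * (norm wt)\<^sup>2" "0 \<le> r * a\<^sup>2" "0 \<le> r * b\<^sup>2" "0 \<le> r * (\<epsilon> * x\<^sup>2)" "0 \<le> \<epsilon> * x\<^sup>2" "0 \<le> \<mu> * x\<^sup>2"
    using e r mu by simp_all
  have "c * (x * y) = L * (x * y) + 2 * N * (x * y) + k * (x * y)" by (simp add: c_def algebra_simps)
  then have "- (\<epsilon> * (norm wt)\<^sup>2) - d \<bullet> s - \<mu> * x\<^sup>2 - \<epsilon> * (w \<bullet> h) - 2 * \<epsilon>\<^sup>2 * (wt \<bullet> h) + 2 * \<epsilon> * (st \<bullet> d) + k * (d \<bullet> g)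
    \<le> (1 + r) * (a\<^sup>2 + y\<^sup>2 + b\<^sup>2 + \<epsilon> * x\<^sup>2) + 2 * z\<^sup>2"
    using 1 2 3[unfolded mult.assoc] 4[unfolded mult.assoc] 5 6 7 zero_le_power2[of a] zero_le_power2[of b] zero_le_power2[of y] zero_le_power2[of z]
    unfolding distrib_right distrib_left mult.assoc mult_1_left by linarith
  then show ?thesis by (simp add: a_def b_def x_def y_def z_def r_def c_def power_mult_distrib mult_ac)
qed

lemma square_integrable_norm2: "square_integrable u \<Longrightarrow> integrable lborel (\<lambda>x. (norm (u x))\<^sup>2)"
  by (simp add: square_integrable_def)

text \<open>Here \<open>c\<close> is the constant of \<open>energy_density_lower\<close> and
  \<open>k\<close> the Gronwall rate, that is the constant of \<open>dissipation_density\<close>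
  divided by \<open>c\<close>. The middle factor collects the constant of
  \<open>energy_density_upper\<close> for the initial energy and \<open>2 * H * T\<close> for the
  forcing by the defect.\<close>

definition energy_const :: "real \<Rightarrow> real \<Rightarrow> real \<Rightarrow> real \<Rightarrow> real \<Rightarrow> real" where
  "energy_const \<mu> L N H T =
    (let c = min (1/8) (\<mu>/2); k = (1 + (L + 2 * N + (2 + 4 * L\<^sup>2 / \<mu>))\<^sup>2 / \<mu>) / c
     in exp (k * T) * ((2 + 2 * \<mu> + 3 * L\<^sup>2 / \<mu>) + 2 * H * T) / c)"

text \<open>The partial differential equation enters through its two tested forms and through
  \<open>dG\<close>. What remains concerns curves of square integrable functions with strong
  derivatives: the density inequalities are integrated and Gronwall's inequality is applied.\<close>

lemma energy_estimate:
  fixes W Wt Wtt Hh :: "real \<Rightarrow> real^3 \<Rightarrow> 'a::euclidean_space" and DW DWt G SS SSt :: "real \<Rightarrow> real^3 \<Rightarrow> 'b::euclidean_space"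
    and \<epsilon> \<mu> L N H T :: real
  assumes T: "T > 0" and e: "0 < \<epsilon>" "\<epsilon> \<le> 1" and mu: "\<mu> > 0" and L: "0 \<le> L" and N: "0 \<le> N" and small: "8 * L * \<epsilon> \<le> \<mu>"
    and sW: "\<And>t. t \<in> {0..T} \<Longrightarrow> square_integrable (W t)" and sWt: "\<And>t. t \<in> {0..T} \<Longrightarrow> square_integrable (Wt t)"
    and sDW: "\<And>t. t \<in> {0..T} \<Longrightarrow> square_integrable (DW t)" and sG: "\<And>t. t \<in> {0..T} \<Longrightarrow> square_integrable (G t)"
    and sSS: "\<And>t. t \<in> {0..T} \<Longrightarrow> square_integrable (SS t)" and sH: "\<And>t. t \<in> {0..T} \<Longrightarrow> square_integrable (Hh t)"
    and dW: "\<And>t. t \<in> {0..T} \<Longrightarrow> L2_deriv T W (Wt t) t" and dWt: "\<And>t. t \<in> {0..T} \<Longrightarrow> L2_deriv T Wt (Wtt t) t"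
    and dDW: "\<And>t. t \<in> {0..T} \<Longrightarrow> L2_deriv T DW (DWt t) t" and dG: "\<And>t. t \<in> {0..T} \<Longrightarrow> L2_deriv T G (DW t) t"
    and dSS: "\<And>t. t \<in> {0..T} \<Longrightarrow> L2_deriv T SS (SSt t) t"
    and test_W: "\<And>t. t \<in> {0..T} \<Longrightarrow> \<epsilon> * (LINT x|lborel. W t x \<bullet> Wtt t x) = - (LINT x|lborel. W t x \<bullet> Wt t x)
        - (LINT x|lborel. DW t x \<bullet> SS t x) - \<mu> * (LINT x|lborel. DW t x \<bullet> DW t x) - \<epsilon> * (LINT x|lborel. W t x \<bullet> Hh t x)"
    and test_Wt: "\<And>t. t \<in> {0..T} \<Longrightarrow> \<epsilon> * (LINT x|lborel. Wt t x \<bullet> Wtt t x) = - (LINT x|lborel. Wt t x \<bullet> Wt t x)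
        - (LINT x|lborel. DWt t x \<bullet> SS t x) - \<mu> * (LINT x|lborel. DWt t x \<bullet> DW t x) - \<epsilon> * (LINT x|lborel. Wt t x \<bullet> Hh t x)"
    and SS_le: "\<And>t x. t \<in> {0..T} \<Longrightarrow> norm (SS t x) \<le> L * norm (G t x)"
    and SSt_le: "\<And>t x. t \<in> {0..T} \<Longrightarrow> norm (SSt t x) \<le> L * norm (DW t x) + N * norm (G t x)"
    and H_le: "\<And>t. t \<in> {0..T} \<Longrightarrow> (LINT x|lborel. (norm (Hh t x))\<^sup>2) \<le> H"
    and t: "t \<in> {0..T}"
  defines "\<Phi> \<equiv> \<lambda>t. LINT x|lborel. (norm (W t x))\<^sup>2 + (norm (G t x))\<^sup>2 + \<epsilon>\<^sup>2 * (norm (Wt t x))\<^sup>2 + \<epsilon> * (norm (DW t x))\<^sup>2"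
  shows "\<Phi> t \<le> energy_const \<mu> L N H T * (\<epsilon>\<^sup>2 + \<Phi> 0)"
proof -
  \<comment> \<open>Twice the coefficient of the square of \<open>norm (G t x)\<close> in the
    energy, so that differentiation produces exactly \<open>K\<close> times the integral of
    \<open>DW \<bullet> G\<close>.\<close>
  define K where "K = 2 + 4 * L\<^sup>2 / \<mu>"
  define c where "c = min (1/8) (\<mu>/2)"
  define C0 where "C0 = 2 + 2 * \<mu> + 3 * L\<^sup>2 / \<mu>"
  define C2 where "C2 = 1 + (L + 2 * N + K)\<^sup>2 / \<mu>"
  have c: "c > 0" using mu by (simp add: c_def)
  have K: "K \<ge> 0" using mu by (simp add: K_def)
  have C0: "C0 \<ge> 0" using mu by (simp add: C0_def)
  have C2: "C2 \<ge> 0" using mu by (simp add: C2_def)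
  have H: "H \<ge> 0" using H_le[OF t] by (rule order_trans[rotated]) (intro integral_nonneg_AE AE_I2, simp)
  define ph where "ph t x = (norm (W t x))\<^sup>2 + (norm (G t x))\<^sup>2 + \<epsilon>\<^sup>2 * (norm (Wt t x))\<^sup>2 + \<epsilon> * (norm (DW t x))\<^sup>2" for t x
  have ph_nn: "0 \<le> ph t x" for t x using e unfolding ph_def by simp
  have Phi: "\<Phi> t = (LINT x|lborel. ph t x)" for t unfolding \<Phi>_def ph_def ..
  have iph: "integrable lborel (ph t)" if "t \<in> {0..T}" for t
    unfolding ph_def by (intro Bochner_Integration.integrable_add integrable_mult_right square_integrable_norm2 sW sG sWt sDW that)
  \<comment> \<open>In the time derivative, the equation for \<open>\<epsilon> Wtt\<close> tested with \<open>W\<close> cancels the derivative of \<open>W \<bullet> W / 2\<close>, and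
    tested with \<open>2 \<epsilon> Wt\<close> it cancels all terms in \<open>DWt\<close>.\<close>
  define ed where "ed t x = (norm (W t x))\<^sup>2 / 2 + \<epsilon> * (W t x \<bullet> Wt t x) + \<epsilon>\<^sup>2 * (norm (Wt t x))\<^sup>2 + \<epsilon> * \<mu> * (norm (DW t x))\<^sup>2 + 2 * \<epsilon> * (SS t x \<bullet> DW t x) + (1 + 2 * L\<^sup>2 / \<mu>) * (norm (G t x))\<^sup>2" for t x
  have ied: "integrable lborel (ed t)" if "t \<in> {0..T}" for t
    unfolding ed_def by (intro Bochner_Integration.integrable_add integrable_mult_right integrable_divide_zero integrable_inner_L2 square_integrable_norm2 sW sG sWt sDW sSS that)
  define E where "E t = (LINT x|lborel. ed t x)" for t
  have Eeq: "E t = (1/2) * (LINT x|lborel. W t x \<bullet> W t x) + \<epsilon> * (LINT x|lborel. W t x \<bullet> Wt t x) + \<epsilon>\<^sup>2 * (LINT x|lborel. Wt t x \<bullet> Wt t x)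
      + \<epsilon> * \<mu> * (LINT x|lborel. DW t x \<bullet> DW t x) + 2 * \<epsilon> * (LINT x|lborel. SS t x \<bullet> DW t x) + (K/2) * (LINT x|lborel. G t x \<bullet> G t x)" if t: "t \<in> {0..T}" for t
  proof -
    note i = integrable_inner_L2[OF sW[OF t] sW[OF t]] integrable_inner_L2[OF sW[OF t] sWt[OF t]] integrable_inner_L2[OF sWt[OF t] sWt[OF t]]
      integrable_inner_L2[OF sDW[OF t] sDW[OF t]] integrable_inner_L2[OF sSS[OF t] sDW[OF t]] integrable_inner_L2[OF sG[OF t] sG[OF t]]
    have ede: "ed t = (\<lambda>x. (1/2) * (W t x \<bullet> W t x) + \<epsilon> * (W t x \<bullet> Wt t x) + \<epsilon>\<^sup>2 * (Wt t x \<bullet> Wt t x) + \<epsilon> * \<mu> * (DW t x \<bullet> DW t x) + 2 * \<epsilon> * (SS t x \<bullet> DW t x) + (K/2) * (G t x \<bullet> G t x))"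
      unfolding ed_def[abs_def] power2_norm_eq_inner K_def by (simp add: add_divide_distrib)
    show ?thesis unfolding E_def ede using i by simp
  qed
  define E' where "E' t = - \<epsilon> * (LINT x|lborel. Wt t x \<bullet> Wt t x) - (LINT x|lborel. DW t x \<bullet> SS t x) - \<mu> * (LINT x|lborel. DW t x \<bullet> DW t x)
      - \<epsilon> * (LINT x|lborel. W t x \<bullet> Hh t x) - 2 * \<epsilon>\<^sup>2 * (LINT x|lborel. Wt t x \<bullet> Hh t x) + 2 * \<epsilon> * (LINT x|lborel. SSt t x \<bullet> DW t x) + K * (LINT x|lborel. DW t x \<bullet> G t x)" for t
  have sSSt: "square_integrable (SSt t)" if "t \<in> {0..T}" for t using dSS[OF that] by (simp add: L2_deriv_def)
  have DE: "(E has_real_derivative E' t) (at t within {0..T})" if t: "t \<in> {0..T}" for t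
  proof -
    note d = L2_deriv_inner[OF sW sW dW[OF t] dW[OF t] t] L2_deriv_inner[OF sW sWt dW[OF t] dWt[OF t] t] L2_deriv_inner[OF sWt sWt dWt[OF t] dWt[OF t] t]
      L2_deriv_inner[OF sDW sDW dDW[OF t] dDW[OF t] t] L2_deriv_inner[OF sSS sDW dSS[OF t] dDW[OF t] t] L2_deriv_inner[OF sG sG dG[OF t] dG[OF t] t]
    have "((\<lambda>t. (1/2) * (LINT x|lborel. W t x \<bullet> W t x) + \<epsilon> * (LINT x|lborel. W t x \<bullet> Wt t x) + \<epsilon>\<^sup>2 * (LINT x|lborel. Wt t x \<bullet> Wt t x)
      + \<epsilon> * \<mu> * (LINT x|lborel. DW t x \<bullet> DW t x) + 2 * \<epsilon> * (LINT x|lborel. SS t x \<bullet> DW t x) + (K/2) * (LINT x|lborel. G t x \<bullet> G t x)) has_real_derivative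
      (1/2) * ((LINT x|lborel. Wt t x \<bullet> W t x) + (LINT x|lborel. W t x \<bullet> Wt t x)) + \<epsilon> * ((LINT x|lborel. Wt t x \<bullet> Wt t x) + (LINT x|lborel. W t x \<bullet> Wtt t x))
      + \<epsilon>\<^sup>2 * ((LINT x|lborel. Wtt t x \<bullet> Wt t x) + (LINT x|lborel. Wt t x \<bullet> Wtt t x))
      + \<epsilon> * \<mu> * ((LINT x|lborel. DWt t x \<bullet> DW t x) + (LINT x|lborel. DW t x \<bullet> DWt t x))
      + 2 * \<epsilon> * ((LINT x|lborel. SSt t x \<bullet> DW t x) + (LINT x|lborel. SS t x \<bullet> DWt t x))
      + (K/2) * ((LINT x|lborel. DW t x \<bullet> G t x) + (LINT x|lborel. G t x \<bullet> DW t x))) (at t within {0..T})"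
      by (intro DERIV_add DERIV_cmult d)
    moreover have "(1/2) * ((LINT x|lborel. Wt t x \<bullet> W t x) + (LINT x|lborel. W t x \<bullet> Wt t x)) + \<epsilon> * ((LINT x|lborel. Wt t x \<bullet> Wt t x) + (LINT x|lborel. W t x \<bullet> Wtt t x))
      + \<epsilon>\<^sup>2 * ((LINT x|lborel. Wtt t x \<bullet> Wt t x) + (LINT x|lborel. Wt t x \<bullet> Wtt t x))
      + \<epsilon> * \<mu> * ((LINT x|lborel. DWt t x \<bullet> DW t x) + (LINT x|lborel. DW t x \<bullet> DWt t x))
      + 2 * \<epsilon> * ((LINT x|lborel. SSt t x \<bullet> DW t x) + (LINT x|lborel. SS t x \<bullet> DWt t x))
      + (K/2) * ((LINT x|lborel. DW t x \<bullet> G t x) + (LINT x|lborel. G t x \<bullet> DW t x)) = E' t"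
    proof -
      have cm: "(LINT x|lborel. Wt t x \<bullet> W t x) = (LINT x|lborel. W t x \<bullet> Wt t x)" "(LINT x|lborel. Wtt t x \<bullet> Wt t x) = (LINT x|lborel. Wt t x \<bullet> Wtt t x)"
        "(LINT x|lborel. DW t x \<bullet> DWt t x) = (LINT x|lborel. DWt t x \<bullet> DW t x)" "(LINT x|lborel. SS t x \<bullet> DWt t x) = (LINT x|lborel. DWt t x \<bullet> SS t x)"
        "(LINT x|lborel. G t x \<bullet> DW t x) = (LINT x|lborel. DW t x \<bullet> G t x)"
        by (simp_all only: inner_commute)
      have w2: "2 * \<epsilon> * (\<epsilon> * (LINT x|lborel. Wt t x \<bullet> Wtt t x)) = 2 * \<epsilon> * (- (LINT x|lborel. Wt t x \<bullet> Wt t x)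
        - (LINT x|lborel. DWt t x \<bullet> SS t x) - \<mu> * (LINT x|lborel. DWt t x \<bullet> DW t x) - \<epsilon> * (LINT x|lborel. Wt t x \<bullet> Hh t x))"
        using test_Wt[OF t] by simp
      show ?thesis unfolding cm E'_def using test_W[OF t] w2 by (simp add: power2_eq_square algebra_simps)
    qed
    ultimately have "((\<lambda>t. (1/2) * (LINT x|lborel. W t x \<bullet> W t x) + \<epsilon> * (LINT x|lborel. W t x \<bullet> Wt t x) + \<epsilon>\<^sup>2 * (LINT x|lborel. Wt t x \<bullet> Wt t x)
      + \<epsilon> * \<mu> * (LINT x|lborel. DW t x \<bullet> DW t x) + 2 * \<epsilon> * (LINT x|lborel. SS t x \<bullet> DW t x) + (K/2) * (LINT x|lborel. G t x \<bullet> G t x)) has_real_derivative E' t) (at t within {0..T})"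
      by (simp only:)
    from this[unfolded has_field_derivative_def] show ?thesis unfolding has_field_derivative_def
      by (rule has_derivative_transform[OF t Eeq, rotated])
  qed
  have lower: "c * \<Phi> t \<le> E t" if t: "t \<in> {0..T}" for t
  proof -
    have "c * \<Phi> t = (LINT x|lborel. c * ph t x)" unfolding Phi by simp
    also have "\<dots> \<le> E t" unfolding E_def
    proof (rule integral_mono[OF integrable_mult_right[OF iph[OF t]] ied[OF t]])
      show "c * ph t x \<le> ed t x" for x
        unfolding c_def ph_def ed_def by (rule energy_density_lower[OF e mu SS_le[OF t]])
    qed
    finally show ?thesis .
  qed
  have upper: "E t \<le> C0 * \<Phi> t" if t: "t \<in> {0..T}" for t
  proof -
    have "E t \<le> (LINT x|lborel. C0 * ph t x)" unfolding E_def
    proof (rule integral_mono[OF ied[OF t] integrable_mult_right[OF iph[OF t]]])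
      show "ed t x \<le> C0 * ph t x" for x
        unfolding C0_def ph_def ed_def by (rule energy_density_upper[OF e mu SS_le[OF t]])
    qed
    then show ?thesis unfolding Phi by simp
  qed
  have E'_le: "E' t \<le> C2 * \<Phi> t + 2 * \<epsilon>\<^sup>2 * H" if t: "t \<in> {0..T}" for t
  proof -
    define dd where "dd x = - \<epsilon> * (norm (Wt t x))\<^sup>2 - DW t x \<bullet> SS t x - \<mu> * (norm (DW t x))\<^sup>2 - \<epsilon> * (W t x \<bullet> Hh t x) - 2 * \<epsilon>\<^sup>2 * (Wt t x \<bullet> Hh t x) + 2 * \<epsilon> * (SSt t x \<bullet> DW t x) + K * (DW t x \<bullet> G t x)" for x
    note i = integrable_inner_L2[OF sWt[OF t] sWt[OF t]] integrable_inner_L2[OF sDW[OF t] sSS[OF t]] integrable_inner_L2[OF sDW[OF t] sDW[OF t]]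
      integrable_inner_L2[OF sW[OF t] sH[OF t]] integrable_inner_L2[OF sWt[OF t] sH[OF t]] integrable_inner_L2[OF sSSt[OF t] sDW[OF t]] integrable_inner_L2[OF sDW[OF t] sG[OF t]]
    have "E' t = (LINT x|lborel. dd x)" unfolding E'_def dd_def power2_norm_eq_inner using i by simp
    also have "\<dots> \<le> (LINT x|lborel. C2 * ph t x + 2 * \<epsilon>\<^sup>2 * (norm (Hh t x))\<^sup>2)"
    proof (rule integral_mono)
      show "integrable lborel dd" unfolding dd_def power2_norm_eq_inner using i by auto
      show "integrable lborel (\<lambda>x. C2 * ph t x + 2 * \<epsilon>\<^sup>2 * (norm (Hh t x))\<^sup>2)"
        by (intro Bochner_Integration.integrable_add integrable_mult_right iph square_integrable_norm2 sH t)
      show "dd x \<le> C2 * ph t x + 2 * \<epsilon>\<^sup>2 * (norm (Hh t x))\<^sup>2" for x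
        unfolding dd_def C2_def ph_def by (rule dissipation_density[OF e mu SS_le[OF t] L N K SSt_le[OF t] small])
    qed
    also have "\<dots> = C2 * \<Phi> t + 2 * \<epsilon>\<^sup>2 * (LINT x|lborel. (norm (Hh t x))\<^sup>2)"
      unfolding Phi using iph[OF t] square_integrable_norm2[OF sH[OF t]] by simp
    also have "\<dots> \<le> C2 * \<Phi> t + 2 * \<epsilon>\<^sup>2 * H" using H_le[OF t] by (intro add_left_mono mult_left_mono) auto
    finally show ?thesis .
  qed
  have Phi_nn: "0 \<le> \<Phi> t" for t unfolding Phi by (intro integral_nonneg_AE AE_I2 ph_nn)
  have E_nn: "0 \<le> E t" if "t \<in> {0..T}" for t
    using lower[OF that] Phi_nn[of t] c by (meson mult_nonneg_nonneg less_imp_le order_trans)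
  have "E t \<le> exp (C2 / c * T) * (\<bar>E 0\<bar> + (2 * \<epsilon>\<^sup>2 * H) * T)"
  proof (rule Gronwall_Icc[OF DE _ _ _ t])
    show "E' t \<le> C2 / c * E t + 2 * \<epsilon>\<^sup>2 * H" if t: "t \<in> {0..T}" for t
    proof -
      have "C2 * \<Phi> t = C2 / c * (c * \<Phi> t)" using c by simp
      also have "\<dots> \<le> C2 / c * E t" using lower[OF t] c C2 by (intro mult_left_mono) auto
      finally show ?thesis using E'_le[OF t] by simp
    qed
  qed (use c C2 H in auto)
  also have "\<bar>E 0\<bar> = E 0" using E_nn[of 0] T by simp
  also have "exp (C2 / c * T) * (E 0 + (2 * \<epsilon>\<^sup>2 * H) * T) \<le> exp (C2 / c * T) * ((C0 + 2 * H * T) * (\<epsilon>\<^sup>2 + \<Phi> 0))"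
  proof (rule mult_left_mono)
    have "E 0 \<le> C0 * \<Phi> 0" using upper[of 0] T by simp
    moreover have "0 \<le> C0 * \<epsilon>\<^sup>2" "0 \<le> 2 * H * T * \<Phi> 0" using C0 H T Phi_nn[of 0] by simp_all
    ultimately show "E 0 + (2 * \<epsilon>\<^sup>2 * H) * T \<le> (C0 + 2 * H * T) * (\<epsilon>\<^sup>2 + \<Phi> 0)" by (simp add: algebra_simps)
  qed simp
  finally have "c * \<Phi> t \<le> exp (C2 / c * T) * ((C0 + 2 * H * T) * (\<epsilon>\<^sup>2 + \<Phi> 0))" using lower[OF t] by simp
  then have "\<Phi> t \<le> exp (C2 / c * T) * ((C0 + 2 * H * T) * (\<epsilon>\<^sup>2 + \<Phi> 0)) / c" using c by (simp add: pos_le_divide_eq mult.commute)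
  then show ?thesis unfolding energy_const_def Let_def c_def[symmetric] K_def[symmetric] C2_def[symmetric] C0_def[symmetric] by (simp add: mult_ac)
qed

lemma energy_const_pos:
  assumes "\<mu> > 0" "0 \<le> H" "0 < T" shows "energy_const \<mu> L N H T > 0"
proof -
  have "min (1/8) (\<mu>/2) > 0" using assms by simp
  moreover have "(2 + 2 * \<mu> + 3 * L\<^sup>2 / \<mu>) + 2 * H * T > 0" using assms by (intro add_pos_nonneg) auto
  ultimately show ?thesis unfolding energy_const_def Let_def by (intro divide_pos_pos mult_pos_pos) auto
qed

section \<open>Vector calculus and auxiliary facts on time derivatives\<close>

definition grad :: "(real^3 \<Rightarrow> real^3) \<Rightarrow> real^3 \<Rightarrow> real^3^3" where
  "grad v x = (\<chi> i \<alpha>. pdx \<alpha> (\<lambda>y. v y $ i) x)"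

definition divergence :: "(real^3 \<Rightarrow> real^3^3) \<Rightarrow> real^3 \<Rightarrow> real^3" where
  "divergence R x = (\<chi> i. \<Sum>\<alpha>\<in>UNIV. pdx \<alpha> (\<lambda>y. R y $ i $ \<alpha>) x)"

lemma square_integrable_component:
  "square_integrable u \<Longrightarrow> square_integrable (\<lambda>x. u x $ i)"
  by (rule square_integrable_bounded_linear[OF _ bounded_linear_vec_nth])

lemma integral_by_parts_divergence:
  assumes a: "\<And>i. Ck_on (Suc 0) UNIV (\<lambda>x. a x $ i)" "square_integrable a" "square_integrable (grad a)"
    and R: "\<And>i \<alpha>. Ck_on (Suc 0) UNIV (\<lambda>x. R x $ i $ \<alpha>)" "square_integrable R"
      "\<And>i \<alpha>. square_integrable (pdx \<alpha> (\<lambda>x. R x $ i $ \<alpha>))"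
  shows "(LINT x|lborel. a x \<bullet> divergence R x) = - (LINT x|lborel. grad a x \<bullet> R x)"
proof -
  have ga: "square_integrable (pdx \<alpha> (\<lambda>x. a x $ i))" for i \<alpha>
    using square_integrable_component[OF square_integrable_component[OF a(3), of i], of \<alpha>] by (simp add: grad_def)
  note sa = square_integrable_component[OF a(2)] and sR = square_integrable_component[OF square_integrable_component[OF R(2)]]
  have i1: "integrable lborel (\<lambda>x. a x $ i * pdx \<alpha> (\<lambda>x. R x $ i $ \<alpha>) x)" for i \<alpha>
    using integrable_inner_L2[OF sa R(3)] by simp
  have i2: "integrable lborel (\<lambda>x. pdx \<alpha> (\<lambda>x. a x $ i) x * R x $ i $ \<alpha>)" for i \<alpha>
    using integrable_inner_L2[OF ga sR] by simp
  have "(LINT x|lborel. a x \<bullet> divergence R x) = (LINT x|lborel. (\<Sum>i\<in>UNIV. \<Sum>\<alpha>\<in>UNIV. a x $ i * pdx \<alpha> (\<lambda>x. R x $ i $ \<alpha>) x))"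
    by (simp add: inner_vec_def divergence_def sum_distrib_left)
  also have "\<dots> = (\<Sum>i\<in>UNIV. \<Sum>\<alpha>\<in>UNIV. (LINT x|lborel. a x $ i * pdx \<alpha> (\<lambda>x. R x $ i $ \<alpha>) x))"
    using i1 by (simp add: Bochner_Integration.integral_sum Bochner_Integration.integrable_sum)
  also have "\<dots> = (\<Sum>i\<in>UNIV. \<Sum>\<alpha>\<in>UNIV. - (LINT x|lborel. pdx \<alpha> (\<lambda>x. a x $ i) x * R x $ i $ \<alpha>))"
    by (intro sum.cong refl integral_by_parts_L2 a R ga sa sR)
  also have "\<dots> = - (LINT x|lborel. (\<Sum>i\<in>UNIV. \<Sum>\<alpha>\<in>UNIV. pdx \<alpha> (\<lambda>x. a x $ i) x * R x $ i $ \<alpha>))"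
    using i2 by (simp add: Bochner_Integration.integral_sum Bochner_Integration.integrable_sum sum_negf)
  also have "(LINT x|lborel. (\<Sum>i\<in>UNIV. \<Sum>\<alpha>\<in>UNIV. pdx \<alpha> (\<lambda>x. a x $ i) x * R x $ i $ \<alpha>)) = (LINT x|lborel. grad a x \<bullet> R x)"
    by (simp add: inner_vec_def grad_def)
  finally show ?thesis .
qed

lemma L2_deriv_add:
  assumes "L2_deriv T a a' t" "L2_deriv T b b' t" "t \<in> {0..T}"
  shows "L2_deriv T (\<lambda>\<tau> x. a \<tau> x + b \<tau> x) (\<lambda>x. a' x + b' x) t"
proof -
  have "L2_deriv T (\<lambda>\<tau> x. 0) (\<lambda>x. 0) t" by (simp add: L2_deriv_def square_integrable_def)
  from L2_deriv_diff[OF assms(1) L2_deriv_diff[OF this assms(2,3)] assms(3)] show ?thesis by simp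
qed

lemma Ck_H_1_pdt:
  assumes C1: "Ck_H 1 s T u" and s: "s > 3/2 + 1" and T: "T > 0"
    and c: "\<And>t. t \<in> {0..T} \<Longrightarrow> continuous_on UNIV (u t)" and t: "t \<in> {0..T}"
  shows "((\<lambda>\<tau>. u \<tau> x) has_vector_derivative pdt T u t x) (at t within {0..T})" "Ck_on (Suc 0) UNIV (pdt T u t)"
proof -
  obtain u' where u': "\<And>t. t \<in> {0..T} \<Longrightarrow> Ck_on (Suc 0) UNIV (u' t)"
    "\<And>t x. t \<in> {0..T} \<Longrightarrow> ((\<lambda>\<tau>. u \<tau> x) has_vector_derivative u' t x) (at t within {0..T})"
    using Ck_H_1_pointwise[OF C1 s T c] by metis
  have eq: "pdt T u t x = u' t x" for x
    unfolding pdt_def by (rule vector_derivative_within[OF at_within_Icc_nontrivial[OF T t] u'(2)[OF t]])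
  show "((\<lambda>\<tau>. u \<tau> x) has_vector_derivative pdt T u t x) (at t within {0..T})" unfolding eq by (rule u'(2)[OF t])
  show "Ck_on (Suc 0) UNIV (pdt T u t)" by (rule Ck_on_cong[OF u'(1)[OF t]]) (simp add: eq)
qed

lemma pdt_unique:
  "T > 0 \<Longrightarrow> t \<in> {0..T} \<Longrightarrow> ((\<lambda>\<tau>. u \<tau> x) has_vector_derivative d) (at t within {0..T}) \<Longrightarrow> pdt T u t x = d"
  unfolding pdt_def by (rule vector_derivative_within[OF at_within_Icc_nontrivial])

section \<open>Curves bounded in the space of square integrable functions\<close>

text \<open>Uniform in time but without continuity: this is preserved by every operation occurring
  in the equation, and for the defect a uniform bound is all that Gronwall's inequality
  requires.\<close>

definition L2_bounded :: "real \<Rightarrow> (real \<Rightarrow> real^3 \<Rightarrow> 'b::euclidean_space) \<Rightarrow> bool" where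
  "L2_bounded T u \<longleftrightarrow> (\<forall>t\<in>{0..T}. square_integrable (u t)) \<and> (\<exists>K. \<forall>t\<in>{0..T}. (LINT x|lborel. (norm (u t x))\<^sup>2) \<le> K)"

lemma L2_boundedD: "L2_bounded T u \<Longrightarrow> t \<in> {0..T} \<Longrightarrow> square_integrable (u t)"
  by (simp add: L2_bounded_def)

lemma L2_bounded_dominated:
  assumes v: "L2_bounded T v" and m: "\<And>t. t \<in> {0..T} \<Longrightarrow> u t \<in> borel_measurable borel"
    and le: "\<And>t x. t \<in> {0..T} \<Longrightarrow> norm (u t x) \<le> c * norm (v t x)"
  shows "L2_bounded T u"
proof -
  obtain K where K: "\<And>t. t \<in> {0..T} \<Longrightarrow> (LINT x|lborel. (norm (v t x))\<^sup>2) \<le> K"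
    using v unfolding L2_bounded_def by blast
  have s: "square_integrable (u t)" if t: "t \<in> {0..T}" for t
  proof (rule square_integrable_bound[OF _ m[OF t]])
    show "square_integrable (\<lambda>x. c *\<^sub>R v t x)"
      by (rule square_integrable_bounded_linear[OF L2_boundedD[OF v t] bounded_linear_scaleR_right])
    show "norm (u t x) \<le> norm (c *\<^sub>R v t x)" for x
      using le[OF t, of x] by (simp add: order_trans[OF _ mult_right_mono[OF abs_ge_self]])
  qed
  have "(LINT x|lborel. (norm (u t x))\<^sup>2) \<le> c\<^sup>2 * K" if t: "t \<in> {0..T}" for t
  proof -
    have "(LINT x|lborel. (norm (u t x))\<^sup>2) \<le> (LINT x|lborel. c\<^sup>2 * (norm (v t x))\<^sup>2)"
    proof (rule integral_mono[OF square_integrable_norm2[OF s[OF t]] integrable_mult_right[OF square_integrable_norm2[OF L2_boundedD[OF v t]]]])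
      show "(norm (u t x))\<^sup>2 \<le> c\<^sup>2 * (norm (v t x))\<^sup>2" for x
        using power_mono[OF le[OF t, of x] norm_ge_zero, of 2] by (simp add: power_mult_distrib)
    qed
    also have "\<dots> = c\<^sup>2 * (LINT x|lborel. (norm (v t x))\<^sup>2)" by simp
    also have "\<dots> \<le> c\<^sup>2 * K" by (intro mult_left_mono K t) simp
    finally show ?thesis .
  qed
  with s show ?thesis unfolding L2_bounded_def by blast
qed

lemma L2_bounded_add:
  assumes u: "L2_bounded T u" and v: "L2_bounded T v"
  shows "L2_bounded T (\<lambda>t x. u t x + v t x)"
proof -
  obtain K L where K: "\<And>t. t \<in> {0..T} \<Longrightarrow> (LINT x|lborel. (norm (u t x))\<^sup>2) \<le> K"
    and L: "\<And>t. t \<in> {0..T} \<Longrightarrow> (LINT x|lborel. (norm (v t x))\<^sup>2) \<le> L"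
    using u v unfolding L2_bounded_def by blast
  note s = square_integrable_add[OF L2_boundedD[OF u] L2_boundedD[OF v]]
  have "(LINT x|lborel. (norm (u t x + v t x))\<^sup>2) \<le> 2 * K + 2 * L" if t: "t \<in> {0..T}" for t
  proof -
    note i = square_integrable_norm2[OF L2_boundedD[OF u t]] square_integrable_norm2[OF L2_boundedD[OF v t]]
    have "(LINT x|lborel. (norm (u t x + v t x))\<^sup>2) \<le> (LINT x|lborel. 2 * (norm (u t x))\<^sup>2 + 2 * (norm (v t x))\<^sup>2)"
      by (intro integral_mono square_integrable_norm2 s t norm_add_power2_le Bochner_Integration.integrable_add integrable_mult_right i)
    also have "\<dots> = 2 * (LINT x|lborel. (norm (u t x))\<^sup>2) + 2 * (LINT x|lborel. (norm (v t x))\<^sup>2)" using i by simp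
    finally show ?thesis using K[OF t] L[OF t] by simp
  qed
  then show ?thesis unfolding L2_bounded_def using s by blast
qed

lemma L2_bounded_linear:
  assumes u: "L2_bounded T u" and B: "bounded_linear B" shows "L2_bounded T (\<lambda>t x. B (u t x))"
proof -
  obtain K where K: "\<And>x. norm (B x) \<le> norm x * K" using bounded_linear.bounded[OF B] by blast
  show ?thesis
    by (rule L2_bounded_dominated[OF u, of _ K])
      (use square_integrable_measurable[OF square_integrable_bounded_linear[OF L2_boundedD[OF u] B]] K in \<open>auto simp: mult.commute\<close>)
qed

lemma L2_bounded_cmult: "L2_bounded T u \<Longrightarrow> L2_bounded T (\<lambda>t x. c * u t x)"
  for u :: "real \<Rightarrow> real^3 \<Rightarrow> real"
  by (rule L2_bounded_linear[where B="(*) c"]) (simp_all add: bounded_linear_mult_right)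

lemma L2_bounded_diff: "L2_bounded T u \<Longrightarrow> L2_bounded T v \<Longrightarrow> L2_bounded T (\<lambda>t x. u t x - v t x)"
  using L2_bounded_add[OF _ L2_bounded_linear[where B=uminus and u=v and T=T], of u]
  by (simp add: bounded_linear_minus bounded_linear_ident)

lemma L2_bounded_component: "L2_bounded T u \<Longrightarrow> L2_bounded T (\<lambda>t x. u t x $ i)"
  by (rule L2_bounded_linear[OF _ bounded_linear_vec_nth])

lemma L2_bounded_vec:
  fixes u :: "real \<Rightarrow> real^3 \<Rightarrow> ('b::euclidean_space)^3"
  assumes u: "\<And>i. L2_bounded T (\<lambda>t x. u t x $ i)" shows "L2_bounded T u"
proof -
  obtain K where K: "\<And>i t. t \<in> {0..T} \<Longrightarrow> (LINT x|lborel. (norm (u t x $ i))\<^sup>2) \<le> K i"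
    using u unfolding L2_bounded_def by metis
  have s: "square_integrable (u t)" if "t \<in> {0..T}" for t by (rule square_integrable_vec[OF L2_boundedD[OF u that]])
  have "(LINT x|lborel. (norm (u t x))\<^sup>2) \<le> (\<Sum>i\<in>UNIV. K i)" if t: "t \<in> {0..T}" for t
  proof -
    have "(LINT x|lborel. (norm (u t x))\<^sup>2) = (\<Sum>i\<in>UNIV. (LINT x|lborel. (norm (u t x $ i))\<^sup>2))"
      unfolding norm_vec_power2 by (rule Bochner_Integration.integral_sum) (rule square_integrable_norm2[OF L2_boundedD[OF u t]])
    then show ?thesis using K[OF t] by (simp add: sum_mono)
  qed
  with s show ?thesis unfolding L2_bounded_def by blast
qed

lemma L2_bounded_sum: "finite I \<Longrightarrow> (\<And>i. i \<in> I \<Longrightarrow> L2_bounded T (u i)) \<Longrightarrow> L2_bounded T (\<lambda>t x. \<Sum>i\<in>I. u i t x)"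
proof (induction I rule: finite_induct)
  case empty
  show ?case by (auto simp: L2_bounded_def square_integrable_def)
next
  case (insert i I)
  then show ?case by (simp add: L2_bounded_add)
qed

lemma L2_bounded_C0_H:
  assumes u: "C0_H s T u" and s: "0 \<le> s" and T: "0 \<le> T" shows "L2_bounded T u"
proof -
  obtain K where K: "\<And>t. t \<in> {0..T} \<Longrightarrow> H_norm s (u t) \<le> K" using C0_H_bounded[OF u T] by blast
  have uH: "in_H s (u t)" if "t \<in> {0..T}" for t using u that unfolding C0_H_def by blast
  have "(LINT x|lborel. (norm (u t x))\<^sup>2) \<le> K\<^sup>2" if t: "t \<in> {0..T}" for t
  proof -
    have "(LINT x|lborel. (norm (u t x))\<^sup>2) \<le> (H_norm s (u t))\<^sup>2" using L2_le_H_norm[OF uH[OF t] s] by simp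
    also have "\<dots> \<le> K\<^sup>2" by (intro power_mono K t H_norm_nonneg)
    finally show ?thesis .
  qed
  then show ?thesis unfolding L2_bounded_def using in_H_square_integrable[OF uH] by blast
qed

lemma pdx_quotient:
  assumes "Ck_on (Suc 0) UNIV a" "Ck_on (Suc 0) UNIV b" "Ck_on (Suc 0) UNIV d"
  shows "pdx \<alpha> (\<lambda>x. (a x - b x) / c - d x) x = (pdx \<alpha> a x - pdx \<alpha> b x) / c - pdx \<alpha> d x"
proof -
  have "((\<lambda>x. (a x - b x) / c - d x) has_derivative (\<lambda>h. (frechet_derivative a (at x) h - frechet_derivative b (at x) h) / c - frechet_derivative d (at x) h)) (at x)"
    unfolding divide_inverse
    by (intro has_derivative_diff has_derivative_mult_left Ck_on_Suc_UNIV_frechet(1)[OF assms(1)] Ck_on_Suc_UNIV_frechet(1)[OF assms(2)] Ck_on_Suc_UNIV_frechet(1)[OF assms(3)])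
  from frechet_derivative_at[OF this, symmetric] show ?thesis by (simp add: pdx_def)
qed

lemma pdx_diff:
  assumes "Ck_on (Suc 0) UNIV a" "Ck_on (Suc 0) UNIV b"
  shows "pdx \<alpha> (\<lambda>x. a x - b x) x = pdx \<alpha> a x - pdx \<alpha> b x"
  using pdx_quotient[OF assms Ck_on_const[of _ _ 0], of \<alpha> 1 x] by (simp add: pdx_def frechet_derivative_const)

lemma C0_H_pdx:
  assumes u: "C0_H s T u" and s: "1 \<le> s" and C1: "\<And>t. t \<in> {0..T} \<Longrightarrow> Ck_on (Suc 0) UNIV (u t)"
  shows "C0_H (s - 1) T (\<lambda>t. pdx \<alpha> (u t))"
  unfolding C0_H_def
proof (intro ballI conjI)
  fix t assume t: "t \<in> {0..T}"
  have uH: "in_H s (u t)" if "t \<in> {0..T}" for t using u that unfolding C0_H_def by blast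
  show "in_H (s - 1) (pdx \<alpha> (u t))" by (rule in_H_pdx(1)[OF uH[OF t] s C1[OF t]])
  have lim: "((\<lambda>\<tau>. H_norm s (\<lambda>x. u \<tau> x - u t x)) \<longlongrightarrow> 0) (at t within {0..T})" using u t unfolding C0_H_def by blast
  show "((\<lambda>\<tau>. H_norm (s - 1) (\<lambda>x. pdx \<alpha> (u \<tau>) x - pdx \<alpha> (u t) x)) \<longlongrightarrow> 0) (at t within {0..T})"
  proof (rule Lim_null_comparison[OF _ lim])
    show "\<forall>\<^sub>F \<tau> in at t within {0..T}. norm (H_norm (s - 1) (\<lambda>x. pdx \<alpha> (u \<tau>) x - pdx \<alpha> (u t) x)) \<le> H_norm s (\<lambda>x. u \<tau> x - u t x)"
      using eventually_at_within_mem
    proof eventually_elim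
      case (elim \<tau>)
      have "pdx \<alpha> (\<lambda>x. u \<tau> x - u t x) = (\<lambda>x. pdx \<alpha> (u \<tau>) x - pdx \<alpha> (u t) x)"
        by (rule ext) (rule pdx_diff[OF C1[OF elim] C1[OF t]])
      then show ?case
        using in_H_pdx(2)[OF in_H_diff[OF uH[OF elim] uH[OF t]] s Ck_on_diff[OF C1[OF elim] C1[OF t]], of \<alpha>] by (simp add: H_norm_nonneg)
    qed
  qed
qed

lemma C0_H_sup_bounded:
  assumes u: "C0_H s T u" and s: "s > 3/2" and T: "0 \<le> T" and c: "\<And>t. t \<in> {0..T} \<Longrightarrow> continuous_on UNIV (u t)"
  obtains B where "B \<ge> 0" "\<And>t x. t \<in> {0..T} \<Longrightarrow> \<bar>u t x\<bar> \<le> B"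
proof -
  obtain K where K: "\<And>t. t \<in> {0..T} \<Longrightarrow> H_norm s (u t) \<le> K" using C0_H_bounded[OF u T] by blast
  obtain C where C: "C \<ge> 0" "\<And>u x. in_H s u \<Longrightarrow> continuous_on UNIV u \<Longrightarrow> \<bar>u x\<bar> \<le> C * H_norm s u"
    using Sobolev_sup_bound[OF s] by blast
  have uH: "in_H s (u t)" if "t \<in> {0..T}" for t using u that unfolding C0_H_def by blast
  have "\<bar>u t x\<bar> \<le> C * K" if t: "t \<in> {0..T}" for t x
    using C(2)[OF uH[OF t] c[OF t], of x] mult_left_mono[OF K[OF t] C(1)] by linarith
  moreover have "0 \<le> C * K" using C(1) order_trans[OF H_norm_nonneg K[of 0]] T by simp
  ultimately show thesis using that by blast
qed

lemma matrix_norm_bounded: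
  fixes A :: "'i \<Rightarrow> real^3^3"
  assumes "\<And>i \<alpha>. \<exists>B\<ge>0. \<forall>z\<in>Z. \<bar>A z $ i $ \<alpha>\<bar> \<le> B"
  obtains M where "M \<ge> 0" "\<And>z. z \<in> Z \<Longrightarrow> norm (A z) \<le> M"
proof -
  obtain B where B: "\<And>i \<alpha> z. z \<in> Z \<Longrightarrow> \<bar>A z $ i $ \<alpha>\<bar> \<le> B i \<alpha>" using assms by metis
  have "norm (A z) \<le> sqrt (\<Sum>i\<in>UNIV. \<Sum>\<alpha>\<in>UNIV. (B i \<alpha>)\<^sup>2)" if "z \<in> Z" for z
  proof (rule real_le_rsqrt)
    have "(norm (A z))\<^sup>2 = (\<Sum>i\<in>UNIV. \<Sum>\<alpha>\<in>UNIV. \<bar>A z $ i $ \<alpha>\<bar>\<^sup>2)" by (simp add: norm_vec_power2)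
    also have "\<dots> \<le> (\<Sum>i\<in>UNIV. \<Sum>\<alpha>\<in>UNIV. (B i \<alpha>)\<^sup>2)" by (intro sum_mono power_mono B that) auto
    finally show "(norm (A z))\<^sup>2 \<le> (\<Sum>i\<in>UNIV. \<Sum>\<alpha>\<in>UNIV. (B i \<alpha>)\<^sup>2)" .
  qed
  moreover have "0 \<le> sqrt (\<Sum>i\<in>UNIV. \<Sum>\<alpha>\<in>UNIV. (B i \<alpha>)\<^sup>2)" by (intro real_sqrt_ge_zero sum_nonneg) auto
  ultimately show thesis using that by blast
qed

lemma bounded_linear_entry: "bounded_linear (\<lambda>A :: real^3^3. A $ i $ \<alpha>)"
  by (rule bounded_linear_compose[OF bounded_linear_vec_nth bounded_linear_vec_nth])

lemma Ck_on_matrix: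
  fixes F :: "'a::real_normed_vector \<Rightarrow> real^3^3"
  shows "(\<And>i \<alpha>. Ck_on k S (\<lambda>x. F x $ i $ \<alpha>)) \<Longrightarrow> Ck_on k S F"
  by (intro Ck_on_vec)

lemma pdx_entry:
  "Ck_on (Suc 0) UNIV F \<Longrightarrow> pdx \<beta> (\<lambda>y. F y $ i $ \<alpha>) x = frechet_derivative F (at x) (axis \<beta> 1) $ i $ \<alpha>"
  for F :: "real^3 \<Rightarrow> real^3^3"
  unfolding pdx_def by (rule frechet_derivative_bounded_linear[OF _ bounded_linear_entry])

lemma Ck_on_slab_component:
  "Ck_on k (A \<times> UNIV) (\<lambda>(t, x). v t x) \<Longrightarrow> Ck_on k (A \<times> UNIV) (\<lambda>(t, x). v t x $ i)"
  by (rule Ck_on_cong[OF Ck_on_component[of _ _ "\<lambda>(t, x). v t x" i]]) auto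

text \<open>The derivative in the sense of \<open>L\<^sup>2\<close>.  It is defined up to null sets only, and the difference quotients
  need not converge pointwise.\<close>

definition L2_dt :: "real \<Rightarrow> (real \<Rightarrow> real^3 \<Rightarrow> real) \<Rightarrow> real \<Rightarrow> real^3 \<Rightarrow> real" where
  "L2_dt T u = (SOME u'. C0_H 0 T u' \<and> (\<forall>t\<in>{0..T}. L2_deriv T u (u' t) t))"

lemma L2_dt:
  assumes u: "Ck_H (Suc 0) 0 T u"
  shows "C0_H 0 T (L2_dt T u)" "\<And>t. t \<in> {0..T} \<Longrightarrow> L2_deriv T u (L2_dt T u t) t"
proof -
  obtain u' where u': "Ck_H 0 0 T u'"
    "\<And>t. t \<in> {0..T} \<Longrightarrow> ((\<lambda>\<tau>. H_norm 0 (\<lambda>x. (u \<tau> x - u t x) / (\<tau> - t) - u' t x)) \<longlongrightarrow> 0) (at t within {0..T})"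
    using Ck_H_SucE[OF u] by blast
  have "L2_deriv T u (u' t) t" if t: "t \<in> {0..T}" for t
    by (rule L2_deriv_of_H[OF t order_refl u'(2)[OF t] Ck_H_in_H[OF u] Ck_H_in_H[OF u'(1) t]])
  with u'(1) have "\<exists>u'. C0_H 0 T u' \<and> (\<forall>t\<in>{0..T}. L2_deriv T u (u' t) t)" by auto
  from someI_ex[OF this] show "C0_H 0 T (L2_dt T u)" "\<And>t. t \<in> {0..T} \<Longrightarrow> L2_deriv T u (L2_dt T u t) t"
    unfolding L2_dt_def by blast+
qed

text \<open>A space derivative is bounded from order 1 to order 0, so it commutes with the limit of
  the difference quotients.\<close>

lemma L2_deriv_pdx:
  assumes t: "t \<in> {0..T}" and lim: "((\<lambda>\<tau>. H_norm 1 (\<lambda>x. (u \<tau> x - u t x) / (\<tau> - t) - p x)) \<longlongrightarrow> 0) (at t within {0..T})"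
    and uH: "\<And>t. t \<in> {0..T} \<Longrightarrow> in_H 1 (u t)" and pH: "in_H 1 p"
    and uC: "\<And>t. t \<in> {0..T} \<Longrightarrow> Ck_on (Suc 0) UNIV (u t)" and pC: "Ck_on (Suc 0) UNIV p"
  shows "L2_deriv T (\<lambda>t. pdx \<alpha> (u t)) (pdx \<alpha> p) t"
proof (rule L2_deriv_of_H[OF t order_refl])
  have H0: "in_H 0 (pdx \<alpha> f)" "H_norm 0 (pdx \<alpha> f) \<le> H_norm 1 f" if "in_H 1 f" "Ck_on (Suc 0) UNIV f" for f
    using in_H_pdx[OF that(1) _ that(2), of \<alpha>] by auto
  show "in_H 0 (pdx \<alpha> (u t))" if "t \<in> {0..T}" for t by (rule H0(1)[OF uH uC]) (rule that)+
  show "in_H 0 (pdx \<alpha> p)" by (rule H0(1)[OF pH pC])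
  show "((\<lambda>\<tau>. H_norm 0 (\<lambda>x. (pdx \<alpha> (u \<tau>) x - pdx \<alpha> (u t) x) / (\<tau> - t) - pdx \<alpha> p x)) \<longlongrightarrow> 0) (at t within {0..T})"
  proof (rule Lim_null_comparison[OF _ lim])
    show "\<forall>\<^sub>F \<tau> in at t within {0..T}. norm (H_norm 0 (\<lambda>x. (pdx \<alpha> (u \<tau>) x - pdx \<alpha> (u t) x) / (\<tau> - t) - pdx \<alpha> p x)) \<le> H_norm 1 (\<lambda>x. (u \<tau> x - u t x) / (\<tau> - t) - p x)"
      using eventually_at_within_mem
    proof eventually_elim
      case (elim \<tau>)
      have eq: "pdx \<alpha> (\<lambda>x. (u \<tau> x - u t x) / (\<tau> - t) - p x) = (\<lambda>x. (pdx \<alpha> (u \<tau>) x - pdx \<alpha> (u t) x) / (\<tau> - t) - pdx \<alpha> p x)"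
        by (rule ext) (rule pdx_quotient[OF uC[OF elim] uC[OF t] pC])
      have C: "Ck_on (Suc 0) UNIV (\<lambda>x. (u \<tau> x - u t x) / (\<tau> - t) - p x)"
        unfolding divide_inverse by (intro Ck_on_diff Ck_on_mult Ck_on_const uC elim t pC)
      from H0(2)[OF in_H_quotient[OF uH[OF elim] uH[OF t] pH] C] show ?case
        unfolding eq real_norm_def abs_of_nonneg[OF H_norm_nonneg] .
    qed
  qed
qed

lemma L2_bounded_cong:
  assumes u: "L2_bounded T u" and e: "\<And>t x. t \<in> {0..T} \<Longrightarrow> u t x = u' t x" shows "L2_bounded T u'"
proof -
  have "u t = u' t" if "t \<in> {0..T}" for t by (rule ext) (rule e[OF that])
  then show ?thesis using u by (simp add: L2_bounded_def)
qed

section \<open>The system and its relaxation\<close>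

text \<open>The limit solution has its own locale, so that bounds drawn from it are fixed before
  \<open>\<epsilon>\<close> is introduced.\<close>

locale viscoelastic =
  fixes \<mu> T j :: real and S :: "real^3^3 \<Rightarrow> real^3^3"
    and Fh :: "real \<Rightarrow> real^3 \<Rightarrow> real^3^3" and vh :: "real \<Rightarrow> real^3 \<Rightarrow> real^3"
  assumes mu: "\<mu> > 0" and stress: "smooth_on UNIV S" and T: "T > 0" and j: "j > 3/2 + 2"
    and reg_F: "Ck_H_mat 1 j T Fh" and reg_v: "Ck_H_vec 1 j T vh"
    and cont_F: "\<And>t. t \<in> {0..T} \<Longrightarrow> continuous_on UNIV (Fh t)"
    and cont_v: "\<And>t. t \<in> {0..T} \<Longrightarrow> continuous_on UNIV (vh t)"
    and sol: "viscoelastic_solution \<mu> S T Fh vh"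
begin

lemma S_C: "Ck_on k UNIV S"
  using stress by (simp add: smooth_on_def)

lemma T_nonneg: "0 \<le> T" using T by simp

lemma Ck_vh: "Ck_H 1 j T (\<lambda>t x. vh t x $ i)" and Ck_Fh: "Ck_H 1 j T (\<lambda>t x. Fh t x $ i $ \<alpha>)"
  using reg_v reg_F unfolding Ck_H_vec_def Ck_H_mat_def by blast+

lemma cont_vh: "t \<in> {0..T} \<Longrightarrow> continuous_on UNIV (\<lambda>x. vh t x $ i)"
  by (rule continuous_on_component[OF cont_v])

lemma cont_Fh: "t \<in> {0..T} \<Longrightarrow> continuous_on UNIV (\<lambda>x. Fh t x $ i $ \<alpha>)"
  by (rule continuous_on_component[OF continuous_on_component[OF cont_F]])

text \<open>Here \<open>j > 3/2 + 2\<close> is used in full: the Laplacian of the limit velocity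
  becomes a classical one.\<close>

lemma vh_C2: "t \<in> {0..T} \<Longrightarrow> Ck_on (Suc (Suc 0)) UNIV (\<lambda>x. vh t x $ i)"
  and Fh_C2: "t \<in> {0..T} \<Longrightarrow> Ck_on (Suc (Suc 0)) UNIV (\<lambda>x. Fh t x $ i $ \<alpha>)"
proof -
  have j2: "j > 3/2 + real (Suc (Suc 0))" using j by simp
  show "t \<in> {0..T} \<Longrightarrow> Ck_on (Suc (Suc 0)) UNIV (\<lambda>x. vh t x $ i)"
    by (rule Sobolev_embedding(2)[OF Ck_H_in_H[OF Ck_vh] j2 cont_vh])
  show "t \<in> {0..T} \<Longrightarrow> Ck_on (Suc (Suc 0)) UNIV (\<lambda>x. Fh t x $ i $ \<alpha>)"
    by (rule Sobolev_embedding(2)[OF Ck_H_in_H[OF Ck_Fh] j2 cont_Fh])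
qed

lemmas vh_C1 = Ck_on_Suc_imp[OF vh_C2] and Fh_C1 = Ck_on_Suc_imp[OF Fh_C2]

lemma j1: "j > 3/2 + 1" using j by simp

lemma vh_t:
  assumes t: "t \<in> {0..T}"
  shows "((\<lambda>\<tau>. vh \<tau> x $ i) has_vector_derivative pdt T (\<lambda>t x. vh t x $ i) t x) (at t within {0..T})"
    and "Ck_on (Suc 0) UNIV (pdt T (\<lambda>t x. vh t x $ i) t)"
  by (rule Ck_H_1_pdt(1)[OF Ck_vh j1 T cont_vh t], assumption, rule Ck_H_1_pdt(2)[OF Ck_vh j1 T cont_vh t], assumption)

lemma Fh_t:
  assumes t: "t \<in> {0..T}"
  shows "((\<lambda>\<tau>. Fh \<tau> x $ i $ \<alpha>) has_vector_derivative pdt T (\<lambda>t x. Fh t x $ i $ \<alpha>) t x) (at t within {0..T})"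
  by (rule Ck_H_1_pdt(1)[OF Ck_Fh j1 T cont_Fh t])

lemma Fh_eq: "t \<in> {0..T} \<Longrightarrow> pdt T (\<lambda>t x. Fh t x $ i $ \<alpha>) t x = pdx \<alpha> (\<lambda>y. vh t y $ i) x"
  by (drule bspec[OF sol[unfolded viscoelastic_solution_def]]) simp

lemma vh_eq: "t \<in> {0..T} \<Longrightarrow> pdt T (\<lambda>t x. vh t x $ i) t x - (\<Sum>\<alpha>\<in>UNIV. pdx \<alpha> (\<lambda>y. S (Fh t y) $ i $ \<alpha>) x)
    = \<mu> * (\<Sum>\<alpha>\<in>UNIV. pdx \<alpha> (pdx \<alpha> (\<lambda>y. vh t y $ i)) x)"
  by (drule bspec[OF sol[unfolded viscoelastic_solution_def]]) simp

lemma Fh_bounded: obtains M where "M \<ge> 0" "\<And>t x. t \<in> {0..T} \<Longrightarrow> norm (Fh t x) \<le> M"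
proof -
  have j32: "j > 3/2" using j by simp
  have "\<exists>B\<ge>0. \<forall>z\<in>{0..T} \<times> UNIV. \<bar>(case z of (t, x) \<Rightarrow> Fh t x) $ i $ \<alpha>\<bar> \<le> B" for i \<alpha>
    by (rule C0_H_sup_bounded[OF Ck_H_C0[OF Ck_Fh[of i \<alpha>]] j32 T_nonneg cont_Fh]) auto
  from matrix_norm_bounded[of "{0..T} \<times> UNIV" "\<lambda>(t, x). Fh t x", OF this]
  obtain M where "M \<ge> 0" "\<And>z. z \<in> {0..T} \<times> UNIV \<Longrightarrow> norm (case z of (t, x) \<Rightarrow> Fh t x) \<le> M" by blast
  then show thesis using that[of M] by force
qed

lemma C0_pdx_vh: "C0_H (j - 1) T (\<lambda>t. pdx \<alpha> (\<lambda>y. vh t y $ i))"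
  using j by (intro C0_H_pdx Ck_H_C0[OF Ck_vh] vh_C1) auto

lemma C0_pdx_Fh: "C0_H (j - 1) T (\<lambda>t. pdx \<beta> (\<lambda>y. Fh t y $ i $ \<alpha>))"
  using j by (intro C0_H_pdx Ck_H_C0[OF Ck_Fh] Fh_C1) auto

text \<open>A gradient still has order \<open>j - 1 > 3/2\<close>, enough for the sup bound. The
  bound enters the estimate of \<open>SSt\<close>, where the limit gradient multiplies the change of
  the stress derivative.\<close>

lemma grad_vh_bounded: obtains V where "V \<ge> 0" "\<And>t x. t \<in> {0..T} \<Longrightarrow> norm (grad (vh t) x) \<le> V"
proof -
  have j32: "j - 1 > 3/2" using j by simp
  have c: "t \<in> {0..T} \<Longrightarrow> continuous_on UNIV (pdx \<alpha> (\<lambda>y. vh t y $ i))" for t i \<alpha>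
    by (rule Ck_on_continuous[OF Ck_on_pdx[OF vh_C1]])
  have "\<exists>B\<ge>0. \<forall>z\<in>{0..T} \<times> UNIV. \<bar>(case z of (t, x) \<Rightarrow> grad (vh t) x) $ i $ \<alpha>\<bar> \<le> B" for i \<alpha>
    by (rule C0_H_sup_bounded[OF C0_pdx_vh[of \<alpha> i] j32 T_nonneg c]) (auto simp: grad_def)
  from matrix_norm_bounded[of "{0..T} \<times> UNIV" "\<lambda>(t, x). grad (vh t) x", OF this]
  obtain M where "M \<ge> 0" "\<And>z. z \<in> {0..T} \<times> UNIV \<Longrightarrow> norm (case z of (t, x) \<Rightarrow> grad (vh t) x) \<le> M" by blast
  then show thesis using that[of M] by force
qed

lemma pdx_Fh_L2: "L2_bounded T (\<lambda>t. pdx \<beta> (\<lambda>y. Fh t y $ i $ \<alpha>))"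
  using j by (intro L2_bounded_C0_H[OF C0_pdx_Fh] T_nonneg) auto

lemma Fh_L2_deriv: "t \<in> {0..T} \<Longrightarrow> L2_deriv T (\<lambda>t x. Fh t x $ i $ \<alpha>) (\<lambda>x. pdx \<alpha> (\<lambda>y. vh t y $ i) x) t"
proof -
  assume t: "t \<in> {0..T}"
  have j0: "0 \<le> j" using j by simp
  have pw: "((\<lambda>\<tau>. Fh \<tau> x $ i $ \<alpha>) has_vector_derivative pdx \<alpha> (\<lambda>y. vh t y $ i) x) (at t within {0..T})" if "t \<in> {0..T}" for t x
    using Fh_t[OF that, of x i \<alpha>] Fh_eq[OF that, of i \<alpha> x] by simp
  have m: "pdx \<alpha> (\<lambda>y. vh t y $ i) \<in> borel_measurable borel" if "t \<in> {0..T}" for t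
    by (rule borel_measurable_continuous_onI[OF Ck_on_continuous[OF Ck_on_pdx[OF vh_C1[OF that]]]])
  note P = Ck_H_Suc_pointwise[OF Ck_Fh[of i \<alpha>, unfolded One_nat_def] j0 T]
  have p1: "Ck_H 0 j T (\<lambda>t. pdx \<alpha> (\<lambda>y. vh t y $ i))" by (rule P(1)[OF pw m])
  show ?thesis by (rule L2_deriv_of_H[OF t j0 P(2)[OF pw m t] Ck_H_in_H[OF Ck_Fh] Ck_H_in_H[OF p1 t]])
qed

end

text \<open>Two instances over the same limit, for different \<open>\<epsilon>\<close>, can be
  compared; this serves to identify their defects. \<open>M\<close> is the radius of a ball in which
  the stress is evaluated for both solutions.\<close>

locale relaxation_pair = viscoelastic +
  fixes \<epsilon> M :: real and F :: "real \<Rightarrow> real^3 \<Rightarrow> real^3^3" and v :: "real \<Rightarrow> real^3 \<Rightarrow> real^3"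
  assumes eps: "\<epsilon> > 0"
    and smooth_F: "smooth_on ({0..T} \<times> UNIV) (\<lambda>(t, x). F t x)"
    and smooth_v: "smooth_on ({0..T} \<times> UNIV) (\<lambda>(t, x). v t x)"
    and F_bound: "\<And>t x. t \<in> {0..T} \<Longrightarrow> norm (F t x) \<le> M" and Fh_bound: "\<And>t x. t \<in> {0..T} \<Longrightarrow> norm (Fh t x) \<le> M"
    and relax: "relaxation_solution \<epsilon> \<mu> S T F v"
    and G_1_0: "Ck_H_mat 1 0 T (\<lambda>t x. F t x - Fh t x)" and G_0_1: "Ck_H_mat 0 1 T (\<lambda>t x. F t x - Fh t x)"
    and w_0_2: "Ck_H_vec 0 2 T (\<lambda>t x. v t x - vh t x)" and w_1_1: "Ck_H_vec 1 1 T (\<lambda>t x. v t x - vh t x)"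
    and w_2_0: "Ck_H_vec 2 0 T (\<lambda>t x. v t x - vh t x)"
begin

definition w :: "real \<Rightarrow> real^3 \<Rightarrow> real^3" where "w t x = v t x - vh t x"

definition G :: "real \<Rightarrow> real^3 \<Rightarrow> real^3^3" where "G t x = F t x - Fh t x"

definition wt :: "real \<Rightarrow> real^3 \<Rightarrow> real^3" where "wt t x = (\<chi> i. pdt T (\<lambda>t x. w t x $ i) t x)"

definition wtt :: "real \<Rightarrow> real^3 \<Rightarrow> real^3" where "wtt t x = (\<chi> i. L2_dt T (\<lambda>t x. wt t x $ i) t x)"

text \<open>The defect represents \<open>\<partial>\<^sub>t\<^sup>2\<close> of the limit velocity, of which no second time derivative is assumed: the first
  term is classical, and the second one exists in \<open>L\<^sup>2\<close> by the regularity of the differences.\<close>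

definition defect :: "real \<Rightarrow> real^3 \<Rightarrow> real^3" where
  "defect t x = (\<chi> i. pdt T (pdt T (\<lambda>t x. v t x $ i)) t x - wtt t x $ i)"

definition SS :: "real \<Rightarrow> real^3 \<Rightarrow> real^3^3" where "SS t x = S (F t x) - S (Fh t x)"

text \<open>The chain rule for the time derivative of \<open>SS\<close>, with the time derivatives
  of \<open>F\<close> and \<open>Fh\<close> replaced by velocity gradients through the first
  equation.\<close>

definition SSt :: "real \<Rightarrow> real^3 \<Rightarrow> real^3^3" where
  "SSt t x = frechet_derivative S (at (F t x)) (grad (v t) x) - frechet_derivative S (at (Fh t x)) (grad (vh t) x)"

lemma slab_v: "Ck_on k ({0..T} \<times> UNIV) (\<lambda>(t, x). v t x $ i)"
  using smooth_v by (intro Ck_on_slab_component) (simp add: smooth_on_def)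

lemma slab_F: "Ck_on k ({0..T} \<times> UNIV) (\<lambda>(t, x). F t x $ i $ \<alpha>)"
  using smooth_F by (intro Ck_on_slab_component) (simp add: smooth_on_def)

lemmas v_t = slab_has_vector_derivative[OF slab_v T] and slab_vt = Ck_on_slab_pdt[OF slab_v T]

lemmas F_t = slab_has_vector_derivative[OF slab_F T]

lemma v_C: "t \<in> {0..T} \<Longrightarrow> Ck_on k UNIV (\<lambda>x. v t x $ i)"
  using Ck_on_slice[OF slab_v] by simp

lemma F_C: "t \<in> {0..T} \<Longrightarrow> Ck_on k UNIV (\<lambda>x. F t x $ i $ \<alpha>)"
  using Ck_on_slice[OF slab_F] by simp

lemma vt_C: "t \<in> {0..T} \<Longrightarrow> Ck_on k UNIV (pdt T (\<lambda>t x. v t x $ i) t)"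
  using Ck_on_slice[OF slab_vt] by simp

lemma vtt: "t \<in> {0..T} \<Longrightarrow> ((\<lambda>\<tau>. pdt T (\<lambda>t x. v t x $ i) \<tau> x) has_vector_derivative pdt T (pdt T (\<lambda>t x. v t x $ i)) t x) (at t within {0..T})"
  by (rule slab_has_vector_derivative[OF slab_vt T])

lemma w_C2: "t \<in> {0..T} \<Longrightarrow> Ck_on (Suc (Suc 0)) UNIV (\<lambda>x. w t x $ i)"
  unfolding w_def vector_minus_component by (intro Ck_on_diff v_C vh_C2)

lemmas w_C1 = Ck_on_Suc_imp[OF w_C2]

lemma G_C1: "t \<in> {0..T} \<Longrightarrow> Ck_on (Suc 0) UNIV (\<lambda>x. G t x $ i $ \<alpha>)"
  unfolding G_def vector_minus_component by (intro Ck_on_diff F_C Fh_C1)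

lemma w_t: "t \<in> {0..T} \<Longrightarrow> ((\<lambda>\<tau>. w \<tau> x $ i) has_vector_derivative wt t x $ i) (at t within {0..T})"
  and wt_eq: "t \<in> {0..T} \<Longrightarrow> wt t x $ i = pdt T (\<lambda>t x. v t x $ i) t x - pdt T (\<lambda>t x. vh t x $ i) t x"
proof -
  assume t: "t \<in> {0..T}"
  have d: "((\<lambda>\<tau>. w \<tau> x $ i) has_vector_derivative pdt T (\<lambda>t x. v t x $ i) t x - pdt T (\<lambda>t x. vh t x $ i) t x) (at t within {0..T})"
    unfolding w_def vector_minus_component by (intro has_vector_derivative_diff v_t vh_t t)
  have e: "wt t x $ i = pdt T (\<lambda>t x. v t x $ i) t x - pdt T (\<lambda>t x. vh t x $ i) t x"
    using pdt_unique[where u="\<lambda>t x. w t x $ i", OF T t d] by (simp add: wt_def)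
  show "((\<lambda>\<tau>. w \<tau> x $ i) has_vector_derivative wt t x $ i) (at t within {0..T})"
    "wt t x $ i = pdt T (\<lambda>t x. v t x $ i) t x - pdt T (\<lambda>t x. vh t x $ i) t x"
    using d e by auto
qed

lemma wt_C1: "t \<in> {0..T} \<Longrightarrow> Ck_on (Suc 0) UNIV (\<lambda>x. wt t x $ i)"
proof -
  assume t: "t \<in> {0..T}"
  have "Ck_on (Suc 0) UNIV (\<lambda>x. pdt T (\<lambda>t x. v t x $ i) t x - pdt T (\<lambda>t x. vh t x $ i) t x)"
    by (intro Ck_on_diff vt_C vh_t t)
  then show ?thesis by (simp only: wt_eq[OF t])
qed

lemma wt_measurable: "t \<in> {0..T} \<Longrightarrow> (\<lambda>x. wt t x $ i) \<in> borel_measurable borel"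
  by (rule borel_measurable_continuous_onI[OF Ck_on_continuous[OF wt_C1]])

lemma Ck_w: "Ck_H 0 2 T (\<lambda>t x. w t x $ i)" "Ck_H (Suc 0) 1 T (\<lambda>t x. w t x $ i)" "Ck_H (Suc (Suc 0)) 0 T (\<lambda>t x. w t x $ i)"
  using w_0_2 w_1_1 w_2_0 unfolding Ck_H_vec_def w_def One_nat_def numeral_2_eq_2 by blast+

lemma Ck_G: "Ck_H (Suc 0) 0 T (\<lambda>t x. G t x $ i $ \<alpha>)" "Ck_H 0 1 T (\<lambda>t x. G t x $ i $ \<alpha>)"
  using G_1_0 G_0_1 unfolding Ck_H_mat_def G_def One_nat_def by blast+

text \<open>The hypothesis with values in \<open>H^1\<close> makes the gradient of \<open>wt\<close>
  available; the one of class C^2 in L^2, used next, makes its time derivative available.\<close>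

lemma wt_H1: "Ck_H 0 1 T (\<lambda>t x. wt t x $ i)"
  "t \<in> {0..T} \<Longrightarrow> ((\<lambda>\<tau>. H_norm 1 (\<lambda>x. (w \<tau> x $ i - w t x $ i) / (\<tau> - t) - wt t x $ i)) \<longlongrightarrow> 0) (at t within {0..T})"
  by (rule Ck_H_Suc_pointwise(1)[OF Ck_w(2) zero_le_one T w_t wt_measurable], assumption+,
      rule Ck_H_Suc_pointwise(2)[OF Ck_w(2) zero_le_one T w_t wt_measurable], assumption+)

lemma wt_H0: "Ck_H (Suc 0) 0 T (\<lambda>t x. wt t x $ i)"
  "t \<in> {0..T} \<Longrightarrow> ((\<lambda>\<tau>. H_norm 0 (\<lambda>x. (w \<tau> x $ i - w t x $ i) / (\<tau> - t) - wt t x $ i)) \<longlongrightarrow> 0) (at t within {0..T})"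
  by (rule Ck_H_Suc_pointwise(1)[OF Ck_w(3) order_refl T w_t wt_measurable], assumption+,
      rule Ck_H_Suc_pointwise(2)[OF Ck_w(3) order_refl T w_t wt_measurable], assumption+)

lemma w_L2: "L2_bounded T w"
  by (rule L2_bounded_vec, rule L2_bounded_C0_H[OF Ck_H_C0[OF Ck_w(1)] _ T_nonneg]) simp

lemma wt_L2: "L2_bounded T wt"
  by (rule L2_bounded_vec, rule L2_bounded_C0_H[OF Ck_H_C0[OF wt_H0(1)] _ T_nonneg]) simp

lemma C0_pdx_w: "C0_H (2 - 1) T (\<lambda>t. pdx \<alpha> (\<lambda>x. w t x $ i))"
  by (intro C0_H_pdx Ck_H_C0[OF Ck_w(1)] w_C1) auto

lemma pdx_w_L2: "L2_bounded T (\<lambda>t. pdx \<alpha> (\<lambda>x. w t x $ i))"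
  by (rule L2_bounded_C0_H[OF C0_pdx_w _ T_nonneg]) simp

lemma pdx_pdx_w_L2: "L2_bounded T (\<lambda>t. pdx \<beta> (pdx \<alpha> (\<lambda>x. w t x $ i)))"
proof -
  have "C0_H (2 - 1 - 1) T (\<lambda>t. pdx \<beta> (pdx \<alpha> (\<lambda>x. w t x $ i)))"
    by (intro C0_H_pdx C0_pdx_w Ck_on_pdx w_C2) auto
  then show ?thesis by (rule L2_bounded_C0_H) (auto intro: T_nonneg)
qed

lemma pdx_wt_L2: "L2_bounded T (\<lambda>t. pdx \<alpha> (\<lambda>x. wt t x $ i))"
proof -
  have "C0_H (1 - 1) T (\<lambda>t. pdx \<alpha> (\<lambda>x. wt t x $ i))"
    by (intro C0_H_pdx Ck_H_C0[OF wt_H1(1)] wt_C1) auto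
  then show ?thesis by (rule L2_bounded_C0_H) (auto intro: T_nonneg)
qed

lemma grad_w_L2: "L2_bounded T (\<lambda>t. grad (w t))" and grad_wt_L2: "L2_bounded T (\<lambda>t. grad (wt t))"
  by (intro L2_bounded_vec; simp add: grad_def pdx_w_L2 pdx_wt_L2)+

lemma G_L2: "L2_bounded T G"
  by (rule L2_bounded_vec, rule L2_bounded_vec, rule L2_bounded_C0_H[OF Ck_H_C0[OF Ck_G(2)] _ T_nonneg]) simp

lemma pdx_G_L2: "L2_bounded T (\<lambda>t. pdx \<beta> (\<lambda>x. G t x $ i $ \<alpha>))"
proof -
  have "C0_H (1 - 1) T (\<lambda>t. pdx \<beta> (\<lambda>x. G t x $ i $ \<alpha>))"
    by (intro C0_H_pdx Ck_H_C0[OF Ck_G(2)] G_C1) auto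
  then show ?thesis by (rule L2_bounded_C0_H) (auto intro: T_nonneg)
qed

lemma w_L2_deriv: "t \<in> {0..T} \<Longrightarrow> L2_deriv T w (wt t) t"
  by (rule L2_deriv_vec[OF L2_deriv_of_H[OF _ order_refl wt_H0(2) Ck_H_in_H[OF Ck_w(3)] Ck_H_in_H[OF wt_H0(1)]]])

lemma grad_w_L2_deriv: "t \<in> {0..T} \<Longrightarrow> L2_deriv T (\<lambda>t. grad (w t)) (grad (wt t)) t"
proof (intro L2_deriv_vec)
  fix i \<alpha> assume t: "t \<in> {0..T}"
  show "L2_deriv T (\<lambda>t x. grad (w t) x $ i $ \<alpha>) (\<lambda>x. grad (wt t) x $ i $ \<alpha>) t"
    using L2_deriv_pdx[OF t wt_H1(2)[OF t] Ck_H_in_H[OF Ck_w(2)] Ck_H_in_H[OF wt_H1(1) t] w_C1 wt_C1[OF t], of \<alpha> i] by (simp add: grad_def)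
qed

lemma wtt_L2: "L2_bounded T wtt"
proof (rule L2_bounded_vec)
  show "L2_bounded T (\<lambda>t x. wtt t x $ i)" for i
    using L2_bounded_C0_H[OF L2_dt(1)[OF wt_H0(1)[of i]] order_refl T_nonneg] by (simp add: wtt_def)
qed

lemma wt_L2_deriv: "t \<in> {0..T} \<Longrightarrow> L2_deriv T wt (wtt t) t"
proof (rule L2_deriv_vec)
  show "L2_deriv T (\<lambda>t x. wt t x $ i) (\<lambda>x. wtt t x $ i) t" if "t \<in> {0..T}" for i
    using L2_dt(2)[OF wt_H0(1)[of i] that] by (simp add: wtt_def)
qed

lemma pdx_v_minus_vh: "t \<in> {0..T} \<Longrightarrow> pdx \<alpha> (\<lambda>y. w t y $ i) x = pdx \<alpha> (\<lambda>y. v t y $ i) x - pdx \<alpha> (\<lambda>y. vh t y $ i) x"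
  unfolding w_def vector_minus_component by (rule pdx_diff[OF v_C vh_C1])

lemma G_L2_deriv: "t \<in> {0..T} \<Longrightarrow> L2_deriv T G (grad (w t)) t"
proof (intro L2_deriv_vec)
  fix i \<alpha> assume t: "t \<in> {0..T}"
  have pw: "((\<lambda>\<tau>. G \<tau> x $ i $ \<alpha>) has_vector_derivative pdx \<alpha> (\<lambda>y. w t y $ i) x) (at t within {0..T})" if t: "t \<in> {0..T}" for t x
  proof -
    have "pdt T (\<lambda>t x. F t x $ i $ \<alpha>) t x = pdx \<alpha> (\<lambda>y. v t y $ i) x"
      using bspec[OF relax[unfolded relaxation_solution_def] t] by simp
    then show ?thesis
      unfolding G_def vector_minus_component pdx_v_minus_vh[OF t]
      using has_vector_derivative_diff[OF F_t[OF t, of x i \<alpha>] Fh_t[OF t, of x i \<alpha>]] Fh_eq[OF t, of i \<alpha> x] by simp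
  qed
  have m: "pdx \<alpha> (\<lambda>y. w t y $ i) \<in> borel_measurable borel" if "t \<in> {0..T}" for t
    by (rule borel_measurable_continuous_onI[OF Ck_on_continuous[OF Ck_on_pdx[OF w_C1[OF that]]]])
  note P = Ck_H_Suc_pointwise[OF Ck_G(1)[of i \<alpha>] order_refl T]
  have p1: "Ck_H 0 0 T (\<lambda>t. pdx \<alpha> (\<lambda>y. w t y $ i))" by (rule P(1)[OF pw m])
  have "L2_deriv T (\<lambda>t x. G t x $ i $ \<alpha>) (\<lambda>x. pdx \<alpha> (\<lambda>y. w t y $ i) x) t"
    by (rule L2_deriv_of_H[OF t order_refl P(2)[OF pw m t] Ck_H_in_H[OF Ck_G(1)] Ck_H_in_H[OF p1 t]])
  then show "L2_deriv T (\<lambda>t x. G t x $ i $ \<alpha>) (\<lambda>x. grad (w t) x $ i $ \<alpha>) t" by (simp add: grad_def)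
qed

lemma Fh_matrix_L2_deriv: "t \<in> {0..T} \<Longrightarrow> L2_deriv T Fh (grad (vh t)) t"
  by (intro L2_deriv_vec) (auto simp: grad_def Fh_L2_deriv)

text \<open>Smoothness of \<open>F\<close> on the slab says nothing about decay in space; the strong
  derivative is the sum of those of \<open>G\<close> and \<open>Fh\<close>.\<close>

lemma F_L2_deriv: "t \<in> {0..T} \<Longrightarrow> L2_deriv T F (grad (v t)) t"
proof -
  assume t: "t \<in> {0..T}"
  have "grad (w t) x + grad (vh t) x = grad (v t) x" for x
    by (simp add: vec_eq_iff grad_def pdx_v_minus_vh[OF t])
  then show ?thesis using L2_deriv_add[OF G_L2_deriv[OF t] Fh_matrix_L2_deriv[OF t] t] by (simp add: G_def)
qed

lemma F_matrix_C1: "t \<in> {0..T} \<Longrightarrow> Ck_on (Suc 0) UNIV (F t)" and Fh_matrix_C1: "t \<in> {0..T} \<Longrightarrow> Ck_on (Suc 0) UNIV (Fh t)"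
  by (rule Ck_on_matrix[OF F_C], assumption, rule Ck_on_matrix[OF Fh_C1], assumption)

lemma SS_L2_deriv: assumes t: "t \<in> {0..T}" shows "L2_deriv T SS (SSt t) t"
  unfolding SS_def[abs_def] SSt_def[abs_def]
proof (rule L2_deriv_diff[OF L2_deriv_compose[OF S_C F_L2_deriv[OF t] t _ F_bound] L2_deriv_compose[OF S_C Fh_matrix_L2_deriv[OF t] t _ Fh_bound] t])
  show "F \<tau> \<in> borel_measurable borel" "Fh \<tau> \<in> borel_measurable borel" if "\<tau> \<in> {0..T}" for \<tau>
    by (rule borel_measurable_continuous_onI[OF Ck_on_continuous[OF F_matrix_C1[OF that]]],
        rule borel_measurable_continuous_onI[OF Ck_on_continuous[OF Fh_matrix_C1[OF that]]])
  show "((\<lambda>\<tau>. F \<tau> x) \<longlongrightarrow> F t x) (at t within {0..T})" for x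
    using has_vector_derivative_continuous[OF F_t[OF t]] by (intro vec_tendstoI) (simp add: continuous_within)
  show "((\<lambda>\<tau>. Fh \<tau> x) \<longlongrightarrow> Fh t x) (at t within {0..T})" for x
    using has_vector_derivative_continuous[OF Fh_t[OF t]] by (intro vec_tendstoI) (simp add: continuous_within)
qed

lemma SS_C1: "t \<in> {0..T} \<Longrightarrow> Ck_on (Suc 0) UNIV (\<lambda>x. SS t x $ i $ \<alpha>)"
  unfolding SS_def
  by (rule Ck_on_component[OF Ck_on_component[OF Ck_on_diff[OF Ck_on_compose_C1[OF S_C F_matrix_C1] Ck_on_compose_C1[OF S_C Fh_matrix_C1]]]])

lemma pdx_SS: "t \<in> {0..T} \<Longrightarrow> pdx \<beta> (\<lambda>y. SS t y $ i $ \<alpha>) x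
   = (frechet_derivative S (at (F t x)) (frechet_derivative (F t) (at x) (axis \<beta> 1))
    - frechet_derivative S (at (Fh t x)) (frechet_derivative (Fh t) (at x) (axis \<beta> 1))) $ i $ \<alpha>"
proof -
  assume t: "t \<in> {0..T}"
  note SF = Ck_on_compose_C1[OF S_C F_matrix_C1[OF t]] and SFh = Ck_on_compose_C1[OF S_C Fh_matrix_C1[OF t]]
  show ?thesis
    unfolding SS_def vector_minus_component
    by (subst pdx_diff[OF Ck_on_component[OF Ck_on_component[OF SF]] Ck_on_component[OF Ck_on_component[OF SFh]]])
      (simp add: pdx_entry[OF SF] pdx_entry[OF SFh] frechet_derivative_compose_C1[OF S_C F_matrix_C1[OF t]] frechet_derivative_compose_C1[OF S_C Fh_matrix_C1[OF t]])
qed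

text \<open>The two terms of the chain rule are bounded separately: the stress derivative is at most
  \<open>L\<close> on the ball, and the space derivatives of \<open>F\<close> and \<open>Fh\<close>
  lie in L^2. This justifies integration by parts of the stress term.\<close>

lemma pdx_SS_L2: "L2_bounded T (\<lambda>t. pdx \<beta> (\<lambda>y. SS t y $ i $ \<alpha>))"
proof -
  obtain L where L: "L \<ge> 0" "\<And>p h. norm p \<le> M \<Longrightarrow> norm (frechet_derivative S (at p) h) \<le> L * norm h"
    by (rule C1_ball_bounds[OF S_C, of M]) (rule that)
  let ?dF = "\<lambda>t x. frechet_derivative (F t) (at x) (axis \<beta> 1)" and ?dFh = "\<lambda>t x. frechet_derivative (Fh t) (at x) (axis \<beta> 1)"
  have L2h: "L2_bounded T ?dFh"
  proof (intro L2_bounded_vec)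
    fix i \<alpha>
    show "L2_bounded T (\<lambda>t x. ?dFh t x $ i $ \<alpha>)"
      by (rule L2_bounded_cong[OF pdx_Fh_L2[of \<beta> i \<alpha>]]) (rule pdx_entry[OF Fh_matrix_C1])
  qed
  have L2F: "L2_bounded T ?dF"
  proof (intro L2_bounded_vec)
    fix i \<alpha>
    have s: "L2_bounded T (\<lambda>t x. pdx \<beta> (\<lambda>y. G t y $ i $ \<alpha>) x + pdx \<beta> (\<lambda>y. Fh t y $ i $ \<alpha>) x)"
      by (intro L2_bounded_add pdx_G_L2 pdx_Fh_L2)
    have eq: "pdx \<beta> (\<lambda>y. G t y $ i $ \<alpha>) x + pdx \<beta> (\<lambda>y. Fh t y $ i $ \<alpha>) x = ?dF t x $ i $ \<alpha>" if t: "t \<in> {0..T}" for t x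
      unfolding G_def vector_minus_component pdx_diff[OF F_C[OF t] Fh_C1[OF t]] by (simp add: pdx_entry[OF F_matrix_C1[OF t]])
    show "L2_bounded T (\<lambda>t x. ?dF t x $ i $ \<alpha>)"
      by (rule L2_bounded_cong[OF s eq])
  qed
  have mF: "F t \<in> borel_measurable borel" "Fh t \<in> borel_measurable borel" if "t \<in> {0..T}" for t
    by (rule borel_measurable_continuous_onI[OF Ck_on_continuous[OF F_matrix_C1[OF that]]],
        rule borel_measurable_continuous_onI[OF Ck_on_continuous[OF Fh_matrix_C1[OF that]]])
  have "L2_bounded T (\<lambda>t x. frechet_derivative S (at (F t x)) (?dF t x) - frechet_derivative S (at (Fh t x)) (?dFh t x))"
  proof (rule L2_bounded_diff)
    show "L2_bounded T (\<lambda>t x. frechet_derivative S (at (F t x)) (?dF t x))"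
      by (rule L2_bounded_dominated[OF L2F frechet_derivative_measurable[OF S_C mF(1) square_integrable_measurable[OF L2_boundedD[OF L2F]]] L(2)[OF F_bound]])
    show "L2_bounded T (\<lambda>t x. frechet_derivative S (at (Fh t x)) (?dFh t x))"
      by (rule L2_bounded_dominated[OF L2h frechet_derivative_measurable[OF S_C mF(2) square_integrable_measurable[OF L2_boundedD[OF L2h]]] L(2)[OF Fh_bound]])
  qed
  from L2_bounded_component[OF L2_bounded_component[OF this, of i], of \<alpha>]
  have s: "L2_bounded T (\<lambda>t x. (frechet_derivative S (at (F t x)) (?dF t x) - frechet_derivative S (at (Fh t x)) (?dFh t x)) $ i $ \<alpha>)" .
  show ?thesis
    by (rule L2_bounded_cong[OF s]) (rule pdx_SS[symmetric])
qed

lemma SS_measurable: assumes t: "t \<in> {0..T}" shows "SS t \<in> borel_measurable borel"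
proof -
  have "Ck_on (Suc 0) UNIV (\<lambda>x. S (F t x) - S (Fh t x))"
    by (rule Ck_on_diff[OF Ck_on_compose_C1[OF S_C F_matrix_C1[OF t]] Ck_on_compose_C1[OF S_C Fh_matrix_C1[OF t]]])
  then have "Ck_on (Suc 0) UNIV (SS t)" by (simp only: SS_def[abs_def])
  then show ?thesis by (rule borel_measurable_continuous_onI[OF Ck_on_continuous])
qed

text \<open>Difference of the two momentum equations, with the classical second time derivative of
  \<open>v\<close> replaced by \<open>wtt\<close> plus the defect.\<close>

lemma pde: assumes t: "t \<in> {0..T}"
  shows "\<epsilon> *\<^sub>R wtt t x = - wt t x + divergence (SS t) x + \<mu> *\<^sub>R divergence (grad (w t)) x - \<epsilon> *\<^sub>R defect t x"
proof -
  have "\<epsilon> * wtt t x $ i = - (wt t x $ i) + (\<Sum>\<alpha>\<in>UNIV. pdx \<alpha> (\<lambda>y. SS t y $ i $ \<alpha>) x) + \<mu> * (\<Sum>\<alpha>\<in>UNIV. pdx \<alpha> (pdx \<alpha> (\<lambda>y. w t y $ i)) x) - \<epsilon> * defect t x $ i" for i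
  proof -
    have r: "pdt T (\<lambda>t x. v t x $ i) t x - (\<Sum>\<alpha>\<in>UNIV. pdx \<alpha> (\<lambda>y. S (F t y) $ i $ \<alpha>) x)
       = \<mu> * (\<Sum>\<alpha>\<in>UNIV. pdx \<alpha> (pdx \<alpha> (\<lambda>y. v t y $ i)) x) - \<epsilon> * pdt T (pdt T (\<lambda>t x. v t x $ i)) t x"
      using bspec[OF relax[unfolded relaxation_solution_def] t] by simp
    have s: "(\<Sum>\<alpha>\<in>UNIV. pdx \<alpha> (\<lambda>y. SS t y $ i $ \<alpha>) x) = (\<Sum>\<alpha>\<in>UNIV. pdx \<alpha> (\<lambda>y. S (F t y) $ i $ \<alpha>) x) - (\<Sum>\<alpha>\<in>UNIV. pdx \<alpha> (\<lambda>y. S (Fh t y) $ i $ \<alpha>) x)"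
      unfolding SS_def vector_minus_component
      by (simp only: pdx_diff[OF Ck_on_component[OF Ck_on_component[OF Ck_on_compose_C1[OF S_C F_matrix_C1[OF t]]]] Ck_on_component[OF Ck_on_component[OF Ck_on_compose_C1[OF S_C Fh_matrix_C1[OF t]]]]] sum_subtractf)
    have "pdx \<alpha> (\<lambda>y. w t y $ i) = (\<lambda>x. pdx \<alpha> (\<lambda>y. v t y $ i) x - pdx \<alpha> (\<lambda>y. vh t y $ i) x)" for \<alpha>
      by (rule ext) (rule pdx_v_minus_vh[OF t])
    then have l: "(\<Sum>\<alpha>\<in>UNIV. pdx \<alpha> (pdx \<alpha> (\<lambda>y. w t y $ i)) x) = (\<Sum>\<alpha>\<in>UNIV. pdx \<alpha> (pdx \<alpha> (\<lambda>y. v t y $ i)) x) - (\<Sum>\<alpha>\<in>UNIV. pdx \<alpha> (pdx \<alpha> (\<lambda>y. vh t y $ i)) x)"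
      by (simp only: pdx_diff[OF Ck_on_pdx[OF v_C[OF t]] Ck_on_pdx[OF vh_C2[OF t]]] sum_subtractf)
    \<comment> \<open>Exact at every point by definition of the defect, whatever representative
      \<open>wtt\<close> is.\<close>
    have "\<epsilon> * pdt T (pdt T (\<lambda>t x. v t x $ i)) t x = \<epsilon> * wtt t x $ i + \<epsilon> * defect t x $ i"
      unfolding distrib_left[symmetric] by (simp add: defect_def)
    then show ?thesis using r vh_eq[OF t, of i x] unfolding s l wt_eq[OF t] right_diff_distrib by linarith
  qed
  then show ?thesis by (simp add: vec_eq_iff divergence_def grad_def)
qed

lemma divergence_SS_L2: "L2_bounded T (\<lambda>t. divergence (SS t))"
proof (rule L2_bounded_vec)
  show "L2_bounded T (\<lambda>t x. divergence (SS t) x $ i)" for i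
    unfolding divergence_def vec_lambda_beta by (rule L2_bounded_sum[OF finite]) (rule pdx_SS_L2)
qed

lemma divergence_grad_w_L2: "L2_bounded T (\<lambda>t. divergence (grad (w t)))"
proof (rule L2_bounded_vec)
  show "L2_bounded T (\<lambda>t x. divergence (grad (w t)) x $ i)" for i
    unfolding divergence_def grad_def vec_lambda_beta by (rule L2_bounded_sum[OF finite]) (rule pdx_pdx_w_L2)
qed

text \<open>The equation is solved for the defect, and all other terms are bounded in L^2. The
  resulting bound involves \<open>1 / \<epsilon>\<close>; a bound uniform in
  \<open>\<epsilon>\<close> is drawn from it only at \<open>\<epsilon> = 1\<close>.\<close>

lemma defect_L2: "L2_bounded T defect"
proof -
  have s: "L2_bounded T (\<lambda>t x. (1 / \<epsilon>) *\<^sub>R (divergence (SS t) x - wt t x + \<mu> *\<^sub>R divergence (grad (w t)) x) - wtt t x)"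
    by (intro L2_bounded_diff L2_bounded_add L2_bounded_linear[OF _ bounded_linear_scaleR_right] divergence_SS_L2 wt_L2 divergence_grad_w_L2 wtt_L2)
  have eq: "(1 / \<epsilon>) *\<^sub>R (divergence (SS t) x - wt t x + \<mu> *\<^sub>R divergence (grad (w t)) x) - wtt t x = defect t x" if t: "t \<in> {0..T}" for t x
  proof -
    have "divergence (SS t) x - wt t x + \<mu> *\<^sub>R divergence (grad (w t)) x = \<epsilon> *\<^sub>R (wtt t x + defect t x)"
      using pde[OF t, of x] by (simp add: algebra_simps)
    then show ?thesis using eps by simp
  qed
  show ?thesis
    by (rule L2_bounded_cong[OF s eq])
qed

lemma SS_L2: "L2_bounded T SS"
proof -
  obtain L where L: "L \<ge> 0" "\<And>p q. norm p \<le> M \<Longrightarrow> norm q \<le> M \<Longrightarrow> norm (S p - S q) \<le> L * norm (p - q)"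
    by (rule C1_ball_bounds[OF S_C, of M]) (rule that)
  show ?thesis
    by (rule L2_bounded_dominated[OF G_L2 SS_measurable]) (auto simp: SS_def G_def intro!: L F_bound Fh_bound)
qed

text \<open>The function \<open>h\<close> may be the defect of a different relaxation parameter; it
  replaces the defect under the integral because the two agree almost everywhere.\<close>

lemma tested:
  assumes t: "t \<in> {0..T}" and a: "\<And>i. Ck_on (Suc 0) UNIV (\<lambda>x. a x $ i)" "square_integrable a" "square_integrable (grad a)"
    and h: "square_integrable h" "AE x in lborel. h x = defect t x"
  shows "\<epsilon> * (LINT x|lborel. a x \<bullet> wtt t x) = - (LINT x|lborel. a x \<bullet> wt t x)
        - (LINT x|lborel. grad a x \<bullet> SS t x) - \<mu> * (LINT x|lborel. grad a x \<bullet> grad (w t) x) - \<epsilon> * (LINT x|lborel. a x \<bullet> h x)"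
proof -
  note d = L2_boundedD[OF divergence_SS_L2 t] L2_boundedD[OF divergence_grad_w_L2 t] L2_boundedD[OF wt_L2 t] L2_boundedD[OF defect_L2 t]
  note i = integrable_inner_L2[OF a(2) d(1)] integrable_inner_L2[OF a(2) d(2)] integrable_inner_L2[OF a(2) d(3)] integrable_inner_L2[OF a(2) d(4)]
  have "\<epsilon> * (LINT x|lborel. a x \<bullet> wtt t x) = (LINT x|lborel. a x \<bullet> (\<epsilon> *\<^sub>R wtt t x))" by simp
  also have "\<dots> = (LINT x|lborel. - (a x \<bullet> wt t x) + a x \<bullet> divergence (SS t) x + \<mu> * (a x \<bullet> divergence (grad (w t)) x) - \<epsilon> * (a x \<bullet> defect t x))"
    unfolding pde[OF t] by (simp add: inner_diff_right inner_add_right)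
  also have "\<dots> = - (LINT x|lborel. a x \<bullet> wt t x) + (LINT x|lborel. a x \<bullet> divergence (SS t) x) + \<mu> * (LINT x|lborel. a x \<bullet> divergence (grad (w t)) x) - \<epsilon> * (LINT x|lborel. a x \<bullet> defect t x)"
    using i by simp
  also have "(LINT x|lborel. a x \<bullet> divergence (SS t) x) = - (LINT x|lborel. grad a x \<bullet> SS t x)"
    by (intro integral_by_parts_divergence a SS_C1 t L2_boundedD[OF SS_L2] L2_boundedD[OF pdx_SS_L2])
  also have "(LINT x|lborel. a x \<bullet> divergence (grad (w t)) x) = - (LINT x|lborel. grad a x \<bullet> grad (w t) x)"
  proof (intro integral_by_parts_divergence a L2_boundedD[OF grad_w_L2 t])
    show "Ck_on (Suc 0) UNIV (\<lambda>x. grad (w t) x $ i $ \<alpha>)" for i \<alpha>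
      unfolding grad_def using Ck_on_pdx[OF w_C2[OF t, of i], of \<alpha>] by (simp del: Ck_on.simps)
    show "square_integrable (pdx \<alpha> (\<lambda>x. grad (w t) x $ i $ \<alpha>))" for i \<alpha>
      unfolding grad_def using L2_boundedD[OF pdx_pdx_w_L2 t, of \<alpha> \<alpha> i] by simp
  qed
  also have "(LINT x|lborel. a x \<bullet> defect t x) = (LINT x|lborel. a x \<bullet> h x)"
    using square_integrable_measurable[OF h(1)] square_integrable_measurable[OF a(2)] square_integrable_measurable[OF d(4)] h(2)
    by (intro integral_cong_AE) auto
  finally show ?thesis by simp
qed

text \<open>\<open>phi\<close> differentiates the vector-valued difference, \<open>wt\<close> its
  components; the axis decomposition matches the two.\<close>

lemma phi_eq:
  assumes t: "t \<in> {0..T}"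
  shows "phi \<epsilon> T (\<lambda>t x. F t x - Fh t x) (\<lambda>t x. v t x - vh t x) t
    = (LINT x|lborel. (norm (w t x))\<^sup>2 + (norm (G t x))\<^sup>2 + \<epsilon>\<^sup>2 * (norm (wt t x))\<^sup>2 + \<epsilon> * (norm (grad (w t) x))\<^sup>2)"
proof -
  have e1: "pdt T (\<lambda>t x. v t x - vh t x) t x = wt t x" for x
  proof (rule pdt_unique[OF T t])
    have "((\<lambda>\<tau>. w \<tau> x) has_vector_derivative wt t x) (at t within {0..T})"
    proof -
      have "((\<lambda>\<tau>. \<Sum>i\<in>UNIV. axis i (w \<tau> x $ i)) has_vector_derivative (\<Sum>i\<in>UNIV. axis i (wt t x $ i))) (at t within {0..T})"
      proof (rule has_vector_derivative_sum)
        fix i :: 3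
        have "bounded_linear (axis i :: real \<Rightarrow> real^3)"
          unfolding linear_conv_bounded_linear[symmetric] by (rule linearI) (auto simp: vec_eq_iff axis_def)
        from bounded_linear.has_vector_derivative[OF this w_t[OF t, of x i]]
        show "((\<lambda>\<tau>. axis i (w \<tau> x $ i)) has_vector_derivative axis i (wt t x $ i)) (at t within {0..T})" .
      qed
      moreover have "(\<Sum>i\<in>UNIV. axis i (u $ i)) = u" for u :: "real^3" by (simp add: vec_eq_iff axis_def sum.delta)
      ultimately show ?thesis by simp
    qed
    then show "((\<lambda>\<tau>. v \<tau> x - vh \<tau> x) has_vector_derivative wt t x) (at t within {0..T})" by (simp add: w_def)
  qed
  have e2: "(\<Sum>i\<in>UNIV. \<Sum>\<alpha>\<in>UNIV. \<bar>pdx \<alpha> (\<lambda>y. (v t y - vh t y) $ i) x\<bar>\<^sup>2) = (norm (grad (w t) x))\<^sup>2" for x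
    by (simp add: norm_vec_power2 grad_def w_def)
  show ?thesis unfolding phi_def e1 e2 unfolding w_def G_def by (rule refl)
qed

end

section \<open>Uniform constants and the conclusion\<close>

text \<open>Adding and subtracting the stress derivative at \<open>F\<close> applied to the limit
  gradient leaves a term linear in the gradient of \<open>w\<close> and a difference of stress
  derivatives at \<open>F\<close> and \<open>Fh\<close>, which is of order \<open>G\<close>.\<close>

lemma (in relaxation_pair) SSt_le:
  assumes t: "t \<in> {0..T}"
    and L: "\<And>p h. norm p \<le> M \<Longrightarrow> norm (frechet_derivative S (at p) h) \<le> L * norm h"
    and K: "0 \<le> K" "\<And>p q h. norm p \<le> M \<Longrightarrow> norm q \<le> M \<Longrightarrow>
      norm (frechet_derivative S (at p) h - frechet_derivative S (at q) h) \<le> K * norm (p - q) * norm h"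
    and V: "norm (grad (vh t) x) \<le> V"
  shows "norm (SSt t x) \<le> L * norm (grad (w t) x) + K * V * norm (G t x)"
proof -
  interpret D: bounded_linear "frechet_derivative S (at (F t x))"
    by (rule has_derivative_bounded_linear[OF Ck_on_Suc_UNIV_frechet(1)[OF S_C]])
  have g: "grad (v t) x = grad (w t) x + grad (vh t) x"
    by (simp add: vec_eq_iff grad_def pdx_v_minus_vh[OF t])
  have "SSt t x = frechet_derivative S (at (F t x)) (grad (w t) x)
      + (frechet_derivative S (at (F t x)) (grad (vh t) x) - frechet_derivative S (at (Fh t x)) (grad (vh t) x))"
    unfolding SSt_def g by (simp add: D.add)
  then have "norm (SSt t x) \<le> norm (frechet_derivative S (at (F t x)) (grad (w t) x))
      + norm (frechet_derivative S (at (F t x)) (grad (vh t) x) - frechet_derivative S (at (Fh t x)) (grad (vh t) x))"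
    by (simp only: norm_triangle_ineq)
  also have "\<dots> \<le> L * norm (grad (w t) x) + K * norm (F t x - Fh t x) * norm (grad (vh t) x)"
    by (rule add_mono[OF L[OF F_bound[OF t]] K(2)[OF F_bound[OF t] Fh_bound[OF t]]])
  also have "\<dots> \<le> L * norm (grad (w t) x) + K * norm (F t x - Fh t x) * V"
    using K(1) V by (intro add_left_mono mult_left_mono) auto
  finally show ?thesis by (simp add: G_def mult_ac)
qed

lemma (in relaxation_pair) phi_estimate:
  assumes e: "\<epsilon> \<le> 1" and small: "8 * L * \<epsilon> \<le> \<mu>"
    and L: "0 \<le> L" "\<And>p h. norm p \<le> M \<Longrightarrow> norm (frechet_derivative S (at p) h) \<le> L * norm h"
      "\<And>p q. norm p \<le> M \<Longrightarrow> norm q \<le> M \<Longrightarrow> norm (S p - S q) \<le> L * norm (p - q)"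
    and K: "0 \<le> K" "\<And>p q h. norm p \<le> M \<Longrightarrow> norm q \<le> M \<Longrightarrow>
      norm (frechet_derivative S (at p) h - frechet_derivative S (at q) h) \<le> K * norm (p - q) * norm h"
    and V: "0 \<le> V" "\<And>t x. t \<in> {0..T} \<Longrightarrow> norm (grad (vh t) x) \<le> V"
    and h: "L2_bounded T h" "\<And>t. t \<in> {0..T} \<Longrightarrow> AE x in lborel. h t x = defect t x"
      "\<And>t. t \<in> {0..T} \<Longrightarrow> (LINT x|lborel. (norm (h t x))\<^sup>2) \<le> H"
    and t: "t \<in> {0..T}"
  shows "phi \<epsilon> T (\<lambda>t x. F t x - Fh t x) (\<lambda>t x. v t x - vh t x) t
    \<le> energy_const \<mu> L (K * V) H T * (\<epsilon>\<^sup>2 + phi \<epsilon> T (\<lambda>t x. F t x - Fh t x) (\<lambda>t x. v t x - vh t x) 0)"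
proof -
  have 0: "0 \<in> {0..T}" using T by simp
  show ?thesis
    unfolding phi_eq[OF t] phi_eq[OF 0]
  proof (rule energy_estimate[where W=w and Wt=wt and Wtt=wtt and Hh=h and DW="\<lambda>t. grad (w t)" and DWt="\<lambda>t. grad (wt t)"
        and G=G and SS=SS and SSt=SSt and t=t and \<epsilon>=\<epsilon> and \<mu>=\<mu> and L=L and N="K * V" and H=H and T=T])
    show "T > 0" "0 < \<epsilon>" "\<epsilon> \<le> 1" "\<mu> > 0" "0 \<le> L" "8 * L * \<epsilon> \<le> \<mu>" "t \<in> {0..T}" by (rule T eps e mu L small t)+
    show "0 \<le> K * V" using K V by simp
    fix t x assume t: "t \<in> {0..T}"
    note sw = L2_boundedD[OF w_L2 t] and swt = L2_boundedD[OF wt_L2 t]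
      and sgw = L2_boundedD[OF grad_w_L2 t] and sgwt = L2_boundedD[OF grad_wt_L2 t]
      and sh = L2_boundedD[OF h(1) t]
    show "square_integrable (w t)" "square_integrable (wt t)" "square_integrable (grad (w t))" "square_integrable (G t)"
      "square_integrable (SS t)" "square_integrable (h t)"
      by (rule sw, rule swt, rule sgw, rule L2_boundedD[OF G_L2 t], rule L2_boundedD[OF SS_L2 t], rule sh)
    show "L2_deriv T w (wt t) t" "L2_deriv T wt (wtt t) t" "L2_deriv T (\<lambda>t. grad (w t)) (grad (wt t)) t"
      "L2_deriv T G (grad (w t)) t" "L2_deriv T SS (SSt t) t"
      by (rule w_L2_deriv[OF t], rule wt_L2_deriv[OF t], rule grad_w_L2_deriv[OF t], rule G_L2_deriv[OF t], rule SS_L2_deriv[OF t])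
    show "\<epsilon> * (LINT x|lborel. w t x \<bullet> wtt t x) = - (LINT x|lborel. w t x \<bullet> wt t x)
        - (LINT x|lborel. grad (w t) x \<bullet> SS t x) - \<mu> * (LINT x|lborel. grad (w t) x \<bullet> grad (w t) x) - \<epsilon> * (LINT x|lborel. w t x \<bullet> h t x)"
      by (rule tested[OF t w_C1[OF t] sw sgw sh h(2)[OF t]])
    show "\<epsilon> * (LINT x|lborel. wt t x \<bullet> wtt t x) = - (LINT x|lborel. wt t x \<bullet> wt t x)
        - (LINT x|lborel. grad (wt t) x \<bullet> SS t x) - \<mu> * (LINT x|lborel. grad (wt t) x \<bullet> grad (w t) x) - \<epsilon> * (LINT x|lborel. wt t x \<bullet> h t x)"
      by (rule tested[OF t wt_C1[OF t] swt sgwt sh h(2)[OF t]])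
    show "norm (SS t x) \<le> L * norm (G t x)"
      unfolding SS_def G_def by (rule L(3)[OF F_bound[OF t] Fh_bound[OF t]])
    show "norm (SSt t x) \<le> L * norm (grad (w t) x) + K * V * norm (G t x)"
      by (rule SSt_le[OF t L(2) K V(2)[OF t]])
    show "(LINT x|lborel. (norm (h t x))\<^sup>2) \<le> H" by (rule h(3)[OF t])
  qed
qed

text \<open>The difference quotients of the two first derivatives \<open>wt\<close> differ by classically differentiable terms, so their
  limits in \<open>L\<^sup>2\<close> and pointwise agree.\<close>

lemma defect_unique:
  assumes A: "relaxation_pair \<mu> T j S Fh vh \<epsilon>\<^sub>1 M\<^sub>1 F\<^sub>1 v\<^sub>1" and B: "relaxation_pair \<mu> T j S Fh vh \<epsilon>\<^sub>2 M\<^sub>2 F\<^sub>2 v\<^sub>2"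
    and t: "t \<in> {0..T}"
  shows "AE x in lborel. relaxation_pair.defect T vh v\<^sub>1 t x = relaxation_pair.defect T vh v\<^sub>2 t x"
proof -
  interpret a: relaxation_pair \<mu> T j S Fh vh \<epsilon>\<^sub>1 M\<^sub>1 F\<^sub>1 v\<^sub>1 by (rule A)
  interpret b: relaxation_pair \<mu> T j S Fh vh \<epsilon>\<^sub>2 M\<^sub>2 F\<^sub>2 v\<^sub>2 by (rule B)
  have c: "AE x in lborel. a.defect t x $ i - b.defect t x $ i = 0" for i
  proof (rule L2_limit_pointwise_AE[OF a.T t])
    let ?D = "\<lambda>\<tau> x. a.wt \<tau> x $ i - b.wt \<tau> x $ i"
    let ?p = "\<lambda>x. a.wtt t x $ i - b.wtt t x $ i"
    let ?V = "\<lambda>\<tau> x. pdt T (\<lambda>t x. v\<^sub>1 t x $ i) \<tau> x - pdt T (\<lambda>t x. v\<^sub>2 t x $ i) \<tau> x"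
    have d: "L2_deriv T ?D ?p t"
      using L2_deriv_diff[OF L2_dt(2)[OF a.wt_H0(1)[of i] t] L2_dt(2)[OF b.wt_H0(1)[of i] t] t]
      by (simp add: a.wtt_def b.wtt_def)
    let ?f = "\<lambda>\<tau> x. (?D \<tau> x - ?D t x) /\<^sub>R (\<tau> - t) - ?p x"
    show "square_integrable (?f \<tau>)" if "\<tau> \<in> {0..T}" for \<tau>
    proof (rule square_integrable_diff[OF square_integrable_bounded_linear[OF _ bounded_linear_scaleR_right]])
      show "square_integrable (\<lambda>x. ?D \<tau> x - ?D t x)" "square_integrable ?p"
        using d that unfolding L2_deriv_def by blast+
    qed
    show "((\<lambda>\<tau>. LINT x|lborel. (?f \<tau> x)\<^sup>2) \<longlongrightarrow> 0) (at t within {0..T})"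
      using d unfolding L2_deriv_def by simp
    \<comment> \<open>The time derivative of the limit velocity, which may fail to be differentiable
      in time, cancels between the two pairs; smooth functions on the slab remain.\<close>
    have DV: "?D \<tau> x = ?V \<tau> x" if "\<tau> \<in> {0..T}" for \<tau> x
      using a.wt_eq[OF that] b.wt_eq[OF that] by simp
    show "((\<lambda>\<tau>. ?f \<tau> x) \<longlongrightarrow> a.defect t x $ i - b.defect t x $ i) (at t within {0..T})" for x
    proof -
      have "((\<lambda>\<tau>. ?V \<tau> x) has_vector_derivative pdt T (pdt T (\<lambda>t x. v\<^sub>1 t x $ i)) t x - pdt T (pdt T (\<lambda>t x. v\<^sub>2 t x $ i)) t x) (at t within {0..T})"
        by (intro has_vector_derivative_diff a.vtt b.vtt t)
      then have "((\<lambda>\<tau>. (?V \<tau> x - ?V t x) / (\<tau> - t)) \<longlongrightarrow> pdt T (pdt T (\<lambda>t x. v\<^sub>1 t x $ i)) t x - pdt T (pdt T (\<lambda>t x. v\<^sub>2 t x $ i)) t x) (at t within {0..T})"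
        by (simp only: has_real_derivative_iff_has_vector_derivative[symmetric] has_field_derivative_iff)
      then have "((\<lambda>\<tau>. (?V \<tau> x - ?V t x) / (\<tau> - t) - ?p x) \<longlongrightarrow> (pdt T (pdt T (\<lambda>t x. v\<^sub>1 t x $ i)) t x - pdt T (pdt T (\<lambda>t x. v\<^sub>2 t x $ i)) t x) - ?p x) (at t within {0..T})"
        by (intro tendsto_diff tendsto_const)
      moreover have "(pdt T (pdt T (\<lambda>t x. v\<^sub>1 t x $ i)) t x - pdt T (pdt T (\<lambda>t x. v\<^sub>2 t x $ i)) t x) - ?p x = a.defect t x $ i - b.defect t x $ i"
        by (simp add: a.defect_def b.defect_def)
      moreover have "\<forall>\<^sub>F \<tau> in at t within {0..T}. (?V \<tau> x - ?V t x) / (\<tau> - t) - ?p x = ?f \<tau> x"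
        using eventually_at_within_mem
        by (rule eventually_mono) (simp only: DV DV[OF t] real_scaleR_def divide_inverse mult.commute)
      ultimately show ?thesis by (simp only: tendsto_cong)
    qed
  qed
  have "AE x in lborel. \<forall>i\<in>UNIV. a.defect t x $ i - b.defect t x $ i = 0"
    by (rule AE_ball_countable'[OF c]) simp
  then show ?thesis by (auto simp: vec_eq_iff)
qed

theorem mainTheorem2:
  fixes \<mu> \<T> j \<Gamma> :: real
    and S :: "real^3^3 \<Rightarrow> real^3^3"
    and Fhat :: "real \<Rightarrow> real^3 \<Rightarrow> real^3^3"
    and vhat :: "real \<Rightarrow> real^3 \<Rightarrow> real^3"
    and Fbar :: "real \<Rightarrow> real \<Rightarrow> real^3 \<Rightarrow> real^3^3"
    and vbar :: "real \<Rightarrow> real \<Rightarrow> real^3 \<Rightarrow> real^3"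
  assumes mu: "\<mu> > 0"
    and stress: "smooth_on UNIV S"
    and time: "\<T> > 0"
    and j: "j > 3/2 + 2"
    and hat_reg: "Ck_H_mat 1 j \<T> Fhat" "Ck_H_vec 1 j \<T> vhat"
    \<comment> \<open>elements of \<open>H\<^sup>j\<close> are identified with their continuous representatives (which are \<open>C\<^sup>2\<close>)\<close>
    and hat_repr: "\<And>t. t \<in> {0..\<T>} \<Longrightarrow> continuous_on UNIV (Fhat t)"
      "\<And>t. t \<in> {0..\<T>} \<Longrightarrow> continuous_on UNIV (vhat t)"
    and hat_sol: "viscoelastic_solution \<mu> S \<T> Fhat vhat"
    and bar_smooth: "\<And>\<epsilon>. \<epsilon> > 0 \<Longrightarrow> smooth_on ({0..\<T>} \<times> UNIV) (\<lambda>(t, x). Fbar \<epsilon> t x)"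
      "\<And>\<epsilon>. \<epsilon> > 0 \<Longrightarrow> smooth_on ({0..\<T>} \<times> UNIV) (\<lambda>(t, x). vbar \<epsilon> t x)"
    and bar_bounded: "\<exists>M. \<forall>\<epsilon>>0. \<forall>t\<in>{0..\<T>}. \<forall>x. norm (Fbar \<epsilon> t x) \<le> M \<and> norm (vbar \<epsilon> t x) \<le> M"
    and bar_sol: "\<And>\<epsilon>. \<epsilon> > 0 \<Longrightarrow> relaxation_solution \<epsilon> \<mu> S \<T> (Fbar \<epsilon>) (vbar \<epsilon>)"
    and diff_F: "\<And>\<epsilon>. \<epsilon> > 0 \<Longrightarrow> Ck_H_mat 1 0 \<T> (\<lambda>t x. Fbar \<epsilon> t x - Fhat t x)"
      "\<And>\<epsilon>. \<epsilon> > 0 \<Longrightarrow> Ck_H_mat 0 1 \<T> (\<lambda>t x. Fbar \<epsilon> t x - Fhat t x)"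
    and diff_v: "\<And>\<epsilon>. \<epsilon> > 0 \<Longrightarrow> Ck_H_vec 0 2 \<T> (\<lambda>t x. vbar \<epsilon> t x - vhat t x)"
      "\<And>\<epsilon>. \<epsilon> > 0 \<Longrightarrow> Ck_H_vec 1 1 \<T> (\<lambda>t x. vbar \<epsilon> t x - vhat t x)"
      "\<And>\<epsilon>. \<epsilon> > 0 \<Longrightarrow> Ck_H_vec 2 0 \<T> (\<lambda>t x. vbar \<epsilon> t x - vhat t x)"
    and Gamma: "\<Gamma> > 0"
    and stress_bound_hat: "\<And>t x. t \<in> {0..\<T>} \<Longrightarrow>
      onorm (frechet_derivative S (at (Fhat t x))) \<le> \<Gamma>"
    and stress_bound_bar: "\<And>\<epsilon> t x. \<epsilon> > 0 \<Longrightarrow> t \<in> {0..\<T>} \<Longrightarrow>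
      onorm (frechet_derivative S (at (Fbar \<epsilon> t x))) \<le> \<Gamma>"
  shows "\<exists>\<epsilon>\<^sub>0>0. \<exists>C>0. \<forall>\<epsilon>. 0 < \<epsilon> \<and> \<epsilon> \<le> \<epsilon>\<^sub>0 \<longrightarrow> (\<forall>t\<in>{0..\<T>}.
    phi \<epsilon> \<T> (\<lambda>t x. Fbar \<epsilon> t x - Fhat t x) (\<lambda>t x. vbar \<epsilon> t x - vhat t x) t
      \<le> C * (\<epsilon>\<^sup>2 +
          phi \<epsilon> \<T> (\<lambda>t x. Fbar \<epsilon> t x - Fhat t x) (\<lambda>t x. vbar \<epsilon> t x - vhat t x) 0))"
proof -
  interpret viscoelastic \<mu> \<T> j S Fhat vhat
    by (rule viscoelastic.intro[OF mu stress time j hat_reg hat_repr hat_sol])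
  obtain M\<^sub>1 where M1: "\<And>\<epsilon> t x. \<epsilon> > 0 \<Longrightarrow> t \<in> {0..\<T>} \<Longrightarrow> norm (Fbar \<epsilon> t x) \<le> M\<^sub>1"
    using bar_bounded by blast
  obtain M\<^sub>2 where M2: "\<And>t x. t \<in> {0..\<T>} \<Longrightarrow> norm (Fhat t x) \<le> M\<^sub>2"
    by (rule Fh_bounded) (rule that)
  \<comment> \<open>One ball for all \<open>\<epsilon>\<close>, whence the constants
    \<open>L\<close> and \<open>K\<close> below do not depend on \<open>\<epsilon>\<close>.\<close>
  define M where "M = max M\<^sub>1 M\<^sub>2"
  have R: "relaxation_pair \<mu> \<T> j S Fhat vhat \<epsilon> M (Fbar \<epsilon>) (vbar \<epsilon>)" if e: "\<epsilon> > 0" for \<epsilon>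
  proof
    show "norm (Fbar \<epsilon> t x) \<le> M" "norm (Fhat t x) \<le> M" if "t \<in> {0..\<T>}" for t x
      unfolding M_def by (rule max.coboundedI1[OF M1[OF e that]], rule max.coboundedI2[OF M2[OF that]])
  qed (rule e bar_smooth bar_sol diff_F diff_v | assumption)+
  obtain L where L: "L \<ge> 0" "\<And>p h. norm p \<le> M \<Longrightarrow> norm (frechet_derivative S (at p) h) \<le> L * norm h"
    "\<And>p q. norm p \<le> M \<Longrightarrow> norm q \<le> M \<Longrightarrow> norm (S p - S q) \<le> L * norm (p - q)"
    by (rule C1_ball_bounds[OF S_C, of M]) (rule that)
  obtain K where K: "K \<ge> 0" "\<And>p q h. norm p \<le> M \<Longrightarrow> norm q \<le> M \<Longrightarrow>
      norm (frechet_derivative S (at p) h - frechet_derivative S (at q) h) \<le> K * norm (p - q) * norm h"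
    by (rule C2_ball_Lipschitz[OF S_C, of M]) (rule that)
  obtain V where V: "V \<ge> 0" "\<And>t x. t \<in> {0..\<T>} \<Longrightarrow> norm (grad (vhat t) x) \<le> V"
    by (rule grad_vh_bounded) (rule that)
  \<comment> \<open>The relaxed solution with parameter 1 is the reference: its defect represents
    every other defect, and so fixes \<open>H\<close> once and for all.\<close>
  interpret one: relaxation_pair \<mu> \<T> j S Fhat vhat 1 M "Fbar 1" "vbar 1"
    by (rule R) simp
  obtain H where H: "\<And>t. t \<in> {0..\<T>} \<Longrightarrow> (LINT x|lborel. (norm (one.defect t x))\<^sup>2) \<le> H"
    using one.defect_L2 unfolding L2_bounded_def by blast
  have "0 \<le> (LINT x|lborel. (norm (one.defect 0 x))\<^sup>2)" by simp
  also have "\<dots> \<le> H" using H[of 0] time by simp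
  finally have H0: "0 \<le> H" .
  \<comment> \<open>The bound 1 serves the density inequalities, the second one the absorption
    \<open>8 * L * \<epsilon> \<le> \<mu>\<close>; \<open>L + 1\<close> keeps the denominator
    positive if \<open>L = 0\<close>.\<close>
  let ?e = "min 1 (\<mu> / (8 * (L + 1)))"
  have "?e > 0" using mu L(1) by simp
  moreover have "energy_const \<mu> L (K * V) H \<T> > 0" by (rule energy_const_pos[OF mu H0 time])
  moreover have "phi \<epsilon> \<T> (\<lambda>t x. Fbar \<epsilon> t x - Fhat t x) (\<lambda>t x. vbar \<epsilon> t x - vhat t x) t
      \<le> energy_const \<mu> L (K * V) H \<T> * (\<epsilon>\<^sup>2 +
          phi \<epsilon> \<T> (\<lambda>t x. Fbar \<epsilon> t x - Fhat t x) (\<lambda>t x. vbar \<epsilon> t x - vhat t x) 0)"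
    if e: "0 < \<epsilon> \<and> \<epsilon> \<le> ?e" and t: "t \<in> {0..\<T>}" for \<epsilon> t
  proof (rule relaxation_pair.phi_estimate[OF R _ _ L K V one.defect_L2 _ H t])
    show "0 < \<epsilon>" "\<epsilon> \<le> 1" using e by auto
    have "\<epsilon> * (8 * (L + 1)) \<le> \<mu>" using e L(1) by (simp add: pos_le_divide_eq)
    moreover have "8 * L * \<epsilon> \<le> \<epsilon> * (8 * (L + 1))" using e by (simp add: algebra_simps)
    ultimately show "8 * L * \<epsilon> \<le> \<mu>" by linarith
    show "AE x in lborel. one.defect t x = relaxation_pair.defect \<T> vhat (vbar \<epsilon>) t x" if "t \<in> {0..\<T>}" for t
      by (rule defect_unique[OF one.relaxation_pair_axioms R that]) (use e in simp)
  qed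
  ultimately show ?thesis by blast
qed

end
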